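(* Let $d\in\{2,3\}$ and let $\nu>0$ be fixed. For each $\varepsilon>0$ (in a sequence tending to $0$) let $(u_\varepsilon,\ell_\varepsilon,\omega_\varepsilon)$ be a Hopf-Leray weak solution of the fluid-rigid body system with viscosity $\nu$ (as defined in the context) associated with initial data $\mathcal{S}^{in}_\varepsilon$, $\rho^{in}_\varepsilon$, $u^{in}_\varepsilon$, $\ell^{in}_\varepsilon$, $\omega^{in}_\varepsilon$ which satisfy the compatibility conditions (as defined in the context) and are such that $\tilde u^{in}_\varepsilon\in L^2(\mathbb{R}^d)$. Let $m_\varepsilon$ and $\mathcal{J}_\varepsilon$ denote the mass and the initial inertia matrix of the rigid body. Assume that, as $\varepsilon\to0$: 1. $\mathcal{S}^{in}_\varepsilon\subset B_0(\varepsilon)$, the ball of centre $0$ and radius $\varepsilon$; 2. $m_\varepsilon/\varepsilon^{d}\to+\infty$; 3. $\tilde u^{in}_\varepsilon\to u^{in}$ in $L^2(\mathbb{R}^d)$ for some $u^{in}\in L^2(\mathbb{R}^d)$, and $m_\varepsilon|\ell^{in}_\varepsilon|^2+(\mathcal{J}_\varepsilon\omega^{in}_\varepsilon)\cdot\omega^{in}_\varepsilon\to 2E$ for some real number $E$; 4. if $d=3$, $m_\varepsilon/\varepsilon^{1/2}\to+\infty$; if $d=2$, there is a constant $C>0$ independent of $\varepsilon$ such that $m_\varepsilon\ge C$; 5. $\ell^{in}_\varepsilon\to\ell^{in}$ for some $\ell^{in}\in\mathbb{R}^d$. Then $$\ell_\varepsilon\to\ell^{in}\quad\text{in } L^\infty_{loc}(\mathbb{R}^+)\quad\text{as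 }\varepsilon\to0,$$ where $\ell^{in}$ is regarded as a function constant in time.
   Context: Notation: $\mathbb{R}^+=[0,+\infty)$. $L^\infty_{loc}(\mathbb{R}^+)$ convergence means convergence in $L^\infty(0,T)$ for every $T>0$. $\chi_A$ is the indicator function of $A$. $D(u)=\frac12(\nabla u+(\nabla u)^T)$. In dimension $2$, $x^\perp=(-x_2,x_1)^T$, angular velocities $\omega\in\mathbb{R}^{2d-3}=\mathbb{R}$ are scalars, and every expression $\omega\times x$ is to be read as $\omega x^\perp$; in dimension $3$, $\omega\in\mathbb{R}^{2d-3}=\mathbb{R}^3$ and $\times$ is the cross product. Rigid body: the initial position $\mathcal{S}^{in}\subset\mathbb{R}^d$ is a closed, connected, simply connected set with nonempty interior and smooth boundary; $\rho^{in}:\mathcal{S}^{in}\to\mathbb{R}$, $\rho^{in}>0$, is its density, with (finite) mass $m=\int_{\mathcal{S}^{in}}\rho^{in}\,dx$ and centre of mass at the origin, $\int_{\mathcal{S}^{in}}\rho^{in}(x)x\,dx=0$. Given the velocity $\ell(t)$ of the centre of mass and the angular velocity $\omega(t)$, the centre of mass is $h$ with $h'=\ell$, $h(0)=0$; the rotation $Q(t)$ is determined by $Q'(t)Q^T(t)x=\omega(t)\times x$ for all $x$, with $Q(0)=\mathbb{I}$ (the identity matrix); the position of the body is $\mathcal{S}(t)=\{x\in\mathbb{R}^d: Q^T(t)(x-h(t))\in\mathcal{S}^{in}\}$, its density is $\rho(t,x)=\rho^{in}(Q^T(t)(x-h(t)))$, its velocity is $u_{\mathcal{S}}(t,x)=\ell(t)+\omega(t)\times(x-h(t))$,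 and the fluid domain is $\mathcal{F}(t)=\mathbb{R}^d\setminus\mathcal{S}(t)$. The inertia matrix is $\mathcal{J}(t)=\int_{\mathcal{S}(t)}\rho(t,x)\left[|x-h(t)|^2\mathbb{I}-(x-h(t))\otimes(x-h(t))\right]dx$ for $d=3$; for $d=2$ it is the time-independent scalar $\mathcal{J}=\int_{\mathcal{S}(t)}\rho(t,x)|x-h(t)|^2dx$. The initial inertia matrix is $\mathcal{J}(0)$. Global density and velocity: $\tilde\rho=\chi_{\mathcal{F}(t)}+\rho\chi_{\mathcal{S}(t)}$ and $\tilde u=u\chi_{\mathcal{F}(t)}+u_{\mathcal{S}}\chi_{\mathcal{S}(t)}$; $\tilde\rho^{in}$ and $\tilde u^{in}$ are the corresponding objects at time $0$, i.e. $\tilde\rho^{in}=\chi_{\mathcal{F}(0)}+\rho^{in}\chi_{\mathcal{S}^{in}}$ and $\tilde u^{in}=u^{in}\chi_{\mathcal{F}(0)}+(\ell^{in}+\omega^{in}\times x)\chi_{\mathcal{S}^{in}}$, where $\ell^{in}\in\mathbb{R}^d$, $\omega^{in}\in\mathbb{R}^{2d-3}$. Compatibility conditions on initial data: $\operatorname{div}u^{in}=0$ in $\mathcal{F}(0)$ and $u^{in}\cdot n=(\ell^{in}+\omega^{in}\times x)\cdot n$ on $\partial\mathcal{S}^{in}$, where $n$ is the unit normal. The system (formally): $u$ solves the incompressible Navier-Stokes equations $\partial_tu+u\cdot\nabla u-\nu\Delta u+\nabla p=0$, $\operatorname{div}u=0$ in $\mathcal{F}(t)$, with $u=u_{\mathcal{S}}$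 on $\partial\mathcal{S}(t)$ and $u\to0$ as $|x|\to\infty$, coupled with Newton's laws for the body. Definition (Hopf-Leray weak solution). Given initial data $\mathcal{S}^{in},\rho^{in},u^{in},\ell^{in},\omega^{in}$ satisfying the compatibility conditions with $\tilde u^{in}\in L^2(\mathbb{R}^d)$, a triple $(u,\ell,\omega)$ is a Hopf-Leray weak solution if: (i) $\ell\in L^\infty(\mathbb{R}^+;\mathbb{R}^d)$, $\omega\in L^\infty(\mathbb{R}^+;\mathbb{R}^{2d-3})$, $u\in L^\infty(\mathbb{R}^+;L^2(\mathcal{F}(t)))\cap L^2_{loc}(\mathbb{R}^+;H^1(\mathcal{F}(t)))$ and $\tilde u\in C_w(\mathbb{R}^+;L^2(\mathbb{R}^d))$ (weakly continuous in time); (ii) $\tilde u$ is divergence free in $\mathbb{R}^d$ with $D(\tilde u)=0$ in $\mathcal{S}(t)$; (iii) for every $\varphi\in C^\infty_c(\mathbb{R}^+\times\mathbb{R}^d;\mathbb{R}^d)$ with $\operatorname{div}\varphi=0$ and $D(\varphi)=0$ in $\mathcal{S}(t)$, $$-\int_{\mathbb{R}^+}\int_{\mathbb{R}^d}\Big[\tilde\rho\tilde u\cdot(\partial_t\varphi+\tilde u\cdot\nabla\varphi)-2\nu D(\tilde u):D(\varphi)\Big]dx\,dt=\int_{\mathbb{R}^d}\tilde\rho^{in}\tilde u^{in}\cdot\varphi(0,\cdot)\,dx;$$ (iv) for almost every $t\in\mathbb{R}^+$, $$\int_{\mathbb{R}^d}\tilde\rho(t,\cdot)|\tilde u(t,\cdot)|^2dx+4\nu\int_0^t\int_{\mathbb{R}^d}|D(\tilde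 u)|^2dx\,dt\le\int_{\mathbb{R}^d}\tilde\rho^{in}|\tilde u^{in}|^2dx.$$ In the claim, a subscript $\varepsilon$ on any of these objects indicates the object associated with the data and solution of index $\varepsilon$. *)

theory Defs
  imports "HOL-Analysis.Analysis" "HOL-Probability.Essential_Supremum"
begin

subsection \<open>Smooth functions and differential operators\<close>

text \<open>\<open>U\<close> is meant to be open; \<open>Ck\<close> differentiability is expressed through iterated
  directional derivatives, which is the usual notion on finite-dimensional spaces.\<close>

fun Ck_on :: "nat \<Rightarrow> 'a::euclidean_space set \<Rightarrow> ('a \<Rightarrow> 'b::real_normed_vector) \<Rightarrow> bool" where
  "Ck_on 0 U f \<longleftrightarrow> continuous_on U f"
| "Ck_on (Suc k) U f \<longleftrightarrow>
     (\<forall>x\<in>U. f differentiable (at x)) \<and> (\<forall>v. Ck_on k U (\<lambda>x. frechet_derivative f (at x) v))"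

definition smooth_on :: "'a::euclidean_space set \<Rightarrow> ('a \<Rightarrow> 'b::real_normed_vector) \<Rightarrow> bool" where
  "smooth_on U f \<longleftrightarrow> (\<forall>k. Ck_on k U f)"

definition grad :: "(real^'n \<Rightarrow> real) \<Rightarrow> real^'n \<Rightarrow> real^'n" where
  "grad f x = (\<chi> j. frechet_derivative f (at x) (axis j 1))"

definition divergence :: "(real^'n \<Rightarrow> real^'n) \<Rightarrow> real^'n \<Rightarrow> real" where
  "divergence v x = trace (jacobian v (at x))"

definition sym_grad :: "(real^'n \<Rightarrow> real^'n) \<Rightarrow> real^'n \<Rightarrow> real^'n^'n" where
  "sym_grad v x = (1/2) *\<^sub>R (jacobian v (at x) + transpose (jacobian v (at x)))"

text \<open>Near every boundary point the set is a sublevel set of a smooth function without critical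
  points.\<close>

definition smooth_boundary :: "(real^'n) set \<Rightarrow> bool" where
  "smooth_boundary S \<longleftrightarrow>
     (\<forall>p\<in>frontier S. \<exists>U g. open U \<and> p \<in> U \<and> smooth_on U g \<and>
        (\<forall>x\<in>U. grad g x \<noteq> 0) \<and> S \<inter> U = {x\<in>U. g x \<le> 0})"

subsection \<open>Function spaces and weak derivatives\<close>

definition L2 :: "(real^'n) set \<Rightarrow> (real^'n \<Rightarrow> 'b::euclidean_space) \<Rightarrow> bool" where
  "L2 A f \<longleftrightarrow> set_borel_measurable lebesgue A f \<and> set_integrable lebesgue A (\<lambda>x. (norm (f x))\<^sup>2)"

definition L1_loc :: "(real^'n) set \<Rightarrow> (real^'n \<Rightarrow> 'b::euclidean_space) \<Rightarrow> bool" where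
  "L1_loc U f \<longleftrightarrow> (\<forall>K. compact K \<longrightarrow> K \<subseteq> U \<longrightarrow> set_integrable lebesgue K f)"

definition Linf_time :: "(real \<Rightarrow> 'b::euclidean_space) \<Rightarrow> bool" where
  "Linf_time f \<longleftrightarrow> f \<in> borel_measurable (lebesgue_on {0..}) \<and>
     esssup (lebesgue_on {0..}) (\<lambda>t. ereal (norm (f t))) < \<infinity>"

definition Linf_loc_tendsto :: "(nat \<Rightarrow> real \<Rightarrow> 'b::euclidean_space) \<Rightarrow> (real \<Rightarrow> 'b) \<Rightarrow> bool" where
  "Linf_loc_tendsto f g \<longleftrightarrow>
     (\<forall>T>0. (\<lambda>k. esssup (lebesgue_on {0<..<T}) (\<lambda>t. ereal (norm (f k t - g t)))) \<longlonglongrightarrow> 0)"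

definition weakly_continuous_L2 :: "(real \<Rightarrow> real^'n \<Rightarrow> real^'n) \<Rightarrow> bool" where
  "weakly_continuous_L2 v \<longleftrightarrow> (\<forall>t\<ge>0. L2 UNIV (v t)) \<and>
     (\<forall>f. L2 UNIV f \<longrightarrow> continuous_on {0..} (\<lambda>t. LINT x|lebesgue. v t x \<bullet> f x))"

definition test_function :: "(real^'n) set \<Rightarrow> (real^'n \<Rightarrow> real) \<Rightarrow> bool" where
  "test_function U \<psi> \<longleftrightarrow> smooth_on UNIV \<psi> \<and>
     compact (closure {x. \<psi> x \<noteq> 0}) \<and> closure {x. \<psi> x \<noteq> 0} \<subseteq> U"

text \<open>In the following three notions \<open>U\<close> is open and the derivatives are in the sense of
  distributions on \<open>U\<close>; \<open>G x $ i $ j\<close> is the partial derivative of \<open>v $ i\<close> in the direction \<open>j\<close>,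
  respectively the \<open>(i, j)\<close> entry of the symmetric gradient.\<close>

definition weak_grad :: "(real^'n) set \<Rightarrow> (real^'n \<Rightarrow> real^'n) \<Rightarrow> (real^'n \<Rightarrow> real^'n^'n) \<Rightarrow> bool" where
  "weak_grad U v G \<longleftrightarrow> L1_loc U v \<and> L1_loc U G \<and>
     (\<forall>\<psi> i j. test_function U \<psi> \<longrightarrow>
        (LINT x:U|lebesgue. G x $ i $ j * \<psi> x) = - (LINT x:U|lebesgue. v x $ i * grad \<psi> x $ j))"

definition weak_sym_grad :: "(real^'n) set \<Rightarrow> (real^'n \<Rightarrow> real^'n) \<Rightarrow> (real^'n \<Rightarrow> real^'n^'n) \<Rightarrow> bool" where
  "weak_sym_grad U v G \<longleftrightarrow> L1_loc U v \<and> L1_loc U G \<and>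
     (\<forall>\<psi> i j. test_function U \<psi> \<longrightarrow>
        (LINT x:U|lebesgue. G x $ i $ j * \<psi> x) =
        - (LINT x:U|lebesgue. (v x $ i * grad \<psi> x $ j + v x $ j * grad \<psi> x $ i) / 2))"

definition weakly_div_free :: "(real^'n) set \<Rightarrow> (real^'n \<Rightarrow> real^'n) \<Rightarrow> bool" where
  "weakly_div_free U v \<longleftrightarrow> L1_loc U v \<and>
     (\<forall>\<psi>. test_function U \<psi> \<longrightarrow> (LINT x:U|lebesgue. v x \<bullet> grad \<psi> x) = 0)"

text \<open>For a square integrable divergence free field \<open>v\<close> on \<open>U\<close>, the normal component on the
  boundary is the functional given by Green's formula; the normal is the one pointing out of \<open>U\<close>.\<close>

definition normal_trace :: "(real^'n) set \<Rightarrow> (real^'n \<Rightarrow> real^'n) \<Rightarrow> (real^'n \<Rightarrow> real) \<Rightarrow> real" where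
  "normal_trace U v \<psi> = (LINT x:U|lebesgue. v x \<bullet> grad \<psi> x)"

subsection \<open>The rigid body\<close>

definition rigid_body :: "(real^'n) set \<Rightarrow> (real^'n \<Rightarrow> real) \<Rightarrow> bool" where
  "rigid_body S \<rho> \<longleftrightarrow>
     closed S \<and> connected S \<and> simply_connected S \<and> interior S \<noteq> {} \<and> smooth_boundary S \<and>
     (\<forall>x\<in>S. \<rho> x > 0) \<and> set_integrable lebesgue S \<rho> \<and>
     set_integrable lebesgue S (\<lambda>x. \<rho> x *\<^sub>R x) \<and> (LINT x:S|lebesgue. \<rho> x *\<^sub>R x) = 0"

definition mass :: "(real^'n) set \<Rightarrow> (real^'n \<Rightarrow> real) \<Rightarrow> real" where
  "mass S \<rho> = (LINT x:S|lebesgue. \<rho> x)"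

text \<open>Inertia at time \<open>0\<close>, when the centre of mass is the origin.\<close>

definition inertia2 :: "(real^2) set \<Rightarrow> (real^2 \<Rightarrow> real) \<Rightarrow> real" where
  "inertia2 S \<rho> = (LINT x:S|lebesgue. \<rho> x * (norm x)\<^sup>2)"

definition inertia3 :: "(real^3) set \<Rightarrow> (real^3 \<Rightarrow> real) \<Rightarrow> real^3^3" where
  "inertia3 S \<rho> =
     (LINT x:S|lebesgue. \<rho> x *\<^sub>R ((norm x)\<^sup>2 *\<^sub>R mat 1 - (\<chi> i j. x $ i * x $ j)))"

definition cross2 :: "real \<Rightarrow> real^2 \<Rightarrow> real^2" where
  "cross2 \<omega> x = \<omega> *\<^sub>R vector [- (x $ 2), x $ 1]"

text \<open>From here on \<open>ang\<close> is the action of angular velocities: \<open>cross2\<close> in dimension 2 (with scalar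
  angular velocities), \<open>cross3\<close> in dimension 3.

  Velocities are only essentially bounded in time, so \<open>h\<close> and \<open>Q\<close> are Lipschitz and their
  differential equations hold almost everywhere.\<close>

definition rigid_motion ::
  "('w \<Rightarrow> real^'n \<Rightarrow> real^'n) \<Rightarrow> (real \<Rightarrow> real^'n) \<Rightarrow> (real \<Rightarrow> 'w) \<Rightarrow>
   (real \<Rightarrow> real^'n) \<Rightarrow> (real \<Rightarrow> real^'n^'n) \<Rightarrow> bool" where
  "rigid_motion ang l \<omega> h Q \<longleftrightarrow>
     h 0 = 0 \<and> (\<exists>L. L-lipschitz_on {0..} h) \<and>
     (AE t in lebesgue_on {0..}. (h has_vector_derivative l t) (at t)) \<and>
     Q 0 = mat 1 \<and> (\<exists>L. L-lipschitz_on {0..} Q) \<and> (\<forall>t\<ge>0. rotation_matrix (Q t)) \<and>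
     (AE t in lebesgue_on {0..}. \<exists>Q'. (Q has_vector_derivative Q') (at t) \<and>
        (\<forall>x. (Q' ** transpose (Q t)) *v x = ang (\<omega> t) x))"

definition body_position :: "(real^'n) set \<Rightarrow> real^'n \<Rightarrow> real^'n^'n \<Rightarrow> (real^'n) set" where
  "body_position S h Q = {x. transpose Q *v (x - h) \<in> S}"

definition body_density :: "(real^'n \<Rightarrow> real) \<Rightarrow> real^'n \<Rightarrow> real^'n^'n \<Rightarrow> real^'n \<Rightarrow> real" where
  "body_density \<rho> h Q x = \<rho> (transpose Q *v (x - h))"

definition body_velocity ::
  "('w \<Rightarrow> real^'n \<Rightarrow> real^'n) \<Rightarrow> real^'n \<Rightarrow> 'w \<Rightarrow> real^'n \<Rightarrow> real^'n \<Rightarrow> real^'n" where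
  "body_velocity ang l \<omega> h x = l + ang \<omega> (x - h)"

text \<open>Global density and velocity at one instant, \<open>B\<close> being the current position of the body.\<close>

definition global_density :: "(real^'n) set \<Rightarrow> (real^'n \<Rightarrow> real) \<Rightarrow> real^'n \<Rightarrow> real" where
  "global_density B \<rho> x = (if x \<in> B then \<rho> x else 1)"

definition global_velocity ::
  "(real^'n) set \<Rightarrow> (real^'n \<Rightarrow> real^'n) \<Rightarrow> (real^'n \<Rightarrow> real^'n) \<Rightarrow> real^'n \<Rightarrow> real^'n" where
  "global_velocity B uS u x = (if x \<in> B then uS x else u x)"

definition initial_velocity ::
  "('w \<Rightarrow> real^'n \<Rightarrow> real^'n) \<Rightarrow> (real^'n) set \<Rightarrow> (real^'n \<Rightarrow> real^'n) \<Rightarrow> real^'n \<Rightarrow> 'w \<Rightarrow>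
   real^'n \<Rightarrow> real^'n" where
  "initial_velocity ang S u0 l0 \<omega>0 = global_velocity S (body_velocity ang l0 \<omega>0 0) u0"

text \<open>The outer normals of the fluid domain and of the body are opposite, whence the sign.\<close>

definition compatible ::
  "('w \<Rightarrow> real^'n \<Rightarrow> real^'n) \<Rightarrow> (real^'n) set \<Rightarrow> (real^'n \<Rightarrow> real^'n) \<Rightarrow> real^'n \<Rightarrow> 'w \<Rightarrow> bool" where
  "compatible ang S u0 l0 \<omega>0 \<longleftrightarrow> weakly_div_free (- S) u0 \<and>
     (\<forall>\<psi>. test_function UNIV \<psi> \<longrightarrow>
        normal_trace (- S) u0 \<psi> = - normal_trace (interior S) (body_velocity ang l0 \<omega>0 0) \<psi>)"

subsection \<open>Hopf-Leray weak solutions\<close>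

text \<open>Smooth compactly supported functions on the closed half space of nonnegative times are
  represented by smooth compactly supported extensions to all times; only nonnegative times matter
  below. \<open>B t\<close> is the position of the body.\<close>

definition fluid_body_test_function ::
  "(real \<Rightarrow> (real^'n) set) \<Rightarrow> (real \<times> (real^'n) \<Rightarrow> real^'n) \<Rightarrow> bool" where
  "fluid_body_test_function B \<phi> \<longleftrightarrow>
     smooth_on UNIV \<phi> \<and> compact (closure {z. \<phi> z \<noteq> 0}) \<and>
     (\<forall>t\<ge>0. \<forall>x. divergence (\<lambda>y. \<phi> (t, y)) x = 0) \<and>
     (\<forall>t\<ge>0. \<forall>x\<in>B t. sym_grad (\<lambda>y. \<phi> (t, y)) x = 0)"

definition Linf_time_L2 :: "(real \<Rightarrow> (real^'n) set) \<Rightarrow> (real \<Rightarrow> real^'n \<Rightarrow> real^'n) \<Rightarrow> bool" where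
  "Linf_time_L2 F u \<longleftrightarrow>
     set_borel_measurable lebesgue {(t, x). t \<ge> 0 \<and> x \<in> F t} (\<lambda>(t, x). u t x) \<and>
     (\<exists>C. AE t in lebesgue_on {0..}.
        L2 (F t) (u t) \<and> (LINT x:F t|lebesgue. (norm (u t x))\<^sup>2) \<le> C)"

definition L2_loc_time_H1 :: "(real \<Rightarrow> (real^'n) set) \<Rightarrow> (real \<Rightarrow> real^'n \<Rightarrow> real^'n) \<Rightarrow> bool" where
  "L2_loc_time_H1 F u \<longleftrightarrow>
     set_borel_measurable lebesgue {(t, x). t \<ge> 0 \<and> x \<in> F t} (\<lambda>(t, x). u t x) \<and>
     (\<exists>G. set_borel_measurable lebesgue {(t, x). t \<ge> 0 \<and> x \<in> F t} (\<lambda>(t, x). G t x) \<and>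
        (AE t in lebesgue_on {0..}. L2 (F t) (u t) \<and> L2 (F t) (G t) \<and> weak_grad (F t) (u t) (G t)) \<and>
        (\<forall>T>0. (\<integral>\<^sup>+t\<in>{0..T}. (\<integral>\<^sup>+x\<in>F t. ennreal ((norm (u t x))\<^sup>2 + (norm (G t x))\<^sup>2) \<partial>lebesgue)
                 \<partial>lebesgue) < \<infinity>))"

text \<open>Below, \<open>B t\<close>, \<open>\<rho>' t\<close> and \<open>u' t\<close> are the position of the body and the global density and
  velocity at time \<open>t\<close>, \<open>\<rho>0'\<close> and \<open>u0'\<close> the initial ones, and \<open>Du\<close> is the distributional
  symmetric gradient of \<open>u'\<close> on the whole space. The pair \<open>(h, Q)\<close> is determined by \<open>(l, \<omega>)\<close>, and
  \<open>Du\<close> is determined almost everywhere by \<open>u'\<close>. As \<open>u\<close>, \<open>l\<close>, \<open>\<omega>\<close> are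
  classes modulo equality at almost every time, weak continuity is that of a representative.\<close>

definition hopf_leray ::
  "('w::euclidean_space \<Rightarrow> real^'n \<Rightarrow> real^'n) \<Rightarrow> real \<Rightarrow>
   (real^'n) set \<Rightarrow> (real^'n \<Rightarrow> real) \<Rightarrow> (real^'n \<Rightarrow> real^'n) \<Rightarrow> real^'n \<Rightarrow> 'w \<Rightarrow>
   (real \<Rightarrow> real^'n \<Rightarrow> real^'n) \<Rightarrow> (real \<Rightarrow> real^'n) \<Rightarrow> (real \<Rightarrow> 'w) \<Rightarrow> bool" where
  "hopf_leray ang \<nu> S \<rho>0 u0 l0 \<omega>0 u l \<omega> \<longleftrightarrow>
    (\<exists>h Q B \<rho>' u' \<rho>0' u0' Du.
       rigid_motion ang l \<omega> h Q \<and>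
       B = (\<lambda>t. body_position S (h t) (Q t)) \<and>
       \<rho>' = (\<lambda>t. global_density (B t) (body_density \<rho>0 (h t) (Q t))) \<and>
       u' = (\<lambda>t. global_velocity (B t) (body_velocity ang (l t) (\<omega> t) (h t)) (u t)) \<and>
       \<rho>0' = global_density S \<rho>0 \<and>
       u0' = initial_velocity ang S u0 l0 \<omega>0 \<and>
       Linf_time l \<and> Linf_time \<omega> \<and>
       Linf_time_L2 (\<lambda>t. - B t) u \<and> L2_loc_time_H1 (\<lambda>t. - B t) u \<and>
       (\<exists>v. weakly_continuous_L2 v \<and>
          (AE t in lebesgue_on {0..}. AE x in lebesgue. v t x = u' t x)) \<and>
       set_borel_measurable lebesgue ({0..} \<times> UNIV) (\<lambda>(t, x). Du t x) \<and>
       (AE t in lebesgue_on {0..}. weak_sym_grad UNIV (u' t) (Du t)) \<and>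
       (AE t in lebesgue_on {0..}. weakly_div_free UNIV (u' t)) \<and>
       (AE t in lebesgue_on {0..}. AE x in lebesgue. x \<in> B t \<longrightarrow> Du t x = 0) \<and>
       (\<forall>\<phi>. fluid_body_test_function B \<phi> \<longrightarrow>
          - (LINT t:{0..}|lebesgue. LINT x|lebesgue.
               \<rho>' t x * (u' t x \<bullet> (vector_derivative (\<lambda>s. \<phi> (s, x)) (at t)
                                    + jacobian (\<lambda>y. \<phi> (t, y)) (at x) *v u' t x))
               - 2 * \<nu> * (Du t x \<bullet> sym_grad (\<lambda>y. \<phi> (t, y)) x))
          = (LINT x|lebesgue. \<rho>0' x * (u0' x \<bullet> \<phi> (0, x)))) \<and>
       (AE t in lebesgue_on {0..}.
          (\<integral>\<^sup>+x. ennreal (\<rho>' t x * (norm (u' t x))\<^sup>2) \<partial>lebesgue)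
          + ennreal (4 * \<nu>) * (\<integral>\<^sup>+s\<in>{0..t}. (\<integral>\<^sup>+x. ennreal ((norm (Du s x))\<^sup>2) \<partial>lebesgue) \<partial>lebesgue)
          \<le> (\<integral>\<^sup>+x. ennreal (\<rho>0' x * (norm (u0' x))\<^sup>2) \<partial>lebesgue)))"

text \<open>Admissible initial data together with a solution issued from them.\<close>

definition fluid_body_solution ::
  "('w::euclidean_space \<Rightarrow> real^'n \<Rightarrow> real^'n) \<Rightarrow> real \<Rightarrow>
   (real^'n) set \<Rightarrow> (real^'n \<Rightarrow> real) \<Rightarrow> (real^'n \<Rightarrow> real^'n) \<Rightarrow> real^'n \<Rightarrow> 'w \<Rightarrow>
   (real \<Rightarrow> real^'n \<Rightarrow> real^'n) \<Rightarrow> (real \<Rightarrow> real^'n) \<Rightarrow> (real \<Rightarrow> 'w) \<Rightarrow> bool" where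
  "fluid_body_solution ang \<nu> S \<rho>0 u0 l0 \<omega>0 u l \<omega> \<longleftrightarrow>
     rigid_body S \<rho>0 \<and> compatible ang S u0 l0 \<omega>0 \<and>
     L2 UNIV (initial_velocity ang S u0 l0 \<omega>0) \<and>
     hopf_leray ang \<nu> S \<rho>0 u0 l0 \<omega>0 u l \<omega>"

end

theory Submission
  imports Defs
begin

text \<open>The momentum of the body is read off the weak formulation with a test field that is constant on
  the body. Dyadic averages of cut-offs of a constant vector \<open>e\<close>, corrected to be divergence free,
  give fields \<open>W\<close> with \<open>W = e\<close> near the origin, supported in a ball of radius \<open>R = 2\<^sup>N \<cdot> 2\<epsilon>\<close>, bounded
  uniformly, small in \<open>L\<^sup>2\<close>, and whose gradient is small in \<open>L\<^sup>2\<close>: in dimension 3 by scaling with \<open>N = 1\<close>,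
  in dimension 2 like \<open>1 / \<surd>N\<close>, where \<open>N \<rightarrow> \<infinity>\<close> slowly enough that \<open>R \<rightarrow> 0\<close>.

  Test with \<open>\<sigma>(t) W(x - h\<^sub>\<delta>(t))\<close>, where \<open>h\<^sub>\<delta>\<close> is a smooth approximation within \<open>\<epsilon>\<close> of the trajectory \<open>h\<close> and
  \<open>\<sigma>\<close> approximates the indicator of \<open>[0, a]\<close>. Since the centre of mass is at rest in the body frame,
  the body contributes \<open>m (l(a) - l\<^sup>i\<^sup>n) \<bullet> e\<close>, and it remains to bound the fluid terms by \<open>o(m)\<close>. Because
  \<open>u\<close> and \<open>W\<close> are divergence free, the convective term equals \<open>-2 \<integral> (D(u) u) \<bullet> W\<close> and the transport term
  equals \<open>-2 \<integral> (D(u) h\<^sub>\<delta>') \<bullet> W\<close>. The symmetric gradient vanishes on the body, so only the \<open>L\<^sup>2\<close> norm of \<open>u\<close> over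
  the fluid part of a ball of radius \<open>R\<close> enters the former; it is of order \<open>\<surd>R\<close>, since
  \<open>\<integral> |u\<^sub>i|\<^sup>2\<close> over a slab of width \<open>R\<close> is at most a multiple of \<open>R \<integral> |u\<^sub>i| |D(u)\<^sub>i\<^sub>i|\<close>.\<close>

subsection \<open>Smooth functions\<close>

text \<open>The energy controls the velocity weighted by the density, so on the body neither the
  angular velocity nor the unweighted L2 norm is bounded uniformly. Hence the fluid terms are
  rewritten through the symmetric gradient, which does not see the body, and the test field is
  constant near it. A single cut-off at scale r has squared gradient norm of order r^(d-2). With r
  of order \<epsilon> this gives a norm of order \<epsilon>^(1/2) in dimension 3, exactly the
  threshold imposed on the mass, but no decay in dimension 2; there, spreading the transition over N
  disjoint annuli gains a factor 1/N in the squared norm. The trajectory is only Lipschitz whereas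
  test functions are smooth; following a smooth curve at distance \<epsilon> merely doubles the
  radius on which the field must be constant. The outcome is a bound at almost every time, m |(l -
  l_in) . e| \<le> c (R^(d/2) (1 + m^(-1/2)) + R^(1/2) + g), where g measures the gradient of the
  field and c depends on the energy, \<nu>, e, the dimension and the time horizon. No compactness
  argument enters, so the convergence is uniform on bounded time intervals.\<close>

lemma frechet_derivative_cong_open:
  assumes "open U" "x \<in> U" "\<And>y. y \<in> U \<Longrightarrow> f y = g y"
  shows "frechet_derivative f (at x) = frechet_derivative g (at x)"
proof -
  have "(f has_derivative D) (at x) \<longleftrightarrow> (g has_derivative D) (at x)" for D
    using has_derivative_transform_within_open[of f D x UNIV U g]
          has_derivative_transform_within_open[of g D x UNIV U f] assms by auto
  then show ?thesis by (simp add: frechet_derivative_def)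
qed

lemma differentiable_cong_open:
  assumes "open U" "x \<in> U" "\<And>y. y \<in> U \<Longrightarrow> f y = g y" "f differentiable (at x)"
  shows "g differentiable (at x)"
  using has_derivative_transform_within_open[of f _ x UNIV U g] assms
  unfolding differentiable_def by blast

text \<open>A derivative at a point only sees a neighbourhood, so on an open set equality of
  functions passes to all directional derivatives and the induction can continue with them.\<close>

lemma Ck_on_cong:
  assumes "open U" "\<And>x. x \<in> U \<Longrightarrow> f x = g x" "Ck_on k U f"
  shows "Ck_on k U g"
  using assms(2,3)
proof (induction k arbitrary: f g)
  case 0
  then show ?case using continuous_on_cong[of U U f g] by simp
next
  case (Suc k)
  have "Ck_on k U (\<lambda>x. frechet_derivative g (at x) v)" for v
    using Suc.IH[of "\<lambda>x. frechet_derivative f (at x) v" "\<lambda>x. frechet_derivative g (at x) v"]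
      frechet_derivative_cong_open[OF assms(1), of _ f g] Suc.prems by auto
  then show ?case
    using differentiable_cong_open[OF assms(1), of _ f g] Suc.prems by auto
qed

text \<open>Derivatives are unique, so an explicit formula \<open>f'\<close> may stand in for
  \<open>frechet_derivative\<close>. The inductions for sums, products, compositions and
  convolutions all enter through this rule.\<close>

lemma Ck_on_SucI:
  assumes "open U" "\<And>x. x \<in> U \<Longrightarrow> (f has_derivative f' x) (at x)"
    and "\<And>v. Ck_on k U (\<lambda>x. f' x v)"
  shows "Ck_on (Suc k) U f"
proof -
  have "frechet_derivative f (at x) = f' x" if "x \<in> U" for x
    using frechet_derivative_at[OF assms(2)[OF that]] by simp
  then have "Ck_on k U (\<lambda>x. frechet_derivative f (at x) v)" for v
    using Ck_on_cong[OF assms(1) _ assms(3)[of v]] by simp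
  then show ?thesis using assms(2) by (auto simp: differentiable_def)
qed

lemma Ck_on_continuous_on: "Ck_on k U f \<Longrightarrow> continuous_on U f"
  by (cases k) (auto intro!: continuous_at_imp_continuous_on dest: differentiable_imp_continuous_within)

lemma Ck_on_pred: "Ck_on (Suc k) U f \<Longrightarrow> Ck_on k U f"
proof (induction k arbitrary: f)
  case 0 then show ?case using Ck_on_continuous_on[OF 0] by simp
next
  case (Suc k) then show ?case by (metis Ck_on.simps(2))
qed

lemma Ck_on_const: "Ck_on k U (\<lambda>x. c)"
  by (induction k arbitrary: c) (auto simp: frechet_derivative_const)

lemma Ck_on_has_derivative:
  "Ck_on (Suc k) U f \<Longrightarrow> x \<in> U \<Longrightarrow> (f has_derivative frechet_derivative f (at x)) (at x)"
  by (simp add: frechet_derivative_works)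

lemma Ck_on_linear:
  assumes "open U" "bounded_linear L" "Ck_on k U f"
  shows "Ck_on k U (\<lambda>x. L (f x))"
  using assms(3)
proof (induction k arbitrary: f)
  case 0
  then show ?case by (simp add: bounded_linear.continuous_on[OF assms(2)])
next
  case (Suc k)
  show ?case
    by (rule Ck_on_SucI[OF assms(1) bounded_linear.has_derivative[OF assms(2) Ck_on_has_derivative[OF Suc.prems]]])
      (use Suc in auto)
qed

lemma Ck_on_bounded_linear: "open U \<Longrightarrow> bounded_linear L \<Longrightarrow> Ck_on k U L"
proof (cases k)
  case 0 then show "bounded_linear L \<Longrightarrow> ?thesis" by (simp add: linear_continuous_on)
next
  case (Suc j)
  assume "open U" "bounded_linear L"
  then show ?thesis unfolding Suc
    by (intro Ck_on_SucI[where f' = "\<lambda>_. L"] Ck_on_const) (auto intro: bounded_linear_imp_has_derivative)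
qed

lemma Ck_on_add:
  assumes "open U" "Ck_on k U f" "Ck_on k U g"
  shows "Ck_on k U (\<lambda>x. f x + g x)"
  using assms(2,3)
proof (induction k arbitrary: f g)
  case 0 then show ?case by (simp add: continuous_on_add)
next
  case (Suc k)
  show ?case
    by (rule Ck_on_SucI[OF assms(1) has_derivative_add[OF Ck_on_has_derivative[OF Suc.prems(1)]
       Ck_on_has_derivative[OF Suc.prems(2)]]]) (use Suc in auto)
qed

lemma Ck_on_sum:
  assumes "open U" "\<And>i. i \<in> I \<Longrightarrow> Ck_on k U (f i)"
  shows "Ck_on k U (\<lambda>x. \<Sum>i\<in>I. f i x)"
  using assms(2)
  by (induction I rule: infinite_finite_induct) (auto intro: Ck_on_const Ck_on_add[OF assms(1)])

lemma Ck_on_bilinear: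
  assumes "open U" "bounded_bilinear B" "Ck_on k U f" "Ck_on k U g"
  shows "Ck_on k U (\<lambda>x. B (f x) (g x))"
  using assms(3,4)
proof (induction k arbitrary: f g)
  case 0 then show ?case by (simp add: bounded_bilinear.continuous_on[OF assms(2)])
next
  case (Suc k)
  have "Ck_on k U (\<lambda>x. B (f x) (frechet_derivative g (at x) v) + B (frechet_derivative f (at x) v) (g x))" for v
    using Suc.prems by (intro Ck_on_add[OF assms(1)] Suc.IH) (simp_all add: Ck_on_pred del: Ck_on.simps, simp_all)
  moreover have "((\<lambda>x. B (f x) (g x)) has_derivative
      (\<lambda>v. B (f x) (frechet_derivative g (at x) v) + B (frechet_derivative f (at x) v) (g x))) (at x)" if "x \<in> U" for x
    by (rule bounded_bilinear.FDERIV[OF assms(2) Ck_on_has_derivative[OF Suc.prems(1) that]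
         Ck_on_has_derivative[OF Suc.prems(2) that]])
  ultimately show ?case by (intro Ck_on_SucI[OF assms(1)])
qed

text \<open>The chain rule produces \<open>Dg (f x) (Df x v)\<close>, in which both the point and
  the direction vary with x. Expanding the direction in the basis leaves the derivative of
  \<open>g\<close> only at fixed directions, so the induction hypothesis applies to each coefficient
  and the rest is a product.\<close>

lemma Ck_on_compose:
  fixes g :: "'b::euclidean_space \<Rightarrow> 'c::real_normed_vector"
  assumes "open U" "open V" "Ck_on k U f" "Ck_on k V g" "f ` U \<subseteq> V"
  shows "Ck_on k U (\<lambda>x. g (f x))"
  using assms(3,4)
proof (induction k arbitrary: g)
  case 0 then show ?case using assms(5) by (simp add: continuous_on_compose2)
next
  case (Suc k)
  let ?f' = "\<lambda>x. frechet_derivative f (at x)" and ?g' = "\<lambda>y. frechet_derivative g (at y)"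
  have d: "(g has_derivative ?g' (f x)) (at (f x))" if "x \<in> U" for x
    by (rule Ck_on_has_derivative[OF Suc.prems(2)]) (use that assms(5) in auto)
  have lin: "?g' (f x) w = (\<Sum>b\<in>Basis. (w \<bullet> b) *\<^sub>R ?g' (f x) b)" if "x \<in> U" for x w
  proof -
    interpret bounded_linear "?g' (f x)" using d[OF that] by (rule has_derivative_bounded_linear)
    show ?thesis by (subst euclidean_representation[of w, symmetric]) (simp only: sum scaleR)
  qed
  have "Ck_on k U (\<lambda>x. ?g' (f x) (?f' x v))" for v
  proof (rule Ck_on_cong[OF assms(1) lin[symmetric]])
    show "Ck_on k U (\<lambda>x. \<Sum>b\<in>Basis. (?f' x v \<bullet> b) *\<^sub>R ?g' (f x) b)"
    proof (intro Ck_on_sum[OF assms(1)] Ck_on_bilinear[OF assms(1) bounded_bilinear_scaleR])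
      show "Ck_on k U (\<lambda>x. ?f' x v \<bullet> b)" for b
        using Suc.prems(1) by (auto intro: Ck_on_linear[OF assms(1) bounded_linear_inner_left])
      show "Ck_on k U (\<lambda>x. ?g' (f x) b)" for b
        by (rule Suc.IH[OF Ck_on_pred[OF Suc.prems(1)]]) (use Suc.prems(2) in auto)
    qed
  qed
  moreover have "((\<lambda>x. g (f x)) has_derivative (\<lambda>v. ?g' (f x) (?f' x v))) (at x)" if "x \<in> U" for x
    using has_derivative_compose[OF Ck_on_has_derivative[OF Suc.prems(1) that], of g "?g' (f x)"] d[OF that] by simp
  ultimately show ?case
    by (intro Ck_on_SucI[OF assms(1), where f' = "\<lambda>x v. ?g' (f x) (?f' x v)"])
qed

text \<open>The derivative of 1/x is minus a product of two copies of 1/x, so each order reduces to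
  the previous one by the product rule.\<close>

lemma Ck_on_inverse: "Ck_on k {0<..} (\<lambda>x::real. inverse x)"
proof (induction k)
  case 0 then show ?case by (auto intro!: continuous_intros)
next
  case (Suc k)
  have d: "((\<lambda>x::real. inverse x) has_derivative (\<lambda>v. - (inverse x * v * inverse x))) (at x)" if "x \<in> {0<..}" for x
    using that by (intro has_derivative_inverse') auto
  have "Ck_on k {0<..} (\<lambda>x. - v * (inverse x * inverse x))" for v :: real
    by (intro Ck_on_linear[OF _ bounded_linear_mult_right] Ck_on_bilinear[OF _ bounded_bilinear_mult] Suc) auto
  then have "Ck_on k {0<..} (\<lambda>x. - (inverse x * v * inverse x))" for v :: real
    by (rule Ck_on_cong[rotated 2]) auto
  then show ?case by (intro Ck_on_SucI[OF _ d]) auto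
qed

lemma smooth_on_const: "smooth_on U (\<lambda>x. c)"
  unfolding smooth_on_def using Ck_on_const by blast
lemma smooth_on_linear: "open U \<Longrightarrow> bounded_linear L \<Longrightarrow> smooth_on U f \<Longrightarrow> smooth_on U (\<lambda>x. L (f x))"
  unfolding smooth_on_def using Ck_on_linear by blast
lemma smooth_on_bounded_linear: "open U \<Longrightarrow> bounded_linear L \<Longrightarrow> smooth_on U L"
  unfolding smooth_on_def using Ck_on_bounded_linear by blast
lemma smooth_on_add: "open U \<Longrightarrow> smooth_on U f \<Longrightarrow> smooth_on U g \<Longrightarrow> smooth_on U (\<lambda>x. f x + g x)"
  unfolding smooth_on_def using Ck_on_add by blast
lemma smooth_on_sum: "open U \<Longrightarrow> (\<And>i. i \<in> I \<Longrightarrow> smooth_on U (f i)) \<Longrightarrow> smooth_on U (\<lambda>x. \<Sum>i\<in>I. f i x)"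
  unfolding smooth_on_def using Ck_on_sum[of U I _ f] by blast
lemma smooth_on_bilinear:
  "open U \<Longrightarrow> bounded_bilinear B \<Longrightarrow> smooth_on U f \<Longrightarrow> smooth_on U g \<Longrightarrow> smooth_on U (\<lambda>x. B (f x) (g x))"
  unfolding smooth_on_def using Ck_on_bilinear by blast
lemma smooth_on_compose:
  "open U \<Longrightarrow> open V \<Longrightarrow> smooth_on U f \<Longrightarrow> smooth_on V g \<Longrightarrow> f ` U \<subseteq> V \<Longrightarrow> smooth_on U (\<lambda>x. g (f x))"
  unfolding smooth_on_def using Ck_on_compose by blast
lemma smooth_on_compose_UNIV:
  "smooth_on UNIV f \<Longrightarrow> smooth_on UNIV g \<Longrightarrow> smooth_on UNIV (\<lambda>x. g (f x))"
  by (rule smooth_on_compose) auto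
lemma smooth_on_diff:
  assumes "open U" "smooth_on U f" "smooth_on U g" shows "smooth_on U (\<lambda>x. f x - g x)"
  using smooth_on_add[OF assms(1,2) smooth_on_linear[OF assms(1) bounded_linear_minus[OF bounded_linear_ident] assms(3)]] by simp

lemmas smooth_on_mult = smooth_on_bilinear[OF _ bounded_bilinear_mult]
lemmas smooth_on_scaleR = smooth_on_bilinear[OF _ bounded_bilinear_scaleR]
lemmas smooth_on_inner = smooth_on_bilinear[OF _ bounded_bilinear_inner]

lemma smooth_on_id: "open U \<Longrightarrow> smooth_on U (\<lambda>x. x)"
  by (rule smooth_on_bounded_linear) auto

lemma smooth_on_has_derivative:
  "smooth_on U f \<Longrightarrow> x \<in> U \<Longrightarrow> (f has_derivative frechet_derivative f (at x)) (at x)"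
  using Ck_on_has_derivative[of 0] unfolding smooth_on_def by blast

lemma smooth_on_frechet_derivative:
  "smooth_on U f \<Longrightarrow> smooth_on U (\<lambda>x. frechet_derivative f (at x) v)"
  unfolding smooth_on_def by (metis Ck_on.simps(2))

lemma smooth_on_continuous_on: "smooth_on U f \<Longrightarrow> continuous_on U f"
  unfolding smooth_on_def using Ck_on_continuous_on by blast

lemma smooth_on_power2:
  fixes f :: "'a::euclidean_space \<Rightarrow> real"
  assumes "open U" "smooth_on U f" shows "smooth_on U (\<lambda>x. (f x)\<^sup>2)"
  using smooth_on_mult[OF assms assms(2)] by (simp add: power2_eq_square)

text \<open>\<open>flat P\<close> is the general form of the derivatives of \<open>\<lambda>x. exp (- 1 / x)\<close>, extended by 0.\<close>

definition flat :: "real poly \<Rightarrow> real \<Rightarrow> real" where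
  "flat P x = (if x > 0 then poly P (inverse x) * exp (- inverse x) else 0)"

text \<open>The substitution x = 1/y turns the extra factor 1/y into a multiplication of the
  polynomial by x, which is \<open>pCons 0 P\<close>, and the exponential beats every polynomial at
  infinity. The limit says that \<open>flat P\<close> is differentiable at 0 with derivative
  0.\<close>

lemma flat_at_0: "((\<lambda>y. flat P y / y) \<longlongrightarrow> 0) (at 0)"
proof -
  have lim: "((\<lambda>x::real. x ^ k * exp (- x)) \<longlongrightarrow> 0) at_top" for k :: nat
    using tendsto_power_div_exp_0[of k] by (simp add: exp_minus divide_inverse)
  have "((\<lambda>x. poly (pCons 0 P) x * exp (- x)) \<longlongrightarrow> 0) at_top"
    unfolding poly_altdef sum_distrib_right mult.assoc
    by (intro tendsto_null_sum tendsto_mult_right_zero lim)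
  then have "((\<lambda>y. poly (pCons 0 P) (inverse y) * exp (- inverse y)) \<longlongrightarrow> 0) (at_right 0)"
    by (rule filterlim_compose[OF _ filterlim_inverse_at_top_right])
  then have "((\<lambda>y. flat P y / y) \<longlongrightarrow> 0) (at_right 0)"
    by (rule Lim_transform_eventually) (auto simp: eventually_at_filter flat_def field_simps)
  moreover have "((\<lambda>y. flat P y / y) \<longlongrightarrow> 0) (at_left 0)"
    by (rule Lim_transform_eventually[OF tendsto_const]) (auto simp: eventually_at_filter flat_def)
  ultimately show ?thesis by (simp add: filterlim_split_at_real)
qed

text \<open>Differentiating P(1/x) exp(-1/x) gives x^(-2) (P - P')(1/x) exp(-1/x), which has the
  same shape with the polynomial X^2 (P - P'). The class is thus closed under differentiation, which
  yields smoothness.\<close>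

lemma flat_has_field_derivative:
  "(flat P has_field_derivative flat (monom 1 2 * (P - pderiv P)) x) (at x)"
proof -
  consider "x > 0" | "x < 0" | "x = 0" by linarith
  then show ?thesis
  proof cases
    case 1
    have "((\<lambda>x. poly P (inverse x) * exp (- inverse x)) has_field_derivative 
        flat (monom 1 2 * (P - pderiv P)) x) (at x)"
      using 1 by (auto intro!: derivative_eq_intros 
        simp: flat_def poly_monom power2_eq_square algebra_simps)
    then show ?thesis
      by (rule has_field_derivative_transform_within_open[where S = "{0<..}"]) (use 1 in \<open>auto simp: flat_def dist_real_def\<close>)
  next
    case 2
    have "((\<lambda>x. 0) has_field_derivative flat (monom 1 2 * (P - pderiv P)) x) (at x)"
      using 2 by (simp add: flat_def)
    then show ?thesis
      by (rule has_field_derivative_transform_within_open[where S = "{..<0}"]) (use 2 in \<open>auto simp: flat_def dist_real_def\<close>)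
  next
    case 3
    then show ?thesis using flat_at_0[of P] by (simp add: DERIV_def flat_def)
  qed
qed

lemma smooth_flat: "smooth_on UNIV (flat P)"
proof -
  have "Ck_on k UNIV (flat P)" for k
  proof (induction k arbitrary: P)
    case 0 show ?case
      by (auto intro!: continuous_at_imp_continuous_on DERIV_isCont flat_has_field_derivative)
  next
    case (Suc k)
    show ?case
      by (intro Ck_on_SucI[OF _ flat_has_field_derivative[unfolded has_field_derivative_def]]
          Ck_on_bilinear[OF _ bounded_bilinear_mult] Suc Ck_on_const) auto
  qed
  then show ?thesis by (simp add: smooth_on_def)
qed

definition smooth_step :: "real \<Rightarrow> real" where
  "smooth_step x = flat 1 x * inverse (flat 1 x + flat 1 (1 - x))"

lemma flat1: "flat 1 x \<ge> 0" "flat 1 x > 0 \<longleftrightarrow> x > 0" "flat 1 x = 0 \<longleftrightarrow> x \<le> 0"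
  by (auto simp: flat_def)

text \<open>The numbers x and 1 - x are never both nonpositive.\<close>

lemma smooth_step_denominator_pos: "flat 1 x + flat 1 (1 - x) > 0"
  by (cases "x > 0") (auto simp: flat_def add_pos_nonneg)

lemma smooth_step_smooth: "smooth_on UNIV smooth_step"
proof -
  have *: "smooth_on UNIV (\<lambda>x. flat 1 (1 - x))"
    by (intro smooth_on_compose_UNIV[OF _ smooth_flat] smooth_on_diff smooth_on_const smooth_on_id) auto
  have "smooth_on UNIV (\<lambda>x. inverse (flat 1 x + flat 1 (1 - x)))"
    by (rule smooth_on_compose[where V = "{0<..}" and g = inverse])
       (use * Ck_on_inverse smooth_step_denominator_pos in \<open>auto intro!: smooth_on_add smooth_flat simp: smooth_on_def[of "{0<..}"]\<close>)
  then have "smooth_on UNIV (\<lambda>x. flat 1 x * inverse (flat 1 x + flat 1 (1 - x)))"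
    by (intro smooth_on_mult smooth_flat) auto
  then show ?thesis by (simp add: smooth_step_def[abs_def])
qed

lemma smooth_step_0: "x \<le> 0 \<Longrightarrow> smooth_step x = 0"
  by (simp add: smooth_step_def flat_def)

lemma smooth_step_pos: "x > 0 \<Longrightarrow> smooth_step x > 0"
  using smooth_step_denominator_pos[of x] by (simp add: smooth_step_def flat1)

lemma smooth_step_1: "x \<ge> 1 \<Longrightarrow> smooth_step x = 1"
  by (simp add: smooth_step_def flat_def)

lemma smooth_step_range: "0 \<le> smooth_step x" "smooth_step x \<le> 1"
  using flat1[of x] flat1[of "1 - x"] smooth_step_denominator_pos[of x]
  by (auto simp: smooth_step_def field_simps)

subsection \<open>Mollification\<close>

lemma norm_integral_le_AE:
  fixes f :: "'a \<Rightarrow> 'b::{banach, second_countable_topology}"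
  assumes "integrable M g" "AE x in M. norm (f x) \<le> g x"
  shows "norm (LINT x|M. f x) \<le> (LINT x|M. g x)"
proof -
  have "AE x in M. 0 \<le> g x" using assms(2) by eventually_elim (use norm_ge_zero order_trans in blast)
  then show ?thesis
    by (intro order_trans[OF integral_norm_bound integral_mono_AE'] assms) auto
qed

text \<open>Compact support with an explicit radius and without closures: the property passes at
  once to products, derivatives and translates, and the radii that enter the estimates stay
  visible.\<close>

definition ball_supported :: "real \<Rightarrow> ('a::real_normed_vector \<Rightarrow> 'b::zero) \<Rightarrow> bool" where
  "ball_supported r k \<longleftrightarrow> (\<forall>z. r < norm z \<longrightarrow> k z = 0)"

lemma ball_supported_frechet_derivative:
  assumes "ball_supported r k"
  shows "ball_supported r (\<lambda>z. frechet_derivative k (at z) v)"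
  unfolding ball_supported_def
proof safe
  fix z :: 'a assume z: "r < norm z"
  have "open {z::'a. r < norm z}" by (intro open_Collect_less continuous_intros)
  then have "frechet_derivative k (at z) = frechet_derivative (\<lambda>z. 0) (at z)"
    using z assms by (intro frechet_derivative_cong_open) (auto simp: ball_supported_def)
  then show "frechet_derivative k (at z) v = 0" by simp
qed

lemma ball_supported_bounded:
  fixes k :: "'a::euclidean_space \<Rightarrow> 'b::real_normed_vector"
  assumes "continuous_on UNIV k" "ball_supported r k"
  obtains B where "B > 0" "\<And>z. norm (k z) \<le> B"
proof -
  have "compact (k ` cball 0 r)"
    by (intro compact_continuous_image continuous_on_subset[OF assms(1)]) auto
  then obtain B where B: "B > 0" "\<And>z. z \<in> cball 0 r \<Longrightarrow> norm (k z) \<le> B"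
    using bounded_pos[of "k ` cball 0 r"] compact_imp_bounded by (auto simp: image_iff)
  show ?thesis
  proof (rule that[OF B(1)])
    show "norm (k z) \<le> B" for z
      using B assms(2) by (cases "norm z \<le> r") (auto simp: ball_supported_def)
  qed
qed

lemma ball_supported_integrable:
  fixes g :: "'a::euclidean_space \<Rightarrow> 'b::euclidean_space"
  assumes "continuous_on UNIV g" "ball_supported r g"
  shows "integrable lborel g"
proof -
  have "integrable lborel (\<lambda>z. indicator (cball 0 r) z *\<^sub>R g z)"
    by (intro borel_integrable_compact continuous_on_subset[OF assms(1)]) auto
  moreover have "indicator (cball 0 r) z *\<^sub>R g z = g z" for z
    using assms(2) by (auto simp: ball_supported_def indicator_def)
  ultimately show ?thesis by simp
qed

lemma ball_supported_uniformly_continuous: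
  fixes g :: "'a::euclidean_space \<Rightarrow> 'b::real_normed_vector"
  assumes "continuous_on UNIV g" "ball_supported r g" "e > 0"
  obtains d where "0 < d" "d \<le> 1" "\<And>x y::'a. dist x y < d \<Longrightarrow> dist (g x) (g y) < e"
proof -
  have "uniformly_continuous_on (cball 0 (r + 1)) g"
    by (intro compact_uniformly_continuous continuous_on_subset[OF assms(1)]) auto
  then obtain d where d: "d > 0"
    "\<And>x y. x \<in> cball 0 (r + 1) \<Longrightarrow> y \<in> cball 0 (r + 1) \<Longrightarrow> dist y x < d \<Longrightarrow> dist (g y) (g x) < e"
    using assms(3) unfolding uniformly_continuous_on_def by metis
  show ?thesis
  proof (rule that[of "min d 1"])
    fix x y :: 'a assume xy: "dist x y < min d (1::real)"
    have n: "norm y \<le> norm x + dist x y" "norm x \<le> norm y + dist x y"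
      using norm_triangle_sub[of y x] norm_triangle_sub[of x y] by (auto simp: dist_norm norm_minus_commute)
    show "dist (g x) (g y) < e"
    \<comment> \<open>The margin 1 matches d \<le> 1: if one of two points at distance below 1
      leaves the ball of radius r + 1, both lie outside the ball of radius r, where \<open>g\<close>
      vanishes.\<close>
    proof (cases "norm x \<le> r + 1 \<and> norm y \<le> r + 1")
      case True then show ?thesis using d(2)[of y x] xy by auto
    next
      case False
      then have "g x = 0" "g y = 0" using n xy assms(2) by (auto simp: ball_supported_def)
      then show ?thesis using assms(3) by simp
    qed
  qed (use d in auto)
qed

definition locally_integrable :: "('a::euclidean_space \<Rightarrow> 'b::euclidean_space) \<Rightarrow> bool" where
  "locally_integrable f \<longleftrightarrow> f \<in> borel_measurable borel \<and> (\<forall>R. set_integrable lborel (cball 0 R) f)"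

definition conv :: "('a::euclidean_space \<Rightarrow> real) \<Rightarrow> ('a \<Rightarrow> 'b::euclidean_space) \<Rightarrow> 'a \<Rightarrow> 'b" where
  "conv k f x = (LINT y|lborel. k (x - y) *\<^sub>R f y)"

lemma conv_integrable:
  assumes k: "continuous_on UNIV k" "ball_supported r k" and f: "locally_integrable f"
  shows "integrable lborel (\<lambda>y. k (x - y) *\<^sub>R f y)"
proof -
  obtain B where B: "B > 0" "\<And>z. norm (k z) \<le> B" using ball_supported_bounded[OF k] by blast
  have [measurable]: "k \<in> borel_measurable borel" "f \<in> borel_measurable borel"
    using k(1) f by (auto simp: borel_measurable_continuous_onI locally_integrable_def)
  show ?thesis
  proof (rule Bochner_Integration.integrable_bound)
    show "integrable lborel (\<lambda>y. B *\<^sub>R (indicator (cball 0 (norm x + r)) y *\<^sub>R f y))"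
      using f by (intro integrable_scaleR_right) (auto simp: locally_integrable_def set_integrable_def)
    show "AE y in lborel. norm (k (x - y) *\<^sub>R f y) \<le> norm (B *\<^sub>R (indicator (cball 0 (norm x + r)) y *\<^sub>R f y))"
    proof (intro AE_I2)
      fix y
      show "norm (k (x - y) *\<^sub>R f y) \<le> norm (B *\<^sub>R (indicator (cball 0 (norm x + r)) y *\<^sub>R f y))"
      proof (cases "norm y \<le> norm x + r")
        case True then show ?thesis using B by (auto intro!: mult_right_mono simp: B(2))
      next
        case False
        then have "r < norm (x - y)" using norm_triangle_ineq2[of y x] by (simp add: norm_minus_commute)
        then show ?thesis using k(2) by (simp add: ball_supported_def)
      qed
    qed
  qed simp
qed

lemma smooth_frechet_derivative_gradient:
  fixes k :: "'a::euclidean_space \<Rightarrow> real"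
  assumes "smooth_on UNIV k"
  shows "frechet_derivative k (at z) v = (\<Sum>b\<in>Basis. frechet_derivative k (at z) b *\<^sub>R b) \<bullet> v"
proof -
  interpret bounded_linear "frechet_derivative k (at z)"
    using smooth_on_has_derivative[OF assms] has_derivative_bounded_linear by auto
  show ?thesis
    by (subst euclidean_representation[of v, symmetric])
       (simp only: sum scaleR inner_sum_left inner_scaleR_left inner_commute[of v] real_scaleR_def mult.commute
          euclidean_representation)
qed

text \<open>The derivative falls on the kernel. Its gradient is uniformly continuous, so the
  linearisation error of \<open>k\<close> is at most \<open>e'\<close> times the length of the
  increment, uniformly in the point; the error also vanishes outside a fixed ball, on which
  \<open>f\<close> is integrable.\<close>

lemma conv_has_derivative:
  assumes k: "smooth_on UNIV k" "ball_supported r k" and f: "locally_integrable f"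
  shows "(conv k f has_derivative (\<lambda>v. conv (\<lambda>z. frechet_derivative k (at z) v) f x)) (at x)"
proof -
  define G where "G z = (\<Sum>b\<in>Basis. frechet_derivative k (at z) b *\<^sub>R b)" for z
  have DG: "frechet_derivative k (at z) v = G z \<bullet> v" for z v
    unfolding G_def by (rule smooth_frechet_derivative_gradient[OF k(1)])
  have Dc: "continuous_on UNIV (\<lambda>z. frechet_derivative k (at z) v)" for v
    by (intro smooth_on_continuous_on smooth_on_frechet_derivative k)
  have Gc: "continuous_on UNIV G" unfolding G_def by (intro continuous_intros Dc)
  have Gs: "ball_supported r G"
    using ball_supported_frechet_derivative[OF k(2)] by (simp add: ball_supported_def G_def)
  have kc: "continuous_on UNIV k" by (rule smooth_on_continuous_on[OF k(1)])
  note Di = conv_integrable[OF Dc ball_supported_frechet_derivative[OF k(2)] f]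
  note ki = conv_integrable[OF kc k(2) f]
  \<comment> \<open>Radius |x| + r, with a margin 1 for the increment, whose length stays below d
    \<le> 1.\<close>
  define A where "A = cball (0::'a) (norm x + r + 1)"
  define C where "C = (LINT y|lborel. indicator A y * norm (f y))"
  have fi: "integrable lborel (\<lambda>y. indicator A y * norm (f y))"
    using f integrable_norm[of lborel "\<lambda>y. indicator A y *\<^sub>R f y"]
    by (simp add: locally_integrable_def set_integrable_def A_def)
  have C: "C \<ge> 0" unfolding C_def by (rule integral_nonneg_AE) auto
  show ?thesis
    unfolding has_derivative_within_alt
  proof (intro conjI allI impI)
    have "linear (\<lambda>v. conv (\<lambda>z. frechet_derivative k (at z) v) f x)"
    proof (rule linearI)
      fix v w
      show "conv (\<lambda>z. frechet_derivative k (at z) (v + w)) f x =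
        conv (\<lambda>z. frechet_derivative k (at z) v) f x + conv (\<lambda>z. frechet_derivative k (at z) w) f x"
        unfolding conv_def using Di[of x v] Di[of x w]
        by (subst Bochner_Integration.integral_add[symmetric]) (auto simp: DG inner_add_right scaleR_add_left)
    next
      fix c v
      show "conv (\<lambda>z. frechet_derivative k (at z) (c *\<^sub>R v)) f x = c *\<^sub>R conv (\<lambda>z. frechet_derivative k (at z) v) f x"
        unfolding conv_def by (subst integral_scaleR_right[symmetric]) (auto simp: DG intro!: Bochner_Integration.integral_cong)
    qed
    then show "bounded_linear (\<lambda>v. conv (\<lambda>z. frechet_derivative k (at z) v) f x)"
      by (simp add: linear_conv_bounded_linear)
    fix e :: real assume "e > 0"
    \<comment> \<open>Adding 1 covers the case that \<open>f\<close> vanishes almost everywhere on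
      \<open>A\<close>.\<close>
    define e' where "e' = e / (C + 1)"
    have e': "e' > 0" "e' * C \<le> e" using \<open>e > 0\<close> C by (auto simp: e'_def field_simps)
    obtain d where d: "0 < d" "d \<le> 1" "\<And>x y. dist x y < d \<Longrightarrow> dist (G x) (G y) < e'"
      using ball_supported_uniformly_continuous[OF Gc Gs e'(1)] by blast
    show "\<exists>d>0. \<forall>y\<in>UNIV. norm (y - x) < d \<longrightarrow>
       norm (conv k f y - conv k f x - conv (\<lambda>z. frechet_derivative k (at z) (y - x)) f x) \<le> e * norm (y - x)"
    proof (intro exI[of _ d] conjI ballI impI d(1))
      fix y assume y: "norm (y - x) < d"
      define v where "v = y - x"
      define q where "q z = k (z + v) - k z - frechet_derivative k (at z) v" for z
      have q: "norm (q z) \<le> norm v * e'" for z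
      proof -
        have "norm (k (z + v) - k z - frechet_derivative k (at z) (z + v - z)) \<le> norm (z + v - z) * e'"
        proof (rule differentiable_bound_linearization[where S = "ball z d"])
          show "z + t *\<^sub>R (z + v - z) \<in> ball z d" if "t \<in> {0..1}" for t
          proof -
            have "norm (t *\<^sub>R v) \<le> norm v" using that by (simp add: mult_left_le_one_le)
            then show ?thesis using y by (simp add: dist_norm v_def)
          qed
          show "(k has_derivative frechet_derivative k (at z')) (at z' within ball z d)" for z'
            using smooth_on_has_derivative[OF k(1)] has_derivative_at_withinI by blast
          show "onorm (frechet_derivative k (at z') - frechet_derivative k (at z)) \<le> e'" if "z' \<in> ball z d" for z'
          proof (rule onorm_bound)
            fix w
            have "norm ((G z' - G z) \<bullet> w) \<le> norm (G z' - G z) * norm w" by (simp add: Cauchy_Schwarz_ineq2)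
            also have "\<dots> \<le> e' * norm w"
              using d(3)[of z' z] that by (intro mult_right_mono) (auto simp: dist_norm norm_minus_commute)
            finally show "norm ((frechet_derivative k (at z') - frechet_derivative k (at z)) w) \<le> e' * norm w"
              by (simp add: DG inner_diff_left)
          qed (use e' in auto)
        qed (use d in auto)
        then show ?thesis by (simp add: q_def)
      qed
      have q0: "q (x - u) = 0" if "u \<notin> A" for u
      proof -
        have "r + 1 < norm (x - u)" using that norm_triangle_ineq2[of u x] by (simp add: A_def norm_minus_commute)
        moreover have "norm v < 1" using y d(2) by (simp add: v_def)
        moreover have "norm (x - u) \<le> norm (x - u + v) + norm v" using norm_triangle_ineq4[of "x - u + v" v] by simp
        ultimately have "r < norm (x - u)" "r < norm (x - u + v)" by auto
        then show ?thesis using k(2) Gs by (simp add: q_def DG ball_supported_def)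
      qed
      have eq: "q (x - u) *\<^sub>R f u = k (y - u) *\<^sub>R f u - k (x - u) *\<^sub>R f u - frechet_derivative k (at (x - u)) v *\<^sub>R f u" for u
        by (simp add: q_def v_def scaleR_diff_left algebra_simps)
      have "conv k f y - conv k f x - conv (\<lambda>z. frechet_derivative k (at z) v) f x
        = (LINT u|lborel. q (x - u) *\<^sub>R f u)"
        unfolding conv_def eq using ki[of y] ki[of x] Di[of x v] by simp
      moreover have "norm (LINT u|lborel. q (x - u) *\<^sub>R f u) \<le> (LINT u|lborel. (norm v * e') * (indicator A u * norm (f u)))"
      proof (rule norm_integral_le_AE)
        show "integrable lborel (\<lambda>u. norm v * e' * (indicator A u * norm (f u)))"
          by (intro integrable_mult_right fi)
        have "norm (q (x - u) *\<^sub>R f u) \<le> norm v * e' * (indicator A u * norm (f u))" for u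
          using q[of "x - u"] q0[of u] by (cases "u \<in> A") (auto intro!: mult_right_mono)
        then show "AE u in lborel. norm (q (x - u) *\<^sub>R f u) \<le> norm v * e' * (indicator A u * norm (f u))" by simp
      qed
      moreover have "(LINT u|lborel. (norm v * e') * (indicator A u * norm (f u))) \<le> e * norm v"
        using mult_left_mono[OF e'(2), of "norm v"] by (simp add: C_def mult_ac)
      ultimately show "norm (conv k f y - conv k f x - conv (\<lambda>z. frechet_derivative k (at z) (y - x)) f x) \<le> e * norm (y - x)"
        by (simp add: v_def)
    qed
  qed
qed

text \<open>Each derivative of the convolution is the convolution with a derived kernel, which is
  why the kernel is generalised in the induction.\<close>

lemma conv_smooth:
  assumes "smooth_on UNIV k" "ball_supported r k" "locally_integrable f"
  shows "smooth_on UNIV (conv k f)"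
proof -
  have "Ck_on n UNIV (conv k f)" for n
    using assms(1,2)
  proof (induction n arbitrary: k)
    case 0
    show ?case
      by (auto intro!: continuous_at_imp_continuous_on has_derivative_continuous[OF conv_has_derivative[OF 0 assms(3)]])
  next
    case (Suc n)
    show ?case
      by (intro Ck_on_SucI[OF open_UNIV conv_has_derivative[OF Suc.prems assms(3)]] Suc.IH
          smooth_on_frechet_derivative ball_supported_frechet_derivative Suc.prems)
  qed
  then show ?thesis by (simp add: smooth_on_def)
qed

section \<open>Continuity of translations in L2\<close>

lemma nn_integral_lborel_translation:
  fixes f :: "'a::euclidean_space \<Rightarrow> ennreal"
  assumes [measurable]: "f \<in> borel_measurable borel"
  shows "(\<integral>\<^sup>+x. f (x - a) \<partial>lborel) = (\<integral>\<^sup>+x. f x \<partial>lborel)"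
proof -
  have "(\<integral>\<^sup>+x. f x \<partial>lborel) = (\<integral>\<^sup>+x. f x \<partial>distr lborel borel ((+) (- a)))"
    by (simp add: lborel_distr_plus)
  also have "\<dots> = (\<integral>\<^sup>+x. f (- a + x) \<partial>lborel)" by (subst nn_integral_distr) auto
  finally show ?thesis by simp
qed

text \<open>The squared distance is an extended nonnegative integral, so that it can be estimated
  before the difference is known to be square integrable.\<close>

definition translation_L2_continuous :: "('a::euclidean_space \<Rightarrow> real) \<Rightarrow> bool" where
  "translation_L2_continuous f \<longleftrightarrow>
     (\<forall>e>0. \<exists>d>0. \<forall>a. norm a < d \<longrightarrow> (\<integral>\<^sup>+x. ennreal ((f (x - a) - f x)\<^sup>2) \<partial>lborel) \<le> ennreal e)"

lemma translation_L2_continuousD: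
  assumes "translation_L2_continuous f" "e > 0"
  obtains d where "d > 0" "\<And>a. norm a < d \<Longrightarrow> (\<integral>\<^sup>+x. ennreal ((f (x - a) - f x)\<^sup>2) \<partial>lborel) \<le> ennreal e"
  using assms unfolding translation_L2_continuous_def by blast

lemma sum_two_squares_le: "(a + b)\<^sup>2 \<le> 2 * a\<^sup>2 + 2 * (b::real)\<^sup>2"
  using zero_le_power2[of "a - b"] by (simp add: power2_sum power2_diff)

lemma nn_integral_sum_squares_le:
  assumes [measurable]: "f \<in> borel_measurable lborel" "g \<in> borel_measurable lborel"
  shows "(\<integral>\<^sup>+x. ennreal ((f x + g x :: real)\<^sup>2) \<partial>lborel)
    \<le> 2 * (\<integral>\<^sup>+x. ennreal ((f x)\<^sup>2) \<partial>lborel) + 2 * (\<integral>\<^sup>+x. ennreal ((g x)\<^sup>2) \<partial>lborel)"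
proof -
  have "(\<integral>\<^sup>+x. ennreal ((f x + g x :: real)\<^sup>2) \<partial>lborel)
      \<le> (\<integral>\<^sup>+x. (2 * ennreal ((f x)\<^sup>2) + 2 * ennreal ((g x)\<^sup>2)) \<partial>lborel)"
  proof (rule nn_integral_mono)
    fix x
    have "ennreal ((f x + g x)\<^sup>2) \<le> ennreal (2 * (f x)\<^sup>2 + 2 * (g x)\<^sup>2)"
      by (intro ennreal_leI sum_two_squares_le)
    then show "ennreal ((f x + g x)\<^sup>2) \<le> 2 * ennreal ((f x)\<^sup>2) + 2 * ennreal ((g x)\<^sup>2)"
      by (simp add: ennreal_plus ennreal_mult)
  qed
  also have "\<dots> = 2 * (\<integral>\<^sup>+x. ennreal ((f x)\<^sup>2) \<partial>lborel) + 2 * (\<integral>\<^sup>+x. ennreal ((g x)\<^sup>2) \<partial>lborel)"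
    by (simp add: nn_integral_add nn_integral_cmult)
  finally show ?thesis .
qed

lemma translation_L2_continuous_add:
  fixes f :: "'a::euclidean_space \<Rightarrow> real"
  assumes f: "translation_L2_continuous f" "f \<in> borel_measurable borel"
    and g: "translation_L2_continuous g" "g \<in> borel_measurable borel"
  shows "translation_L2_continuous (\<lambda>x. f x + g x)"
  unfolding translation_L2_continuous_def
proof (intro allI impI)
  fix e :: real assume "e > 0"
  then have e4: "e / 4 > 0" by simp
  obtain d1 where d1: "d1 > 0"
    "\<And>a. norm a < d1 \<Longrightarrow> (\<integral>\<^sup>+x. ennreal ((f (x - a) - f x)\<^sup>2) \<partial>lborel) \<le> ennreal (e/4)"
    using translation_L2_continuousD[OF f(1) e4] by blast
  obtain d2 where d2: "d2 > 0"
    "\<And>a. norm a < d2 \<Longrightarrow> (\<integral>\<^sup>+x. ennreal ((g (x - a) - g x)\<^sup>2) \<partial>lborel) \<le> ennreal (e/4)"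
    using translation_L2_continuousD[OF g(1) e4] by blast
  note d = d1 d2
  have [measurable]: "f \<in> borel_measurable borel" "g \<in> borel_measurable borel" by fact+
  show "\<exists>d>0. \<forall>a. norm a < d \<longrightarrow> (\<integral>\<^sup>+x. ennreal ((f (x - a) + g (x - a) - (f x + g x))\<^sup>2) \<partial>lborel) \<le> ennreal e"
  proof (intro exI[of _ "min d1 d2"] conjI allI impI)
    fix a :: 'a assume a: "norm a < min d1 d2"
    have "(\<integral>\<^sup>+x. ennreal ((f (x - a) + g (x - a) - (f x + g x))\<^sup>2) \<partial>lborel)
      = (\<integral>\<^sup>+x. ennreal (((f (x - a) - f x) + (g (x - a) - g x))\<^sup>2) \<partial>lborel)"
      by (simp add: algebra_simps)
    also have "\<dots> \<le> 2 * (\<integral>\<^sup>+x. ennreal ((f (x - a) - f x)\<^sup>2) \<partial>lborel) + 2 * (\<integral>\<^sup>+x. ennreal ((g (x - a) - g x)\<^sup>2) \<partial>lborel)"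
      by (rule nn_integral_sum_squares_le) auto
    also have "\<dots> \<le> 2 * ennreal (e/4) + 2 * ennreal (e/4)"
      using a d by (intro add_mono mult_left_mono) auto
    also have "\<dots> = ennreal e"
      using \<open>e > 0\<close> by (simp flip: ennreal_plus ennreal_mult' ennreal_numeral add: numeral_mult_ennreal)
    finally show "(\<integral>\<^sup>+x. ennreal ((f (x - a) + g (x - a) - (f x + g x))\<^sup>2) \<partial>lborel) \<le> ennreal e" .
  qed (use d in auto)
qed

lemma translation_L2_continuous_cmult:
  fixes f :: "'a::euclidean_space \<Rightarrow> real"
  assumes f: "translation_L2_continuous f" "f \<in> borel_measurable borel"
  shows "translation_L2_continuous (\<lambda>x. c * f x)"
  unfolding translation_L2_continuous_def
proof (intro allI impI)
  fix e :: real assume "e > 0"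
  then have "e / (c\<^sup>2 + 1) > 0" by (intro divide_pos_pos) (auto simp: add_nonneg_pos)
  then obtain d where d: "d > 0"
    "\<And>a. norm a < d \<Longrightarrow> (\<integral>\<^sup>+x. ennreal ((f (x - a) - f x)\<^sup>2) \<partial>lborel) \<le> ennreal (e / (c\<^sup>2 + 1))"
    using translation_L2_continuousD[OF f(1)] by blast
  have [measurable]: "f \<in> borel_measurable borel" by fact
  show "\<exists>d>0. \<forall>a. norm a < d \<longrightarrow> (\<integral>\<^sup>+x. ennreal ((c * f (x - a) - c * f x)\<^sup>2) \<partial>lborel) \<le> ennreal e"
  proof (intro exI[of _ d] conjI allI impI d)
    fix a :: 'a assume a: "norm a < d"
    have "(\<integral>\<^sup>+x. ennreal ((c * f (x - a) - c * f x)\<^sup>2) \<partial>lborel)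
      = (\<integral>\<^sup>+x. ennreal (c\<^sup>2) * ennreal ((f (x - a) - f x)\<^sup>2) \<partial>lborel)"
      by (simp add: right_diff_distrib[symmetric] power_mult_distrib ennreal_mult)
    also have "\<dots> = ennreal (c\<^sup>2) * (\<integral>\<^sup>+x. ennreal ((f (x - a) - f x)\<^sup>2) \<partial>lborel)"
      by (rule nn_integral_cmult) auto
    also have "\<dots> \<le> ennreal (c\<^sup>2) * ennreal (e / (c\<^sup>2 + 1))"
      using d(2)[OF a] by (intro mult_left_mono) auto
    also have "\<dots> = ennreal (c\<^sup>2 * (e / (c\<^sup>2 + 1)))"
      by (rule ennreal_mult[symmetric]) (use \<open>e > 0\<close> in auto)
    also have "\<dots> \<le> ennreal e"
      proof (rule ennreal_leI)
      have "0 < 1 + c\<^sup>2" by (simp add: add_pos_nonneg)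
      then show "c\<^sup>2 * (e / (c\<^sup>2 + 1)) \<le> e" using \<open>e > 0\<close> by (simp add: field_simps)
    qed
    finally show "(\<integral>\<^sup>+x. ennreal ((c * f (x - a) - c * f x)\<^sup>2) \<partial>lborel) \<le> ennreal e" .
  qed
qed

lemma translation_L2_continuous_sum:
  assumes "finite I" "\<And>i. i \<in> I \<Longrightarrow> translation_L2_continuous (f i)" "\<And>i. i \<in> I \<Longrightarrow> f i \<in> borel_measurable borel"
  shows "translation_L2_continuous (\<lambda>x::'a::euclidean_space. \<Sum>i\<in>I. f i x)"
  using assms
proof (induction I rule: finite_induct)
  case empty
  show ?case unfolding translation_L2_continuous_def by (auto intro: exI[of _ "1::real"])
next
  case (insert i I)
  then show ?case by (simp add: translation_L2_continuous_add)
qed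

text \<open>Outer regularity gives an open \<open>U\<close> around \<open>A\<close> with little
  excess, and the points of \<open>A\<close> within 1/(n+1) of the complement of \<open>U\<close>
  form sets decreasing to the empty set. A shift shorter than 1/(n+1) can change membership in
  \<open>A\<close> only at points which, themselves or after the shift, lie in one of these two
  small sets.\<close>

lemma translation_L2_continuous_indicator:
  assumes A: "A \<in> sets borel" "emeasure lborel A < \<infinity>"
  shows "translation_L2_continuous (indicator A :: 'a::euclidean_space \<Rightarrow> real)"
  unfolding translation_L2_continuous_def
proof (intro allI impI)
  fix e :: real assume "e > 0"
  have [measurable]: "A \<in> sets borel" by (rule A)
  obtain U where U: "open U" "A \<subseteq> U" "emeasure lborel (U - A) < e/4"
    using outer_regular_lborel[OF A(1), of "e/4"] \<open>e > 0\<close> by auto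
  have [measurable]: "U \<in> sets borel" using U by auto
  define C where "C n = {x. \<exists>y\<in>-U. dist y x < inverse (real (Suc n))}" for n
  have "C n = (\<Union>y\<in>-U. ball y (inverse (real (Suc n))))" for n by (auto simp: C_def)
  then have "open (C n)" for n by auto
  then have [measurable]: "C n \<in> sets borel" for n by (intro borel_open)
  have "(\<lambda>n. emeasure lborel (A \<inter> C n)) \<longlonglongrightarrow> emeasure lborel (\<Inter>n. A \<inter> C n)"
  proof (rule Lim_emeasure_decseq)
    show "decseq (\<lambda>n. A \<inter> C n)"
      unfolding decseq_def C_def
    proof safe
      fix m n x y assume mn: "m \<le> n" and *: "y \<notin> U" "dist y x < inverse (real (Suc n))"
      have "inverse (real (Suc n)) \<le> inverse (real (Suc m))" using mn by (simp add: field_simps)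
      then have "dist y x < inverse (real (Suc m))" using *(2) by linarith
      then show "\<exists>y\<in>-U. dist y x < inverse (real (Suc m))" using *(1) by blast
    qed
    show "emeasure lborel (A \<inter> C i) \<noteq> \<infinity>" for i
      using A(2) emeasure_mono[of "A \<inter> C i" A lborel] by (auto simp: top_unique less_top)
  qed auto
  moreover have "(\<Inter>n. A \<inter> C n) = {}"
  proof -
    have False if x: "x \<in> A" "\<And>n. x \<in> C n" for x
    proof -
      obtain d where d: "d > 0" "ball x d \<subseteq> U" using U x(1) by (meson openE subsetD)
      obtain n where "inverse (real (Suc n)) < d" using reals_Archimedean[OF d(1)] by blast
      then show False using x(2)[of n] d(2) by (auto simp: C_def subset_iff dist_commute)
    qed
    then show ?thesis by blast
  qed
  ultimately have "(\<lambda>n. emeasure lborel (A \<inter> C n)) \<longlonglongrightarrow> 0" by simp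
  then have "\<forall>\<^sub>F n in sequentially. emeasure lborel (A \<inter> C n) < e/4"
    using \<open>e > 0\<close> by (intro order_tendstoD) auto
  then obtain n where n: "emeasure lborel (A \<inter> C n) < e/4" by (auto simp: eventually_sequentially)
  show "\<exists>d>0. \<forall>a. norm a < d \<longrightarrow> (\<integral>\<^sup>+x. ennreal ((indicator A (x - a) - indicator A x)\<^sup>2) \<partial>lborel) \<le> ennreal e"
  proof (intro exI[of _ "inverse (real (Suc n))"] conjI allI impI)
    fix a :: 'a assume a: "norm a < inverse (real (Suc n))"
    have "(\<integral>\<^sup>+x. ennreal ((indicator A (x - a) - indicator A x)\<^sup>2) \<partial>lborel)
      \<le> (\<integral>\<^sup>+x. (indicator (U - A) x + indicator (A \<inter> C n) x) + (indicator (U - A) (x - a) + indicator (A \<inter> C n) (x - a)) \<partial>lborel)"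
    proof (rule nn_integral_mono)
      fix x
      have 1: "x \<in> U" if "x - a \<notin> C n"
        using that a unfolding C_def by (intro ccontr[of "x \<in> U"]) (auto simp: dist_norm dest: bspec[where x = x])
      have 2: "x - a \<in> U" if "x \<notin> C n"
        using that a unfolding C_def by (intro ccontr[of "x - a \<in> U"]) (auto simp: dist_norm dest: bspec[where x = "x - a"])
      show "ennreal ((indicator A (x - a) - indicator A x)\<^sup>2) \<le> (indicator (U - A) x + indicator (A \<inter> C n) x) + (indicator (U - A) (x - a) + indicator (A \<inter> C n) (x - a))"
        using 1 2 by (cases "x \<in> A"; cases "x - a \<in> A"; cases "x \<in> C n"; cases "x - a \<in> C n")
          (auto simp: indicator_def add_increasing2 add_increasing)
    qed
    also have "\<dots> = (emeasure lborel (U - A) + emeasure lborel (A \<inter> C n)) + (emeasure lborel (U - A) + emeasure lborel (A \<inter> C n))"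
      using nn_integral_lborel_translation[of "indicator (U - A)" a] nn_integral_lborel_translation[of "indicator (A \<inter> C n)" a]
      by (simp add: nn_integral_add)
    also have "\<dots> \<le> (ennreal (e/4) + ennreal (e/4)) + (ennreal (e/4) + ennreal (e/4))"
      using n U(3) by (intro add_mono) auto
    also have "\<dots> = ennreal e" using \<open>e > 0\<close> by (simp flip: ennreal_plus)
    finally show "(\<integral>\<^sup>+x. ennreal ((indicator A (x - a) - indicator A x)\<^sup>2) \<partial>lborel) \<le> ennreal e" .
  qed auto
qed

lemma translation_L2_continuous_limit:
  fixes f :: "'a::euclidean_space \<Rightarrow> real"
  assumes f: "f \<in> borel_measurable borel"
    and g: "\<And>e. e > 0 \<Longrightarrow> \<exists>g. translation_L2_continuous g \<and> g \<in> borel_measurable borel \<and>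
        (\<integral>\<^sup>+x. ennreal ((f x - g x)\<^sup>2) \<partial>lborel) \<le> ennreal e"
  shows "translation_L2_continuous f"
  unfolding translation_L2_continuous_def
proof (intro allI impI)
  fix e :: real assume "e > 0"
  \<comment> \<open>The inequality (a + b)^2 \<le> 2 a^2 + 2 b^2 is used twice: it turns the errors
    e/16 of \<open>f - g\<close> and of its translate into e/4, and the sum of this with the e/4 of
    \<open>g\<close> into e.\<close>
  then obtain g where g: "translation_L2_continuous g" "g \<in> borel_measurable borel"
     "(\<integral>\<^sup>+x. ennreal ((f x - g x)\<^sup>2) \<partial>lborel) \<le> ennreal (e/16)" using g[of "e/16"] by auto
  obtain d where d: "d > 0"
    "\<And>a. norm a < d \<Longrightarrow> (\<integral>\<^sup>+x. ennreal ((g (x - a) - g x)\<^sup>2) \<partial>lborel) \<le> ennreal (e / 4)"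
    using \<open>e > 0\<close> translation_L2_continuousD[OF g(1), of "e/4"] by auto
  have [measurable]: "f \<in> borel_measurable borel" "g \<in> borel_measurable borel" by fact+
  show "\<exists>d>0. \<forall>a. norm a < d \<longrightarrow> (\<integral>\<^sup>+x. ennreal ((f (x - a) - f x)\<^sup>2) \<partial>lborel) \<le> ennreal e"
  proof (intro exI[of _ d] conjI allI impI d)
    fix a :: 'a assume a: "norm a < d"
    define h where "h x = f x - g x" for x
    have [measurable]: "h \<in> borel_measurable borel" unfolding h_def[abs_def] by measurable
    have h: "(\<integral>\<^sup>+x. ennreal ((h x)\<^sup>2) \<partial>lborel) \<le> ennreal (e/16)" using g(3) by (simp add: h_def)
    have ha: "(\<integral>\<^sup>+x. ennreal ((h (x - a))\<^sup>2) \<partial>lborel) \<le> ennreal (e/16)"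
      using nn_integral_lborel_translation[of "\<lambda>x. ennreal ((h x)\<^sup>2)" a] h by simp
    have "(\<integral>\<^sup>+x. ennreal ((h (x - a) + (- h x))\<^sup>2) \<partial>lborel)
      \<le> 2 * (\<integral>\<^sup>+x. ennreal ((h (x - a))\<^sup>2) \<partial>lborel) + 2 * (\<integral>\<^sup>+x. ennreal ((- h x)\<^sup>2) \<partial>lborel)"
      by (rule nn_integral_sum_squares_le) auto
    also have "\<dots> \<le> 2 * ennreal (e/16) + 2 * ennreal (e/16)"
      using h ha by (intro add_mono mult_left_mono) auto
    also have "\<dots> = ennreal (e/4)"
      using \<open>e > 0\<close> by (simp flip: ennreal_plus ennreal_mult' ennreal_numeral add: numeral_mult_ennreal)
    finally have hd: "(\<integral>\<^sup>+x. ennreal ((h (x - a) + (- h x))\<^sup>2) \<partial>lborel) \<le> ennreal (e/4)" .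
    have "(\<integral>\<^sup>+x. ennreal ((f (x - a) - f x)\<^sup>2) \<partial>lborel)
      = (\<integral>\<^sup>+x. ennreal (((g (x - a) - g x) + (h (x - a) + (- h x)))\<^sup>2) \<partial>lborel)"
      by (simp add: h_def algebra_simps)
    also have "\<dots> \<le> 2 * (\<integral>\<^sup>+x. ennreal ((g (x - a) - g x)\<^sup>2) \<partial>lborel) + 2 * (\<integral>\<^sup>+x. ennreal ((h (x - a) + (- h x))\<^sup>2) \<partial>lborel)"
      by (rule nn_integral_sum_squares_le) auto
    also have "\<dots> \<le> 2 * ennreal (e/4) + 2 * ennreal (e/4)"
      using a d hd by (intro add_mono mult_left_mono) auto
    also have "\<dots> = ennreal e"
      using \<open>e > 0\<close> by (simp flip: ennreal_plus ennreal_mult' ennreal_numeral add: numeral_mult_ennreal)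
    finally show "(\<integral>\<^sup>+x. ennreal ((f (x - a) - f x)\<^sup>2) \<partial>lborel) \<le> ennreal e" .
  qed
qed

text \<open>Simple functions bounded by 2|f| approximate \<open>f\<close> in L2 by dominated
  convergence, and each of them is a finite combination of indicators of its level sets.\<close>

lemma translation_L2_continuous_L2:
  fixes f :: "'a::euclidean_space \<Rightarrow> real"
  assumes f: "f \<in> borel_measurable borel" "integrable lborel (\<lambda>x. (f x)\<^sup>2)"
  shows "translation_L2_continuous f"
proof (rule translation_L2_continuous_limit[OF f(1)])
  fix e :: real assume "e > 0"
  have [measurable]: "f \<in> borel_measurable borel" by fact
  have "f \<in> borel_measurable lborel" by simp
  from borel_measurable_implies_sequence_metric[OF this, of 0]
  obtain F where F: "\<And>i. simple_function lborel (F i)" "\<And>x. (\<lambda>i. F i x) \<longlonglongrightarrow> f x"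
    "\<And>i x. \<bar>F i x\<bar> \<le> 2 * \<bar>f x\<bar>" by auto
  have [measurable]: "F i \<in> borel_measurable borel" for i using borel_measurable_simple_function[OF F(1)] by simp
  have fin: "(\<integral>\<^sup>+x. ennreal ((f x)\<^sup>2) \<partial>lborel) < \<infinity>"
    using f(2) by (subst nn_integral_eq_integral) auto
  have "(\<lambda>i. \<integral>\<^sup>+x. ennreal ((f x - F i x)\<^sup>2) \<partial>lborel) \<longlonglongrightarrow> (\<integral>\<^sup>+x. 0 \<partial>(lborel :: 'a measure))"
  proof (rule nn_integral_dominated_convergence[where w = "\<lambda>x. 9 * ennreal ((f x)\<^sup>2)"])
    show "(\<integral>\<^sup>+x. 9 * ennreal ((f x)\<^sup>2) \<partial>lborel) < \<infinity>"
      using fin by (subst nn_integral_cmult) (auto simp: ennreal_mult_less_top)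
    show "AE x in lborel. ennreal ((f x - F i x)\<^sup>2) \<le> 9 * ennreal ((f x)\<^sup>2)" for i
    proof (rule AE_I2)
      fix x
      have "\<bar>f x - F i x\<bar> \<le> 3 * \<bar>f x\<bar>" using F(3)[of i x] by linarith
      then have "(f x - F i x)\<^sup>2 \<le> (3 * f x)\<^sup>2" by (intro abs_le_square_iff[THEN iffD1]) (simp add: abs_mult)
      then have "ennreal ((f x - F i x)\<^sup>2) \<le> ennreal (9 * (f x)\<^sup>2)"
        by (intro ennreal_leI) (simp add: power_mult_distrib)
      then show "ennreal ((f x - F i x)\<^sup>2) \<le> 9 * ennreal ((f x)\<^sup>2)" by (simp add: ennreal_mult)
    qed
    show "AE x in lborel. (\<lambda>i. ennreal ((f x - F i x)\<^sup>2)) \<longlonglongrightarrow> 0"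
    proof (rule AE_I2)
      fix x
      have "(\<lambda>i. (f x - F i x)\<^sup>2) \<longlonglongrightarrow> (f x - f x)\<^sup>2" by (intro tendsto_intros F)
      then show "(\<lambda>i. ennreal ((f x - F i x)\<^sup>2)) \<longlonglongrightarrow> 0" by (simp add: tendsto_ennreal_iff flip: ennreal_0)
    qed
  qed auto
  then have "(\<lambda>i. \<integral>\<^sup>+x. ennreal ((f x - F i x)\<^sup>2) \<partial>lborel) \<longlonglongrightarrow> 0" by simp
  then have "\<forall>\<^sub>F i in sequentially. (\<integral>\<^sup>+x. ennreal ((f x - F i x)\<^sup>2) \<partial>lborel) < ennreal e"
    using \<open>e > 0\<close> by (intro order_tendstoD) auto
  then obtain i where i: "(\<integral>\<^sup>+x. ennreal ((f x - F i x)\<^sup>2) \<partial>lborel) < ennreal e" by (auto simp: eventually_sequentially)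
  \<comment> \<open>The value 0 is left out because its level set may have infinite measure; the
    other level sets have finite measure by Chebyshev's inequality.\<close>
  have "translation_L2_continuous (\<lambda>x. \<Sum>c\<in>range (F i) - {0}. c * indicator (F i -` {c}) x)"
  proof (intro translation_L2_continuous_sum translation_L2_continuous_cmult translation_L2_continuous_indicator)
    show "finite (range (F i) - {0})" using F(1)[of i] by (simp add: simple_function_def)
    fix c assume c: "c \<in> range (F i) - {0}"
    have "F i -` {c} \<inter> space lborel \<in> sets lborel" by measurable
    then show S: "F i -` {c} \<in> sets borel" by simp
    have "ennreal (c\<^sup>2) * emeasure lborel (F i -` {c}) = (\<integral>\<^sup>+x. ennreal (c\<^sup>2) * indicator (F i -` {c}) x \<partial>lborel)"
      using S by (simp add: nn_integral_cmult)
    also have "\<dots> \<le> (\<integral>\<^sup>+x. 4 * ennreal ((f x)\<^sup>2) \<partial>lborel)"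
    proof (rule nn_integral_mono)
      fix x
      have "(F i x)\<^sup>2 \<le> (2 * f x)\<^sup>2" using F(3)[of i x] by (intro abs_le_square_iff[THEN iffD1]) (simp add: abs_mult)
      then have "ennreal ((F i x)\<^sup>2) \<le> ennreal (4 * (f x)\<^sup>2)" by (intro ennreal_leI) (simp add: power_mult_distrib)
      then show "ennreal (c\<^sup>2) * indicator (F i -` {c}) x \<le> 4 * ennreal ((f x)\<^sup>2)"
        by (auto simp: indicator_def ennreal_mult)
    qed
    also have "\<dots> < \<infinity>" using fin by (subst nn_integral_cmult) (auto simp: ennreal_mult_less_top)
    finally show "emeasure lborel (F i -` {c}) < \<infinity>"
      using c by (auto simp: ennreal_mult_less_top)
    show "indicator (F i -` {c}) \<in> borel_measurable borel" using S by simp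
    show "(\<lambda>x. c * indicator (F i -` {c}) x) \<in> borel_measurable borel" using S by simp
  qed
  moreover have "(\<Sum>c\<in>range (F i) - {0}. c * indicator (F i -` {c}) x) = F i x" for x
  proof -
    have "finite (range (F i) - {0})" using F(1)[of i] by (simp add: simple_function_def)
    then have "(\<Sum>c\<in>range (F i) - {0}. c * indicator (F i -` {c}) x) = (\<Sum>c\<in>range (F i) - {0}. if c = F i x then c else 0)"
      by (intro sum.cong) (auto simp: indicator_def)
    also have "\<dots> = F i x" using \<open>finite (range (F i) - {0})\<close> by (subst sum.delta) auto
    finally show ?thesis .
  qed
  ultimately have "translation_L2_continuous (F i)" by simp
  then show "\<exists>g. translation_L2_continuous g \<and> g \<in> borel_measurable borel \<and>
        (\<integral>\<^sup>+x. ennreal ((f x - g x)\<^sup>2) \<partial>lborel) \<le> ennreal e"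
    using i by (intro exI[of _ "F i"]) (auto intro: less_imp_le)
qed

text \<open>Nonnegativity of the variance of \<open>Z\<close> under the probability density
  \<open>p\<close>, that is, Jensen's inequality for the square.\<close>

lemma integral_square_le_weighted:
  fixes Z p :: "'a \<Rightarrow> real"
  assumes p: "integrable M p" "(LINT x|M. p x) = 1" "\<And>x. 0 \<le> p x"
    and Z: "integrable M (\<lambda>x. p x * Z x)" "integrable M (\<lambda>x. p x * (Z x)\<^sup>2)"
  shows "(LINT x|M. p x * Z x)\<^sup>2 \<le> (LINT x|M. p x * (Z x)\<^sup>2)"
proof -
  define m where "m = (LINT x|M. p x * Z x)"
  have "0 \<le> (LINT x|M. p x * (Z x - m)\<^sup>2)" by (intro integral_nonneg_AE) (auto simp: p)
  also have "\<dots> = (LINT x|M. p x * (Z x)\<^sup>2 - 2 * m * (p x * Z x) + m\<^sup>2 * p x)"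
    by (intro Bochner_Integration.integral_cong) (auto simp: power2_eq_square algebra_simps)
  also have "\<dots> = (LINT x|M. p x * (Z x)\<^sup>2) - 2 * m * m + m\<^sup>2"
    using p Z by (simp add: m_def)
  finally show ?thesis by (simp add: m_def power2_eq_square)
qed

lemma locally_integrable_L2:
  fixes f :: "'a::euclidean_space \<Rightarrow> real"
  assumes [measurable]: "f \<in> borel_measurable borel" and f: "integrable lborel (\<lambda>x. (f x)\<^sup>2)"
  shows "locally_integrable f"
  unfolding locally_integrable_def set_integrable_def
proof (intro conjI allI assms(1))
  fix R
  show "integrable lborel (\<lambda>x. indicator (cball 0 R) x *\<^sub>R f x)"
  proof (rule Bochner_Integration.integrable_bound)
    show "integrable lborel (\<lambda>x. indicator (cball 0 R) x + (f x)\<^sup>2)"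
      by (intro Bochner_Integration.integrable_add f integrable_real_indicator) (use emeasure_compact_finite[of "cball (0::'a) R"] in auto)
    show "AE x in lborel. norm (indicator (cball 0 R) x *\<^sub>R f x) \<le> norm (indicator (cball 0 R) x + (f x)\<^sup>2)"
    proof (rule AE_I2)
      fix x
      have "\<bar>f x\<bar> \<le> 1 + (f x)\<^sup>2" using zero_le_power2[of "\<bar>f x\<bar> - 1"] by (simp add: power2_diff)
      then show "norm (indicator (cball 0 R) x *\<^sub>R f x) \<le> norm (indicator (cball 0 R) x + (f x)\<^sup>2)"
        by (auto simp: indicator_def)
    qed
    have [measurable]: "cball (0::'a) R \<in> sets borel" by simp
    show "(\<lambda>x. indicator (cball 0 R) x *\<^sub>R f x) \<in> borel_measurable lborel"
      unfolding measurable_lborel1 by measurable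
  qed
qed

lemma lborel_integral_reflect:
  fixes f :: "'a::euclidean_space \<Rightarrow> real"
  assumes [measurable]: "f \<in> borel_measurable borel"
  shows "integrable lborel (\<lambda>y. f (x - y)) \<longleftrightarrow> integrable lborel f"
    and "(LINT y|lborel. f (x - y)) = (LINT y|lborel. f y)"
proof -
  have d: "distr lborel borel (\<lambda>y. x - y) = (lborel :: 'a measure)"
    using lborel_affine[of "-1" x] by (simp add: density_1)
  have "integrable (distr lborel borel (\<lambda>y. x - y)) f \<longleftrightarrow> integrable lborel (\<lambda>y. f (x - y))"
    by (rule integrable_distr_eq) auto
  then show "integrable lborel (\<lambda>y. f (x - y)) \<longleftrightarrow> integrable lborel f" unfolding d by simp
  have "integral\<^sup>L (distr lborel borel (\<lambda>y. x - y)) f = (LINT y|lborel. f (x - y))"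
    by (rule integral_distr) auto
  then show "(LINT y|lborel. f (x - y)) = (LINT y|lborel. f y)" unfolding d by simp
qed

text \<open>Jensen's inequality bounds the squared error at a point by the average of the squared
  differences between \<open>f\<close> and its translates. Exchanging the integrals leaves an
  average of translation errors over shifts of length at most r.\<close>

lemma conv_L2_close:
  fixes f :: "'a::euclidean_space \<Rightarrow> real"
  assumes k: "continuous_on UNIV k" "ball_supported r k" "\<And>z. 0 \<le> k z" "integrable lborel k" "(LINT z|lborel. k z) = 1"
    and f: "f \<in> borel_measurable borel" "integrable lborel (\<lambda>x. (f x)\<^sup>2)"
    and e: "\<And>a. norm a \<le> r \<Longrightarrow> (\<integral>\<^sup>+x. ennreal ((f (x - a) - f x)\<^sup>2) \<partial>lborel) \<le> ennreal e"
  shows "(\<integral>\<^sup>+x. ennreal ((conv k f x - f x)\<^sup>2) \<partial>lborel) \<le> ennreal e"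
proof -
  have [measurable]: "k \<in> borel_measurable borel" "f \<in> borel_measurable borel"
    using k(1) f by (auto simp: borel_measurable_continuous_onI)
  have li: "locally_integrable f" by (rule locally_integrable_L2[OF f])
  have i1: "integrable lborel (\<lambda>y. k y * f (x - y))" and c1: "conv k f x = (LINT y|lborel. k y * f (x - y))" for x
    using lborel_integral_reflect[of "\<lambda>y. k y * f (x - y)" x] conv_integrable[OF k(1,2) li, of x] by (auto simp: conv_def)
  have "(\<integral>\<^sup>+x. ennreal ((conv k f x - f x)\<^sup>2) \<partial>lborel)
    \<le> (\<integral>\<^sup>+x. (\<integral>\<^sup>+y. ennreal (k y * (f (x - y) - f x)\<^sup>2) \<partial>lborel) \<partial>lborel)"
  proof (rule nn_integral_mono)
    fix x
    show "ennreal ((conv k f x - f x)\<^sup>2) \<le> (\<integral>\<^sup>+y. ennreal (k y * (f (x - y) - f x)\<^sup>2) \<partial>lborel)"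
    \<comment> \<open>Where the average is infinite the bound is trivial; finiteness supplies the
      integrability that Jensen's inequality requires.\<close>
    proof (cases "(\<integral>\<^sup>+y. ennreal (k y * (f (x - y) - f x)\<^sup>2) \<partial>lborel) = \<infinity>")
      case False
      then have i2: "integrable lborel (\<lambda>y. k y * (f (x - y) - f x)\<^sup>2)"
        using k(3) by (intro integrableI_nonneg) (auto simp: less_top)
      have i3: "integrable lborel (\<lambda>y. k y * (f (x - y) - f x))"
        using i1[of x] k(4) by (simp add: right_diff_distrib)
      have "conv k f x - f x = (LINT y|lborel. k y * (f (x - y) - f x))"
        using i1[of x] k(4,5) by (simp add: c1 right_diff_distrib)
      also have "(\<dots>)\<^sup>2 \<le> (LINT y|lborel. k y * (f (x - y) - f x)\<^sup>2)"
        by (rule integral_square_le_weighted[OF k(4,5,3) i3 i2])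
      finally show ?thesis
        using i2 k(3) by (subst nn_integral_eq_integral) (auto intro!: ennreal_leI)
    qed simp
  qed
  also have "\<dots> = (\<integral>\<^sup>+y. (\<integral>\<^sup>+x. ennreal (k y * (f (x - y) - f x)\<^sup>2) \<partial>lborel) \<partial>lborel)"
    by (rule lborel_pair.Fubini') simp
  also have "\<dots> \<le> (\<integral>\<^sup>+y. ennreal (k y) * ennreal e \<partial>lborel)"
  proof (rule nn_integral_mono)
    fix y
    have "(\<integral>\<^sup>+x. ennreal (k y * (f (x - y) - f x)\<^sup>2) \<partial>lborel) = ennreal (k y) * (\<integral>\<^sup>+x. ennreal ((f (x - y) - f x)\<^sup>2) \<partial>lborel)"
      using k(3) by (simp add: ennreal_mult nn_integral_cmult)
    also have "\<dots> \<le> ennreal (k y) * ennreal e"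
    proof (cases "norm y \<le> r")
      case True then show ?thesis using e by (intro mult_left_mono) auto
    next
      case False then show ?thesis using k(2) by (simp add: ball_supported_def)
    qed
    finally show "(\<integral>\<^sup>+x. ennreal (k y * (f (x - y) - f x)\<^sup>2) \<partial>lborel) \<le> ennreal (k y) * ennreal e" .
  qed
  also have "\<dots> = (\<integral>\<^sup>+y. ennreal (k y) \<partial>lborel) * ennreal e"
    by (rule nn_integral_multc) simp
  also have "(\<integral>\<^sup>+y. ennreal (k y) \<partial>lborel) = 1"
    using k by (subst nn_integral_eq_integral) auto
  finally show ?thesis by simp
qed

lemma ex_mollifier:
  assumes "r > 0"
  obtains k :: "'a::euclidean_space \<Rightarrow> real" where
    "smooth_on UNIV k" "ball_supported r k" "\<And>z. 0 \<le> k z" "integrable lborel k" "(LINT z|lborel. k z) = 1"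
proof -
  define g :: "'a \<Rightarrow> real" where "g z = smooth_step (1 - (z \<bullet> z) / r\<^sup>2)" for z
  have "smooth_on UNIV (\<lambda>z::'a. 1 - (inverse (r\<^sup>2)) * (z \<bullet> z))"
    by (intro smooth_on_diff smooth_on_const smooth_on_mult smooth_on_inner smooth_on_id) auto
  from smooth_on_compose_UNIV[OF this smooth_step_smooth] have g: "smooth_on UNIV g"
    by (simp add: g_def[abs_def] field_simps)
  have gs: "ball_supported r g"
    unfolding ball_supported_def g_def using assms
    by (auto intro!: smooth_step_0 simp: dot_square_norm divide_simps power_mono less_imp_le)
  have g0: "0 \<le> g z" for z by (simp add: g_def smooth_step_range)
  have gc: "continuous_on UNIV g" by (rule smooth_on_continuous_on[OF g])
  have gi: "integrable lborel g" by (rule ball_supported_integrable[OF gc gs])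
  have pos: "(LINT z|lborel. g z) > 0"
  proof (rule ccontr)
    assume "\<not> ?thesis"
    moreover have "0 \<le> (LINT z|lborel. g z)" by (intro integral_nonneg_AE) (auto simp: g0)
    ultimately have "(LINT z|lborel. g z) = 0" by simp
    then have ae: "AE z in lborel. g z = 0" using integral_nonneg_eq_0_iff_AE[OF gi] g0 by auto
    have nz: "g z \<noteq> 0" if "z \<in> ball 0 r" for z
    proof -
      have "(z \<bullet> z) / r\<^sup>2 < 1" using that assms by (simp add: dot_square_norm power_strict_mono)
      then show ?thesis using smooth_step_pos[of "1 - (z \<bullet> z) / r\<^sup>2"] by (simp add: g_def)
    qed
    have "AE z in lborel. z \<notin> ball (0::'a) r" by (rule eventually_mono[OF ae]) (use nz in blast)
    then have "emeasure lborel (ball (0::'a) r) = 0" by (subst (asm) AE_iff_measurable[of "ball 0 r"]) auto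
    then have "ball 0 r \<in> null_sets (lborel :: 'a measure)" by (simp add: null_sets_def)
    then show False using assms open_not_negligible[of "ball (0::'a) r"] by (simp add: negligible_iff_null_sets null_sets_completionI)
  qed
  show ?thesis
  proof (rule that[of "\<lambda>z. inverse (LINT z|lborel. g z) * g z"])
    show "smooth_on UNIV (\<lambda>z. inverse (LINT z|lborel. g z) * g z)"
      by (intro smooth_on_mult smooth_on_const g) auto
    show "ball_supported r (\<lambda>z. inverse (LINT z|lborel. g z) * g z)" using gs by (simp add: ball_supported_def)
  qed (use g0 gi pos in auto)
qed

section \<open>Partial derivatives and their integrals\<close>

definition pd :: "'n::finite \<Rightarrow> (real^'n \<Rightarrow> real) \<Rightarrow> real^'n \<Rightarrow> real" where
  "pd j g x = frechet_derivative g (at x) (axis j 1)"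

lemma pd_smooth: "smooth_on UNIV g \<Longrightarrow> smooth_on UNIV (pd j g)"
  unfolding pd_def[abs_def] by (rule smooth_on_frechet_derivative)

lemma pd_ball_supported: "ball_supported r g \<Longrightarrow> ball_supported r (pd j g)"
  using ball_supported_frechet_derivative[of r g "axis j 1"] by (simp add: pd_def[abs_def])

lemma pd_eqI: "(g has_derivative g') (at x) \<Longrightarrow> pd j g x = g' (axis j 1)"
  unfolding pd_def using frechet_derivative_at by metis

lemma smooth_has_derivative_pd:
  "smooth_on UNIV g \<Longrightarrow> (g has_derivative frechet_derivative g (at x)) (at x)"
  by (rule smooth_on_has_derivative) auto

lemma pd_mult:
  assumes "smooth_on UNIV g" "smooth_on UNIV h"
  shows "pd j (\<lambda>x. g x * h x) x = pd j g x * h x + g x * pd j h x"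
  by (subst pd_eqI[OF has_derivative_mult[OF smooth_has_derivative_pd[OF assms(1)] smooth_has_derivative_pd[OF assms(2)]]])
     (simp add: pd_def)

lemma pd_grad: "grad \<psi> x $ j = pd j \<psi> x"
  by (simp add: grad_def pd_def)

text \<open>The convolution of \<open>g\<close> with the constant 1 is constant, so its derivative
  is 0. By \<open>conv_has_derivative\<close> that derivative is also the convolution of
  \<open>pd j g\<close> with 1, which is the integral in question. Iterated integrals and the
  one-dimensional fundamental theorem are thereby avoided.\<close>

lemma integral_pd_eq_0:
  assumes "smooth_on UNIV g" "ball_supported r g"
  shows "(LINT x|lborel. pd j g x) = 0"
proof -
  have li: "locally_integrable (\<lambda>x::real^'n. 1::real)"
    unfolding locally_integrable_def set_integrable_def
    using emeasure_compact_finite[of "cball (0::real^'n) _"] by (auto intro!: integrable_real_indicator)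
  have gm: "g \<in> borel_measurable borel" and pm: "pd j g \<in> borel_measurable borel"
    using assms(1) pd_smooth[OF assms(1)] smooth_on_continuous_on borel_measurable_continuous_onI by blast+
  have c: "conv g (\<lambda>x. 1::real) = (\<lambda>x. (LINT y|lborel. g y))"
    using lborel_integral_reflect(2)[OF gm] by (auto simp: conv_def fun_eq_iff)
  have "(conv g (\<lambda>x. 1::real) has_derivative (\<lambda>v. conv (\<lambda>z. frechet_derivative g (at z) v) (\<lambda>x. 1::real) 0)) (at 0)"
    by (rule conv_has_derivative[OF assms li])
  moreover have "(conv g (\<lambda>x. 1::real) has_derivative (\<lambda>v. 0)) (at 0)"
    unfolding c by (rule has_derivative_const)
  ultimately have "(\<lambda>v. conv (\<lambda>z. frechet_derivative g (at z) v) (\<lambda>x. 1::real) 0) = (\<lambda>v. 0)"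
    by (rule has_derivative_unique)
  from fun_cong[OF this, of "axis j 1"] have "conv (pd j g) (\<lambda>x. 1::real) 0 = 0"
    by (simp add: pd_def[abs_def])
  then show ?thesis using lborel_integral_reflect(2)[OF pm, of 0] by (simp add: conv_def)
qed

section \<open>Products of square integrable functions\<close>

lemma integrable_mult_L2:
  fixes f g :: "'a \<Rightarrow> real"
  assumes [measurable]: "f \<in> borel_measurable M" "g \<in> borel_measurable M"
    and "integrable M (\<lambda>x. (f x)\<^sup>2)" "integrable M (\<lambda>x. (g x)\<^sup>2)"
  shows "integrable M (\<lambda>x. f x * g x)"
proof (rule Bochner_Integration.integrable_bound)
  show "integrable M (\<lambda>x. (f x)\<^sup>2 + (g x)\<^sup>2)" using assms by auto
  show "AE x in M. norm (f x * g x) \<le> norm ((f x)\<^sup>2 + (g x)\<^sup>2)"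
  proof (rule AE_I2)
    fix x
    have "2 * (\<bar>f x\<bar> * \<bar>g x\<bar>) \<le> (f x)\<^sup>2 + (g x)\<^sup>2"
      using zero_le_power2[of "\<bar>f x\<bar> - \<bar>g x\<bar>"] by (simp add: power2_diff)
    moreover have "0 \<le> \<bar>f x\<bar> * \<bar>g x\<bar>" by simp
    ultimately show "norm (f x * g x) \<le> norm ((f x)\<^sup>2 + (g x)\<^sup>2)" unfolding real_norm_def abs_mult by linarith
  qed
qed measurable

lemma Cauchy_Schwarz_integral:
  fixes f g :: "'a \<Rightarrow> real"
  assumes m: "f \<in> borel_measurable M" "g \<in> borel_measurable M"
    and i: "integrable M (\<lambda>x. (f x)\<^sup>2)" "integrable M (\<lambda>x. (g x)\<^sup>2)"
  shows "\<bar>LINT x|M. f x * g x\<bar> \<le> sqrt (LINT x|M. (f x)\<^sup>2) * sqrt (LINT x|M. (g x)\<^sup>2)"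
proof -
  define A B C where "A = (LINT x|M. (f x)\<^sup>2)" and "B = (LINT x|M. (g x)\<^sup>2)" and "C = (LINT x|M. f x * g x)"
  have fg: "integrable M (\<lambda>x. f x * g x)" by (rule integrable_mult_L2[OF m i])
  have q: "0 \<le> A - 2 * t * C + t\<^sup>2 * B" for t
  proof -
    have "0 \<le> (LINT x|M. (f x - t * g x)\<^sup>2)" by (intro integral_nonneg_AE) auto
    also have "\<dots> = (LINT x|M. (f x)\<^sup>2 - 2 * t * (f x * g x) + t\<^sup>2 * (g x)\<^sup>2)"
      by (intro Bochner_Integration.integral_cong) (auto simp: power2_eq_square algebra_simps)
    also have "\<dots> = A - 2 * t * C + t\<^sup>2 * B" using i fg by (simp add: A_def B_def C_def)
    finally show ?thesis .
  qed
  have A: "A \<ge> 0" and B: "B \<ge> 0" unfolding A_def B_def by (intro integral_nonneg_AE; simp)+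
  have "C\<^sup>2 \<le> A * B"
  proof (cases "B = 0")
    case True
    have "C = 0"
    proof (rule ccontr)
      assume "C \<noteq> 0"
      \<comment> \<open>For B = 0 the quadratic reduces to A - 2tC, and this t gives it the value
        -1.\<close>
      then show False using q[of "(A + 1) / (2 * C)"] True by simp
    qed
    then show ?thesis using True by simp
  next
    case False
    have "0 \<le> B * (A - 2 * (C / B) * C + (C / B)\<^sup>2 * B)" using q[of "C / B"] B by simp
    also have "\<dots> = A * B - C\<^sup>2" using False by (simp add: power2_eq_square field_simps)
    finally show ?thesis by simp
  qed
  then have "sqrt (C\<^sup>2) \<le> sqrt (A * B)" by (rule real_sqrt_le_mono)
  then show ?thesis by (simp add: A_def B_def C_def real_sqrt_mult)
qed

definition square_integrable :: "('a::euclidean_space \<Rightarrow> real) \<Rightarrow> bool" where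
  "square_integrable f \<longleftrightarrow> f \<in> borel_measurable borel \<and> integrable lborel (\<lambda>x. (f x)\<^sup>2)"

definition L2_dist :: "('a::euclidean_space \<Rightarrow> real) \<Rightarrow> ('a \<Rightarrow> real) \<Rightarrow> real" where
  "L2_dist f g = sqrt (LINT x|lborel. (f x - g x)\<^sup>2)"

lemma square_integrable_diff:
  assumes "square_integrable f" "square_integrable g"
  shows "square_integrable (\<lambda>x. f x - g x)"
proof -
  have [measurable]: "f \<in> borel_measurable borel" "g \<in> borel_measurable borel"
    using assms by (auto simp: square_integrable_def)
  have "integrable lborel (\<lambda>x. (f x)\<^sup>2 - 2 * (f x * g x) + (g x)\<^sup>2)"
    using assms integrable_mult_L2[of f lborel g] by (auto simp: square_integrable_def)
  then show ?thesis by (simp add: square_integrable_def power2_diff algebra_simps)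
qed

lemma square_integrable_mult_bounded:
  assumes "square_integrable f" "c \<in> borel_measurable borel" "\<And>x. \<bar>c x\<bar> \<le> B"
  shows "square_integrable (\<lambda>x. f x * c x)"
proof -
  have [measurable]: "f \<in> borel_measurable borel" "c \<in> borel_measurable borel"
    using assms by (auto simp: square_integrable_def)
  have "integrable lborel (\<lambda>x. (f x * c x)\<^sup>2)"
  proof (rule Bochner_Integration.integrable_bound)
    show "integrable lborel (\<lambda>x. B\<^sup>2 * (f x)\<^sup>2)" using assms by (simp add: square_integrable_def)
    have "(c x)\<^sup>2 \<le> B\<^sup>2" for x using assms(3)[of x] by (intro abs_le_square_iff[THEN iffD1]) linarith
    then show "AE x in lborel. norm ((f x * c x)\<^sup>2) \<le> norm (B\<^sup>2 * (f x)\<^sup>2)"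
      by (intro AE_I2) (simp add: power_mult_distrib mult.commute[of "(f _)\<^sup>2"] mult_right_mono)
  qed measurable
  then show ?thesis by (simp add: square_integrable_def)
qed

text \<open>With p = F - f and q = G - g one has FG - fg = pq + pg + fq. The Cauchy-Schwarz
  inequality handles each term, and the bounded weight \<open>c\<close> costs a factor
  \<open>B\<close>.\<close>

lemma integral_mult_tendsto:
  assumes f: "\<And>n. square_integrable (F n)" "square_integrable f" "(\<lambda>n. L2_dist (F n) f) \<longlonglongrightarrow> 0"
    and g: "\<And>n. square_integrable (G n)" "square_integrable g" "(\<lambda>n. L2_dist (G n) g) \<longlonglongrightarrow> 0"
    and c: "c \<in> borel_measurable borel" "\<And>x. \<bar>c x\<bar> \<le> B"
  shows "(\<lambda>n. LINT x|lborel. F n x * G n x * c x) \<longlonglongrightarrow> (LINT x|lborel. f x * g x * c x)"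
proof -
  define N where "N h = sqrt (LINT x|lborel. (h x)\<^sup>2)" for h :: "'a \<Rightarrow> real"
  have CS: "\<bar>LINT x|lborel. p x * q x\<bar> \<le> N p * N q" "integrable lborel (\<lambda>x. p x * q x)"
    if "square_integrable p" "square_integrable q" for p q
    using Cauchy_Schwarz_integral[of p lborel q] integrable_mult_L2[of p lborel q] that
    by (auto simp: square_integrable_def N_def)
  have B: "B \<ge> 0" using c(2)[of undefined] by linarith
  have Nc: "N (\<lambda>x. p x * c x) \<le> B * N p" if "square_integrable p" for p
  proof -
    have "(c x)\<^sup>2 \<le> B\<^sup>2" for x using c(2)[of x] by (intro abs_le_square_iff[THEN iffD1]) linarith
    then have "(LINT x|lborel. (p x * c x)\<^sup>2) \<le> (LINT x|lborel. B\<^sup>2 * (p x)\<^sup>2)"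
      using square_integrable_mult_bounded[OF that c] that
      by (intro integral_mono) (auto simp: square_integrable_def power_mult_distrib mult.commute[of "(p _)\<^sup>2"] intro: mult_right_mono)
    also have "\<dots> = B\<^sup>2 * (LINT x|lborel. (p x)\<^sup>2)" by simp
    finally have "N (\<lambda>x. p x * c x) \<le> sqrt (B\<^sup>2 * (LINT x|lborel. (p x)\<^sup>2))" unfolding N_def by (rule real_sqrt_le_mono)
    then show ?thesis using B by (simp add: N_def real_sqrt_mult)
  qed
  note dc = square_integrable_mult_bounded[OF _ c]
  have bound: "\<bar>(LINT x|lborel. F n x * G n x * c x) - (LINT x|lborel. f x * g x * c x)\<bar>
     \<le> B * (L2_dist (F n) f * L2_dist (G n) g + L2_dist (F n) f * N g + N f * L2_dist (G n) g)" for n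
  proof -
    define p where "p x = F n x - f x" for x
    define q where "q x = G n x - g x" for x
    have p: "square_integrable p" and q: "square_integrable q"
      unfolding p_def[abs_def] q_def[abs_def] using f g square_integrable_diff by blast+
    have Np: "N p = L2_dist (F n) f" "N q = L2_dist (G n) g" by (simp_all add: N_def p_def q_def L2_dist_def)
    have ip: "integrable lborel (\<lambda>x. p x * (q x * c x))" "integrable lborel (\<lambda>x. p x * (g x * c x))" "integrable lborel (\<lambda>x. f x * (q x * c x))"
       "integrable lborel (\<lambda>x. f x * (g x * c x))"
      using CS(2) p q f(2) g(2) dc by blast+
    have "(LINT x|lborel. F n x * G n x * c x) = (LINT x|lborel. p x * (q x * c x) + p x * (g x * c x) + f x * (q x * c x) + f x * (g x * c x))"
      by (intro Bochner_Integration.integral_cong) (auto simp: p_def q_def algebra_simps)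
    also have "\<dots> = (LINT x|lborel. p x * (q x * c x)) + (LINT x|lborel. p x * (g x * c x)) + (LINT x|lborel. f x * (q x * c x)) + (LINT x|lborel. f x * g x * c x)"
      using ip by (simp add: mult.assoc)
    finally have "\<bar>(LINT x|lborel. F n x * G n x * c x) - (LINT x|lborel. f x * g x * c x)\<bar>
      \<le> \<bar>LINT x|lborel. p x * (q x * c x)\<bar> + \<bar>LINT x|lborel. p x * (g x * c x)\<bar> + \<bar>LINT x|lborel. f x * (q x * c x)\<bar>" by linarith
    also have "\<dots> \<le> N p * N (\<lambda>x. q x * c x) + N p * N (\<lambda>x. g x * c x) + N f * N (\<lambda>x. q x * c x)"
      using CS(1) p q f(2) g(2) dc by (intro add_mono) blast+
    also have "\<dots> \<le> N p * (B * N q) + N p * (B * N g) + N f * (B * N q)"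
      using Nc p q f(2) g(2) by (intro add_mono mult_left_mono) (auto simp: N_def)
    finally show ?thesis by (simp add: Np algebra_simps)
  qed
  have "(\<lambda>n. B * (L2_dist (F n) f * L2_dist (G n) g + L2_dist (F n) f * N g + N f * L2_dist (G n) g))
     \<longlonglongrightarrow> B * (0 * 0 + 0 * N g + N f * 0)"
    by (intro tendsto_intros f g)
  then have z: "(\<lambda>n. B * (L2_dist (F n) f * L2_dist (G n) g + L2_dist (F n) f * N g + N f * L2_dist (G n) g)) \<longlonglongrightarrow> 0" by simp
  have "(\<lambda>n. (LINT x|lborel. F n x * G n x * c x) - (LINT x|lborel. f x * g x * c x)) \<longlonglongrightarrow> 0"
    by (rule tendsto_rabs_zero_cancel, rule real_tendsto_sandwich[OF _ _ tendsto_const z]) (use bound in auto)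
  then show ?thesis by (simp add: LIM_zero_iff)
qed

lemma square_integrable_bounded_smooth_mult:
  assumes "square_integrable f" "square_integrable g" "c \<in> borel_measurable borel" "\<And>x. \<bar>c x\<bar> \<le> B"
  shows "integrable lborel (\<lambda>x. f x * g x * c x)"
  using integrable_mult_L2[of f lborel "\<lambda>x. g x * c x"] assms square_integrable_mult_bounded[OF assms(2-4)]
  by (auto simp: square_integrable_def mult.assoc)

lemma conv_square_integrable:
  fixes f :: "'a::euclidean_space \<Rightarrow> real"
  assumes k: "smooth_on UNIV k" "ball_supported r k"
    and f: "square_integrable f" and e: "(\<integral>\<^sup>+x. ennreal ((conv k f x - f x)\<^sup>2) \<partial>lborel) \<le> ennreal e" "e \<ge> 0"
  shows "square_integrable (conv k f)" "L2_dist (conv k f) f \<le> sqrt e"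
proof -
  have li: "locally_integrable f" using locally_integrable_L2 f by (auto simp: square_integrable_def)
  have [measurable]: "conv k f \<in> borel_measurable borel"
    using smooth_on_continuous_on[OF conv_smooth[OF k li]] by (rule borel_measurable_continuous_onI)
  have [measurable]: "f \<in> borel_measurable borel" using f by (simp add: square_integrable_def)
  have d: "square_integrable (\<lambda>x. conv k f x - f x)"
    using e le_less_trans[OF e(1), of \<infinity>] by (auto simp: square_integrable_def intro!: integrableI_nonneg)
  have "square_integrable (\<lambda>x. (conv k f x - f x) - (0 - f x))"
    by (rule square_integrable_diff[OF d]) (use f in \<open>auto simp: square_integrable_def\<close>)
  then show "square_integrable (conv k f)" by simp
  have "ennreal (LINT x|lborel. (conv k f x - f x)\<^sup>2) \<le> ennreal e"
    using e(1) d by (subst (asm) nn_integral_eq_integral) (auto simp: square_integrable_def)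
  then show "L2_dist (conv k f) f \<le> sqrt e" unfolding L2_dist_def using e(2) by (simp add: ennreal_le_iff)
qed

text \<open>One kernel must serve a whole finite family, so that linear differential relations
  between its members survive mollification. The radius is half the smallest of the finitely many
  moduli of translation continuity.\<close>

lemma common_mollifiers:
  fixes f :: "'i::finite \<Rightarrow> 'a::euclidean_space \<Rightarrow> real"
  assumes f: "\<And>i. square_integrable (f i)"
  obtains k :: "nat \<Rightarrow> 'a \<Rightarrow> real" and r where
    "\<And>n. smooth_on UNIV (k n)" "\<And>n. ball_supported (r n) (k n)"
    "\<And>n i. square_integrable (conv (k n) (f i))"
    "\<And>i. (\<lambda>n. L2_dist (conv (k n) (f i)) (f i)) \<longlonglongrightarrow> 0"
proof -
  have "\<exists>k r. smooth_on UNIV k \<and> ball_supported r k \<and> (\<forall>i. square_integrable (conv k (f i)) \<and>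
      L2_dist (conv k (f i)) (f i) \<le> sqrt (inverse (real (Suc n))))" for n
  proof -
    let ?e = "inverse (real (Suc n))"
    have "\<exists>d>0. \<forall>a. norm a < d \<longrightarrow> (\<integral>\<^sup>+x. ennreal ((f i (x - a) - f i x)\<^sup>2) \<partial>lborel) \<le> ennreal ?e" for i
      using translation_L2_continuous_L2[of "f i"] f[of i]
      by (auto simp: square_integrable_def translation_L2_continuous_def simp del: of_nat_Suc)
    then obtain d where d: "\<And>i. d i > 0" "\<And>i a. norm a < d i \<Longrightarrow> (\<integral>\<^sup>+x. ennreal ((f i (x - a) - f i x)\<^sup>2) \<partial>lborel) \<le> ennreal ?e"
      by metis
    define r where "r = Min (range d) / 2"
    have r: "r > 0" "r < d i" for i
    proof -
      show "r > 0" using d(1) by (simp add: r_def)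
      have "Min (range d) \<le> d i" by simp
      then show "r < d i" using d(1)[of i] unfolding r_def by linarith
    qed
    obtain k :: "'a \<Rightarrow> real" where k: "smooth_on UNIV k" "ball_supported r k" "\<And>z. 0 \<le> k z" "integrable lborel k" "(LINT z|lborel. k z) = 1"
      using ex_mollifier[OF r(1)] by blast
    have "(\<integral>\<^sup>+x. ennreal ((conv k (f i) x - f i x)\<^sup>2) \<partial>lborel) \<le> ennreal ?e" for i
    proof (rule conv_L2_close[OF smooth_on_continuous_on[OF k(1)] k(2-5)])
      show "(\<integral>\<^sup>+x. ennreal ((f i (x - a) - f i x)\<^sup>2) \<partial>lborel) \<le> ennreal ?e" if "norm a \<le> r" for a
        using d(2)[of a i] that r(2)[of i] by simp
    qed (use f[of i] in \<open>auto simp: square_integrable_def\<close>)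
    from conv_square_integrable[OF k(1,2) f this] show ?thesis
      using k(1,2) by (intro exI[of _ k] exI[of _ r]) auto
  qed
  then obtain k r where kr: "\<And>n. smooth_on UNIV (k n)" "\<And>n. ball_supported (r n) (k n)"
    "\<And>n i. square_integrable (conv (k n) (f i))" "\<And>n i. L2_dist (conv (k n) (f i)) (f i) \<le> sqrt (inverse (real (Suc n)))"
    by metis
  show ?thesis
  proof (rule that[OF kr(1-3)])
    fix i
    have "(\<lambda>n. sqrt (inverse (real (Suc n)))) \<longlonglongrightarrow> sqrt 0"
      by (intro tendsto_intros LIMSEQ_inverse_real_of_nat)
    then have "(\<lambda>n. sqrt (inverse (real (Suc n)))) \<longlonglongrightarrow> 0" by simp
    then show "(\<lambda>n. L2_dist (conv (k n) (f i)) (f i)) \<longlonglongrightarrow> 0"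
      by (rule real_tendsto_sandwich[OF _ _ tendsto_const, rotated 2]) (use kr(4) in \<open>auto simp: L2_dist_def\<close>)
  qed
qed

text \<open>Up to multiples of div a and div W, the integrand is the sum over i, j of
  \<open>pd j (a i * a j * W i)\<close> and \<open>pd i (a j * a j * W i) / 2\<close>, whose
  integrals vanish. The second family appears because the transposed half of the symmetric gradient
  produces the gradient of |a|^2 / 2, which a divergence free field does not see.\<close>

lemma smooth_symmetric_gradient_identity:
  fixes a W :: "'n::finite \<Rightarrow> real^'n \<Rightarrow> real"
  assumes a: "\<And>i. smooth_on UNIV (a i)" and W: "\<And>i. smooth_on UNIV (W i)" "\<And>i. ball_supported r (W i)"
    and e: "\<And>i j x. pd j (a i) x + pd i (a j) x = 2 * e i j x"
    and da: "\<And>x. (\<Sum>i\<in>UNIV. pd i (a i) x) = 0" and dW: "\<And>x. (\<Sum>i\<in>UNIV. pd i (W i) x) = 0"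
  shows "(LINT x|lborel. (\<Sum>i\<in>UNIV. \<Sum>j\<in>UNIV. a i x * a j x * pd j (W i) x + 2 * (e i j x * a j x * W i x))) = 0"
proof -
  define P where "P i j x = a i x * a j x * W i x" for i j x
  define Q where "Q i j x = a j x * a j x * W i x" for i j x
  have PQ: "smooth_on UNIV (P i j)" "smooth_on UNIV (Q i j)" "ball_supported r (P i j)" "ball_supported r (Q i j)" for i j
    unfolding P_def[abs_def] Q_def[abs_def] using W(2) by (auto intro!: smooth_on_mult a W simp: ball_supported_def)
  have ip: "integrable lborel (pd l (P i j))" "integrable lborel (pd l (Q i j))" for i j l
    using ball_supported_integrable[OF smooth_on_continuous_on[OF pd_smooth[OF PQ(1)]] pd_ball_supported[OF PQ(3)]]
      ball_supported_integrable[OF smooth_on_continuous_on[OF pd_smooth[OF PQ(2)]] pd_ball_supported[OF PQ(4)]] by auto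
  have "(\<Sum>i\<in>UNIV. \<Sum>j\<in>UNIV. a i x * a j x * pd j (W i) x + 2 * (e i j x * a j x * W i x))
    = (\<Sum>i\<in>UNIV. \<Sum>j\<in>UNIV. pd j (P i j) x + pd i (Q i j) x / 2)" for x
  proof -
    have 1: "pd j (P i j) x = pd j (a i) x * a j x * W i x + a i x * W i x * pd j (a j) x + a i x * a j x * pd j (W i) x" for i j
      unfolding P_def[abs_def] by (simp add: pd_mult a W smooth_on_mult algebra_simps)
    have 2: "pd i (Q i j) x / 2 = a j x * pd i (a j) x * W i x + (a j x)\<^sup>2 * pd i (W i) x / 2" for i j
      unfolding Q_def[abs_def] by (simp add: pd_mult a W smooth_on_mult power2_eq_square algebra_simps)
    have 3: "e i j x * a j x * W i x * 2 = pd j (a i) x * a j x * W i x + a j x * pd i (a j) x * W i x" for i j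
      using arg_cong[OF e[of j i x], of "\<lambda>z. z * (a j x * W i x)"] by (simp add: algebra_simps)
    have "(\<Sum>i\<in>UNIV. \<Sum>j\<in>UNIV. pd j (P i j) x + pd i (Q i j) x / 2)
      = (\<Sum>i\<in>UNIV. \<Sum>j\<in>UNIV. a i x * a j x * pd j (W i) x + 2 * (e i j x * a j x * W i x)
          + a i x * W i x * pd j (a j) x + (a j x)\<^sup>2 * pd i (W i) x / 2)"
      by (intro sum.cong refl) (use 1 2 3 in \<open>auto simp: algebra_simps\<close>)
    also have "\<dots> = (\<Sum>i\<in>UNIV. \<Sum>j\<in>UNIV. a i x * a j x * pd j (W i) x + 2 * (e i j x * a j x * W i x))
       + (\<Sum>i\<in>UNIV. a i x * W i x * (\<Sum>j\<in>UNIV. pd j (a j) x))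
       + (\<Sum>i\<in>UNIV. \<Sum>j\<in>UNIV. (a j x)\<^sup>2 * pd i (W i) x / 2)"
      by (simp add: sum.distrib sum_distrib_left)
    also have "(\<Sum>i\<in>UNIV. \<Sum>j\<in>UNIV. (a j x)\<^sup>2 * pd i (W i) x / 2) = (\<Sum>j\<in>UNIV. (a j x)\<^sup>2 / 2 * (\<Sum>i\<in>UNIV. pd i (W i) x))"
      by (subst sum.swap) (simp add: sum_distrib_left)
    finally show ?thesis by (simp add: da dW)
  qed
  then have "(LINT x|lborel. (\<Sum>i\<in>UNIV. \<Sum>j\<in>UNIV. a i x * a j x * pd j (W i) x + 2 * (e i j x * a j x * W i x)))
    = (LINT x|lborel. (\<Sum>i\<in>UNIV. \<Sum>j\<in>UNIV. pd j (P i j) x + pd i (Q i j) x / 2))" by simp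
  also have "\<dots> = (\<Sum>i\<in>UNIV. \<Sum>j\<in>UNIV. (LINT x|lborel. pd j (P i j) x) + (LINT x|lborel. pd i (Q i j) x) / 2)"
    using ip by (simp add: Bochner_Integration.integral_sum)
  also have "\<dots> = 0"
    by (simp add: integral_pd_eq_0[OF PQ(1) PQ(3)] integral_pd_eq_0[OF PQ(2) PQ(4)])
  finally show ?thesis .
qed

lemma smooth_square_identity:
  fixes a \<psi> :: "real^'n \<Rightarrow> real"
  assumes a: "smooth_on UNIV a" and \<psi>: "smooth_on UNIV \<psi>" "ball_supported r \<psi>"
  shows "(LINT x|lborel. a x * a x * pd i \<psi> x + 2 * (a x * pd i a x * \<psi> x)) = 0"
proof -
  have "(\<lambda>x. a x * a x * pd i \<psi> x + 2 * (a x * pd i a x * \<psi> x)) = pd i (\<lambda>x. a x * a x * \<psi> x)"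
    by (rule ext) (simp add: pd_mult a \<psi> smooth_on_mult algebra_simps)
  moreover have "smooth_on UNIV (\<lambda>x. a x * a x * \<psi> x)" by (intro smooth_on_mult a \<psi> open_UNIV)
  moreover have "ball_supported r (\<lambda>x. a x * a x * \<psi> x)" using \<psi>(2) by (simp add: ball_supported_def)
  ultimately show ?thesis using integral_pd_eq_0 by metis
qed

subsection \<open>Integration by parts\<close>

text \<open>Weak solutions are only Lebesgue measurable, while mollification and the exchange of
  integrals are carried out with Borel functions and \<open>lborel\<close>. Integrals are
  transferred along equality almost everywhere.\<close>

lemma lebesgue_AE_borel:
  fixes F G :: "'a::euclidean_space \<Rightarrow> 'b::euclidean_space"
  assumes G: "G \<in> borel_measurable borel" and ae: "AE x in lebesgue. F x = G x"
  shows "F \<in> borel_measurable lebesgue"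
    and "integrable lebesgue F \<longleftrightarrow> integrable lborel G"
    and "(LINT x|lebesgue. F x) = (LINT x|lborel. G x)"
proof -
  have Gl: "G \<in> borel_measurable lebesgue" using G by (intro measurable_completion) simp
  have "AE x in lebesgue. G x = F x" using ae by eventually_elim simp
  from borel_measurable_AE[OF Gl this] show Fl: "F \<in> borel_measurable lebesgue" .
  have "integrable lebesgue F \<longleftrightarrow> integrable lebesgue G"
    by (rule integrable_cong_AE[OF Fl Gl ae])
  then show "integrable lebesgue F \<longleftrightarrow> integrable lborel G" using G by (simp add: integrable_completion)
  have "(LINT x|lebesgue. F x) = (LINT x|lebesgue. G x)" by (rule integral_cong_AE[OF Fl Gl ae])
  then show "(LINT x|lebesgue. F x) = (LINT x|lborel. G x)" using G by (simp add: integral_completion)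
qed

lemma ex_borel_representative:
  fixes f :: "'a::euclidean_space \<Rightarrow> 'b::euclidean_space"
  assumes "f \<in> borel_measurable lebesgue"
  obtains g where "g \<in> borel_measurable borel" "AE x in lebesgue. f x = g x"
proof -
  have "(\<lambda>x. f x \<bullet> b) \<in> borel_measurable lebesgue" for b using assms by measurable
  then have "\<exists>g. g \<in> borel_measurable borel \<and> (AE x in lborel. f x \<bullet> b = g x)" for b
    using completion_ex_borel_measurable_real[of "\<lambda>x. f x \<bullet> b" lborel] by auto
  then obtain g where g: "\<And>b. g b \<in> borel_measurable borel" "\<And>b. AE x in lborel. f x \<bullet> b = g b x"
    by metis
  show ?thesis
  proof (rule that[of "\<lambda>x. \<Sum>b\<in>Basis. g b x *\<^sub>R b"])
    show "(\<lambda>x. \<Sum>b\<in>Basis. g b x *\<^sub>R b) \<in> borel_measurable borel"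
      by (intro borel_measurable_sum borel_measurable_scaleR g) auto
    have "AE x in lborel. \<forall>b\<in>Basis. f x \<bullet> b = g b x" using g(2) by (subst AE_ball_countable) (auto intro: countable_finite)
    then have "AE x in lborel. f x = (\<Sum>b\<in>Basis. g b x *\<^sub>R b)"
    proof eventually_elim
      case (elim x)
      then have "(\<Sum>b\<in>Basis. g b x *\<^sub>R b) = (\<Sum>b\<in>Basis. (f x \<bullet> b) *\<^sub>R b)" by (intro sum.cong) auto
      then show ?case by (simp add: euclidean_representation)
    qed
    then show "AE x in lebesgue. f x = (\<Sum>b\<in>Basis. g b x *\<^sub>R b)" by (simp add: AE_completion_iff)
  qed
qed

lemma L2_UNIV_iff:
  "L2 UNIV f \<longleftrightarrow> f \<in> borel_measurable lebesgue \<and> integrable lebesgue (\<lambda>x. (norm (f x))\<^sup>2)"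
  by (simp add: L2_def set_borel_measurable_def set_integrable_def)

lemma square_integrable_bounded_by_L2:
  fixes g :: "real^'n \<Rightarrow> real"
  assumes f: "L2 UNIV f" and g: "g \<in> borel_measurable borel" and le: "AE x in lebesgue. \<bar>g x\<bar> \<le> norm (f x)"
  shows "square_integrable g"
proof -
  have "integrable lebesgue (\<lambda>x. (g x)\<^sup>2)"
  proof (rule Bochner_Integration.integrable_bound)
    show "integrable lebesgue (\<lambda>x. (norm (f x))\<^sup>2)" using f by (simp add: L2_UNIV_iff)
    show "(\<lambda>x. (g x)\<^sup>2) \<in> borel_measurable lebesgue" using g by (intro measurable_completion) simp
    show "AE x in lebesgue. norm ((g x)\<^sup>2) \<le> norm ((norm (f x))\<^sup>2)"
      using le by eventually_elim (auto simp: abs_le_square_iff[symmetric])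
  qed
  then show ?thesis using g by (simp add: square_integrable_def integrable_completion)
qed

lemma test_function_ball_supported:
  fixes \<psi> :: "real^'n \<Rightarrow> real"
  assumes "smooth_on UNIV \<psi>" "ball_supported r \<psi>"
  shows "test_function UNIV \<psi>"
proof -
  have "{x. \<psi> x \<noteq> 0} \<subseteq> cball 0 r" using assms(2) by (auto simp: ball_supported_def not_less[symmetric])
  then have "closure {x. \<psi> x \<noteq> 0} \<subseteq> cball 0 r" by (rule closure_minimal) auto
  then have "compact (closure {x. \<psi> x \<noteq> 0})"
    using compact_cball closed_closure compact_Int_closed[of "cball 0 r" "closure {x. \<psi> x \<noteq> 0}"] by (simp add: Int_absorb1)
  then show ?thesis using assms(1) by (simp add: test_function_def)
qed

lemma abs_matrix_component_le_norm: "\<bar>(A :: real^'n^'m) $ i $ j\<bar> \<le> norm A"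
  by (metis component_le_norm_cart Finite_Cartesian_Product.norm_nth_le order_trans)

section \<open>Weak derivatives and their mollification\<close>

definition weak_sym_grad_family :: "('n::finite \<Rightarrow> real^'n \<Rightarrow> real) \<Rightarrow> ('n \<Rightarrow> 'n \<Rightarrow> real^'n \<Rightarrow> real) \<Rightarrow> bool" where
  "weak_sym_grad_family w E \<longleftrightarrow> (\<forall>\<psi> r i j. smooth_on UNIV \<psi> \<longrightarrow> ball_supported r \<psi> \<longrightarrow>
      (LINT x|lborel. E i j x * \<psi> x) = - (LINT x|lborel. (w i x * pd j \<psi> x + w j x * pd i \<psi> x) / 2))"

definition weak_div_free_family :: "('n::finite \<Rightarrow> real^'n \<Rightarrow> real) \<Rightarrow> bool" where
  "weak_div_free_family w \<longleftrightarrow> (\<forall>\<psi> r. smooth_on UNIV \<psi> \<longrightarrow> ball_supported r \<psi> \<longrightarrow>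
      (LINT x|lborel. (\<Sum>i\<in>UNIV. w i x * pd i \<psi> x)) = 0)"

lemmas weak_sym_grad_familyD = weak_sym_grad_family_def[THEN iffD1, rule_format]
lemmas weak_div_free_familyD = weak_div_free_family_def[THEN iffD1, rule_format]

text \<open>The entries of \<open>v\<close> and \<open>D\<close> become real Borel functions indexed
  by coordinates, because products and mollifications are taken entry by entry. The weak identities
  consist of integrals, so a change on a null set leaves them intact.\<close>

lemma weak_sym_grad_representative:
  fixes v :: "real^'n \<Rightarrow> real^'n"
  assumes v: "L2 UNIV v" and D: "L2 UNIV D" and vD: "weak_sym_grad UNIV v D"
  shows "\<exists>w E. (AE x in lebesgue. \<forall>i. v x $ i = w i x) \<and> (AE x in lebesgue. \<forall>i j. D x $ i $ j = E i j x) \<and>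
    (\<forall>i. square_integrable (w i)) \<and> (\<forall>i j. square_integrable (E i j)) \<and>
    weak_sym_grad_family w E \<and> (weakly_div_free UNIV v \<longrightarrow> weak_div_free_family w)"
proof -
  obtain v' where v': "v' \<in> borel_measurable borel" "AE x in lebesgue. v x = v' x"
    using ex_borel_representative[of v] v by (auto simp: L2_UNIV_iff)
  obtain D' where D': "D' \<in> borel_measurable borel" "AE x in lebesgue. D x = D' x"
    using ex_borel_representative[of D] D by (auto simp: L2_UNIV_iff)
  define w where "w i x = v' x $ i" for i x
  define E where "E i j x = D' x $ i $ j" for i j x
  have wm [measurable]: "w i \<in> borel_measurable borel" for i
    unfolding w_def[abs_def] by (intro borel_measurable_continuous_on[OF _ v'(1)] continuous_intros)
  have Em [measurable]: "E i j \<in> borel_measurable borel" for i j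
    unfolding E_def[abs_def] by (intro borel_measurable_continuous_on[OF _ D'(1)] continuous_intros)
  have vw: "AE x in lebesgue. \<forall>i. v x $ i = w i x" using v'(2) by eventually_elim (simp add: w_def)
  have DE: "AE x in lebesgue. \<forall>i j. D x $ i $ j = E i j x" using D'(2) by eventually_elim (simp add: E_def)
  have pm: "pd i \<psi> \<in> borel_measurable borel" "\<psi> \<in> borel_measurable borel" if "smooth_on UNIV \<psi>" for i and \<psi> :: "real^'n \<Rightarrow> real"
    using pd_smooth[OF that] that smooth_on_continuous_on borel_measurable_continuous_onI by blast+
  show ?thesis
  proof (rule exI[of _ w], rule exI[of _ E], intro conjI allI impI vw DE)
    show "square_integrable (w i)" for i
      by (rule square_integrable_bounded_by_L2[OF v wm])
         (use v'(2) in eventually_elim, simp add: w_def component_le_norm_cart)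
    show "square_integrable (E i j)" for i j
      by (rule square_integrable_bounded_by_L2[OF D Em])
         (use D'(2) in eventually_elim, simp add: E_def abs_matrix_component_le_norm)
    have "(LINT x|lborel. E i j x * \<psi> x) = - (LINT x|lborel. (w i x * pd j \<psi> x + w j x * pd i \<psi> x) / 2)"
      if \<psi>: "smooth_on UNIV \<psi>" "ball_supported r \<psi>" for \<psi> r i j
    proof -
      note [measurable] = pm[OF \<psi>(1)]
      have "(LINT x|lborel. E i j x * \<psi> x) = (LINT x|lebesgue. D x $ i $ j * \<psi> x)"
        by (rule lebesgue_AE_borel(3)[symmetric]) (measurable, use DE in eventually_elim, simp)
      moreover have "(LINT x|lborel. (w i x * pd j \<psi> x + w j x * pd i \<psi> x) / 2)
        = (LINT x|lebesgue. (v x $ i * grad \<psi> x $ j + v x $ j * grad \<psi> x $ i) / 2)"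
        by (rule lebesgue_AE_borel(3)[symmetric]) (measurable, use vw in eventually_elim, simp add: pd_grad)
      ultimately show ?thesis
        using vD test_function_ball_supported[OF \<psi>] by (simp add: weak_sym_grad_def set_lebesgue_integral_def)
    qed
    then show "weak_sym_grad_family w E" unfolding weak_sym_grad_family_def by blast
    have "(LINT x|lborel. (\<Sum>i\<in>UNIV. w i x * pd i \<psi> x)) = 0"
      if "weakly_div_free UNIV v" and \<psi>: "smooth_on UNIV \<psi>" "ball_supported r \<psi>" for \<psi> r
    proof -
      note [measurable] = pm[OF \<psi>(1)]
      have "(LINT x|lborel. (\<Sum>i\<in>UNIV. w i x * pd i \<psi> x)) = (LINT x|lebesgue. v x \<bullet> grad \<psi> x)"
        by (rule lebesgue_AE_borel(3)[symmetric]) (measurable, use vw in eventually_elim, simp add: inner_vec_def pd_grad)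
      then show ?thesis
        using that(1) test_function_ball_supported[OF \<psi>] by (simp add: weakly_div_free_def set_lebesgue_integral_def)
    qed
    then show "weak_div_free_family w" if "weakly_div_free UNIV v" using that unfolding weak_div_free_family_def by blast
  qed
qed

text \<open>Testing a weak identity with \<open>\<lambda>y. k (x - y)\<close> turns it into a
  pointwise identity at x for the mollified functions. The reflection changes the sign of each
  derivative and so cancels the sign in the weak identity.\<close>

lemma reflected_kernel:
  fixes k :: "real^'n \<Rightarrow> real"
  assumes "smooth_on UNIV k" "ball_supported r k"
  shows "smooth_on UNIV (\<lambda>y. k (x - y))" "ball_supported (norm x + r) (\<lambda>y. k (x - y))"
    "pd j (\<lambda>y. k (x - y)) y = - pd j k (x - y)"
proof -
  show "smooth_on UNIV (\<lambda>y. k (x - y))"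
    by (rule smooth_on_compose_UNIV[OF _ assms(1)]) (intro smooth_on_diff smooth_on_const smooth_on_id open_UNIV)
  show "ball_supported (norm x + r) (\<lambda>y. k (x - y))"
    unfolding ball_supported_def
  proof safe
    fix z :: "real^'n" assume "norm x + r < norm z"
    then have "r < norm (x - z)" using norm_triangle_ineq2[of z x] by (simp add: norm_minus_commute)
    then show "k (x - z) = 0" using assms(2) by (simp add: ball_supported_def)
  qed
  have d: "((\<lambda>y. x - y) has_derivative (\<lambda>h. - h)) (at y)" by (auto intro!: derivative_eq_intros)
  have l: "linear (frechet_derivative k (at (x - y)))"
    using smooth_has_derivative_pd[OF assms(1)] has_derivative_linear by blast
  have "((\<lambda>y. k (x - y)) has_derivative (\<lambda>h. frechet_derivative k (at (x - y)) (- h))) (at y)"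
    by (rule has_derivative_compose[OF d smooth_has_derivative_pd[OF assms(1)]])
  from pd_eqI[OF this] show "pd j (\<lambda>y. k (x - y)) y = - pd j k (x - y)"
    by (simp add: pd_def linear_neg[OF l])
qed

lemma pd_conv:
  assumes "smooth_on UNIV k" "ball_supported r k" "square_integrable f"
  shows "pd j (conv k f) x = conv (pd j k) f x"
  using pd_eqI[OF conv_has_derivative[OF assms(1,2)]] locally_integrable_L2 assms(3)
  by (auto simp: square_integrable_def pd_def[abs_def])

lemma pd_conv_sym:
  fixes w :: "'n::finite \<Rightarrow> real^'n \<Rightarrow> real"
  assumes k: "smooth_on UNIV k" "ball_supported r k"
    and w: "\<And>i. square_integrable (w i)" and E: "\<And>i j. square_integrable (E i j)"
    and wE: "weak_sym_grad_family w E"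
  shows "pd j (conv k (w i)) x + pd i (conv k (w j)) x = 2 * conv k (E i j) x"
proof -
  have li: "locally_integrable (w i)" for i using locally_integrable_L2 w by (auto simp: square_integrable_def)
  have ci: "integrable lborel (\<lambda>y. w i y * pd j k (x - y))" for i j
    using conv_integrable[OF smooth_on_continuous_on[OF pd_smooth[OF k(1)]] pd_ball_supported[OF k(2)] li[of i], of _ x]
    by (simp add: mult.commute)
  have "conv k (E i j) x = (LINT y|lborel. E i j y * k (x - y))" by (simp add: conv_def mult.commute)
  also have "\<dots> = - (LINT y|lborel. (w i y * - pd j k (x - y) + w j y * - pd i k (x - y)) / 2)"
    using weak_sym_grad_familyD[OF wE reflected_kernel(1,2)[OF k, of x]] by (simp add: reflected_kernel(3)[OF k])
  also have "\<dots> = ((LINT y|lborel. w i y * pd j k (x - y)) + (LINT y|lborel. w j y * pd i k (x - y))) / 2"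
    using ci by (simp add: field_simps)
  finally show ?thesis
    by (simp add: pd_conv[OF k w] conv_def mult.commute)
qed

lemma sum_pd_conv:
  fixes w :: "'n::finite \<Rightarrow> real^'n \<Rightarrow> real"
  assumes k: "smooth_on UNIV k" "ball_supported r k" and w: "\<And>i. square_integrable (w i)"
    and dw: "weak_div_free_family w"
  shows "(\<Sum>i\<in>UNIV. pd i (conv k (w i)) x) = 0"
proof -
  have li: "locally_integrable (w i)" for i using locally_integrable_L2 w by (auto simp: square_integrable_def)
  have ci: "integrable lborel (\<lambda>y. w i y * pd j k (x - y))" for i j
    using conv_integrable[OF smooth_on_continuous_on[OF pd_smooth[OF k(1)]] pd_ball_supported[OF k(2)] li[of i], of _ x]
    by (simp add: mult.commute)
  have "0 = (LINT y|lborel. (\<Sum>i\<in>UNIV. w i y * - pd i k (x - y)))"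
    using weak_div_free_familyD[OF dw reflected_kernel(1,2)[OF k, of x]] by (simp add: reflected_kernel(3)[OF k])
  also have "\<dots> = - (\<Sum>i\<in>UNIV. (LINT y|lborel. w i y * pd i k (x - y)))"
    using ci by (simp add: Bochner_Integration.integral_sum sum_negf)
  finally show ?thesis by (simp add: pd_conv[OF k w] conv_def mult.commute)
qed

section \<open>Convection and transport through the symmetric gradient\<close>

lemma smooth_on_vec_nth: "smooth_on UNIV W \<Longrightarrow> smooth_on UNIV (\<lambda>x. W x $ i)"
  by (rule smooth_on_linear[OF open_UNIV bounded_linear_vec_nth])

lemma pd_vec_nth:
  assumes "smooth_on UNIV W"
  shows "pd j (\<lambda>x. W x $ i) x = frechet_derivative W (at x) (axis j 1) $ i"
  using pd_eqI[OF bounded_linear.has_derivative[OF bounded_linear_vec_nth smooth_on_has_derivative[OF assms UNIV_I]]] .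

lemma frechet_derivative_vec_nth:
  fixes W :: "real^'n \<Rightarrow> real^'m"
  assumes "smooth_on UNIV W"
  shows "frechet_derivative W (at x) y $ i = (\<Sum>j\<in>UNIV. y $ j * pd j (\<lambda>x. W x $ i) x)"
proof -
  have l: "linear (frechet_derivative W (at x))"
    using smooth_on_has_derivative[OF assms UNIV_I] has_derivative_linear by blast
  have "y = (\<Sum>j\<in>UNIV. y $ j *\<^sub>R axis j 1)" by (simp add: vec_eq_iff axis_def if_distrib cong: if_cong)
  then have "frechet_derivative W (at x) y = (\<Sum>j\<in>UNIV. y $ j *\<^sub>R frechet_derivative W (at x) (axis j 1))"
    by (metis (no_types, lifting) linear_sum[OF l] linear_cmul[OF l] sum.cong)
  then show ?thesis by (simp add: pd_vec_nth[OF assms])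
qed

lemma divergence_eq_sum_pd:
  assumes "smooth_on UNIV W"
  shows "divergence W x = (\<Sum>i\<in>UNIV. pd i (\<lambda>x. W x $ i) x)"
  by (simp add: divergence_def trace_def jacobian_def matrix_def pd_vec_nth[OF assms])

lemma bounded_measurable_ball_supported:
  assumes "smooth_on UNIV k" "ball_supported r k"
  obtains B where "k \<in> borel_measurable borel" "\<And>x. \<bar>k x\<bar> \<le> (B::real)"
  using ball_supported_bounded[OF smooth_on_continuous_on[OF assms(1)] assms(2)]
    borel_measurable_continuous_onI[OF smooth_on_continuous_on[OF assms(1)]] by (metis real_norm_def)

lemma conv_smooth_square_integrable:
  "smooth_on UNIV k \<Longrightarrow> ball_supported r k \<Longrightarrow> square_integrable f \<Longrightarrow> smooth_on UNIV (conv k f)"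
  using conv_smooth locally_integrable_L2 by (auto simp: square_integrable_def)

text \<open>The product rule behind the identity applies to smooth fields, so the field is mollified
  first. Convergence of velocity and symmetric gradient in L2 suffices for the limit, since every
  integrand is a product of two of their entries and a bounded function coming from
  \<open>W\<close>.\<close>

theorem integral_convection:
  fixes v W :: "real^'n \<Rightarrow> real^'n"
  assumes v: "L2 UNIV v" "L2 UNIV D" "weak_sym_grad UNIV v D" "weakly_div_free UNIV v"
    and W: "smooth_on UNIV W" "ball_supported r W" "\<And>x. divergence W x = 0"
  shows "(LINT x|lebesgue. v x \<bullet> frechet_derivative W (at x) (v x)) = - 2 * (LINT x|lebesgue. W x \<bullet> (D x *v v x))"
proof -
  obtain w E where
    ae: "AE x in lebesgue. \<forall>i. v x $ i = w i x" "AE x in lebesgue. \<forall>i j. D x $ i $ j = E i j x"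
    and sq: "\<And>i. square_integrable (w i)" "\<And>i j. square_integrable (E i j)"
    and wE: "weak_sym_grad_family w E"
    and dw: "weak_div_free_family w"
    using weak_sym_grad_representative[OF v(1-3)] v(4) by blast
  define U where "U i x = W x $ i" for i x
  have U: "smooth_on UNIV (U i)" "ball_supported r (U i)" for i
    using smooth_on_vec_nth[OF W(1)] W(2) by (auto simp: U_def[abs_def] ball_supported_def)
  have dU: "(\<Sum>i\<in>UNIV. pd i (U i) x) = 0" for x
    using W(3)[of x] by (simp add: divergence_eq_sum_pd[OF W(1)] U_def[abs_def])
  have "\<exists>B. U i \<in> borel_measurable borel \<and> (\<forall>x. \<bar>U i x\<bar> \<le> B)" for i
    using bounded_measurable_ball_supported[OF U] by metis
  then obtain B where B: "\<And>i. U i \<in> borel_measurable borel" "\<And>i x. \<bar>U i x\<bar> \<le> B i" by metis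
  have B'1: "pd j (U i) \<in> borel_measurable borel" for i j
    using borel_measurable_continuous_onI[OF smooth_on_continuous_on[OF pd_smooth[OF U(1)]]] .
  have "\<exists>B. \<forall>x. \<bar>pd j (U i) x\<bar> \<le> B" for i j
    using bounded_measurable_ball_supported[OF pd_smooth[OF U(1)] pd_ball_supported[OF U(2)]] by metis
  then have "\<forall>i j. \<exists>B. \<forall>x. \<bar>pd j (U i) x\<bar> \<le> B" by blast
  then obtain B' where B'2: "\<And>i j x. \<bar>pd j (U i) x\<bar> \<le> B' i j" by metis
  note B' = B'1 B'2
  \<comment> \<open>A sum type indexes the entries of \<open>w\<close> and of \<open>E\<close>
    together, so that a single sequence of kernels mollifies both.\<close>
  obtain k r' where k: "\<And>n. smooth_on UNIV (k n)" "\<And>n. ball_supported (r' n) (k n)"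
    and ksq: "\<And>n z. square_integrable (conv (k n) (case_sum w (case_prod E) z))"
    and klim: "\<And>z. (\<lambda>n. L2_dist (conv (k n) (case_sum w (case_prod E) z)) (case_sum w (case_prod E) z)) \<longlonglongrightarrow> 0"
    by (rule common_mollifiers[of "case_sum w (case_prod E)"]) (use sq in \<open>auto split: sum.split\<close>)
  have kw: "square_integrable (conv (k n) (w i))" "(\<lambda>n. L2_dist (conv (k n) (w i)) (w i)) \<longlonglongrightarrow> 0" for n i
    using ksq[of n "Inl i"] klim[of "Inl i"] by simp_all
  have kE: "square_integrable (conv (k n) (E i j))" "(\<lambda>n. L2_dist (conv (k n) (E i j)) (E i j)) \<longlonglongrightarrow> 0" for n i j
    using ksq[of n "Inr (i, j)"] klim[of "Inr (i, j)"] by simp_all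
  define T where "T a e = (LINT x|lborel. (\<Sum>i\<in>UNIV. \<Sum>j\<in>UNIV. a i x * a j x * pd j (U i) x + 2 * (e i j x * a j x * U i x)))"
    for a :: "'n \<Rightarrow> real^'n \<Rightarrow> real" and e :: "'n \<Rightarrow> 'n \<Rightarrow> real^'n \<Rightarrow> real"
  have T_eq: "T a e = (\<Sum>i\<in>UNIV. \<Sum>j\<in>UNIV. (LINT x|lborel. a i x * a j x * pd j (U i) x) + 2 * (LINT x|lborel. e i j x * a j x * U i x))"
    if "\<And>i. square_integrable (a i)" "\<And>i j. square_integrable (e i j)" for a e
    unfolding T_def
    by (simp add: Bochner_Integration.integral_sum square_integrable_bounded_smooth_mult[OF _ _ B'] square_integrable_bounded_smooth_mult[OF _ _ B] that)
  have T0: "T (\<lambda>i. conv (k n) (w i)) (\<lambda>i j. conv (k n) (E i j)) = 0" for n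
    unfolding T_def
    by (rule smooth_symmetric_gradient_identity[OF conv_smooth_square_integrable[OF k sq(1)] U
        pd_conv_sym[OF k sq wE] sum_pd_conv[OF k sq(1) dw] dU])
  have "(\<lambda>n. T (\<lambda>i. conv (k n) (w i)) (\<lambda>i j. conv (k n) (E i j))) \<longlonglongrightarrow> T w E"
    unfolding T_eq[OF sq] T_eq[OF kw(1) kE(1)]
    by (intro tendsto_intros integral_mult_tendsto[OF kw(1) sq(1) kw(2) kw(1) sq(1) kw(2) B']
        integral_mult_tendsto[OF kE(1) sq(2) kE(2) kw(1) sq(1) kw(2) B])
  then have TwE: "T w E = 0" unfolding T0 using LIMSEQ_unique tendsto_const by metis
  note [measurable] = B(1) B'(1)
  have [measurable]: "w i \<in> borel_measurable borel" "E i j \<in> borel_measurable borel" for i j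
    using sq by (auto simp: square_integrable_def)
  have L: "(LINT x|lebesgue. v x \<bullet> frechet_derivative W (at x) (v x)) = (LINT x|lborel. (\<Sum>i\<in>UNIV. \<Sum>j\<in>UNIV. w i x * w j x * pd j (U i) x))"
    by (rule lebesgue_AE_borel(3)) (measurable, use ae(1) in eventually_elim,
       simp add: inner_vec_def frechet_derivative_vec_nth[OF W(1)] U_def[abs_def] sum_distrib_left mult.assoc)
  have R: "(LINT x|lebesgue. W x \<bullet> (D x *v v x)) = (LINT x|lborel. (\<Sum>i\<in>UNIV. \<Sum>j\<in>UNIV. E i j x * w j x * U i x))"
    by (rule lebesgue_AE_borel(3)) (measurable, use ae in eventually_elim,
       simp add: inner_vec_def matrix_vector_mult_def U_def[abs_def] sum_distrib_left mult_ac)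
  have "T w E = (LINT x|lborel. (\<Sum>i\<in>UNIV. \<Sum>j\<in>UNIV. w i x * w j x * pd j (U i) x))
     + 2 * (LINT x|lborel. (\<Sum>i\<in>UNIV. \<Sum>j\<in>UNIV. E i j x * w j x * U i x))"
    unfolding T_eq[OF sq]
    by (simp add: Bochner_Integration.integral_sum square_integrable_bounded_smooth_mult[OF _ _ B'] square_integrable_bounded_smooth_mult[OF _ _ B] sq
        sum.distrib sum_distrib_left)
  then show ?thesis using TwE L R by simp
qed

text \<open>The identity is linear in \<open>v\<close>, so the weak definition applies directly with
  the components of \<open>W\<close> as test functions. One half of the symmetric gradient gives the
  left-hand side; the other contains the divergence of \<open>W\<close> as a factor.\<close>

theorem integral_transport:
  fixes v W :: "real^'n \<Rightarrow> real^'n"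
  assumes v: "L2 UNIV v" "L2 UNIV D" "weak_sym_grad UNIV v D"
    and W: "smooth_on UNIV W" "ball_supported r W" "\<And>x. divergence W x = 0"
  shows "(LINT x|lebesgue. v x \<bullet> frechet_derivative W (at x) p) = - 2 * (LINT x|lebesgue. W x \<bullet> (D x *v p))"
proof -
  obtain w E where
    ae: "AE x in lebesgue. \<forall>i. v x $ i = w i x" "AE x in lebesgue. \<forall>i j. D x $ i $ j = E i j x"
    and sq: "\<And>i. square_integrable (w i)" "\<And>i j. square_integrable (E i j)"
    and wE: "weak_sym_grad_family w E"
    using weak_sym_grad_representative[OF v] by blast
  define U where "U i x = W x $ i" for i x
  have U: "smooth_on UNIV (U i)" "ball_supported r (U i)" for i
    using smooth_on_vec_nth[OF W(1)] W(2) by (auto simp: U_def[abs_def] ball_supported_def)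
  have dU: "(\<Sum>i\<in>UNIV. pd i (U i) x) = 0" for x
    using W(3)[of x] by (simp add: divergence_eq_sum_pd[OF W(1)] U_def[abs_def])
  have [measurable]: "w i \<in> borel_measurable borel" "E i j \<in> borel_measurable borel"
     "U i \<in> borel_measurable borel" "pd j (U i) \<in> borel_measurable borel" for i j
    using sq borel_measurable_continuous_onI[OF smooth_on_continuous_on[OF U(1)]]
      borel_measurable_continuous_onI[OF smooth_on_continuous_on[OF pd_smooth[OF U(1)]]]
    by (auto simp: square_integrable_def)
  have i: "integrable lborel (\<lambda>x. f x * g x)" if f: "square_integrable f" and g: "smooth_on UNIV g" "ball_supported r' g" for r' and f g :: "real^'n \<Rightarrow> real"
  proof -
    have "integrable lborel (\<lambda>x. (g x)\<^sup>2)"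
      using g(2) by (intro ball_supported_integrable[of _ r'] continuous_intros smooth_on_continuous_on g(1)) (simp add: ball_supported_def)
    then show ?thesis
      using f borel_measurable_continuous_onI[OF smooth_on_continuous_on[OF g(1)]]
      by (intro integrable_mult_L2) (auto simp: square_integrable_def)
  qed
  have L: "(LINT x|lebesgue. v x \<bullet> frechet_derivative W (at x) p) = (LINT x|lborel. (\<Sum>i\<in>UNIV. \<Sum>j\<in>UNIV. p $ j * (w i x * pd j (U i) x)))"
    by (rule lebesgue_AE_borel(3)) (measurable, use ae(1) in eventually_elim,
       simp add: inner_vec_def frechet_derivative_vec_nth[OF W(1)] U_def[abs_def] sum_distrib_left mult_ac)
  have R: "(LINT x|lebesgue. W x \<bullet> (D x *v p)) = (LINT x|lborel. (\<Sum>i\<in>UNIV. \<Sum>j\<in>UNIV. p $ j * (E i j x * U i x)))"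
    by (rule lebesgue_AE_borel(3)) (measurable, use ae in eventually_elim,
       simp add: inner_vec_def matrix_vector_mult_def U_def[abs_def] sum_distrib_left mult_ac)
  have e: "(LINT x|lborel. E i j x * U i x) = - ((LINT x|lborel. w i x * pd j (U i) x) + (LINT x|lborel. w j x * pd i (U i) x)) / 2" for i j
    using weak_sym_grad_familyD[OF wE U] i[OF sq(1) pd_smooth[OF U(1)] pd_ball_supported[OF U(2)]] by (simp add: field_simps)
  have z: "(\<Sum>i\<in>UNIV. (LINT x|lborel. w j x * pd i (U i) x)) = 0" for j
  proof -
    have "(LINT x|lborel. w j x * (\<Sum>i\<in>UNIV. pd i (U i) x)) = (\<Sum>i\<in>UNIV. (LINT x|lborel. w j x * pd i (U i) x))"
      using i[OF sq(1) pd_smooth[OF U(1)] pd_ball_supported[OF U(2)]]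
      by (simp add: Bochner_Integration.integral_sum sum_distrib_left)
    then show ?thesis by (simp add: dU)
  qed
  have "(LINT x|lborel. (\<Sum>i\<in>UNIV. \<Sum>j\<in>UNIV. p $ j * (E i j x * U i x))) = (\<Sum>i\<in>UNIV. \<Sum>j\<in>UNIV. p $ j * (LINT x|lborel. E i j x * U i x))"
    using i[OF sq(2) U] by (simp add: Bochner_Integration.integral_sum)
  also have "\<dots> = - (\<Sum>i\<in>UNIV. \<Sum>j\<in>UNIV. p $ j * (LINT x|lborel. w i x * pd j (U i) x)) / 2
      - (\<Sum>j\<in>UNIV. p $ j * (\<Sum>i\<in>UNIV. (LINT x|lborel. w j x * pd i (U i) x))) / 2"
  proof -
    have split: "p * (- (A + B) / 2) = - (p * A) / 2 - p * B / 2" for p A B :: real by (simp add: field_simps)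
    have sw: "(\<Sum>j\<in>UNIV. p $ j * (\<Sum>i\<in>UNIV. (LINT x|lborel. w j x * pd i (U i) x))) = (\<Sum>i\<in>UNIV. \<Sum>j\<in>UNIV. p $ j * (LINT x|lborel. w j x * pd i (U i) x))"
      unfolding sum_distrib_left by (rule sum.swap)
    have "(\<Sum>i\<in>UNIV. \<Sum>j\<in>UNIV. p $ j * (LINT x|lborel. E i j x * U i x))
      = (\<Sum>i\<in>UNIV. \<Sum>j\<in>UNIV. - (p $ j * (LINT x|lborel. w i x * pd j (U i) x)) / 2 - p $ j * (LINT x|lborel. w j x * pd i (U i) x) / 2)"
      by (intro sum.cong refl) (simp only: e split)
    also have "\<dots> = (\<Sum>i\<in>UNIV. \<Sum>j\<in>UNIV. - (p $ j * (LINT x|lborel. w i x * pd j (U i) x))) / 2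
        - (\<Sum>i\<in>UNIV. \<Sum>j\<in>UNIV. p $ j * (LINT x|lborel. w j x * pd i (U i) x)) / 2"
      by (simp only: sum_subtractf sum_divide_distrib)
    finally show ?thesis unfolding sw by (simp only: sum_negf)
  qed
  also have "(\<Sum>i\<in>UNIV. \<Sum>j\<in>UNIV. p $ j * (LINT x|lborel. w i x * pd j (U i) x)) = (LINT x|lborel. (\<Sum>i\<in>UNIV. \<Sum>j\<in>UNIV. p $ j * (w i x * pd j (U i) x)))"
    using i[OF sq(1) pd_smooth[OF U(1)] pd_ball_supported[OF U(2)]] by (simp add: Bochner_Integration.integral_sum)
  finally show ?thesis unfolding L R by (simp add: z)
qed

section \<open>An L2 estimate on slabs\<close>

lemma smooth_arctan: "smooth_on UNIV arctan"
proof -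
  have s: "smooth_on UNIV (\<lambda>x::real. inverse (1 + x\<^sup>2))"
    by (rule smooth_on_compose[where V = "{0<..}" and g = inverse])
       (use Ck_on_inverse in \<open>auto intro!: smooth_on_add smooth_on_const smooth_on_power2 smooth_on_id
          simp: smooth_on_def[of "{0<..}"] add_pos_nonneg\<close>)
  have d: "(arctan has_derivative (\<lambda>v. inverse (1 + x\<^sup>2) * v)) (at x)" for x
    using DERIV_arctan[of x] by (simp add: has_field_derivative_def)
  have "Ck_on k UNIV arctan" for k
  proof (cases k)
    case 0 then show ?thesis by (simp add: continuous_on_arctan)
  next
    case (Suc j)
    show ?thesis unfolding Suc
      by (rule Ck_on_SucI[OF open_UNIV d])
        (use s in \<open>auto intro!: Ck_on_bilinear[OF _ bounded_bilinear_mult] Ck_on_const simp: smooth_on_def\<close>)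
  qed
  then show ?thesis by (simp add: smooth_on_def)
qed

text \<open>Composing with \<open>x \<bullet> x\<close> instead of the norm keeps the function
  smooth at the origin. It vanishes from |x|^2 = 2 on, hence beyond radius 3/2; as 3/2 < 2, the
  transition zones at dyadic scales are disjoint.\<close>

definition cutoff :: "'a::euclidean_space \<Rightarrow> real" where
  "cutoff x = 1 - smooth_step (x \<bullet> x - 1)"

lemma cutoff_smooth: "smooth_on UNIV cutoff"
  unfolding cutoff_def[abs_def]
  by (intro smooth_on_diff smooth_on_const smooth_on_compose_UNIV[OF _ smooth_step_smooth] smooth_on_inner smooth_on_id open_UNIV)

lemma cutoff_1: "norm x \<le> 1 \<Longrightarrow> cutoff x = 1"
  by (simp add: cutoff_def smooth_step_0 dot_square_norm power_le_one)

lemma cutoff_0: "3/2 \<le> norm x \<Longrightarrow> cutoff x = 0"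
proof -
  assume "3/2 \<le> norm x"
  then have "(3/2)\<^sup>2 \<le> (norm x)\<^sup>2" by (rule power_mono) simp
  then show ?thesis by (simp add: cutoff_def smooth_step_1 dot_square_norm power2_eq_square)
qed

lemma cutoff_range: "0 \<le> cutoff x" "cutoff x \<le> 1"
  using smooth_step_range[of "x \<bullet> x - 1"] by (auto simp: cutoff_def)

lemma cutoff_ball_supported: "ball_supported (3/2) cutoff"
  unfolding ball_supported_def by (intro allI impI cutoff_0) simp

text \<open>The weight \<open>R arctan ((x\<^sub>i - a) / R)\<close> is bounded by a multiple of \<open>R\<close> while its derivative
  is at least \<open>1/2\<close> on the slab; this replaces integration along lines.\<close>

theorem slab_estimate:
  fixes v :: "real^'n \<Rightarrow> real^'n"
  assumes v: "L2 UNIV v" "L2 UNIV D" "weak_sym_grad UNIV v D" and R: "R > 0"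
  shows "(LINT x|lebesgue. indicator {x. \<bar>x $ i - a\<bar> \<le> R} x * (v x $ i)\<^sup>2)
     \<le> 2 * pi * R * (LINT x|lebesgue. \<bar>v x $ i\<bar> * \<bar>D x $ i $ i\<bar>)"
proof -
  obtain w E where
    ae: "AE x in lebesgue. \<forall>i. v x $ i = w i x" "AE x in lebesgue. \<forall>i j. D x $ i $ j = E i j x"
    and sq: "\<And>i. square_integrable (w i)" "\<And>i j. square_integrable (E i j)"
    and wE: "weak_sym_grad_family w E"
    using weak_sym_grad_representative[OF v] by blast
  obtain k r' where k: "\<And>n. smooth_on UNIV (k n)" "\<And>n. ball_supported (r' n) (k n)"
    and ksq: "\<And>n z. square_integrable (conv (k n) ((if z then w i else E i i)))"
    and klim: "\<And>z. (\<lambda>n. L2_dist (conv (k n) (if z then w i else E i i)) (if z then w i else E i i)) \<longlonglongrightarrow> 0"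
    by (rule common_mollifiers[of "\<lambda>z. if z then w i else E i i"]) (use sq in auto)
  have kw: "square_integrable (conv (k n) (w i))" "(\<lambda>n. L2_dist (conv (k n) (w i)) (w i)) \<longlonglongrightarrow> 0" for n
    using ksq[of n True] klim[of True] by simp_all
  have kE: "square_integrable (conv (k n) (E i i))" "(\<lambda>n. L2_dist (conv (k n) (E i i)) (E i i)) \<longlonglongrightarrow> 0" for n
    using ksq[of n False] klim[of False] by simp_all
  \<comment> \<open>Only the diagonal entry is involved, and it is the weak derivative of
    \<open>w i\<close> in direction i. The mollified functions satisfy the product rule for the
    square, and the limit gives it for \<open>w i\<close>.\<close>
  have parts: "(LINT x|lborel. w i x * w i x * pd i \<psi> x) = - 2 * (LINT x|lborel. w i x * E i i x * \<psi> x)"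
    if \<psi>: "smooth_on UNIV \<psi>" "ball_supported r \<psi>" for \<psi> r
  proof -
    obtain B where B: "\<psi> \<in> borel_measurable borel" "\<And>x. \<bar>\<psi> x\<bar> \<le> B"
      by (rule bounded_measurable_ball_supported[OF \<psi>]) blast
    obtain B' where B': "pd i \<psi> \<in> borel_measurable borel" "\<And>x. \<bar>pd i \<psi> x\<bar> \<le> B'"
      by (rule bounded_measurable_ball_supported[OF pd_smooth[OF \<psi>(1)] pd_ball_supported[OF \<psi>(2)]]) blast
    have e0: "(LINT x|lborel. conv (k n) (w i) x * conv (k n) (w i) x * pd i \<psi> x)
        + 2 * (LINT x|lborel. conv (k n) (w i) x * conv (k n) (E i i) x * \<psi> x) = 0" for n
    proof -
      have "pd i (conv (k n) (w i)) x = conv (k n) (E i i) x" for x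
        using pd_conv_sym[OF k(1)[of n] k(2)[of n] sq wE, where i = i and j = i and x = x] by simp
      then show ?thesis
        using smooth_square_identity[OF conv_smooth_square_integrable[OF k(1)[of n] k(2)[of n] sq(1)[of i]] \<psi>, of i]
          square_integrable_bounded_smooth_mult[OF kw(1)[of n] kw(1)[of n] B']
          square_integrable_bounded_smooth_mult[OF kw(1)[of n] kE(1)[of n] B] by simp
    qed
    have lim: "(\<lambda>n. (LINT x|lborel. conv (k n) (w i) x * conv (k n) (w i) x * pd i \<psi> x)
        + 2 * (LINT x|lborel. conv (k n) (w i) x * conv (k n) (E i i) x * \<psi> x)) \<longlonglongrightarrow>
        (LINT x|lborel. w i x * w i x * pd i \<psi> x) + 2 * (LINT x|lborel. w i x * E i i x * \<psi> x)"
      by (intro tendsto_intros integral_mult_tendsto[OF kw(1) sq(1) kw(2) kw(1) sq(1) kw(2) B']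
          integral_mult_tendsto[OF kw(1) sq(1) kw(2) kE(1) sq(2) kE(2) B])
    have "(LINT x|lborel. w i x * w i x * pd i \<psi> x) + 2 * (LINT x|lborel. w i x * E i i x * \<psi> x) = 0"
      using LIMSEQ_unique[OF lim[unfolded e0] tendsto_const] by simp
    then show ?thesis by simp
  qed
  define \<theta> where "\<theta> x = R * arctan ((x $ i - a) / R)" for x :: "real^'n"
  define \<theta>' where "\<theta>' x = inverse (1 + ((x $ i - a) / R)\<^sup>2)" for x :: "real^'n"
  have \<theta>s: "smooth_on UNIV \<theta>"
  proof -
    have "smooth_on UNIV (\<lambda>x::real^'n. inverse R * (x $ i - a))"
      by (intro smooth_on_mult smooth_on_diff smooth_on_const smooth_on_vec_nth smooth_on_id open_UNIV)
    from smooth_on_mult[OF open_UNIV smooth_on_const smooth_on_compose_UNIV[OF this smooth_arctan]]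
    show ?thesis by (simp add: \<theta>_def[abs_def] field_simps)
  qed
  have pd\<theta>: "pd i \<theta> x = \<theta>' x" for x
  proof -
    have "((\<lambda>x. inverse R * (x $ i - a)) has_derivative (\<lambda>h. inverse R * (h $ i - 0))) (at x)"
      by (intro has_derivative_mult_right has_derivative_diff has_derivative_const bounded_linear_imp_has_derivative bounded_linear_vec_nth)
    then have g: "((\<lambda>x. (x $ i - a) / R) has_derivative (\<lambda>h. h $ i / R)) (at x)"
      by (simp add: divide_inverse mult.commute)
    have "(arctan has_derivative (\<lambda>v. inverse (1 + y\<^sup>2) * v)) (at y)" for y
      using DERIV_arctan[of y] by (simp add: has_field_derivative_def)
    from pd_eqI[OF has_derivative_mult_right[OF has_derivative_compose[OF g this]], of i R] show ?thesis
      using R by (simp add: \<theta>_def[abs_def] \<theta>'_def)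
  qed
  have \<theta>b: "\<bar>\<theta> x\<bar> \<le> R * (pi / 2)" for x
    using R arctan_bounded[of "(x $ i - a) / R"] by (auto simp: \<theta>_def abs_mult intro!: mult_left_mono)
  have \<theta>'b: "0 \<le> \<theta>' x" "\<theta>' x \<le> 1" for x by (auto simp: \<theta>'_def intro!: inverse_le_1_iff[THEN iffD2])
  \<comment> \<open>The arctan weight does not have compact support. Its truncation at a radius of
    order n produces a term with \<open>pd i (\<zeta> n)\<close>, of order 1/n, which disappears by
    dominated convergence because the weight is bounded and \<open>w i\<close> is square
    integrable.\<close>
  define \<zeta> where "\<zeta> n x = cutoff (inverse (real (Suc n)) *\<^sub>R x)" for n and x :: "real^'n"
  have \<zeta>s: "smooth_on UNIV (\<zeta> n)" for n
    unfolding \<zeta>_def[abs_def]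
    by (rule smooth_on_compose_UNIV[OF _ cutoff_smooth]) (intro smooth_on_scaleR smooth_on_const smooth_on_id open_UNIV)
  have \<zeta>b: "ball_supported (2 * real (Suc n)) (\<zeta> n)" for n
    unfolding ball_supported_def \<zeta>_def
    by (auto intro!: cutoff_0 simp: field_simps simp del: of_nat_Suc)
  have pd\<zeta>: "pd i (\<zeta> n) x = inverse (real (Suc n)) * pd i cutoff (inverse (real (Suc n)) *\<^sub>R x)" for n x
  proof -
    have l: "linear (frechet_derivative cutoff (at y))" for y :: "real^'n"
      using smooth_has_derivative_pd[OF cutoff_smooth] has_derivative_linear by blast
    have "(\<zeta> n has_derivative (\<lambda>h. frechet_derivative cutoff (at (inverse (real (Suc n)) *\<^sub>R x)) (inverse (real (Suc n)) *\<^sub>R h))) (at x)"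
      unfolding \<zeta>_def[abs_def]
      by (rule has_derivative_compose[OF _ smooth_has_derivative_pd[OF cutoff_smooth]]) (auto intro!: derivative_eq_intros)
    from pd_eqI[OF this] show ?thesis by (simp add: pd_def linear_cmul[OF l])
  qed
  obtain B where B: "pd i cutoff \<in> borel_measurable borel" "\<And>x::real^'n. \<bar>pd i cutoff x\<bar> \<le> B"
    by (rule bounded_measurable_ball_supported[OF pd_smooth[OF cutoff_smooth] pd_ball_supported[OF cutoff_ball_supported]]) blast
  have B0: "B \<ge> 0" using B(2)[of 0] by linarith
  have [measurable]: "w i \<in> borel_measurable borel" "E i i \<in> borel_measurable borel"
    using sq by (auto simp: square_integrable_def)
  have [measurable]: "\<theta> \<in> borel_measurable borel" "\<theta>' \<in> borel_measurable borel" "\<zeta> n \<in> borel_measurable borel" "pd i (\<zeta> n) \<in> borel_measurable borel" for n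
    using borel_measurable_continuous_onI[OF smooth_on_continuous_on[OF \<theta>s]]
      borel_measurable_continuous_onI[OF smooth_on_continuous_on[OF pd_smooth[OF \<theta>s, of i]]]
      borel_measurable_continuous_onI[OF smooth_on_continuous_on[OF \<zeta>s]]
      borel_measurable_continuous_onI[OF smooth_on_continuous_on[OF pd_smooth[OF \<zeta>s]]]
    by (auto simp: pd\<theta>[abs_def])
  have iww: "integrable lborel (\<lambda>x. w i x * w i x)" and iwE: "integrable lborel (\<lambda>x. w i x * E i i x)"
    using integrable_mult_L2[of "w i" lborel "w i"] integrable_mult_L2[of "w i" lborel "E i i"] sq
    by (auto simp: square_integrable_def)
  have z1: "(\<lambda>n. \<zeta> n x) \<longlonglongrightarrow> 1" for x
  proof (rule tendsto_eventually, rule eventually_sequentiallyI)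
    fix n assume n: "nat \<lceil>norm x\<rceil> \<le> n"
    have "norm x \<le> real n" using n by linarith
    then show "\<zeta> n x = 1" unfolding \<zeta>_def by (intro cutoff_1) (simp add: field_simps)
  qed
  have z2: "(\<lambda>n. pd i (\<zeta> n) x) \<longlonglongrightarrow> 0" for x
  proof (rule Lim_null_comparison)
    show "\<forall>\<^sub>F n in sequentially. norm (pd i (\<zeta> n) x) \<le> B * inverse (real (Suc n))"
      using B(2) by (intro always_eventually allI) (simp add: pd\<zeta> abs_mult mult.commute mult_right_mono del: of_nat_Suc)
    show "(\<lambda>n. B * inverse (real (Suc n))) \<longlonglongrightarrow> 0"
      using tendsto_mult_right_zero[OF LIMSEQ_inverse_real_of_nat] by simp
  qed
  have z3: "\<bar>pd i (\<zeta> n) x\<bar> \<le> B" for n x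
  proof -
    have "\<bar>pd i (\<zeta> n) x\<bar> = inverse (real (Suc n)) * \<bar>pd i cutoff (inverse (real (Suc n)) *\<^sub>R x)\<bar>" by (simp add: pd\<zeta> abs_mult)
    also have "\<dots> \<le> 1 * B" using B(2) by (intro mult_mono) (auto simp: field_simps)
    finally show ?thesis by simp
  qed
  have z4: "\<bar>\<zeta> n x\<bar> \<le> 1" for n x using cutoff_range[of "inverse (real (Suc n)) *\<^sub>R x"] by (simp add: \<zeta>_def)
  define C where "C = 1 + R * (pi / 2) * B"
  have lim1: "(\<lambda>n. LINT x|lborel. w i x * w i x * (\<theta>' x * \<zeta> n x + \<theta> x * pd i (\<zeta> n) x)) \<longlonglongrightarrow> (LINT x|lborel. w i x * w i x * \<theta>' x)"
  proof (rule integral_dominated_convergence[where w = "\<lambda>x. C * (w i x * w i x)"])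
    show "AE x in lborel. (\<lambda>n. w i x * w i x * (\<theta>' x * \<zeta> n x + \<theta> x * pd i (\<zeta> n) x)) \<longlonglongrightarrow> w i x * w i x * \<theta>' x"
    proof (rule AE_I2)
      fix x
      have "(\<lambda>n. w i x * w i x * (\<theta>' x * \<zeta> n x + \<theta> x * pd i (\<zeta> n) x)) \<longlonglongrightarrow> w i x * w i x * (\<theta>' x * 1 + \<theta> x * 0)"
        by (intro tendsto_intros z1 z2)
      then show "(\<lambda>n. w i x * w i x * (\<theta>' x * \<zeta> n x + \<theta> x * pd i (\<zeta> n) x)) \<longlonglongrightarrow> w i x * w i x * \<theta>' x" by simp
    qed
    show "AE x in lborel. norm (w i x * w i x * (\<theta>' x * \<zeta> n x + \<theta> x * pd i (\<zeta> n) x)) \<le> C * (w i x * w i x)" for n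
    proof (rule AE_I2)
      fix x
      have "\<bar>\<theta>' x * \<zeta> n x + \<theta> x * pd i (\<zeta> n) x\<bar> \<le> \<bar>\<theta>' x\<bar> * \<bar>\<zeta> n x\<bar> + \<bar>\<theta> x\<bar> * \<bar>pd i (\<zeta> n) x\<bar>"
        by (metis abs_mult abs_triangle_ineq)
      also have "\<dots> \<le> 1 * 1 + R * (pi / 2) * B"
        using \<theta>'b[of x] \<theta>b[of x] z3[of n x] z4[of n x] B0 R by (intro add_mono mult_mono) auto
      finally have "\<bar>\<theta>' x * \<zeta> n x + \<theta> x * pd i (\<zeta> n) x\<bar> \<le> C" by (simp add: C_def)
      then have "\<bar>w i x * w i x\<bar> * \<bar>\<theta>' x * \<zeta> n x + \<theta> x * pd i (\<zeta> n) x\<bar> \<le> \<bar>w i x * w i x\<bar> * C" by (rule mult_left_mono) simp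
      then show "norm (w i x * w i x * (\<theta>' x * \<zeta> n x + \<theta> x * pd i (\<zeta> n) x)) \<le> C * (w i x * w i x)"
        by (simp add: abs_mult mult_ac)
    qed
  qed (use iww in auto)
  have lim2: "(\<lambda>n. LINT x|lborel. w i x * E i i x * (\<theta> x * \<zeta> n x)) \<longlonglongrightarrow> (LINT x|lborel. w i x * E i i x * \<theta> x)"
  proof (rule integral_dominated_convergence[where w = "\<lambda>x. (R * (pi / 2)) * \<bar>w i x * E i i x\<bar>"])
    show "AE x in lborel. (\<lambda>n. w i x * E i i x * (\<theta> x * \<zeta> n x)) \<longlonglongrightarrow> w i x * E i i x * \<theta> x"
    proof (rule AE_I2)
      fix x
      have "(\<lambda>n. w i x * E i i x * (\<theta> x * \<zeta> n x)) \<longlonglongrightarrow> w i x * E i i x * (\<theta> x * 1)"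
        by (intro tendsto_intros z1)
      then show "(\<lambda>n. w i x * E i i x * (\<theta> x * \<zeta> n x)) \<longlonglongrightarrow> w i x * E i i x * \<theta> x" by simp
    qed
    show "AE x in lborel. norm (w i x * E i i x * (\<theta> x * \<zeta> n x)) \<le> R * (pi / 2) * \<bar>w i x * E i i x\<bar>" for n
    proof (rule AE_I2)
      fix x
      have "\<bar>\<theta> x\<bar> * \<bar>\<zeta> n x\<bar> \<le> (R * (pi / 2)) * 1" using \<theta>b[of x] z4[of n x] R by (intro mult_mono) auto
      then have "\<bar>w i x * E i i x\<bar> * (\<bar>\<theta> x\<bar> * \<bar>\<zeta> n x\<bar>) \<le> \<bar>w i x * E i i x\<bar> * (R * (pi / 2))" by (intro mult_left_mono) auto
      then show "norm (w i x * E i i x * (\<theta> x * \<zeta> n x)) \<le> R * (pi / 2) * \<bar>w i x * E i i x\<bar>"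
        by (simp add: abs_mult mult_ac)
    qed
  qed (use iwE in auto)
  have eq: "(LINT x|lborel. w i x * w i x * (\<theta>' x * \<zeta> n x + \<theta> x * pd i (\<zeta> n) x)) = - 2 * (LINT x|lborel. w i x * E i i x * (\<theta> x * \<zeta> n x))" for n
    using parts[of "\<lambda>x. \<theta> x * \<zeta> n x" "2 * real (Suc n)"] \<zeta>b[of n]
    by (auto simp: pd_mult[OF \<theta>s \<zeta>s] pd\<theta> ball_supported_def smooth_on_mult \<theta>s \<zeta>s)
  have main: "(LINT x|lborel. w i x * w i x * \<theta>' x) = - 2 * (LINT x|lborel. w i x * E i i x * \<theta> x)"
    using LIMSEQ_unique[OF lim1[unfolded eq] tendsto_mult_left[OF lim2]] by simp
  have iwt: "integrable lborel (\<lambda>x. w i x * w i x * \<theta>' x)"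
    by (rule square_integrable_bounded_smooth_mult[OF sq(1) sq(1), where B = 1]) (use \<theta>'b in auto)
  \<comment> \<open>The factor 2 compensates the lower bound 1/2 of \<open>\<theta>'\<close> on the
    slab. Together with the factor 2 in the identity \<open>main\<close> and the bound R pi / 2 of
    the weight it produces the constant 2 pi R.\<close>
  have "(LINT x|lborel. indicator {x. \<bar>x $ i - a\<bar> \<le> R} x * (w i x)\<^sup>2) \<le> (LINT x|lborel. 2 * (w i x * w i x * \<theta>' x))"
  proof (rule integral_mono_AE')
    show "integrable lborel (\<lambda>x. 2 * (w i x * w i x * \<theta>' x))" using iwt by simp
    show "AE x in lborel. indicator {x. \<bar>x $ i - a\<bar> \<le> R} x * (w i x)\<^sup>2 \<le> 2 * (w i x * w i x * \<theta>' x)"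
    proof (rule AE_I2)
      fix x
      show "indicator {x. \<bar>x $ i - a\<bar> \<le> R} x * (w i x)\<^sup>2 \<le> 2 * (w i x * w i x * \<theta>' x)"
      proof (cases "\<bar>x $ i - a\<bar> \<le> R")
        case True
        then have "((x $ i - a) / R)\<^sup>2 \<le> 1" using R by (intro abs_square_le_1[THEN iffD2]) (simp add: abs_divide)
        then have "1 \<le> 2 * \<theta>' x" unfolding \<theta>'_def by (simp add: field_simps add_pos_nonneg)
        from mult_left_mono[OF this zero_le_square[of "w i x"]] show ?thesis using True by (simp add: power2_eq_square mult_ac)
      next
        case False then show ?thesis using \<theta>'b[of x] by simp
      qed
    qed
    show "AE x in lborel. 0 \<le> 2 * (w i x * w i x * \<theta>' x)" using \<theta>'b by simp
  qed
  also have "\<dots> = - 4 * (LINT x|lborel. w i x * E i i x * \<theta> x)" using main by simp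
  also have "\<dots> \<le> 4 * \<bar>LINT x|lborel. w i x * E i i x * \<theta> x\<bar>" by linarith
  also have "\<bar>LINT x|lborel. w i x * E i i x * \<theta> x\<bar> \<le> (LINT x|lborel. R * (pi / 2) * (\<bar>w i x\<bar> * \<bar>E i i x\<bar>))"
    unfolding real_norm_def[symmetric]
  proof (rule norm_integral_le_AE)
    show "integrable lborel (\<lambda>x. R * (pi / 2) * (norm (w i x) * norm (E i i x)))"
      using integrable_mult_right[OF integrable_norm[OF iwE], of "R * (pi / 2)"] by (simp add: norm_mult abs_mult)
    show "AE x in lborel. norm (w i x * E i i x * \<theta> x) \<le> R * (pi / 2) * (norm (w i x) * norm (E i i x))"
    proof (rule AE_I2)
      fix x
      have "\<bar>\<theta> x\<bar> * (\<bar>w i x\<bar> * \<bar>E i i x\<bar>) \<le> R * (pi / 2) * (\<bar>w i x\<bar> * \<bar>E i i x\<bar>)"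
        by (rule mult_right_mono[OF \<theta>b]) simp
      then show "norm (w i x * E i i x * \<theta> x) \<le> R * (pi / 2) * (norm (w i x) * norm (E i i x))"
        by (simp add: abs_mult mult_ac)
    qed
  qed
  also have "(LINT x|lborel. R * (pi / 2) * (\<bar>w i x\<bar> * \<bar>E i i x\<bar>)) = R * (pi / 2) * (LINT x|lborel. \<bar>w i x\<bar> * \<bar>E i i x\<bar>)" by simp
  finally have fin: "(LINT x|lborel. indicator {x. \<bar>x $ i - a\<bar> \<le> R} x * (w i x)\<^sup>2) \<le> 2 * pi * R * (LINT x|lborel. \<bar>w i x\<bar> * \<bar>E i i x\<bar>)"
    by (simp add: algebra_simps)
  have [measurable]: "{x::real^'n. \<bar>x $ i - a\<bar> \<le> R} \<in> sets borel"
    by (intro borel_closed closed_Collect_le continuous_intros)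
  have L: "(LINT x|lebesgue. indicator {x. \<bar>x $ i - a\<bar> \<le> R} x * (v x $ i)\<^sup>2) = (LINT x|lborel. indicator {x. \<bar>x $ i - a\<bar> \<le> R} x * (w i x)\<^sup>2)"
    by (rule lebesgue_AE_borel(3)) (measurable, use ae(1) in eventually_elim, simp)
  have M: "(LINT x|lebesgue. \<bar>v x $ i\<bar> * \<bar>D x $ i $ i\<bar>) = (LINT x|lborel. \<bar>w i x\<bar> * \<bar>E i i x\<bar>)"
    by (rule lebesgue_AE_borel(3)) (measurable, use ae in eventually_elim, simp)
  show ?thesis using fin unfolding L M .
qed

subsection \<open>The logarithmic test field\<close>

lemma pd_radial:
  fixes p :: "real \<Rightarrow> real"
  assumes "smooth_on UNIV p"
  shows "pd i (\<lambda>x::real^'n. p (x \<bullet> x - 1)) x = frechet_derivative p (at (x \<bullet> x - 1)) 1 * (2 * x $ i)"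
proof -
  have l: "linear (frechet_derivative p (at y))" for y
    using smooth_on_has_derivative[OF assms UNIV_I] has_derivative_linear by blast
  have g: "((\<lambda>x::real^'n. x \<bullet> x - 1) has_derivative (\<lambda>h. 2 * (x \<bullet> h))) (at x)"
    by (auto intro!: derivative_eq_intros simp: inner_commute)
  have "((\<lambda>x::real^'n. p (x \<bullet> x - 1)) has_derivative (\<lambda>h. frechet_derivative p (at (x \<bullet> x - 1)) (2 * (x \<bullet> h)))) (at x)"
    by (rule has_derivative_compose[OF g smooth_on_has_derivative[OF assms UNIV_I]])
  from pd_eqI[OF this] show ?thesis
    using linear_cmul[OF l, of _ "2 * x $ i" 1] by (simp add: inner_axis mult.commute)
qed

lemma smooth_radial:
  assumes "smooth_on UNIV (p :: real \<Rightarrow> real)" shows "smooth_on UNIV (\<lambda>x::'a::euclidean_space. p (x \<bullet> x - 1))"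
  by (intro smooth_on_compose_UNIV[OF _ assms] smooth_on_diff smooth_on_inner smooth_on_id smooth_on_const open_UNIV)

definition smooth_step' :: "real \<Rightarrow> real" where
  "smooth_step' y = frechet_derivative smooth_step (at y) 1"

lemma smooth_step'_smooth: "smooth_on UNIV smooth_step'"
  unfolding smooth_step'_def[abs_def] by (rule smooth_on_frechet_derivative[OF smooth_step_smooth])

lemma smooth_step'_0: "y < 0 \<or> 1 < y \<Longrightarrow> smooth_step' y = 0"
proof -
  assume "y < 0 \<or> 1 < y"
  then consider "y < 0" | "1 < y" by blast
  then show ?thesis
  proof cases
    case 1
    then have "frechet_derivative smooth_step (at y) = frechet_derivative (\<lambda>_. 0) (at y)"
      by (intro frechet_derivative_cong_open[of "{..<0}"]) (auto intro: smooth_step_0)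
    then show ?thesis by (simp add: smooth_step'_def)
  next
    case 2
    then have "frechet_derivative smooth_step (at y) = frechet_derivative (\<lambda>_. 1) (at y)"
      by (intro frechet_derivative_cong_open[of "{1<..}"]) (auto intro: smooth_step_1)
    then show ?thesis by (simp add: smooth_step'_def)
  qed
qed

text \<open>Divergence of the antisymmetric matrix field \<open>cutoff x (e x\<^sup>T - x e\<^sup>T) / (n - 1)\<close>, hence
  divergence free.\<close>

definition plateau_weight :: "real^'n \<Rightarrow> real" where
  "plateau_weight x = - (2 / (real CARD('n) - 1)) * smooth_step' (x \<bullet> x - 1)"

definition plateau_field :: "real^'n \<Rightarrow> real^'n \<Rightarrow> real^'n" where
  "plateau_field e x = cutoff x *\<^sub>R e + plateau_weight x *\<^sub>R ((x \<bullet> x) *\<^sub>R e - (e \<bullet> x) *\<^sub>R x)"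

lemma plateau_weight_smooth: "smooth_on UNIV plateau_weight"
  unfolding plateau_weight_def[abs_def]
  by (intro smooth_on_mult smooth_on_const smooth_radial smooth_step'_smooth open_UNIV)

lemma plateau_weight_0: "norm x < 1 \<or> 3/2 < norm x \<Longrightarrow> plateau_weight x = 0"
proof -
  assume *: "norm x < 1 \<or> 3/2 < norm x"
  have "x \<bullet> x - 1 < 0 \<or> 1 < x \<bullet> x - 1"
  proof (cases "norm x < 1")
    case True then show ?thesis by (simp add: dot_square_norm power_less_one_iff abs_square_less_1)
  next
    case False
    then have "(3/2)\<^sup>2 < (norm x)\<^sup>2" using * by (intro power_strict_mono) auto
    then show ?thesis by (simp add: dot_square_norm power2_eq_square)
  qed
  then show ?thesis using smooth_step'_0 by (simp add: plateau_weight_def)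
qed

lemma plateau_field_smooth: "smooth_on UNIV (plateau_field e)"
  unfolding plateau_field_def[abs_def]
  by (intro smooth_on_add smooth_on_diff smooth_on_scaleR smooth_on_inner smooth_on_const smooth_on_id
     cutoff_smooth plateau_weight_smooth open_UNIV)

lemma plateau_field_near: "norm x < 1 \<Longrightarrow> plateau_field e x = e"
  by (simp add: plateau_field_def plateau_weight_0 cutoff_1)

lemma plateau_field_far: "3/2 < norm x \<Longrightarrow> plateau_field e x = 0"
  by (simp add: plateau_field_def plateau_weight_0 cutoff_0)

lemma sum_vec_nth_mult: "(\<Sum>i\<in>UNIV. x $ i * y $ i) = (x :: real^'n) \<bullet> y"
  by (simp add: inner_vec_def)

text \<open>The weight is radial, so its gradient is parallel to x, while the correction (x . x) e -
  (e . x) x is orthogonal to x; hence the terms with \<Gamma> cancel. What remains is G (e . x)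
  times n - 1 from the cut-off and 1 - n from the divergence of the correction. The bound n \<ge> 2
  permits the division by n - 1.\<close>

lemma divergence_plateau_field:
  fixes e :: "real^'n"
  assumes n: "CARD('n) \<ge> 2"
  shows "divergence (plateau_field e) x = 0"
proof -
  define G where "G = (plateau_weight :: real^'n \<Rightarrow> real)"
  define \<Gamma> where "\<Gamma> = - (2 / (real CARD('n) - 1)) * frechet_derivative smooth_step' (at (x \<bullet> x - 1)) 1 * 2"
  define Q where "Q i x = (x \<bullet> x) * e $ i - (e \<bullet> x) * x $ i" for i and x :: "real^'n"
  have Gs: "smooth_on UNIV G" unfolding G_def by (rule plateau_weight_smooth)
  have Qs: "smooth_on UNIV (Q i)" for i
    unfolding Q_def[abs_def] by (intro smooth_on_diff smooth_on_mult smooth_on_inner smooth_on_const smooth_on_id smooth_on_vec_nth open_UNIV)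
  have pF: "pd i cutoff x = (real CARD('n) - 1) * G x * x $ i" for i
  proof -
    have "smooth_on UNIV (\<lambda>y. 1 - smooth_step y)" by (intro smooth_on_diff smooth_on_const smooth_step_smooth open_UNIV)
    from pd_radial[OF this, of i x]
    have "pd i cutoff x = frechet_derivative (\<lambda>y. 1 - smooth_step y) (at (x \<bullet> x - 1)) 1 * (2 * x $ i)"
      by (simp add: cutoff_def[abs_def])
    also have "frechet_derivative (\<lambda>y. 1 - smooth_step y) (at y) = (\<lambda>h. 0 - frechet_derivative smooth_step (at y) h)" for y
      by (rule frechet_derivative_at[symmetric]) (intro has_derivative_diff has_derivative_const smooth_on_has_derivative[OF smooth_step_smooth UNIV_I])
    finally show ?thesis using n by (simp add: G_def plateau_weight_def smooth_step'_def)
  qed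
  have pG: "pd i G x = \<Gamma> * x $ i" for i
  proof -
    have rs: "smooth_on UNIV (\<lambda>x::real^'n. smooth_step' (x \<bullet> x - 1))" by (rule smooth_radial[OF smooth_step'_smooth])
    have "pd i G x = - (2 / (real CARD('n) - 1)) * pd i (\<lambda>x. smooth_step' (x \<bullet> x - 1)) x"
      unfolding G_def plateau_weight_def[abs_def]
      by (subst pd_eqI[OF has_derivative_mult_right[OF smooth_has_derivative_pd[OF rs]]]) (simp add: pd_def)
    then show ?thesis by (simp add: pd_radial[OF smooth_step'_smooth] \<Gamma>_def)
  qed
  have pQ: "pd i (Q i) x = x $ i * e $ i - e \<bullet> x" for i
  proof -
    have "(Q i has_derivative (\<lambda>h. 2 * (x \<bullet> h) * e $ i - ((e \<bullet> h) * x $ i + (e \<bullet> x) * h $ i))) (at x)"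
      unfolding Q_def[abs_def]
      by (auto intro!: derivative_eq_intros bounded_linear.has_derivative[OF bounded_linear_vec_nth] simp: inner_commute algebra_simps)
    from pd_eqI[OF this] show ?thesis by (simp add: inner_axis)
  qed
  have pc: "pd i (\<lambda>x. e $ i * cutoff x) x = e $ i * pd i cutoff x" for i
    using pd_eqI[OF has_derivative_mult_right[OF smooth_has_derivative_pd[OF cutoff_smooth]]] by (simp add: pd_def)
  have comp: "(\<lambda>x. plateau_field e x $ i) = (\<lambda>x. e $ i * cutoff x + G x * Q i x)" for i
    by (simp add: plateau_field_def G_def Q_def fun_eq_iff)
  have "pd i (\<lambda>x. plateau_field e x $ i) x = e $ i * pd i cutoff x + (pd i G x * Q i x + G x * pd i (Q i) x)" for i
  proof -
    have a: "smooth_on UNIV (\<lambda>x::real^'n. e $ i * cutoff x)" and b: "smooth_on UNIV (\<lambda>x. G x * Q i x)"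
      by (intro smooth_on_mult smooth_on_const cutoff_smooth Gs Qs open_UNIV)+
    have "pd i (\<lambda>x. e $ i * cutoff x + G x * Q i x) x = pd i (\<lambda>x. e $ i * cutoff x) x + pd i (\<lambda>x. G x * Q i x) x"
      by (subst pd_eqI[OF has_derivative_add[OF smooth_has_derivative_pd[OF a] smooth_has_derivative_pd[OF b]]]) (simp add: pd_def)
    then show ?thesis unfolding comp by (simp add: pc pd_mult[OF Gs Qs])
  qed
  then have "divergence (plateau_field e) x = (\<Sum>i\<in>UNIV. e $ i * pd i cutoff x + (pd i G x * Q i x + G x * pd i (Q i) x))"
    by (simp add: divergence_eq_sum_pd[OF plateau_field_smooth])
  also have "\<dots> = (\<Sum>i\<in>UNIV. real CARD('n) * G x * (x $ i * e $ i) + \<Gamma> * (x \<bullet> x) * (x $ i * e $ i) - \<Gamma> * (e \<bullet> x) * (x $ i * x $ i) - G x * (e \<bullet> x))"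
    by (intro sum.cong refl) (simp add: pF pG pQ Q_def algebra_simps)
  also have "\<dots> = 0"
    by (simp add: sum.distrib sum_subtractf sum_distrib_left[symmetric] sum_vec_nth_mult inner_commute)
  finally show ?thesis .
qed

section \<open>Dyadic averages of plateau fields\<close>

lemma sym_grad_eqI:
  assumes "(W has_derivative W') (at x)"
  shows "sym_grad W x = (1/2) *\<^sub>R (matrix W' + transpose (matrix W'))"
  using frechet_derivative_at[OF assms] by (simp add: sym_grad_def jacobian_def)

lemma sym_grad_component:
  assumes "smooth_on UNIV W"
  shows "sym_grad W x $ i $ j = (pd j (\<lambda>x. W x $ i) x + pd i (\<lambda>x. W x $ j) x) / 2"
  by (simp add: sym_grad_def jacobian_def matrix_def transpose_def pd_vec_nth[OF assms])

lemma sym_grad_continuous: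
  assumes "smooth_on UNIV W" shows "continuous_on UNIV (sym_grad W)"
proof -
  have "sym_grad W = (\<lambda>x. \<chi> i j. (pd j (\<lambda>x. W x $ i) x + pd i (\<lambda>x. W x $ j) x) / 2)"
    by (simp add: fun_eq_iff vec_eq_iff sym_grad_component[OF assms])
  moreover have "continuous_on UNIV (pd j (\<lambda>x. W x $ i))" for i j
    by (intro smooth_on_continuous_on pd_smooth smooth_on_vec_nth assms)
  ultimately show ?thesis
    by (simp only:) (intro continuous_on_vec_lambda continuous_on_divide continuous_on_add continuous_on_const; simp)
qed

lemma sym_grad_eq_0:
  assumes "open U" "x \<in> U" "\<And>y. y \<in> U \<Longrightarrow> W y = c"
  shows "sym_grad W x = 0" "frechet_derivative W (at x) h = 0"
proof -
  have d: "frechet_derivative W (at x) = (\<lambda>h. 0)"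
    using frechet_derivative_cong_open[OF assms(1,2), of W "\<lambda>_. c"] assms(3) by simp
  then show "frechet_derivative W (at x) h = 0" by simp
  show "sym_grad W x = 0" by (simp add: sym_grad_def jacobian_def d matrix_def transpose_def vec_eq_iff)
qed

text \<open>A discrete logarithmic cut-off: each doubling of |x| beyond r switches off one of the N
  summands, so the field descends from e to 0 roughly linearly in log |x|.\<close>

definition log_field :: "real^'n \<Rightarrow> nat \<Rightarrow> real \<Rightarrow> real^'n \<Rightarrow> real^'n" where
  "log_field e N r x = (1 / real N) *\<^sub>R (\<Sum>j<N. plateau_field e (inverse (2 ^ j * r) *\<^sub>R x))"

lemma log_field_smooth: "smooth_on UNIV (log_field e N r)"
  unfolding log_field_def[abs_def]
  by (intro smooth_on_scaleR smooth_on_sum smooth_on_compose_UNIV[OF _ plateau_field_smooth] smooth_on_const smooth_on_id open_UNIV)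

lemma log_field_near:
  assumes "N \<ge> 1" "r > 0" "norm x < r" shows "log_field e N r x = e"
proof -
  have "plateau_field e (inverse (2 ^ j * r) *\<^sub>R x) = e" for j
  proof (rule plateau_field_near)
    have "1 * r \<le> 2 ^ j * r" using assms by (intro mult_right_mono) auto
    then have "norm x < 2 ^ j * r" using assms by linarith
    then show "norm (inverse (2 ^ j * r) *\<^sub>R x) < 1" using assms by (simp add: field_simps)
  qed
  then have "log_field e N r x = (1 / real N) *\<^sub>R (\<Sum>j<N. e)" by (simp only: log_field_def)
  also have "(\<Sum>j<N. e) = real N *\<^sub>R e" by (simp add: sum_constant_scaleR del: sum_constant)
  finally show ?thesis using assms by simp
qed

lemma log_field_ball_supported:
  assumes "r > 0" shows "ball_supported (2 ^ N * r) (log_field e N r)"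
  unfolding ball_supported_def
proof safe
  fix x :: "real^'a" assume x: "2 ^ N * r < norm x"
  have "plateau_field e (inverse (2 ^ j * r) *\<^sub>R x) = 0" if "j < N" for j
  proof (rule plateau_field_far)
    have "2 ^ j * 2 \<le> (2::real) ^ N" using that power_increasing[of "Suc j" N "2::real"] by (simp add: mult.commute)
    then have "2 ^ j * 2 * r \<le> 2 ^ N * r" using assms by (intro mult_right_mono) auto
    moreover have "0 < 2 ^ j * r" using assms by simp
    moreover have "2 ^ j * 2 * r = 2 * (2 ^ j * r)" by simp
    ultimately have "3/2 * (2 ^ j * r) < norm x" using x by linarith
    then show "3/2 < norm (inverse (2 ^ j * r) *\<^sub>R x)" using assms by (simp add: field_simps)
  qed
  then show "log_field e N r x = 0" by (simp add: log_field_def)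
qed

lemma has_derivative_log_field:
  "(log_field e N r has_derivative (\<lambda>h. (1 / real N) *\<^sub>R (\<Sum>j<N.
      inverse (2 ^ j * r) *\<^sub>R frechet_derivative (plateau_field e) (at (inverse (2 ^ j * r) *\<^sub>R x)) h))) (at x)"
proof -
  have l: "linear (frechet_derivative (plateau_field e) (at y))" for y
    using smooth_on_has_derivative[OF plateau_field_smooth UNIV_I] has_derivative_linear by blast
  have "((\<lambda>x. plateau_field e (c *\<^sub>R x)) has_derivative (\<lambda>h. frechet_derivative (plateau_field e) (at (c *\<^sub>R x)) (c *\<^sub>R h))) (at x)" for c
    by (rule has_derivative_compose[OF _ smooth_on_has_derivative[OF plateau_field_smooth UNIV_I]]) (auto intro!: derivative_eq_intros)
  then have "((\<lambda>x. plateau_field e (c *\<^sub>R x)) has_derivative (\<lambda>h. c *\<^sub>R frechet_derivative (plateau_field e) (at (c *\<^sub>R x)) h)) (at x)" for c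
    by (simp add: linear_cmul[OF l])
  then show ?thesis
    unfolding log_field_def[abs_def] by (intro has_derivative_scaleR_right has_derivative_sum)
qed

lemma divergence_log_field:
  fixes e :: "real^'n"
  assumes "CARD('n) \<ge> 2" shows "divergence (log_field e N r) x = 0"
proof -
  have d: "(\<Sum>i\<in>UNIV. frechet_derivative (plateau_field e) (at y) (axis i 1) $ i) = 0" for y
    using divergence_plateau_field[OF assms, of e y] by (simp add: divergence_def trace_def jacobian_def matrix_def)
  have "divergence (log_field e N r) x = (\<Sum>i\<in>UNIV. (1 / real N) * (\<Sum>j<N.
      inverse (2 ^ j * r) * frechet_derivative (plateau_field e) (at (inverse (2 ^ j * r) *\<^sub>R x)) (axis i 1) $ i))"
    using frechet_derivative_at[OF has_derivative_log_field[where e = e and N = N and r = r and x = x], symmetric]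
    by (simp add: divergence_def trace_def jacobian_def matrix_def)
  also have "\<dots> = (1 / real N) * (\<Sum>j<N. inverse (2 ^ j * r) * (\<Sum>i\<in>UNIV. frechet_derivative (plateau_field e) (at (inverse (2 ^ j * r) *\<^sub>R x)) (axis i 1) $ i))"
    unfolding sum_distrib_left by (rule sum.swap)
  finally show ?thesis by (simp add: d)
qed

lemma sym_grad_log_field:
  "sym_grad (log_field e N r) x = (1 / real N) *\<^sub>R (\<Sum>j<N. inverse (2 ^ j * r) *\<^sub>R sym_grad (plateau_field e) (inverse (2 ^ j * r) *\<^sub>R x))"
proof -
  define T where "T j a b = frechet_derivative (plateau_field e) (at (inverse (2 ^ j * r) *\<^sub>R x)) (axis b 1) $ a" for j :: nat and a b
  have *: "(1 / real N * (\<Sum>j<N. c j * f j) + 1 / real N * (\<Sum>j<N. c j * g j)) / 2 = 1 / real N * (\<Sum>j<N. c j * ((f j + g j) / 2))"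
    for c f g :: "nat \<Rightarrow> real"
    by (simp add: distrib_left add_divide_distrib sum.distrib sum_divide_distrib mult.commute[of 2])
  have "sym_grad (log_field e N r) x $ a $ b = (1 / real N * (\<Sum>j<N. inverse (2 ^ j * r) * T j a b) + 1 / real N * (\<Sum>j<N. inverse (2 ^ j * r) * T j b a)) / 2" for a b
    unfolding T_def by (simp add: sym_grad_eqI[OF has_derivative_log_field] matrix_def transpose_def)
  moreover have "((1 / real N) *\<^sub>R (\<Sum>j<N. inverse (2 ^ j * r) *\<^sub>R sym_grad (plateau_field e) (inverse (2 ^ j * r) *\<^sub>R x))) $ a $ b
     = 1 / real N * (\<Sum>j<N. inverse (2 ^ j * r) * ((T j a b + T j b a) / 2))" for a b
    unfolding T_def by (simp add: sym_grad_def jacobian_def matrix_def transpose_def)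
  ultimately have "sym_grad (log_field e N r) x $ a $ b = ((1 / real N) *\<^sub>R (\<Sum>j<N. inverse (2 ^ j * r) *\<^sub>R sym_grad (plateau_field e) (inverse (2 ^ j * r) *\<^sub>R x))) $ a $ b" for a b
    by (simp only: *)
  then show ?thesis by (simp add: vec_eq_iff)
qed

lemma sum_square_disjoint:
  fixes a :: "'i \<Rightarrow> real"
  assumes "finite I" "\<And>i j. i \<in> I \<Longrightarrow> j \<in> I \<Longrightarrow> i \<noteq> j \<Longrightarrow> a i = 0 \<or> a j = 0"
  shows "(\<Sum>i\<in>I. a i)\<^sup>2 = (\<Sum>i\<in>I. (a i)\<^sup>2)"
proof -
  have "(\<Sum>i\<in>I. a i)\<^sup>2 = (\<Sum>i\<in>I. \<Sum>j\<in>I. a i * a j)" by (simp add: power2_eq_square sum_product)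
  also have "\<dots> = (\<Sum>i\<in>I. \<Sum>j\<in>I. if i = j then (a i)\<^sup>2 else 0)"
    using assms(2) by (intro sum.cong refl) (auto simp: power2_eq_square)
  also have "\<dots> = (\<Sum>i\<in>I. (a i)\<^sup>2)" using assms(1) by simp
  finally show ?thesis .
qed

text \<open>The symmetric gradient at scale s = 2^j r lives in the annulus between s and 3s/2, and
  different scales differ at least by a factor 2, so at most one summand is nonzero at each point.
  The square of the sum is then the sum of the squares, and the prefactor 1/N^2 meets N terms
  instead of N^2.\<close>

lemma norm_sym_grad_log_field_le:
  fixes e x :: "real^'n"
  assumes B: "\<And>y. norm (sym_grad (plateau_field e) y) \<le> B" and r: "r > 0" "N \<ge> 1"
  shows "(norm (sym_grad (log_field e N r) x))\<^sup>2 \<le> (B\<^sup>2 / (real N)\<^sup>2) * (\<Sum>j<N. (inverse (2 ^ j * r))\<^sup>2 * indicator (cball 0 (2 * (2 ^ j * r))) x)"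
proof -
  define s where "s j = 2 ^ j * r" for j :: nat
  have s: "s j > 0" for j using r by (simp add: s_def)
  define S where "S j = norm (sym_grad (plateau_field e) (inverse (s j) *\<^sub>R x)) * inverse (s j)" for j
  have out: "S j = 0" if "norm x < s j \<or> 3/2 * s j < norm x" for j
  proof -
    have "open {y::real^'n. norm y < 1}" "open {y::real^'n. 3/2 < norm y}"
      by (intro open_Collect_less continuous_intros)+
    moreover have "norm (inverse (s j) *\<^sub>R x) < 1 \<or> 3/2 < norm (inverse (s j) *\<^sub>R x)"
      using that s[of j] by (auto simp: field_simps)
    ultimately have "sym_grad (plateau_field e) (inverse (s j) *\<^sub>R x) = 0"
      using sym_grad_eq_0(1)[of "{y::real^'n. norm y < 1}" "inverse (s j) *\<^sub>R x" "plateau_field e" e]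
        sym_grad_eq_0(1)[of "{y::real^'n. 3/2 < norm y}" "inverse (s j) *\<^sub>R x" "plateau_field e" 0]
        plateau_field_near plateau_field_far by blast
    then show ?thesis by (simp add: S_def)
  qed
  have disj: "S i = 0 \<or> S j = 0" if "i < j" for i j
  proof -
    have "2 * 2 ^ i \<le> (2::real) ^ j" using that power_increasing[of "Suc i" j "2::real"] by simp
    then have "2 * s i \<le> s j" using r mult_right_mono[of "2 * 2 ^ i" "2 ^ j" r] by (simp add: s_def)
    then have "3/2 * s i < s j" using s[of i] by linarith
    then have "norm x < s j \<or> 3/2 * s i < norm x" by linarith
    then show ?thesis using out by blast
  qed
  have disj': "S i = 0 \<or> S j = 0" if "i \<noteq> j" for i j
    using disj[of i j] disj[of j i] that by (meson nat_neq_iff)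
  have "norm (\<Sum>j<N. inverse (s j) *\<^sub>R sym_grad (plateau_field e) (inverse (s j) *\<^sub>R x)) \<le> (\<Sum>j<N. S j)"
    unfolding S_def using s by (intro order_trans[OF norm_sum] sum_mono) (simp add: abs_of_pos)
  then have "norm (sym_grad (log_field e N r) x) \<le> (1 / real N) * (\<Sum>j<N. S j)"
    unfolding sym_grad_log_field s_def[symmetric] norm_scaleR by (intro mult_mono) auto
  then have "(norm (sym_grad (log_field e N r) x))\<^sup>2 \<le> ((1 / real N) * (\<Sum>j<N. S j))\<^sup>2" by (rule power_mono) simp
  also have "\<dots> = (1 / (real N)\<^sup>2) * (\<Sum>j<N. (S j)\<^sup>2)"
    using disj' by (subst power_mult_distrib, subst sum_square_disjoint) (auto simp: power_divide)
  also have "\<dots> \<le> (1 / (real N)\<^sup>2) * (\<Sum>j<N. B\<^sup>2 * ((inverse (s j))\<^sup>2 * indicator (cball 0 (2 * s j)) x))"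
  proof (intro mult_left_mono sum_mono)
    fix j
    show "(S j)\<^sup>2 \<le> B\<^sup>2 * ((inverse (s j))\<^sup>2 * indicator (cball 0 (2 * s j)) x)"
    proof (cases "norm x \<le> 2 * s j")
      case True
      have "(norm (sym_grad (plateau_field e) (inverse (s j) *\<^sub>R x)))\<^sup>2 \<le> B\<^sup>2" by (intro power_mono B) simp
      then show ?thesis using True by (simp add: S_def power_mult_distrib mult_right_mono)
    next
      case False
      then have "S j = 0" using s[of j] by (intro out) linarith
      then show ?thesis using False by simp
    qed
  qed simp
  finally show ?thesis unfolding s_def sum_distrib_left[symmetric] by simp
qed

lemma plateau_field_bounds:
  fixes e :: "real^'n"
  obtains B where "B > 0" "\<And>x. norm (plateau_field e x) \<le> B" "\<And>x. norm (sym_grad (plateau_field e) x) \<le> B"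
proof -
  have s: "ball_supported (3/2) (plateau_field e)" unfolding ball_supported_def by (intro allI impI plateau_field_far)
  obtain B1 where B1: "B1 > 0" "\<And>x. norm (plateau_field e x) \<le> B1"
    using ball_supported_bounded[OF smooth_on_continuous_on[OF plateau_field_smooth] s] by blast
  have "open {y::real^'n. 3/2 < norm y}" by (intro open_Collect_less continuous_intros)
  then have "ball_supported (3/2) (sym_grad (plateau_field e))"
    unfolding ball_supported_def using sym_grad_eq_0(1)[of "{y::real^'n. 3/2 < norm y}" _ "plateau_field e" 0] plateau_field_far by auto
  then obtain B2 where B2: "B2 > 0" "\<And>x. norm (sym_grad (plateau_field e) x) \<le> B2"
    using ball_supported_bounded[OF sym_grad_continuous[OF plateau_field_smooth]] by blast
  show ?thesis
  proof (rule that[of "max B1 B2"])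
    show "norm (plateau_field e x) \<le> max B1 B2" "norm (sym_grad (plateau_field e) x) \<le> max B1 B2" for x
      using B1(2)[of x] B2(2)[of x] by linarith+
  qed (use B1 in auto)
qed

text \<open>The constant depends on e and the dimension but not on N or r. At scale s the gradient
  is of size 1/s on a set of volume at most of order s^n and contributes s^(n-2); in dimension 2
  these contributions are all 1 and the bound becomes B/N.\<close>

theorem log_field_bounds:
  fixes e :: "real^'n"
  assumes n: "CARD('n) \<ge> 2"
  obtains B where "B > 0"
    "\<And>N r x. N \<ge> 1 \<Longrightarrow> norm (log_field e N r x) \<le> B"
    "\<And>N r. N \<ge> 1 \<Longrightarrow> r > 0 \<Longrightarrow> (LINT x|lborel. (norm (log_field e N r x))\<^sup>2) \<le> B * (2 ^ N * r) ^ CARD('n)"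
    "\<And>N r. N \<ge> 1 \<Longrightarrow> r > 0 \<Longrightarrow> (LINT x|lborel. (norm (sym_grad (log_field e N r) x))\<^sup>2)
        \<le> B / (real N)\<^sup>2 * (\<Sum>j<N. (2 ^ j * r) ^ (CARD('n) - 2))"
proof -
  obtain B where B: "B > 0" "\<And>x. norm (plateau_field e x) \<le> B" "\<And>x. norm (sym_grad (plateau_field e) x) \<le> B"
    using plateau_field_bounds by blast
  define c where "c = unit_ball_vol (real CARD('n))"
  have c: "c > 0" unfolding c_def by (rule unit_ball_vol_pos) simp
  have vol: "measure lborel (cball (0::real^'n) s) = c * s ^ CARD('n)" if "s \<ge> 0" for s
    using content_cball[OF that, of "0::real^'n"] by (simp add: c_def)
  have ic: "integrable lborel (indicator (cball (0::real^'n) s) :: _ \<Rightarrow> real)" for s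
    using emeasure_compact_finite[of "cball (0::real^'n) s"] by (intro integrable_real_indicator) auto
  have b: "norm (log_field e N r x) \<le> B" if "N \<ge> 1" for N r x
  proof -
    have "norm (\<Sum>j<N. plateau_field e (inverse (2 ^ j * r) *\<^sub>R x)) \<le> (\<Sum>j<N. B)"
      by (intro order_trans[OF norm_sum] sum_mono B)
    then have "norm (log_field e N r x) \<le> (1 / real N) * (real N * B)"
      unfolding log_field_def norm_scaleR by (intro mult_mono) auto
    then show ?thesis using that by simp
  qed
  define B' where "B' = B + B\<^sup>2 * c + B\<^sup>2 * c * 2 ^ CARD('n)"
  have BB: "B \<le> B'" "B\<^sup>2 * c \<le> B'" "B\<^sup>2 * c * 2 ^ CARD('n) \<le> B'" "B' > 0"
    using B(1) c by (auto simp: B'_def intro!: add_nonneg_nonneg add_pos_nonneg)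
  show ?thesis
  proof (rule that[OF BB(4)])
    show "norm (log_field e N r x) \<le> B'" if "N \<ge> 1" for N r x using b[OF that, of r x] BB(1) by linarith
    show "(LINT x|lborel. (norm (log_field e N r x))\<^sup>2) \<le> B' * (2 ^ N * r) ^ CARD('n)" if N: "N \<ge> 1" and r: "r > 0" for N r
    proof -
      have "(LINT x|lborel. (norm (log_field e N r x))\<^sup>2) \<le> (LINT x|lborel. B\<^sup>2 * indicator (cball (0::real^'n) (2 ^ N * r)) x)"
      proof (rule integral_mono_AE')
        show "integrable lborel (\<lambda>x. B\<^sup>2 * indicator (cball (0::real^'n) (2 ^ N * r)) x)" by (intro integrable_mult_right ic)
        have "(norm (log_field e N r x))\<^sup>2 \<le> B\<^sup>2 * indicator (cball 0 (2 ^ N * r)) x" for x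
          using log_field_ball_supported[OF r, of N e] power_mono[OF b[OF N, of r x], of 2]
          by (auto simp: indicator_def ball_supported_def)
        then show "AE x in lborel. (norm (log_field e N r x))\<^sup>2 \<le> B\<^sup>2 * indicator (cball 0 (2 ^ N * r)) x" by simp
      qed simp
      also have "\<dots> = B\<^sup>2 * c * (2 ^ N * r) ^ CARD('n)" using vol[of "2 ^ N * r"] r by simp
      also have "\<dots> \<le> B' * (2 ^ N * r) ^ CARD('n)" using BB r by (intro mult_right_mono) auto
      finally show ?thesis .
    qed
    show "(LINT x|lborel. (norm (sym_grad (log_field e N r) x))\<^sup>2) \<le> B' / (real N)\<^sup>2 * (\<Sum>j<N. (2 ^ j * r) ^ (CARD('n) - 2))"
      if N: "N \<ge> 1" and r: "r > 0" for N r
    proof -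
      have "(LINT x|lborel. (norm (sym_grad (log_field e N r) x))\<^sup>2)
        \<le> (LINT x|lborel. (B\<^sup>2 / (real N)\<^sup>2) * (\<Sum>j<N. (inverse (2 ^ j * r))\<^sup>2 * indicator (cball (0::real^'n) (2 * (2 ^ j * r))) x))"
      proof (rule integral_mono_AE')
        show "integrable lborel (\<lambda>x::real^'n. (B\<^sup>2 / (real N)\<^sup>2) * (\<Sum>j<N. (inverse (2 ^ j * r))\<^sup>2 * indicator (cball 0 (2 * (2 ^ j * r))) x))"
          by (intro integrable_mult_right Bochner_Integration.integrable_sum ic)
        show "AE x in lborel. (norm (sym_grad (log_field e N r) x))\<^sup>2 \<le> (B\<^sup>2 / (real N)\<^sup>2) * (\<Sum>j<N. (inverse (2 ^ j * r))\<^sup>2 * indicator (cball 0 (2 * (2 ^ j * r))) x)"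
          by (intro AE_I2 norm_sym_grad_log_field_le B r N)
        show "AE x in lborel. 0 \<le> (B\<^sup>2 / (real N)\<^sup>2) * (\<Sum>j<N. (inverse (2 ^ j * r))\<^sup>2 * indicator (cball (0::real^'n) (2 * (2 ^ j * r))) x)"
          by (intro AE_I2 mult_nonneg_nonneg sum_nonneg) auto
      qed
      also have "\<dots> = (B\<^sup>2 / (real N)\<^sup>2) * (\<Sum>j<N. (inverse (2 ^ j * r))\<^sup>2 * (c * (2 * (2 ^ j * r)) ^ CARD('n)))"
        using vol r ic by (simp add: Bochner_Integration.integral_sum del: sum_mult_indicator sum_indicator_mult sum_mult_of_bool_eq sum_of_bool_mult_eq)
      also have "\<dots> = (B\<^sup>2 * c * 2 ^ CARD('n)) / (real N)\<^sup>2 * (\<Sum>j<N. (2 ^ j * r) ^ (CARD('n) - 2))"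
      proof -
        have st: "(inverse s)\<^sup>2 * (c * (2 * s) ^ CARD('n)) = c * 2 ^ CARD('n) * s ^ (CARD('n) - 2)" if "s > 0" for s :: real
        proof -
          have "s ^ CARD('n) = s\<^sup>2 * s ^ (CARD('n) - 2)" by (metis n le_add_diff_inverse power_add)
          then show ?thesis using that by (simp add: power_mult_distrib field_simps)
        qed
        have t: "(inverse (2 ^ j * r))\<^sup>2 * (c * (2 * (2 ^ j * r)) ^ CARD('n)) = c * 2 ^ CARD('n) * (2 ^ j * r) ^ (CARD('n) - 2)" for j
          by (rule st) (use r in simp)
        show ?thesis unfolding t sum_distrib_left[symmetric] by simp
      qed
      also have "\<dots> \<le> B' / (real N)\<^sup>2 * (\<Sum>j<N. (2 ^ j * r) ^ (CARD('n) - 2))"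
        using BB r by (intro mult_right_mono divide_right_mono sum_nonneg) auto
      finally show ?thesis .
    qed
  qed
qed

subsection \<open>Absolute continuity in time\<close>

lemma set_integral_mono_bound:
  fixes F :: "real \<Rightarrow> 'b::euclidean_space"
  assumes "continuous_on {c..d} F" "c \<le> d" "\<And>t. t \<in> {c..d} \<Longrightarrow> norm (F t - v) \<le> B"
  shows "norm (integral {c..d} F - (d - c) *\<^sub>R v) \<le> B * (d - c)"
proof -
  have i: "F integrable_on {c..d}" using assms(1) by (rule integrable_continuous_real)
  have "norm (integral {c..d} (\<lambda>t. F t - v)) \<le> B * (d - c)"
    using assms by (intro integral_bound continuous_intros) auto
  moreover have "integral {c..d} (\<lambda>t. F t - v) = integral {c..d} F - integral {c..d} (\<lambda>t. v)"
    by (rule Henstock_Kurzweil_Integration.integral_diff[OF i integrable_const_ivl])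
  ultimately show ?thesis using assms(2) by simp
qed

lemma has_vector_derivative_quotient:
  assumes "(G has_vector_derivative v) (at t)"
  shows "((\<lambda>h. (G (t + h) - G t) /\<^sub>R h) \<longlongrightarrow> v) (at 0)"
proof -
  have "((\<lambda>h. norm (G (t + h) - G t - h *\<^sub>R v) / norm h) \<longlongrightarrow> 0) (at 0)"
    using assms by (simp add: has_vector_derivative_def has_derivative_at)
  then have "((\<lambda>h. norm ((G (t + h) - G t) /\<^sub>R h - v)) \<longlongrightarrow> 0) (at 0)"
  proof (rule Lim_transform_eventually)
    have "norm (G (t + h) - G t - h *\<^sub>R v) / norm h = norm ((G (t + h) - G t) /\<^sub>R h - v)" if "h \<noteq> 0" for h
    proof -
      have "(G (t + h) - G t) /\<^sub>R h - v = inverse h *\<^sub>R (G (t + h) - G t - h *\<^sub>R v)"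
        using that by (simp add: scaleR_diff_right)
      then show ?thesis using that by (simp add: divide_inverse mult.commute)
    qed
    then show "\<forall>\<^sub>F h in at 0. norm (G (t + h) - G t - h *\<^sub>R v) / norm h = norm ((G (t + h) - G t) /\<^sub>R h - v)"
      by (auto simp: eventually_at_filter)
  qed
  then show ?thesis by (simp add: tendsto_norm_zero_iff LIM_zero_iff)
qed

lemma integral_const_lebesgue_on:
  fixes a b K :: real
  assumes "a \<le> b" shows "integral\<^sup>L (lebesgue_on {a..b}) (\<lambda>t. K) = K * (b - a)"
  using assms by (subst lebesgue_integral_eq_integral[OF continuous_imp_integrable_real[OF continuous_on_const]]) auto

text \<open>Difference quotients of a Lipschitz function are dominated by the Lipschitz constant and their
  integrals telescope.\<close>

lemma lipschitz_FTC:
  fixes F f :: "real \<Rightarrow> 'b::euclidean_space"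
  assumes ab: "a \<le> b" and L: "L-lipschitz_on {a..b} F"
    and f: "f \<in> borel_measurable (lebesgue_on {a..b})"
    and d: "AE t in lebesgue_on {a..b}. (F has_vector_derivative f t) (at t)"
  shows "integrable (lebesgue_on {a..b}) f" "integral\<^sup>L (lebesgue_on {a..b}) f = F b - F a"
proof -
  \<comment> \<open>Extension by the endpoint values gives the difference quotients a meaning up to
    b and keeps the Lipschitz constant on the whole line.\<close>
  define G where "G t = F (max a (min b t))" for t
  have L0: "L \<ge> 0" by (rule lipschitz_on_nonneg[OF L])
  have Glip: "norm (G s - G t) \<le> L * \<bar>s - t\<bar>" for s t
  proof -
    have "norm (G s - G t) \<le> L * dist (max a (min b s)) (max a (min b t))"
      unfolding G_def dist_norm[symmetric] by (rule lipschitz_onD[OF L]) (use ab in auto)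
    also have "\<dots> \<le> L * \<bar>s - t\<bar>" using L0 by (intro mult_left_mono) (auto simp: dist_real_def)
    finally show ?thesis .
  qed
  have "L-lipschitz_on UNIV G" using Glip L0 by (intro lipschitz_onI) (auto simp: dist_norm)
  then have Gc: "continuous_on A G" for A
    using lipschitz_on_continuous_on continuous_on_subset by blast
  define D where "D n t = real (Suc n) *\<^sub>R (G (t + inverse (real (Suc n))) - G t)" for n t
  have Dc: "continuous_on A (D n)" for n A
    unfolding D_def by (intro continuous_intros continuous_on_compose2[OF Gc[of UNIV]]) auto
  have Di: "integrable (lebesgue_on {a..b}) (D n)" for n
    by (rule continuous_imp_integrable_real[OF Dc])
  \<comment> \<open>After a translation the two integrals cancel except on intervals of length
    1/(n+1) at either end, where the averages of \<open>G\<close> tend to its endpoint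
    values.\<close>
  have D_int: "integral\<^sup>L (lebesgue_on {a..b}) (D n) =
      real (Suc n) *\<^sub>R (integral {b..b + inverse (real (Suc n))} G - integral {a..a + inverse (real (Suc n))} G)" for n
  proof -
    define s where "s = inverse (real (Suc n))"
    have s: "s > 0" by (simp add: s_def)
    have Gi: "G integrable_on {u..v}" for u v by (rule integrable_continuous_real[OF Gc])
    have sh: "integral {a..b} (\<lambda>t. G (t + s)) = integral {a + s..b + s} G"
      using integral_shift_Icc_real[of a b G s] by (simp add: o_def add.commute)
    have e1: "integral {a..a + s} G + integral {a + s..b + s} G = integral {a..b} G + integral {b..b + s} G"
      using s ab Henstock_Kurzweil_Integration.integral_combine[of a "a + s" "b + s" G] Henstock_Kurzweil_Integration.integral_combine[of a b "b + s" G] Gi by simp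
    have e2: "integral {a..b} (D n) = real (Suc n) *\<^sub>R (integral {a..b} (\<lambda>t. G (t + s)) - integral {a..b} G)"
    proof -
      have "(\<lambda>t. G (t + s)) integrable_on {a..b}"
        by (intro integrable_continuous_real continuous_on_compose2[OF Gc[of UNIV]] continuous_intros) auto
      then show ?thesis unfolding D_def s_def[symmetric]
        by (simp add: Henstock_Kurzweil_Integration.integral_diff Gi del: of_nat_Suc)
    qed
    have d: "y - z = w - x" if "x + y = z + w" for x y z w :: 'b using that by (simp add: algebra_simps)
    have "integral {a..b} (D n) = real (Suc n) *\<^sub>R (integral {b..b + s} G - integral {a..a + s} G)"
      using e2 unfolding sh d[OF e1] .
    then show ?thesis using lebesgue_integral_eq_integral[OF Di[of n]] unfolding s_def by simp
  qed
  have lim: "(\<lambda>n. real (Suc n) *\<^sub>R integral {c..c + inverse (real (Suc n))} G) \<longlonglongrightarrow> G c" for c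
  proof (rule Lim_transform)
    show "(\<lambda>n. G c) \<longlonglongrightarrow> G c" by (rule tendsto_const)
    show "(\<lambda>n. real (Suc n) *\<^sub>R integral {c..c + inverse (real (Suc n))} G - G c) \<longlonglongrightarrow> 0"
    proof (rule Lim_null_comparison)
      show "\<forall>\<^sub>F n in sequentially. norm (real (Suc n) *\<^sub>R integral {c..c + inverse (real (Suc n))} G - G c) \<le> L * inverse (real (Suc n))"
      proof (intro always_eventually allI)
        fix n
        define s where "s = inverse (real (Suc n))"
        have s: "s > 0" "real (Suc n) * s = 1" by (simp_all add: s_def)
        have "norm (integral {c..c + s} G - (c + s - c) *\<^sub>R G c) \<le> (L * s) * (c + s - c)"
        proof (rule set_integral_mono_bound[OF Gc])
          show "norm (G t - G c) \<le> L * s" if "t \<in> {c..c + s}" for t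
            using that by (intro order_trans[OF Glip] mult_left_mono L0) auto
        qed (use s in auto)
        then have "real (Suc n) * norm (integral {c..c + s} G - s *\<^sub>R G c) \<le> real (Suc n) * ((L * s) * s)"
          by (intro mult_left_mono) auto
        also have "\<dots> = L * s" using s(2) by (metis mult.assoc mult.commute mult_1)
        also have "real (Suc n) * norm (integral {c..c + s} G - s *\<^sub>R G c) = norm (real (Suc n) *\<^sub>R (integral {c..c + s} G - s *\<^sub>R G c))"
          by simp
        also have "real (Suc n) *\<^sub>R (integral {c..c + s} G - s *\<^sub>R G c) = real (Suc n) *\<^sub>R integral {c..c + s} G - G c"
          using s(2) by (simp add: scaleR_diff_right del: of_nat_Suc)
        finally show "norm (real (Suc n) *\<^sub>R integral {c..c + inverse (real (Suc n))} G - G c) \<le> L * inverse (real (Suc n))"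
          by (simp only: s_def)
      qed
      show "(\<lambda>n. L * inverse (real (Suc n))) \<longlonglongrightarrow> 0"
        using tendsto_mult_right_zero[OF LIMSEQ_inverse_real_of_nat] by simp
    qed
  qed
  have G: "G a = F a" "G b = F b" using ab by (auto simp: G_def)
  have "(\<lambda>n. integral\<^sup>L (lebesgue_on {a..b}) (D n)) \<longlonglongrightarrow> G b - G a"
    unfolding D_int scaleR_diff_right by (intro tendsto_diff lim)
  moreover have ae: "AE t in lebesgue_on {a..b}. (\<lambda>n. D n t) \<longlonglongrightarrow> f t"
  proof -
    \<comment> \<open>At a and b the extension may have a corner even where \<open>F\<close> is
      differentiable; these two times are discarded as a null set.\<close>
    have "AE t in lebesgue. t \<noteq> a" "AE t in lebesgue. t \<noteq> b" by (simp_all add: AE_completion AE_lborel_singleton)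
    then have "AE t in lebesgue_on {a..b}. t \<noteq> a \<and> t \<noteq> b"
      by (simp add: AE_restrict_space_iff) (auto elim: eventually_elim2)
    moreover have "AE t in lebesgue_on {a..b}. t \<in> {a..b}" by (rule AE_I2) simp
    ultimately show ?thesis using d
    proof eventually_elim
      case (elim t)
      then have t: "a < t" "t < b" by auto
      have "(G has_vector_derivative f t) (at t)"
        by (rule has_vector_derivative_transform_within_open[OF elim(3), of "{a<..<b}"]) (use t in \<open>auto simp: G_def\<close>)
      then have q: "((\<lambda>h. (G (t + h) - G t) /\<^sub>R h) \<longlongrightarrow> f t) (at 0)"
        by (rule has_vector_derivative_quotient)
      have "filterlim (\<lambda>n. inverse (real (Suc n))) (at 0) sequentially"
        unfolding filterlim_at using LIMSEQ_inverse_real_of_nat by auto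
      from filterlim_compose[OF q this] show ?case by (simp add: D_def)
    qed
  qed
  moreover have bd: "AE t in lebesgue_on {a..b}. norm (D n t) \<le> L" for n
  proof (rule AE_I2)
    fix t
    have "norm (D n t) \<le> real (Suc n) * (L * \<bar>t + inverse (real (Suc n)) - t\<bar>)"
      unfolding D_def norm_scaleR abs_of_nat by (rule mult_left_mono[OF Glip]) simp
    also have "\<dots> = L" by simp
    finally show "norm (D n t) \<le> L" .
  qed
  have iL: "integrable (lebesgue_on {a..b}) (\<lambda>t. L)"
    by (rule continuous_imp_integrable_real[OF continuous_on_const])
  have Dm: "D n \<in> borel_measurable (lebesgue_on {a..b})" for n using Di by (rule borel_measurable_integrable)
  show "integrable (lebesgue_on {a..b}) f" by (rule integrable_dominated_convergence[OF f Dm iL ae bd])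
  have "(\<lambda>n. integral\<^sup>L (lebesgue_on {a..b}) (D n)) \<longlonglongrightarrow> integral\<^sup>L (lebesgue_on {a..b}) f"
    by (rule integral_dominated_convergence[OF f Dm iL ae bd])
  ultimately show "integral\<^sup>L (lebesgue_on {a..b}) f = F b - F a" using LIMSEQ_unique G by metis
qed

text \<open>Integrating the derivative improves any Lipschitz constant to the essential bound of the
  derivative. For the trajectory this replaces the unspecified constant in
  \<open>rigid_motion\<close> by the bound that comes from the energy.\<close>

lemma lipschitz_of_AE_derivative_bound:
  fixes F f :: "real \<Rightarrow> 'b::euclidean_space"
  assumes L: "L-lipschitz_on {0..} F" and f: "f \<in> borel_measurable (lebesgue_on {0..})"
    and d: "AE t in lebesgue_on {0..}. (F has_vector_derivative f t) (at t)"
    and K: "AE t in lebesgue_on {0..}. norm (f t) \<le> K" "K \<ge> 0"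
  shows "K-lipschitz_on {0..} F"
proof (rule lipschitz_on_leI)
  fix a b :: real assume ab: "a \<in> {0..}" "b \<in> {0..}" "a \<le> b"
  have sub: "{a..b} \<subseteq> {0..}" using ab by auto
  have ae: "AE t in lebesgue_on {a..b}. P t" if "AE t in lebesgue_on {0..}. P t" for P
    using that sub by (simp add: AE_restrict_space_iff) (auto elim!: eventually_mono)
  have fm: "f \<in> borel_measurable (lebesgue_on {a..b})"
    using f sub by (rule measurable_restrict_mono)
  note FTC = lipschitz_FTC[OF ab(3) lipschitz_on_subset[OF L sub] fm ae[OF d]]
  have "norm (integral\<^sup>L (lebesgue_on {a..b}) f) \<le> integral\<^sup>L (lebesgue_on {a..b}) (\<lambda>t. K)"
    by (rule norm_integral_le_AE[OF continuous_imp_integrable_real[OF continuous_on_const] ae[OF K(1)]])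
  also have "\<dots> = K * (b - a)"
    by (rule integral_const_lebesgue_on[OF ab(3)])
  finally show "dist (F a) (F b) \<le> K * dist a b"
    using ab FTC(2) by (simp add: dist_norm norm_minus_commute)
qed (use K in auto)

text \<open>An average of translates of a K-Lipschitz function is K-Lipschitz, so mollification
  keeps the bound on the speed, and a kernel of radius r moves the curve by at most K r. Negative
  times are filled in with the value at 0.\<close>

lemma smooth_approximation_of_lipschitz:
  fixes h :: "real \<Rightarrow> 'b::euclidean_space"
  assumes h: "K-lipschitz_on {0..} h" and "\<delta> > 0"
  obtains g where "smooth_on UNIV g" "\<And>t. t \<ge> 0 \<Longrightarrow> norm (g t - h t) \<le> \<delta>"
    "\<And>t. norm (frechet_derivative g (at t) 1) \<le> K"
proof -
  define H where "H t = h (max t 0)" for t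
  have K: "K \<ge> 0" by (rule lipschitz_on_nonneg[OF h])
  have Hlip: "norm (H s - H t) \<le> K * \<bar>s - t\<bar>" for s t
  proof -
    have "norm (H s - H t) \<le> K * dist (max s 0) (max t 0)"
      unfolding H_def dist_norm[symmetric] by (rule lipschitz_onD[OF h]) auto
    also have "\<dots> \<le> K * \<bar>s - t\<bar>" using K by (intro mult_left_mono) (auto simp: dist_real_def)
    finally show ?thesis .
  qed
  have "K-lipschitz_on UNIV H" using Hlip K by (intro lipschitz_onI) (auto simp: dist_norm)
  then have Hc: "continuous_on A H" for A using lipschitz_on_continuous_on continuous_on_subset by blast
  have [measurable]: "H \<in> borel_measurable borel" by (rule borel_measurable_continuous_onI[OF Hc])
  have li: "locally_integrable H"
    unfolding locally_integrable_def set_integrable_def using borel_integrable_compact[OF compact_cball Hc] by simp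
  define r where "r = \<delta> / (K + 1)"
  have r: "r > 0" "K * r \<le> \<delta>" using \<open>\<delta> > 0\<close> K by (auto simp: r_def field_simps)
  obtain k :: "real \<Rightarrow> real" where k: "smooth_on UNIV k" "ball_supported r k" "\<And>z. 0 \<le> k z" "integrable lborel k" "(LINT z|lborel. k z) = 1"
    using ex_mollifier[OF r(1)] by blast
  have kc: "continuous_on UNIV k" by (rule smooth_on_continuous_on[OF k(1)])
  have [measurable]: "k \<in> borel_measurable borel" by (rule borel_measurable_continuous_onI[OF kc])
  define g where "g = conv k H"
  have refl: "integrable lborel (\<lambda>y. k y *\<^sub>R H (t - y))" "g t = (LINT y|lborel. k y *\<^sub>R H (t - y))" for t
  proof -
    have d: "distr lborel borel (\<lambda>y. t - y) = (lborel :: real measure)"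
      using lborel_affine[of "-1" t] by (simp add: density_1)
    have i: "integrable lborel (\<lambda>y. k (t - y) *\<^sub>R H y)" by (rule conv_integrable[OF kc k(2) li])
    have "integrable (distr lborel borel (\<lambda>y. t - y)) (\<lambda>y. k (t - y) *\<^sub>R H y) \<longleftrightarrow> integrable lborel (\<lambda>y. k y *\<^sub>R H (t - y))"
      by (subst integrable_distr_eq) auto
    then show "integrable lborel (\<lambda>y. k y *\<^sub>R H (t - y))" unfolding d using i by simp
    have "integral\<^sup>L (distr lborel borel (\<lambda>y. t - y)) (\<lambda>y. k (t - y) *\<^sub>R H y) = (LINT y|lborel. k y *\<^sub>R H (t - y))"
      by (subst integral_distr) auto
    then show "g t = (LINT y|lborel. k y *\<^sub>R H (t - y))" unfolding d by (simp add: g_def conv_def)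
  qed
  have gs: "smooth_on UNIV g" unfolding g_def by (rule conv_smooth[OF k(1,2) li])
  have glip: "norm (g s - g t) \<le> K * \<bar>s - t\<bar>" for s t
  proof -
    have "g s - g t = (LINT y|lborel. k y *\<^sub>R (H (s - y) - H (t - y)))"
      unfolding refl(2) scaleR_diff_right by (subst Bochner_Integration.integral_diff[OF refl(1) refl(1)]) simp
    also have "norm \<dots> \<le> (LINT y|lborel. k y * (K * \<bar>s - t\<bar>))"
    proof (rule norm_integral_le_AE)
      have "norm (k y *\<^sub>R (H (s - y) - H (t - y))) \<le> k y * (K * \<bar>s - t\<bar>)" for y
        using Hlip[of "s - y" "t - y"] k(3)[of y] by (auto intro!: mult_left_mono)
      then show "AE y in lborel. norm (k y *\<^sub>R (H (s - y) - H (t - y))) \<le> k y * (K * \<bar>s - t\<bar>)" by simp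
    qed (use k in simp)
    also have "\<dots> = K * \<bar>s - t\<bar>" using k by simp
    finally show ?thesis .
  qed
  show ?thesis
  proof (rule that[OF gs])
    show "norm (g t - h t) \<le> \<delta>" if "t \<ge> 0" for t
    proof -
      have "integrable lborel (\<lambda>y. k y *\<^sub>R H t)" using k(4) by simp
      then have "g t - H t = (LINT y|lborel. k y *\<^sub>R (H (t - y) - H t))"
        unfolding refl(2) scaleR_diff_right using k(4,5) by (subst Bochner_Integration.integral_diff[OF refl(1)]) auto
      also have "norm \<dots> \<le> (LINT y|lborel. k y * (K * r))"
      proof (rule norm_integral_le_AE)
        have "norm (k y *\<^sub>R (H (t - y) - H t)) \<le> k y * (K * r)" for y
        proof (cases "\<bar>y\<bar> \<le> r")
          case True
          then have "norm (H (t - y) - H t) \<le> K * r" using K by (intro order_trans[OF Hlip] mult_left_mono) auto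
          then show ?thesis using k(3)[of y] by (auto intro!: mult_left_mono)
        next
          case False
          then have "k y = 0" using k(2) by (simp add: ball_supported_def)
          then show ?thesis by simp
        qed
        then show "AE y in lborel. norm (k y *\<^sub>R (H (t - y) - H t)) \<le> k y * (K * r)" by simp
      qed (use k in simp)
      also have "\<dots> \<le> \<delta>" using k r by simp
      finally show ?thesis using that by (simp add: H_def)
    qed
    show "norm (frechet_derivative g (at t) 1) \<le> K" for t
    proof -
      have l: "linear (frechet_derivative g (at t))"
        using smooth_on_has_derivative[OF gs UNIV_I] has_derivative_linear by blast
      have "(g has_vector_derivative frechet_derivative g (at t) 1) (at t)"
        unfolding has_vector_derivative_def using smooth_on_has_derivative[OF gs UNIV_I, of t]
          linear_cmul[OF l, of _ 1, symmetric] by simp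
      from tendsto_norm[OF has_vector_derivative_quotient[OF this]]
      show ?thesis
      proof (rule tendsto_upperbound)
        show "\<forall>\<^sub>F h in at 0. norm ((g (t + h) - g t) /\<^sub>R h) \<le> K"
          using glip[of "t + _" t] by (auto simp: eventually_at_filter divide_simps mult.commute)
      qed simp
    qed
  qed
qed

section \<open>Recovering a derivative from one-sided averages\<close>

definition smooth_step'' :: "real \<Rightarrow> real" where
  "smooth_step'' y = frechet_derivative smooth_step' (at y) 1"

lemma frechet_derivative_real_has_field_derivative:
  assumes "smooth_on UNIV (p :: real \<Rightarrow> real)"
  shows "(p has_field_derivative frechet_derivative p (at y) 1) (at y)"
proof -
  have l: "linear (frechet_derivative p (at y))"
    using smooth_on_has_derivative[OF assms UNIV_I] has_derivative_linear by blast
  have "frechet_derivative p (at y) = (*) (frechet_derivative p (at y) 1)"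
  proof (rule ext)
    show "frechet_derivative p (at y) h = frechet_derivative p (at y) 1 * h" for h
      using linear_cmul[OF l, of h 1] by (simp add: mult.commute)
  qed
  then show ?thesis unfolding has_field_derivative_def
    by (rule has_derivative_eq_rhs[OF smooth_on_has_derivative[OF assms UNIV_I]])
qed

lemma smooth_step_DERIV: "(smooth_step has_field_derivative smooth_step' y) (at y)"
  unfolding smooth_step'_def by (rule frechet_derivative_real_has_field_derivative[OF smooth_step_smooth])

lemma smooth_step'_DERIV: "(smooth_step' has_field_derivative smooth_step'' y) (at y)"
  unfolding smooth_step''_def by (rule frechet_derivative_real_has_field_derivative[OF smooth_step'_smooth])

lemma smooth_step_derivative_bounds:
  obtains C where "C > 0" "\<And>y. \<bar>smooth_step' y\<bar> \<le> C" "\<And>y. \<bar>smooth_step'' y\<bar> \<le> C"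
proof -
  have s1: "ball_supported 1 smooth_step'"
    using smooth_step'_0 by (auto simp: ball_supported_def abs_if split: if_splits)
  obtain C1 where C1: "C1 > 0" "\<And>y. norm (smooth_step' y) \<le> C1"
    using ball_supported_bounded[OF smooth_on_continuous_on[OF smooth_step'_smooth] s1] by blast
  have "ball_supported 1 smooth_step''"
    unfolding smooth_step''_def[abs_def] by (rule ball_supported_frechet_derivative[OF s1])
  moreover have "continuous_on UNIV smooth_step''"
    unfolding smooth_step''_def[abs_def] by (intro smooth_on_continuous_on smooth_on_frechet_derivative smooth_step'_smooth)
  ultimately obtain C2 where C2: "C2 > 0" "\<And>y. norm (smooth_step'' y) \<le> C2"
    using ball_supported_bounded by blast
  show ?thesis
  proof (rule that[of "max C1 C2"])
    show "\<bar>smooth_step' y\<bar> \<le> max C1 C2" "\<bar>smooth_step'' y\<bar> \<le> max C1 C2" for y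
      using C1(2)[of y] C2(2)[of y] by auto
  qed (use C1 in auto)
qed

lemma AE_lebesgue_on_mono:
  assumes "AE t in lebesgue_on A. P t" "B \<subseteq> A" "A \<in> sets lebesgue" "B \<in> sets lebesgue"
  shows "AE t in lebesgue_on B. P t"
  using assms by (simp add: AE_restrict_space_iff) (auto elim!: eventually_mono)

text \<open>The kernel has mass 1 on [a, a + \<tau>], but at a the function \<open>f\<close> is
  known only as the derivative of \<open>g\<close>. Subtracting the tangent leaves \<open>H\<close>
  with H(t) = o(t - a), and integration by parts moves the derivative to the kernel, where it costs
  1/\<tau>^2 against an interval of length \<tau> and values of \<open>H\<close> of order
  o(\<tau>).\<close>

lemma smooth_step'_kernel_limit:
  fixes f g :: "real \<Rightarrow> real"
  assumes a: "a > 0" and L: "L-lipschitz_on {0..} g" and f: "f \<in> borel_measurable (lebesgue_on {0..})"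
    and d: "AE t in lebesgue_on {0..}. (g has_vector_derivative f t) (at t)"
    and da: "(g has_vector_derivative f a) (at a)"
    and "e > 0"
  obtains \<Lambda> where "\<Lambda> > 0" "\<And>\<tau>. 0 < \<tau> \<Longrightarrow> \<tau> < \<Lambda> \<Longrightarrow>
     \<bar>integral\<^sup>L (lebesgue_on {a..a + \<tau>}) (\<lambda>t. smooth_step' ((t - a) / \<tau>) / \<tau> * f t) - f a\<bar> \<le> e"
proof -
  obtain C where C: "C > 0" "\<And>y. \<bar>smooth_step' y\<bar> \<le> C" "\<And>y. \<bar>smooth_step'' y\<bar> \<le> C"
    using smooth_step_derivative_bounds by blast
  define H where "H t = g t - g a - (t - a) * f a" for t
  have Hd: "(g has_vector_derivative v) (at t) \<Longrightarrow> (H has_vector_derivative (v - f a)) (at t)" for t v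
    unfolding H_def[abs_def] by (auto intro!: derivative_eq_intros)
  \<comment> \<open>The boundary term and the integral each contribute at most C e'.\<close>
  define e' where "e' = e / (2 * C)"
  have e': "e' > 0" using \<open>e > 0\<close> C by (simp add: e'_def)
  have "((\<lambda>h. (H (a + h) - H a) /\<^sub>R h) \<longlongrightarrow> 0) (at 0)"
    using has_vector_derivative_quotient[OF Hd[OF da]] by simp
  then obtain \<Lambda> where \<Lambda>: "\<Lambda> > 0" "\<And>h. h \<noteq> 0 \<Longrightarrow> \<bar>h\<bar> < \<Lambda> \<Longrightarrow> \<bar>(H (a + h) - H a) / h\<bar> < e'"
    using e' unfolding Lim_at by (auto simp: dist_norm divide_inverse mult.commute)
  have H0: "H a = 0" by (simp add: H_def)
  have Hsmall: "\<bar>H t\<bar> \<le> e' * \<tau>" if "0 < \<tau>" "\<tau> < \<Lambda>" "t \<in> {a..a + \<tau>}" for t \<tau>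
  proof (cases "t = a")
    case True then show ?thesis using that e' by (simp add: H0)
  next
    case False
    then have "\<bar>H t / (t - a)\<bar> < e'" using \<Lambda>(2)[of "t - a"] that by (simp add: H0)
    then have "\<bar>H t\<bar> \<le> e' * (t - a)" using False that by (simp add: abs_divide field_simps)
    also have "\<dots> \<le> e' * \<tau>" using that e' by (intro mult_left_mono) auto
    finally show ?thesis .
  qed
  show ?thesis
  proof (rule that[OF \<Lambda>(1)])
    fix \<tau> assume \<tau>: "0 < \<tau>" "\<tau> < \<Lambda>"
    let ?I = "{a..a + \<tau>}"
    define p where "p t = smooth_step' ((t - a) / \<tau>)" for t
    define q where "q t = smooth_step'' ((t - a) / \<tau>)" for t
    have inner: "((\<lambda>t. (t - a) / \<tau>) has_field_derivative 1 / \<tau>) (at t)" for t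
      using \<tau> by (auto intro!: derivative_eq_intros)
    have pd: "(p has_field_derivative q t / \<tau>) (at t)" for t
      unfolding p_def[abs_def] q_def using DERIV_chain2[OF smooth_step'_DERIV inner] by simp
    have pC: "\<bar>p t\<bar> \<le> C" "\<bar>q t\<bar> \<le> C" for t using C by (auto simp: p_def q_def)
    have pc: "continuous_on A p" for A by (intro continuous_at_imp_continuous_on) (auto intro: DERIV_isCont pd)
    have qc: "continuous_on A q" for A
      unfolding q_def smooth_step''_def using \<tau>
      by (intro continuous_on_compose2[OF smooth_on_continuous_on[OF smooth_on_frechet_derivative[OF smooth_step'_smooth]]] continuous_intros) auto
    have plip: "\<bar>p s - p t\<bar> \<le> C / \<tau> * \<bar>s - t\<bar>" for s t
      using field_differentiable_bound[of UNIV p "\<lambda>t. q t / \<tau>" "C / \<tau>" s t] pd pC \<tau>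
      by (auto simp: divide_right_mono)
    have sub: "?I \<subseteq> {0..}" using a by auto
    have aeI: "AE t in lebesgue_on ?I. P t" if "AE t in lebesgue_on {0..}. P t" for P
      by (rule AE_lebesgue_on_mono[OF that sub]) auto
    have fm: "f \<in> borel_measurable (lebesgue_on ?I)" using f sub by (rule measurable_restrict_mono)
    have L0: "L \<ge> 0" by (rule lipschitz_on_nonneg[OF L])
    have Hl: "\<bar>H s - H t\<bar> \<le> (L + \<bar>f a\<bar>) * \<bar>s - t\<bar>" if "s \<in> ?I" "t \<in> ?I" for s t
    proof -
      have "\<bar>g s - g t\<bar> \<le> L * \<bar>s - t\<bar>" using lipschitz_onD[OF L, of s t] that a by (simp add: dist_real_def)
      moreover have "\<bar>(s - t) * f a\<bar> = \<bar>f a\<bar> * \<bar>s - t\<bar>" by (simp add: abs_mult)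
      moreover have "H s - H t = (g s - g t) - (s - t) * f a" by (simp add: H_def algebra_simps)
      ultimately show ?thesis by (simp add: distrib_right)
    qed
    \<comment> \<open>A product of two bounded Lipschitz functions is Lipschitz, so
      \<open>lipschitz_FTC\<close> applied to \<open>P\<close> is the integration by parts, although
      \<open>g\<close> is differentiable only almost everywhere.\<close>
    define P where "P t = p t * H t" for t
    have Plip: "(C * (L + \<bar>f a\<bar>) + C / \<tau> * (e' * \<tau>))-lipschitz_on ?I P"
    proof (rule lipschitz_onI)
      fix s t assume st: "s \<in> ?I" "t \<in> ?I"
      have "P s - P t = p s * (H s - H t) + (p s - p t) * H t" by (simp add: P_def algebra_simps)
      then have "\<bar>P s - P t\<bar> \<le> \<bar>p s\<bar> * \<bar>H s - H t\<bar> + \<bar>p s - p t\<bar> * \<bar>H t\<bar>"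
        by (metis abs_mult abs_triangle_ineq)
      also have "\<dots> \<le> C * ((L + \<bar>f a\<bar>) * \<bar>s - t\<bar>) + (C / \<tau> * \<bar>s - t\<bar>) * (e' * \<tau>)"
        using st pC Hl plip Hsmall \<tau> C L0 by (intro add_mono mult_mono) auto
      also have "x * (y * d) + (k * d) * z = (x * y + k * z) * d" for x y k z d :: real by (simp add: algebra_simps)
      finally show "dist (P s) (P t) \<le> (C * (L + \<bar>f a\<bar>) + C / \<tau> * (e' * \<tau>)) * dist s t"
        by (simp only: dist_real_def)
    qed (use C L0 e' \<tau> in auto)
    have pm: "p \<in> borel_measurable (lebesgue_on ?I)" "q \<in> borel_measurable (lebesgue_on ?I)" "H \<in> borel_measurable (lebesgue_on ?I)"
    proof -
      have "continuous_on {0..} H" unfolding H_def using lipschitz_on_continuous_on[OF L] by (intro continuous_intros)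
      then have "continuous_on ?I H" using sub continuous_on_subset by blast
      then show "H \<in> borel_measurable (lebesgue_on ?I)" by (rule continuous_imp_measurable_on_sets_lebesgue) auto
    qed (auto intro!: continuous_imp_measurable_on_sets_lebesgue pc qc)
    define P' where "P' t = q t / \<tau> * H t + p t * (f t - f a)" for t
    have P'm: "P' \<in> borel_measurable (lebesgue_on ?I)"
      unfolding P'_def[abs_def] using pm fm by (intro borel_measurable_add borel_measurable_times borel_measurable_divide borel_measurable_diff borel_measurable_const)
    have P'd: "AE t in lebesgue_on ?I. (P has_vector_derivative P' t) (at t)"
      using aeI[OF d]
    proof eventually_elim
      case (elim t)
      have "(P has_vector_derivative (p t * (f t - f a) + (q t / \<tau>) * H t)) (at t)"
        unfolding P_def[abs_def]
        by (rule has_vector_derivative_mult[OF has_real_derivative_iff_has_vector_derivative[THEN iffD1, OF pd] Hd[OF elim]])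
      then show ?case by (simp add: P'_def add.commute)
    qed
    have "a \<le> a + \<tau>" using \<tau> by simp
    note FTC = lipschitz_FTC[OF this Plip P'm P'd]
    have qH: "integrable (lebesgue_on ?I) (\<lambda>t. q t / \<tau> * H t)"
      unfolding H_def using lipschitz_on_continuous_on[OF L] sub \<tau>
      by (intro continuous_imp_integrable_real continuous_intros qc) (auto intro: continuous_on_subset)
    have ip: "integrable (lebesgue_on ?I) p" by (rule continuous_imp_integrable_real[OF pc])
    have "integrable (lebesgue_on ?I) (\<lambda>t. P' t - q t / \<tau> * H t + f a * p t)"
      using FTC(1) qH ip by (intro Bochner_Integration.integrable_add Bochner_Integration.integrable_diff integrable_mult_right)
    then have ipf: "integrable (lebesgue_on ?I) (\<lambda>t. p t * f t)"
      by (simp add: P'_def algebra_simps)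
    have intp: "integral\<^sup>L (lebesgue_on ?I) p = \<tau>"
    proof -
      have D: "((\<lambda>t. \<tau> * smooth_step ((t - a) / \<tau>)) has_field_derivative p t) (at t)" for t
      proof -
        have "((\<lambda>t. \<tau> * smooth_step ((t - a) / \<tau>)) has_field_derivative \<tau> * (smooth_step' ((t - a) / \<tau>) * (1 / \<tau>))) (at t)"
          by (intro DERIV_cmult DERIV_chain2[OF smooth_step_DERIV] inner)
        moreover have "\<tau> * (smooth_step' ((t - a) / \<tau>) * (1 / \<tau>)) = p t" using \<tau> by (simp add: p_def)
        ultimately show ?thesis by simp
      qed
      have "(p has_integral (\<tau> * smooth_step ((a + \<tau> - a) / \<tau>) - \<tau> * smooth_step ((a - a) / \<tau>))) ?I"
        by (rule fundamental_theorem_of_calculus)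
          (use \<tau> in simp, rule has_field_derivative_at_within[OF D, unfolded has_real_derivative_iff_has_vector_derivative])
      then have "(p has_integral \<tau>) ?I" using \<tau> smooth_step_0[of 0] smooth_step_1[of 1] by simp
      then have "integral ?I p = \<tau>" by (rule integral_unique)
      moreover have "?I \<in> sets lebesgue" by simp
      ultimately show ?thesis using lebesgue_integral_eq_integral[OF ip] by simp
    qed
    have "integral\<^sup>L (lebesgue_on ?I) P' = integral\<^sup>L (lebesgue_on ?I) (\<lambda>t. q t / \<tau> * H t + p t * f t - f a * p t)"
      by (intro Bochner_Integration.integral_cong refl) (simp add: P'_def algebra_simps)
    also have "\<dots> = integral\<^sup>L (lebesgue_on ?I) (\<lambda>t. q t / \<tau> * H t) + integral\<^sup>L (lebesgue_on ?I) (\<lambda>t. p t * f t) - f a * \<tau>"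
      using qH ipf ip intp by simp
    finally have e1: "integral\<^sup>L (lebesgue_on ?I) (\<lambda>t. p t * f t) - f a * \<tau> = P (a + \<tau>) - P a - integral\<^sup>L (lebesgue_on ?I) (\<lambda>t. q t / \<tau> * H t)"
      using FTC(2) by simp
    have "\<bar>P (a + \<tau>)\<bar> \<le> C * (e' * \<tau>)"
      unfolding P_def abs_mult using pC Hsmall[OF \<tau>, of "a + \<tau>"] \<tau> C by (intro mult_mono) auto
    moreover have "P a = 0" by (simp add: P_def H0)
    moreover have "\<bar>integral\<^sup>L (lebesgue_on ?I) (\<lambda>t. q t / \<tau> * H t)\<bar> \<le> C * (e' * \<tau>)"
    proof -
      have "norm (integral\<^sup>L (lebesgue_on ?I) (\<lambda>t. q t / \<tau> * H t)) \<le> integral\<^sup>L (lebesgue_on ?I) (\<lambda>t. C * e')"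
      proof (rule norm_integral_le_AE)
        show "AE t in lebesgue_on ?I. norm (q t / \<tau> * H t) \<le> C * e'"
        proof (rule AE_I2)
          fix t assume "t \<in> space (lebesgue_on ?I)"
          then have "\<bar>H t\<bar> \<le> e' * \<tau>" using Hsmall[OF \<tau>] by simp
          then have "\<bar>q t\<bar> * \<bar>H t\<bar> \<le> C * (e' * \<tau>)" using pC(2)[of t] C by (intro mult_mono) auto
          then show "norm (q t / \<tau> * H t) \<le> C * e'" using \<tau> by (simp add: abs_mult field_simps)
        qed
      qed (rule continuous_imp_integrable_real[OF continuous_on_const])
      also have "\<dots> = C * e' * \<tau>" using \<tau> by (subst integral_const_lebesgue_on) auto
      finally show ?thesis by simp
    qed
    ultimately have "\<bar>integral\<^sup>L (lebesgue_on ?I) (\<lambda>t. p t * f t) - f a * \<tau>\<bar> \<le> C * (e' * \<tau>) + C * (e' * \<tau>)"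
      unfolding e1 by linarith
    also have "\<dots> = e * \<tau>" using C by (simp add: e'_def)
    finally have "\<bar>integral\<^sup>L (lebesgue_on ?I) (\<lambda>t. p t * f t) - f a * \<tau>\<bar> / \<tau> \<le> e" using \<tau> by (simp add: pos_divide_le_eq)
    moreover have "integral\<^sup>L (lebesgue_on ?I) (\<lambda>t. p t / \<tau> * f t) = integral\<^sup>L (lebesgue_on ?I) (\<lambda>t. p t * f t) / \<tau>" by simp
    moreover have "\<bar>x / \<tau> - f a\<bar> = \<bar>x - f a * \<tau>\<bar> / \<tau>" for x
    proof -
      have "x / \<tau> - f a = (x - f a * \<tau>) / \<tau>" using \<tau> by (simp add: diff_divide_distrib)
      then show ?thesis using \<tau> by simp
    qed
    ultimately show "\<bar>integral\<^sup>L (lebesgue_on ?I) (\<lambda>t. smooth_step' ((t - a) / \<tau>) / \<tau> * f t) - f a\<bar> \<le> e"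
      by (simp add: p_def)
  qed
qed

subsection \<open>Moments of the rigid body\<close>

text \<open>A measure that gives boxes their volume is Lebesgue measure. The preimage of a box is
  its image under a translation followed by the orthogonal map \<open>transpose Q\<close>, and
  neither changes the volume.\<close>

lemma lborel_distr_rigid:
  fixes Q :: "real^'n::{finite,wellorder}^'n::_"
  assumes Q: "orthogonal_matrix Q"
  shows "distr lborel borel (\<lambda>y. Q *v y + h) = lborel"
proof (rule lborel_eqI[symmetric])
  fix l u :: "real^'n::_" assume lu: "\<And>b. b \<in> Basis \<Longrightarrow> l \<bullet> b \<le> u \<bullet> b"
  have QQ: "transpose Q ** Q = mat 1" "Q ** transpose Q = mat 1" using Q by (auto simp: orthogonal_matrix_def)
  have inv: "transpose Q *v (Q *v y) = y" "Q *v (transpose Q *v y) = y" for y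
    by (simp_all add: matrix_vector_mul_assoc QQ del: transpose_matrix_vector)
  have m: "(\<lambda>y. Q *v y + h) \<in> borel_measurable borel"
    by (intro borel_measurable_continuous_onI continuous_intros)
  have ot: "orthogonal_transformation ((*v) (transpose Q))"
    using Q by (simp add: orthogonal_transformation_matrix orthogonal_matrix_transpose)
  have eq: "(\<lambda>y. Q *v y + h) -` box l u = (*v) (transpose Q) ` ((\<lambda>x. x - h) ` box l u)"
  proof (intro equalityI subsetI)
    fix y assume "y \<in> (\<lambda>y. Q *v y + h) -` box l u"
    then show "y \<in> (*v) (transpose Q) ` ((\<lambda>x. x - h) ` box l u)"
      by (intro image_eqI[where f = "(*v) (transpose Q)" and x = "Q *v y", OF inv(1)[symmetric]] image_eqI[where f = "\<lambda>x. x - h" and x = "Q *v y + h"]) auto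
  qed (auto simp: inv simp del: transpose_matrix_vector)
  have bl: "(\<lambda>x. x - h) ` box l u \<in> lmeasurable" by (intro measurable_translation_subtract lmeasurable_box)
  have "emeasure (distr lborel borel (\<lambda>y. Q *v y + h)) (box l u) = emeasure lborel ((\<lambda>y. Q *v y + h) -` box l u)"
    using m by (subst emeasure_distr) auto
  also have "\<dots> = emeasure lebesgue ((*v) (transpose Q) ` ((\<lambda>x. x - h) ` box l u))"
  proof -
    have "(\<lambda>y. Q *v y + h) -` box l u \<in> sets lborel" using measurable_sets_borel[OF m, of "box l u"] by simp
    then show ?thesis unfolding eq by simp
  qed
  also have "\<dots> = ennreal (measure lebesgue ((*v) (transpose Q) ` ((\<lambda>x. x - h) ` box l u)))"
    using measurable_orthogonal_image[OF ot bl] by (simp add: emeasure_eq_measure2)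
  also have "\<dots> = ennreal (measure lebesgue (box l u))"
    by (simp only: measure_orthogonal_image[OF ot bl] measure_translation_subtract)
  also have "\<dots> = emeasure lborel (box l u)" using lu by (simp add: emeasure_lborel_box_eq)
  also have "\<dots> = (\<Prod>b\<in>Basis. (u - l) \<bullet> b)" using lu by (simp add: emeasure_lborel_box_eq)
  finally show "emeasure (distr lborel borel (\<lambda>y. Q *v y + h)) (box l u) = (\<Prod>b\<in>Basis. (u - l) \<bullet> b)" .
qed simp

text \<open>The exceptional set is covered by a Borel null set, whose preimage under the rigid map
  is again null by the invariance of \<open>lborel\<close>.\<close>

lemma lebesgue_AE_rigid:
  fixes Q :: "real^'n::{finite,wellorder}^'n::_"
  assumes Q: "orthogonal_matrix Q" and P: "AE y in lebesgue. P y"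
  shows "AE x in lebesgue. P (transpose Q *v (x - h))"
proof -
  have Q': "orthogonal_matrix (transpose Q)" using Q by (simp add: orthogonal_matrix_transpose)
  obtain N where N: "N \<in> null_sets lborel" "{y. \<not> P y} \<subseteq> N"
    using P unfolding AE_completion_iff by (auto simp: eventually_ae_filter)
  have m: "(\<lambda>x. transpose Q *v x + (- (transpose Q *v h))) \<in> borel_measurable borel"
    by (intro borel_measurable_continuous_onI continuous_intros)
  have "emeasure lborel N = 0" "N \<in> sets borel" using N by (auto simp: null_sets_def)
  then have "emeasure (distr lborel borel (\<lambda>x. transpose Q *v x + (- (transpose Q *v h)))) N = 0"
    unfolding lborel_distr_rigid[OF Q'] by simp
  then have "emeasure lborel ((\<lambda>x. transpose Q *v x + (- (transpose Q *v h))) -` N) = 0"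
    using m \<open>N \<in> sets borel\<close> by (subst (asm) emeasure_distr) auto
  then have "(\<lambda>x. transpose Q *v x + (- (transpose Q *v h))) -` N \<in> null_sets lborel"
    using m \<open>N \<in> sets borel\<close> by (auto simp: null_sets_def dest: measurable_sets_borel)
  moreover have "{x. \<not> P (transpose Q *v (x - h))} \<subseteq> (\<lambda>x. transpose Q *v x + (- (transpose Q *v h))) -` N"
    using N(2) by (auto simp: matrix_vector_mult_diff_distrib simp del: transpose_matrix_vector)
  ultimately show ?thesis unfolding AE_completion_iff by (auto simp: eventually_ae_filter)
qed

lemma lebesgue_integral_rigid:
  fixes Q :: "real^'n::{finite,wellorder}^'n::_" and F :: "real^'n::_ \<Rightarrow> 'b::euclidean_space"
  assumes Q: "orthogonal_matrix Q" and F: "F \<in> borel_measurable lebesgue"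
  shows "integrable lebesgue (\<lambda>x. F (transpose Q *v (x - h))) \<longleftrightarrow> integrable lebesgue F"
    and "(LINT x|lebesgue. F (transpose Q *v (x - h))) = (LINT y|lebesgue. F y)"
proof -
  have Q': "orthogonal_matrix (transpose Q)" using Q by (simp add: orthogonal_matrix_transpose)
  obtain G where G: "G \<in> borel_measurable borel" "AE x in lebesgue. F x = G x"
    using ex_borel_representative[OF F] by blast
  let ?\<Phi> = "\<lambda>x. transpose Q *v x + (- (transpose Q *v h))"
  have \<Phi>: "transpose Q *v (x - h) = ?\<Phi> x" for x by (simp add: matrix_vector_mult_diff_distrib del: transpose_matrix_vector)
  have m: "?\<Phi> \<in> borel_measurable borel"
    by (intro borel_measurable_continuous_onI continuous_intros)
  have Gm: "(\<lambda>x. G (?\<Phi> x)) \<in> borel_measurable borel" by (rule measurable_compose[OF m G(1)])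
  have ae: "AE x in lebesgue. F (transpose Q *v (x - h)) = G (?\<Phi> x)"
    using lebesgue_AE_rigid[OF Q G(2), of h] unfolding \<Phi> .
  have "integrable lborel (\<lambda>x. G (?\<Phi> x)) \<longleftrightarrow> integrable (distr lborel borel ?\<Phi>) G"
    using m G(1) by (subst integrable_distr_eq) auto
  then show "integrable lebesgue (\<lambda>x. F (transpose Q *v (x - h))) \<longleftrightarrow> integrable lebesgue F"
    unfolding lebesgue_AE_borel(2)[OF Gm ae] lebesgue_AE_borel(2)[OF G] lborel_distr_rigid[OF Q'] .
  have "(LINT x|lborel. G (?\<Phi> x)) = integral\<^sup>L (distr lborel borel ?\<Phi>) G"
    using m G(1) by (subst integral_distr) auto
  then show "(LINT x|lebesgue. F (transpose Q *v (x - h))) = (LINT y|lebesgue. F y)"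
    unfolding lebesgue_AE_borel(3)[OF Gm ae] lebesgue_AE_borel(3)[OF G] lborel_distr_rigid[OF Q'] .
qed

text \<open>The angular part drops out because the centre of mass of the body sits at the origin of the body frame.\<close>

lemma body_momentum:
  fixes Q :: "real^'n::{finite,wellorder}^'n::_" and L :: "real^'n::_ \<Rightarrow> real^'n::_"
  assumes Q: "orthogonal_matrix Q" and S: "rigid_body S \<rho>" and L: "linear L"
  shows "integrable lebesgue (\<lambda>x. indicator (body_position S h Q) x * (body_density \<rho> h Q x * ((l + L (x - h)) \<bullet> e)))"
    and "(LINT x|lebesgue. indicator (body_position S h Q) x * (body_density \<rho> h Q x * ((l + L (x - h)) \<bullet> e))) = mass S \<rho> * (l \<bullet> e)"
proof -
  have inv: "Q *v (transpose Q *v y) = y" for y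
    using Q by (simp add: matrix_vector_mul_assoc orthogonal_matrix_def del: transpose_matrix_vector)
  \<comment> \<open>The adjoint moves \<open>L\<close> onto \<open>e\<close>, so that in body
    coordinates the density is multiplied by a constant plus a linear form in y.\<close>
  define A where "A = adjoint L e"
  define c where "c = transpose Q *v A"
  define F where "F y = indicator S y * (\<rho> y * (l \<bullet> e + y \<bullet> c))" for y
  have i1: "integrable lebesgue (\<lambda>y. indicator S y *\<^sub>R \<rho> y)" and i2: "integrable lebesgue (\<lambda>y. indicator S y *\<^sub>R (\<rho> y *\<^sub>R y))"
    and z: "(LINT y|lebesgue. indicator S y *\<^sub>R (\<rho> y *\<^sub>R y)) = 0"
    using S by (auto simp: rigid_body_def set_integrable_def set_lebesgue_integral_def)
  have Feq: "F y = (indicator S y *\<^sub>R \<rho> y) * (l \<bullet> e) + (indicator S y *\<^sub>R (\<rho> y *\<^sub>R y)) \<bullet> c" for y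
    by (simp add: F_def algebra_simps)
  have i2c: "integrable lebesgue (\<lambda>y. (indicator S y *\<^sub>R (\<rho> y *\<^sub>R y)) \<bullet> c)" by (rule integrable_inner_left[OF i2])
  have Fi: "integrable lebesgue F" unfolding Feq[abs_def] using i1 i2c by (intro Bochner_Integration.integrable_add integrable_mult_left)
  have Fint: "(LINT y|lebesgue. F y) = mass S \<rho> * (l \<bullet> e)"
  proof -
    have "(LINT y|lebesgue. F y) = (LINT y|lebesgue. indicator S y *\<^sub>R \<rho> y) * (l \<bullet> e) + (LINT y|lebesgue. indicator S y *\<^sub>R (\<rho> y *\<^sub>R y)) \<bullet> c"
      unfolding Feq using i1 i2c integral_inner_left[OF i2, of c] by (subst Bochner_Integration.integral_add) auto
    then show ?thesis by (simp only: z mass_def set_lebesgue_integral_def inner_zero_left add_0_right)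
  qed
  have eq: "indicator (body_position S h Q) x * (body_density \<rho> h Q x * ((l + L (x - h)) \<bullet> e)) = F (transpose Q *v (x - h))" for x
  proof -
    have "(transpose Q *v (x - h)) \<bullet> c = (x - h) \<bullet> A"
      unfolding c_def by (metis dot_lmul_matrix inv transpose_matrix_vector transpose_transpose)
    also have "\<dots> = L (x - h) \<bullet> e" unfolding A_def by (rule adjoint_works[OF L])
    finally show ?thesis by (simp add: F_def body_position_def body_density_def indicator_def inner_add_left)
  qed
  show "integrable lebesgue (\<lambda>x. indicator (body_position S h Q) x * (body_density \<rho> h Q x * ((l + L (x - h)) \<bullet> e)))"
    unfolding eq using lebesgue_integral_rigid(1)[OF Q borel_measurable_integrable[OF Fi]] Fi by simp
  show "(LINT x|lebesgue. indicator (body_position S h Q) x * (body_density \<rho> h Q x * ((l + L (x - h)) \<bullet> e))) = mass S \<rho> * (l \<bullet> e)"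
    unfolding eq using lebesgue_integral_rigid(2)[OF Q borel_measurable_integrable[OF Fi]] Fint by simp
qed

text \<open>With w the rigid velocity at x, 2 (w . l) - |l|^2 \<le> |w|^2. Integrated against the
  density, the left side is evaluated by \<open>body_momentum\<close> and equals m |l|^2. The right
  side might be infinite at this stage, hence the extended integral.\<close>

lemma body_energy:
  fixes Q :: "real^'n::{finite,wellorder}^'n::_" and L :: "real^'n::_ \<Rightarrow> real^'n::_"
  assumes Q: "orthogonal_matrix Q" and S: "rigid_body S \<rho>" and L: "linear L"
  shows "ennreal (mass S \<rho> * (norm l)\<^sup>2)
    \<le> (\<integral>\<^sup>+x. ennreal (indicator (body_position S h Q) x * (body_density \<rho> h Q x * (norm (l + L (x - h)))\<^sup>2)) \<partial>lebesgue)"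
proof -
  let ?B = "body_position S h Q" and ?\<rho> = "body_density \<rho> h Q"
  have pos: "indicator ?B x * ?\<rho> x \<ge> 0" for x
    using S by (auto simp: rigid_body_def body_position_def body_density_def indicator_def intro: less_imp_le)
  have i0: "integrable lebesgue (\<lambda>x. indicator ?B x * ?\<rho> x)" and m0: "(LINT x|lebesgue. indicator ?B x * ?\<rho> x) = mass S \<rho>"
  proof -
    have i1: "integrable lebesgue (\<lambda>y. indicator S y * \<rho> y)"
      using S by (auto simp: rigid_body_def set_integrable_def)
    have eq: "indicator ?B x * ?\<rho> x = (\<lambda>y. indicator S y * \<rho> y) (transpose Q *v (x - h))" for x
      by (simp add: body_position_def body_density_def indicator_def)
    show "integrable lebesgue (\<lambda>x. indicator ?B x * ?\<rho> x)"
      unfolding eq using lebesgue_integral_rigid(1)[OF Q borel_measurable_integrable[OF i1], of h] i1 by simp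
    show "(LINT x|lebesgue. indicator ?B x * ?\<rho> x) = mass S \<rho>"
      unfolding eq using lebesgue_integral_rigid(2)[OF Q borel_measurable_integrable[OF i1], of h] by (simp add: mass_def set_lebesgue_integral_def)
  qed
  note bm = body_momentum[OF Q S L, of h l l]
  define G where "G x = 2 * (indicator ?B x * (?\<rho> x * ((l + L (x - h)) \<bullet> l))) - (norm l)\<^sup>2 * (indicator ?B x * ?\<rho> x)" for x
  have Gi: "integrable lebesgue G"
    unfolding G_def[abs_def] by (intro Bochner_Integration.integrable_diff integrable_mult_right bm(1) i0)
  have "(LINT x|lebesgue. G x) = 2 * (mass S \<rho> * (l \<bullet> l)) - (norm l)\<^sup>2 * mass S \<rho>"
    unfolding G_def using bm i0 m0 by simp
  then have "mass S \<rho> * (norm l)\<^sup>2 = (LINT x|lebesgue. G x)" by (simp add: dot_square_norm)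
  also have "ennreal (LINT x|lebesgue. G x) \<le> (\<integral>\<^sup>+x. ennreal (G x) \<partial>lebesgue)"
  proof -
    \<comment> \<open>\<open>ennreal\<close> truncates at 0, so the nonnegative integral of
      \<open>G\<close> is that of its positive part, which dominates the integral of
      \<open>G\<close>.\<close>
    have e: "ennreal (max 0 y) = ennreal y" for y :: real by (simp add: max_def ennreal_neg)
    have i: "integrable lebesgue (\<lambda>x. max 0 (G x))" using Gi by (intro integrable_max) auto
    have "(LINT x|lebesgue. G x) \<le> (LINT x|lebesgue. max 0 (G x))" by (intro integral_mono Gi i) auto
    then have "ennreal (LINT x|lebesgue. G x) \<le> (\<integral>\<^sup>+x. ennreal (max 0 (G x)) \<partial>lebesgue)"
      by (subst nn_integral_eq_integral[OF i]) (auto intro: ennreal_leI)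
    then show ?thesis unfolding e .
  qed
  also have "\<dots> \<le> (\<integral>\<^sup>+x. ennreal (indicator ?B x * (?\<rho> x * (norm (l + L (x - h)))\<^sup>2)) \<partial>lebesgue)"
  proof (intro nn_integral_mono ennreal_leI)
    fix x
    define w where "w = l + L (x - h)"
    have "2 * (w \<bullet> l) - (norm l)\<^sup>2 \<le> (norm w)\<^sup>2"
      using zero_le_power2[of "norm (w - l)"] by (simp add: power2_norm_eq_inner algebra_simps inner_commute)
    from mult_left_mono[OF this pos[of x]]
    show "G x \<le> indicator ?B x * (?\<rho> x * (norm (l + L (x - h)))\<^sup>2)" by (simp add: G_def w_def algebra_simps)
  qed
  finally show ?thesis .
qed

section \<open>Integrals over space as functions of time\<close>

lemma lebesgue_product_AE:
  fixes f g :: "real \<times> 'a::euclidean_space \<Rightarrow> 'b"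
  assumes "AE z in lebesgue. f z = g z"
  shows "AE t in lebesgue. AE x in lebesgue. f (t, x) = g (t, x)"
proof -
  have "AE z in lborel. f z = g z" using assms by (simp add: AE_completion_iff)
  then have "AE z in (lborel :: real measure) \<Otimes>\<^sub>M (lborel :: 'a measure). f z = g z" by (simp only: lborel_prod)
  from lborel_pair.AE_pair[OF this] show ?thesis by (simp add: AE_completion_iff)
qed

lemma borel_measurable_time_slice:
  fixes g :: "real \<times> 'a::euclidean_space \<Rightarrow> 'b::topological_space"
  assumes "g \<in> borel_measurable borel" shows "(\<lambda>x. g (t, x)) \<in> borel_measurable borel"
  by (rule measurable_compose[OF _ assms]) (intro borel_measurable_continuous_onI continuous_intros)

text \<open>Lebesgue measurability in space-time refers to the completion of the product, not to the
  product of the completions. Fubini's theorem is therefore applied to a Borel representative, whose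
  slices agree with those of \<open>f\<close> almost everywhere for almost every t.\<close>

lemma borel_measurable_time_integral:
  fixes f :: "real \<times> 'a::euclidean_space \<Rightarrow> real"
  assumes f: "f \<in> borel_measurable lebesgue"
  shows "(\<lambda>t. LINT x|lebesgue. f (t, x)) \<in> borel_measurable lebesgue"
proof -
  obtain g where g: "g \<in> borel_measurable borel" "AE z in lebesgue. f z = g z"
    using ex_borel_representative[OF f] by blast
  have gp: "case_prod (\<lambda>t x. g (t, x)) \<in> borel_measurable (lborel \<Otimes>\<^sub>M lborel)"
    using g(1) by (simp add: lborel_prod)
  have "(\<lambda>t. LINT x|lborel. g (t, x)) \<in> borel_measurable lborel"
    by (rule lborel.borel_measurable_lebesgue_integral[OF gp])
  then have gm: "(\<lambda>t. LINT x|lborel. g (t, x)) \<in> borel_measurable lebesgue"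
    by (rule measurable_completion)
  show ?thesis
  proof (rule borel_measurable_AE[OF gm])
    show "AE t in lebesgue. (LINT x|lborel. g (t, x)) = (LINT x|lebesgue. f (t, x))"
      using lebesgue_product_AE[OF g(2)]
      by eventually_elim (rule lebesgue_AE_borel(3)[OF borel_measurable_time_slice[OF g(1)], symmetric])
  qed
qed

lemma time_nn_integral_representative:
  fixes f :: "real \<times> 'a::euclidean_space \<Rightarrow> real"
  assumes f: "f \<in> borel_measurable lebesgue"
  obtains d where "d \<in> borel_measurable lborel"
    "AE t in lebesgue. (\<integral>\<^sup>+x. ennreal (f (t, x)) \<partial>lebesgue) = d t"
proof -
  obtain g where g: "g \<in> borel_measurable borel" "AE z in lebesgue. f z = g z"
    using ex_borel_representative[OF f] by blast
  have gp: "case_prod (\<lambda>t x. ennreal (g (t, x))) \<in> borel_measurable (lborel \<Otimes>\<^sub>M lborel)"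
  proof -
    have "case_prod (\<lambda>t x. ennreal (g (t, x))) = (\<lambda>z. ennreal (g z))" by auto
    then show ?thesis using g(1) by (simp add: lborel_prod)
  qed
  show ?thesis
  proof (rule that)
    show "(\<lambda>t. \<integral>\<^sup>+x. ennreal (g (t, x)) \<partial>lborel) \<in> borel_measurable lborel"
      by (rule lborel.borel_measurable_nn_integral[OF gp])
    show "AE t in lebesgue. (\<integral>\<^sup>+x. ennreal (f (t, x)) \<partial>lebesgue) = (\<integral>\<^sup>+x. ennreal (g (t, x)) \<partial>lborel)"
      using lebesgue_product_AE[OF g(2)]
    proof eventually_elim
      case (elim t)
      then have "(\<integral>\<^sup>+x. ennreal (f (t, x)) \<partial>lebesgue) = (\<integral>\<^sup>+x. ennreal (g (t, x)) \<partial>lebesgue)"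
        by (intro nn_integral_cong_AE) auto
      then show ?case by (simp add: nn_integral_completion)
    qed
  qed
qed

section \<open>Bounds for the fluid terms at a fixed time\<close>

lemma smooth_shift: "smooth_on UNIV W \<Longrightarrow> smooth_on UNIV (\<lambda>x. W (x - c))"
  by (rule smooth_on_compose_UNIV[of "\<lambda>x. x - c"]) (intro smooth_on_diff smooth_on_id smooth_on_const open_UNIV)

lemma borel_measurable_vec_nth [measurable (raw)]:
  fixes f :: "'a \<Rightarrow> 'b::euclidean_space^'n"
  assumes "f \<in> borel_measurable M"
  shows "(\<lambda>x. f x $ i) \<in> borel_measurable M"
  by (rule borel_measurable_continuous_on[OF _ assms]) (intro continuous_intros)

lemma ball_supported_shift:
  fixes W :: "'a::real_normed_vector \<Rightarrow> 'b::zero"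
  assumes "ball_supported R W" shows "ball_supported (R + norm c) (\<lambda>x. W (x - c))"
  unfolding ball_supported_def
proof safe
  fix z :: 'a assume "R + norm c < norm z"
  then have "R < norm (z - c)" using norm_triangle_ineq2[of z c] by linarith
  then show "W (z - c) = 0" using assms by (simp add: ball_supported_def)
qed

lemma frechet_derivative_shift:
  assumes "smooth_on UNIV W"
  shows "frechet_derivative (\<lambda>x. W (x - c)) (at x) = frechet_derivative W (at (x - c))"
proof -
  have "((\<lambda>x. W (x - c)) has_derivative frechet_derivative W (at (x - c))) (at x)"
    by (rule has_derivative_compose[OF _ smooth_on_has_derivative[OF assms UNIV_I], where f' = "\<lambda>h. h" and f = "\<lambda>x. x - c", simplified])
       (auto intro!: derivative_eq_intros)
  then show ?thesis by (rule frechet_derivative_at[symmetric])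
qed

lemma divergence_shift: "smooth_on UNIV W \<Longrightarrow> divergence (\<lambda>x. W (x - c)) x = divergence W (x - c)"
  by (simp add: divergence_def jacobian_def frechet_derivative_shift)

lemma lebesgue_integral_shift:
  fixes f :: "real^'n \<Rightarrow> real"
  assumes "f \<in> borel_measurable borel"
  shows "(LINT x|lebesgue. f (x - c)) = (LINT x|lborel. f x)"
    and "integrable lebesgue (\<lambda>x. f (x - c)) \<longleftrightarrow> integrable lborel f"
proof -
  have m: "(\<lambda>x. f (x - c)) \<in> borel_measurable borel" using assms by measurable
  have d: "distr lborel borel (\<lambda>x. x - c) = (lborel :: (real^'n) measure)"
  proof -
    have "(\<lambda>x. x - c) = (+) (- c)" by auto
    then show ?thesis using lborel_distr_plus[of "- c"] by simp
  qed
  have "(LINT x|lborel. f (x - c)) = integral\<^sup>L (distr lborel borel (\<lambda>x. x - c)) f"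
    using assms by (subst integral_distr) auto
  then show "(LINT x|lebesgue. f (x - c)) = (LINT x|lborel. f x)" using m by (simp add: integral_completion d)
  have "integrable lborel (\<lambda>x. f (x - c)) \<longleftrightarrow> integrable (distr lborel borel (\<lambda>x. x - c)) f"
    using assms by (subst integrable_distr_eq) auto
  then show "integrable lebesgue (\<lambda>x. f (x - c)) \<longleftrightarrow> integrable lborel f" using m by (simp add: integrable_completion d)
qed

lemma L2_shift:
  fixes W :: "real^'n \<Rightarrow> 'b::euclidean_space"
  assumes W: "continuous_on UNIV W" "ball_supported R W"
  shows "L2 UNIV (\<lambda>x. W (x - c))" "(LINT x|lebesgue. (norm (W (x - c)))\<^sup>2) = (LINT x|lborel. (norm (W x))\<^sup>2)"
proof -
  have c: "continuous_on UNIV (\<lambda>x. (norm (W x))\<^sup>2)" using W(1) by (intro continuous_intros)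
  have m: "(\<lambda>x. (norm (W x))\<^sup>2) \<in> borel_measurable borel" by (rule borel_measurable_continuous_onI[OF c])
  have s: "ball_supported R (\<lambda>x. (norm (W x))\<^sup>2)" using W(2) by (simp add: ball_supported_def)
  have i: "integrable lborel (\<lambda>x. (norm (W x))\<^sup>2)" by (rule ball_supported_integrable[OF c s])
  show "(LINT x|lebesgue. (norm (W (x - c)))\<^sup>2) = (LINT x|lborel. (norm (W x))\<^sup>2)" by (rule lebesgue_integral_shift(1)[OF m])
  have "continuous_on UNIV (\<lambda>x. W (x - c))" by (intro continuous_on_compose2[OF W(1)] continuous_intros) auto
  then have "(\<lambda>x. W (x - c)) \<in> borel_measurable lebesgue" by (intro measurable_completion) (simp add: borel_measurable_continuous_onI)
  then show "L2 UNIV (\<lambda>x. W (x - c))" using i lebesgue_integral_shift(2)[OF m, of c] by (simp add: L2_UNIV_iff)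
qed

definition norm_L2 :: "(real^'n \<Rightarrow> 'b::euclidean_space) \<Rightarrow> real" where
  "norm_L2 f = sqrt (LINT x|lebesgue. (norm (f x))\<^sup>2)"

lemma norm_L2_nonneg: "0 \<le> norm_L2 f"
  by (simp add: norm_L2_def)

lemma power2_norm_L2: "(norm_L2 f)\<^sup>2 = (LINT x|lebesgue. (norm (f x))\<^sup>2)"
  by (simp add: norm_L2_def)

lemma L2_norm_product:
  assumes "L2 UNIV f" "L2 UNIV g"
  shows "integrable lebesgue (\<lambda>x. norm (f x) * norm (g x))"
    and "(LINT x|lebesgue. norm (f x) * norm (g x)) \<le> norm_L2 f * norm_L2 g"
proof -
  have m: "(\<lambda>x. norm (f x)) \<in> borel_measurable lebesgue" "(\<lambda>x. norm (g x)) \<in> borel_measurable lebesgue"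
    using assms by (auto simp: L2_UNIV_iff)
  have i: "integrable lebesgue (\<lambda>x. (norm (f x))\<^sup>2)" "integrable lebesgue (\<lambda>x. (norm (g x))\<^sup>2)"
    using assms by (auto simp: L2_UNIV_iff)
  show "integrable lebesgue (\<lambda>x. norm (f x) * norm (g x))" by (rule integrable_mult_L2[OF m i])
  show "(LINT x|lebesgue. norm (f x) * norm (g x)) \<le> norm_L2 f * norm_L2 g"
    using Cauchy_Schwarz_integral[OF m i] unfolding norm_L2_def by linarith
qed

lemma L2_bounded_product:
  fixes F :: "real^'n \<Rightarrow> real"
  assumes "L2 UNIV f" "L2 UNIV g" "F \<in> borel_measurable lebesgue" "AE x in lebesgue. \<bar>F x\<bar> \<le> C * (norm (f x) * norm (g x))"
  shows "integrable lebesgue F" "\<bar>LINT x|lebesgue. F x\<bar> \<le> C * (LINT x|lebesgue. norm (f x) * norm (g x))"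
proof -
  have i: "integrable lebesgue (\<lambda>x. C * (norm (f x) * norm (g x)))"
    by (intro integrable_mult_right L2_norm_product assms)
  show "integrable lebesgue F"
    by (rule Bochner_Integration.integrable_bound[OF i assms(3)]) (use assms(4) in \<open>auto elim!: eventually_mono\<close>)
  have "norm (LINT x|lebesgue. F x) \<le> (LINT x|lebesgue. C * (norm (f x) * norm (g x)))"
    by (rule norm_integral_le_AE[OF i]) (use assms(4) in simp)
  then show "\<bar>LINT x|lebesgue. F x\<bar> \<le> C * (LINT x|lebesgue. norm (f x) * norm (g x))" by simp
qed

lemma L2_inner_bound:
  assumes "L2 UNIV f" "L2 UNIV g"
  shows "integrable lebesgue (\<lambda>x. f x \<bullet> g x)" "\<bar>LINT x|lebesgue. f x \<bullet> g x\<bar> \<le> norm_L2 f * norm_L2 g"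
proof -
  have m: "(\<lambda>x. f x \<bullet> g x) \<in> borel_measurable lebesgue" using assms by (auto simp: L2_UNIV_iff)
  have "AE x in lebesgue. \<bar>f x \<bullet> g x\<bar> \<le> 1 * (norm (f x) * norm (g x))" by (simp add: Cauchy_Schwarz_ineq2)
  note b = L2_bounded_product[OF assms m this]
  show "integrable lebesgue (\<lambda>x. f x \<bullet> g x)" by (rule b(1))
  show "\<bar>LINT x|lebesgue. f x \<bullet> g x\<bar> \<le> norm_L2 f * norm_L2 g" using b(2) L2_norm_product(2)[OF assms] by simp
qed

text \<open>The norm on matrices is the Euclidean norm of all entries, which dominates the operator
  norm by Cauchy-Schwarz in each row.\<close>

lemma norm_matrix_vector_mult_le: "norm ((A :: real^'n^'m) *v x) \<le> norm A * norm x"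
proof -
  have sq: "(norm y)\<^sup>2 = (\<Sum>i\<in>UNIV. y $ i \<bullet> y $ i)" for y :: "'b::real_inner^'m"
    unfolding power2_norm_eq_inner by (rule inner_vec_def)
  have "(norm (A *v x))\<^sup>2 = (\<Sum>i\<in>UNIV. (A $ i \<bullet> x)\<^sup>2)"
    unfolding sq matrix_vector_mul_component by (simp add: power2_eq_square)
  also have "\<dots> \<le> (\<Sum>i\<in>UNIV. (A $ i \<bullet> A $ i) * (norm x)\<^sup>2)"
    by (intro sum_mono) (metis Cauchy_Schwarz_ineq power2_norm_eq_inner)
  also have "\<dots> = (norm A)\<^sup>2 * (norm x)\<^sup>2"
    unfolding sq[of A] sum_distrib_right ..
  finally have "(norm (A *v x))\<^sup>2 \<le> (norm A * norm x)\<^sup>2" by (simp add: power_mult_distrib)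
  then show ?thesis by (rule power2_le_imp_le) simp
qed

text \<open>After \<open>integral_transport\<close> no derivative is left on \<open>W\<close>, so
  the L2 norm of the field itself, which will be small, multiplies that of the symmetric
  gradient.\<close>

lemma transport_bound:
  fixes v W :: "real^'n \<Rightarrow> real^'n"
  assumes v: "L2 UNIV v" "L2 UNIV D" "weak_sym_grad UNIV v D"
    and W: "smooth_on UNIV W" "ball_supported R W" "\<And>x. divergence W x = 0"
  shows "\<bar>LINT x|lebesgue. v x \<bullet> frechet_derivative W (at (x - c)) p\<bar>
     \<le> 2 * norm p * norm_L2 D * norm_L2 (\<lambda>x. W (x - c))"
proof -
  have W2: "L2 UNIV (\<lambda>x. W (x - c))" by (rule L2_shift(1)[OF smooth_on_continuous_on[OF W(1)] W(2)])
  have [measurable]: "D \<in> borel_measurable lebesgue" "(\<lambda>x. W (x - c)) \<in> borel_measurable lebesgue"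
    using v W2 by (auto simp: L2_UNIV_iff)
  have lin: "bounded_linear (\<lambda>A::real^'n^'n. A *v p)"
    by (rule linear_conv_bounded_linear[THEN iffD1]) (intro linearI; simp add: matrix_vector_mult_add_rdistrib scaleR_matrix_vector_assoc)
  have m: "(\<lambda>x. W (x - c) \<bullet> (D x *v p)) \<in> borel_measurable lebesgue"
    by (intro borel_measurable_inner borel_measurable_continuous_on[OF linear_continuous_on[OF lin]]) auto
  have ae: "AE x in lebesgue. \<bar>W (x - c) \<bullet> (D x *v p)\<bar> \<le> norm p * (norm (D x) * norm (W (x - c)))"
  proof (rule AE_I2)
    fix x
    have "\<bar>W (x - c) \<bullet> (D x *v p)\<bar> \<le> norm (W (x - c)) * norm (D x *v p)" by (rule Cauchy_Schwarz_ineq2)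
    also have "\<dots> \<le> norm (W (x - c)) * (norm (D x) * norm p)" by (intro mult_left_mono norm_matrix_vector_mult_le) simp
    finally show "\<bar>W (x - c) \<bullet> (D x *v p)\<bar> \<le> norm p * (norm (D x) * norm (W (x - c)))" by (simp add: mult_ac)
  qed
  have "(LINT x|lebesgue. v x \<bullet> frechet_derivative W (at (x - c)) p) = - 2 * (LINT x|lebesgue. W (x - c) \<bullet> (D x *v p))"
    using integral_transport[OF v smooth_shift[OF W(1)] ball_supported_shift[OF W(2)], of c p] W(3)
    by (simp add: frechet_derivative_shift[OF W(1)] divergence_shift[OF W(1)])
  then have "\<bar>LINT x|lebesgue. v x \<bullet> frechet_derivative W (at (x - c)) p\<bar> = 2 * \<bar>LINT x|lebesgue. W (x - c) \<bullet> (D x *v p)\<bar>"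
    by (simp add: abs_mult)
  also have "\<dots> \<le> 2 * (norm p * (norm_L2 D * norm_L2 (\<lambda>x. W (x - c))))"
    using L2_bounded_product(2)[OF v(2) W2 m ae] mult_left_mono[OF L2_norm_product(2)[OF v(2) W2], of "norm p"]
    by (intro mult_left_mono) auto
  finally show ?thesis by (simp add: mult_ac)
qed

text \<open>The ball lies in one slab of half-width R for each coordinate, and
  \<open>slab_estimate\<close> bounds the corresponding component of \<open>v\<close> there. The
  products of velocity and strain vanish off \<open>F\<close>, so the norm of \<open>v\<close>
  enters only through its restriction to \<open>F\<close>.\<close>

lemma local_L2_bound:
  fixes v :: "real^'n \<Rightarrow> real^'n"
  assumes v: "L2 UNIV v" "L2 UNIV D" "weak_sym_grad UNIV v D" and R: "R > 0"
    and F: "F \<in> sets lebesgue" "AE x in lebesgue. x \<notin> F \<longrightarrow> D x = 0" "(LINT x|lebesgue. indicator F x * (norm (v x))\<^sup>2) \<le> M"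
  shows "(LINT x|lebesgue. indicator (cball c R) x * (norm (v x))\<^sup>2) \<le> 2 * pi * real CARD('n) * R * (sqrt M * norm_L2 D)"
proof -
  have vi: "integrable lebesgue (\<lambda>x. (norm (v x))\<^sup>2)" and [measurable]: "v \<in> borel_measurable lebesgue" "D \<in> borel_measurable lebesgue"
    using v by (auto simp: L2_UNIV_iff)
  have [measurable]: "F \<in> sets lebesgue" by (rule F)
  define vF where "vF x = indicator F x *\<^sub>R v x" for x
  have nvF: "(norm (vF x))\<^sup>2 = indicator F x * (norm (v x))\<^sup>2" for x by (simp add: vF_def indicator_def)
  have vF2: "L2 UNIV vF"
  proof -
    have "vF \<in> borel_measurable lebesgue" unfolding vF_def[abs_def] by measurable
    moreover have "integrable lebesgue (\<lambda>x. (norm (vF x))\<^sup>2)" unfolding nvF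
      by (rule Bochner_Integration.integrable_bound[OF vi]) (auto simp: indicator_def)
    ultimately show ?thesis by (simp add: L2_UNIV_iff)
  qed
  have vFM: "norm_L2 vF \<le> sqrt M" unfolding norm_L2_def nvF by (rule real_sqrt_le_mono[OF F(3)])
  have sl: "(LINT x|lebesgue. indicator {x. \<bar>x $ i - c $ i\<bar> \<le> R} x * (v x $ i)\<^sup>2) \<le> 2 * pi * R * (sqrt M * norm_L2 D)" for i
  proof -
    have m: "(\<lambda>x. \<bar>v x $ i\<bar> * \<bar>D x $ i $ i\<bar>) \<in> borel_measurable lebesgue" by measurable
    have "AE x in lebesgue. \<bar>\<bar>v x $ i\<bar> * \<bar>D x $ i $ i\<bar>\<bar> \<le> 1 * (norm (vF x) * norm (D x))"
      using F(2)
    proof eventually_elim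
      case (elim x)
      show ?case
      proof (cases "x \<in> F")
        case True
        then show ?thesis using component_le_norm_cart[of "v x" i] abs_matrix_component_le_norm[of "D x" i i]
          by (auto simp: vF_def abs_mult intro!: mult_mono)
      next
        case False then show ?thesis using elim by simp
      qed
    qed
    from L2_bounded_product(2)[OF vF2 v(2) m this]
    have "(LINT x|lebesgue. \<bar>v x $ i\<bar> * \<bar>D x $ i $ i\<bar>) \<le> norm_L2 vF * norm_L2 D" using L2_norm_product(2)[OF vF2 v(2)] by linarith
    also have "\<dots> \<le> sqrt M * norm_L2 D" by (intro mult_right_mono vFM norm_L2_nonneg)
    finally have "2 * pi * R * (LINT x|lebesgue. \<bar>v x $ i\<bar> * \<bar>D x $ i $ i\<bar>) \<le> 2 * pi * R * (sqrt M * norm_L2 D)"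
      using R by (intro mult_left_mono) auto
    then show ?thesis using slab_estimate[OF v R, of i "c $ i"] by linarith
  qed
  have [measurable]: "{x::real^'n. \<bar>x $ i - c $ i\<bar> \<le> R} \<in> sets lebesgue" for i
  proof -
    have "closed {x::real^'n. \<bar>x $ i - c $ i\<bar> \<le> R}" by (intro closed_Collect_le continuous_intros)
    then show ?thesis by (intro sets_completionI_sets) auto
  qed
  have isl: "integrable lebesgue (\<lambda>x. indicator {x. \<bar>x $ i - c $ i\<bar> \<le> R} x * (v x $ i)\<^sup>2)" for i
    by (rule Bochner_Integration.integrable_bound[OF vi])
      (measurable, auto simp: indicator_def abs_le_square_iff[symmetric] component_le_norm_cart)
  have "(LINT x|lebesgue. indicator (cball c R) x * (norm (v x))\<^sup>2) \<le> (LINT x|lebesgue. (\<Sum>i\<in>UNIV. indicator {x. \<bar>x $ i - c $ i\<bar> \<le> R} x * (v x $ i)\<^sup>2))"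
  proof (rule integral_mono_AE')
    show "integrable lebesgue (\<lambda>x. (\<Sum>i\<in>UNIV. indicator {x. \<bar>x $ i - c $ i\<bar> \<le> R} x * (v x $ i)\<^sup>2))"
      by (intro Bochner_Integration.integrable_sum isl)
    show "AE x in lebesgue. indicator (cball c R) x * (norm (v x))\<^sup>2 \<le> (\<Sum>i\<in>UNIV. indicator {x. \<bar>x $ i - c $ i\<bar> \<le> R} x * (v x $ i)\<^sup>2)"
    proof (rule AE_I2)
      fix x
      show "indicator (cball c R) x * (norm (v x))\<^sup>2 \<le> (\<Sum>i\<in>UNIV. indicator {x. \<bar>x $ i - c $ i\<bar> \<le> R} x * (v x $ i)\<^sup>2)"
      proof (cases "x \<in> cball c R")
        case True
        have "\<bar>x $ i - c $ i\<bar> \<le> R" for i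
          using component_le_norm_cart[of "x - c" i] True by (simp add: dist_norm norm_minus_commute)
        then have "(\<Sum>i\<in>UNIV. indicator {x. \<bar>x $ i - c $ i\<bar> \<le> R} x * (v x $ i)\<^sup>2) = (\<Sum>i\<in>UNIV. (v x $ i)\<^sup>2)" by simp
        also have "\<dots> = (norm (v x))\<^sup>2" unfolding power2_norm_eq_inner inner_vec_def[of "v x"] by (simp add: power2_eq_square)
        finally show ?thesis using True by simp
      next
        case False then show ?thesis by (auto intro!: sum_nonneg)
      qed
    qed
    show "AE x in lebesgue. 0 \<le> (\<Sum>i\<in>UNIV. indicator {x. \<bar>x $ i - c $ i\<bar> \<le> R} x * (v x $ i)\<^sup>2)"
      by (intro AE_I2 sum_nonneg) auto
  qed
  also have "\<dots> = (\<Sum>i\<in>UNIV. (LINT x|lebesgue. indicator {x. \<bar>x $ i - c $ i\<bar> \<le> R} x * (v x $ i)\<^sup>2))"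
    by (rule Bochner_Integration.integral_sum[OF isl])
  also have "\<dots> \<le> (\<Sum>i\<in>(UNIV::'n set). 2 * pi * R * (sqrt M * norm_L2 D))" by (intro sum_mono sl)
  finally show ?thesis by (simp add: mult_ac)
qed

text \<open>The convective term carries the power 3/2 of the norm of the symmetric gradient, while
  the energy controls the time integral of its square. Domination by 1 + s^2 makes the bound
  integrable over bounded times.\<close>

lemma sqrt_mult_sqrt_le:
  assumes "s \<ge> 0" "C \<ge> 0" shows "s * sqrt (C * s) \<le> sqrt C * (1 + s\<^sup>2)"
proof -
  have "s * sqrt s \<le> 1 + s\<^sup>2"
  proof (cases "s \<le> 1")
    case True
    then have "s * sqrt s \<le> 1 * 1" using assms by (intro mult_mono) auto
    then show ?thesis by (simp add: add_increasing2)
  next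
    case False
    then have "sqrt s \<le> s" using real_sqrt_le_mono[of s "s\<^sup>2"] self_le_power[of s 2] by simp
    then have "s * sqrt s \<le> s * s" using assms by (intro mult_left_mono)
    then show ?thesis by (simp add: power2_eq_square)
  qed
  from mult_left_mono[OF this, of "sqrt C"] show ?thesis using assms by (simp add: real_sqrt_mult mult_ac)
qed

text \<open>The symmetric gradient contributes one full power of its norm directly and half a power
  through the local L2 norm of \<open>v\<close>. The field \<open>W\<close> is merely bounded here;
  smallness comes from the radius R.\<close>

lemma convection_bound:
  fixes v W :: "real^'n \<Rightarrow> real^'n"
  assumes v: "L2 UNIV v" "L2 UNIV D" "weak_sym_grad UNIV v D" "weakly_div_free UNIV v" and R: "R > 0"
    and F: "F \<in> sets lebesgue" "AE x in lebesgue. x \<notin> F \<longrightarrow> D x = 0" "(LINT x|lebesgue. indicator F x * (norm (v x))\<^sup>2) \<le> M" "M \<ge> 0"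
    and W: "smooth_on UNIV W" "ball_supported R W" "\<And>x. divergence W x = 0" "\<And>x. norm (W x) \<le> b"
  shows "\<bar>LINT x|lebesgue. v x \<bullet> frechet_derivative W (at (x - c)) (v x)\<bar>
     \<le> 2 * b * sqrt (2 * pi * real CARD('n) * R * sqrt M) * (1 + (norm_L2 D)\<^sup>2)"
proof -
  have vi: "integrable lebesgue (\<lambda>x. (norm (v x))\<^sup>2)" and [measurable]: "v \<in> borel_measurable lebesgue" "D \<in> borel_measurable lebesgue"
    using v by (auto simp: L2_UNIV_iff)
  have "continuous_on UNIV (\<lambda>x. W (x - c))" by (intro smooth_on_continuous_on smooth_shift W)
  then have [measurable]: "(\<lambda>x. W (x - c)) \<in> borel_measurable lebesgue" by (intro measurable_completion) (simp add: borel_measurable_continuous_onI)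
  have [measurable]: "cball c R \<in> sets lebesgue" by (intro sets_completionI_sets) simp
  have b: "b \<ge> 0" using W(4)[of 0] norm_ge_zero order_trans by blast
  define w where "w x = indicator (cball c R) x *\<^sub>R v x" for x
  have nw: "(norm (w x))\<^sup>2 = indicator (cball c R) x * (norm (v x))\<^sup>2" for x by (simp add: w_def indicator_def)
  have w2: "L2 UNIV w"
  proof -
    have "w \<in> borel_measurable lebesgue" unfolding w_def[abs_def] by measurable
    moreover have "integrable lebesgue (\<lambda>x. (norm (w x))\<^sup>2)" unfolding nw
    proof (rule Bochner_Integration.integrable_bound[OF vi])
      show "(\<lambda>x. indicator (cball c R) x * (norm (v x))\<^sup>2) \<in> borel_measurable lebesgue" by measurable
    qed (simp add: indicator_def)
    ultimately show ?thesis by (simp add: L2_UNIV_iff)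
  qed
  define C where "C = 2 * pi * real CARD('n) * R * sqrt M"
  have C: "C \<ge> 0" using R F(4) by (simp add: C_def)
  have wn: "norm_L2 w \<le> sqrt (C * norm_L2 D)"
    unfolding norm_L2_def[of w] nw using local_L2_bound[OF v(1-3) R F(1-3), of c] by (intro real_sqrt_le_mono) (simp add: C_def mult_ac)
  have m: "(\<lambda>x. W (x - c) \<bullet> (D x *v v x)) \<in> borel_measurable lebesgue"
    by (simp add: inner_vec_def matrix_vector_mult_def)
  have ae: "AE x in lebesgue. \<bar>W (x - c) \<bullet> (D x *v v x)\<bar> \<le> b * (norm (D x) * norm (w x))"
  proof (rule AE_I2)
    fix x
    show "\<bar>W (x - c) \<bullet> (D x *v v x)\<bar> \<le> b * (norm (D x) * norm (w x))"
    proof (cases "x \<in> cball c R")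
      case True
      have "\<bar>W (x - c) \<bullet> (D x *v v x)\<bar> \<le> norm (W (x - c)) * norm (D x *v v x)" by (rule Cauchy_Schwarz_ineq2)
      also have "\<dots> \<le> b * (norm (D x) * norm (v x))" using b by (intro mult_mono norm_matrix_vector_mult_le W) auto
      finally show ?thesis using True by (simp add: w_def)
    next
      case False
      then have "W (x - c) = 0" using W(2) by (simp add: ball_supported_def dist_norm norm_minus_commute)
      then show ?thesis using b by simp
    qed
  qed
  have "(LINT x|lebesgue. v x \<bullet> frechet_derivative W (at (x - c)) (v x)) = - 2 * (LINT x|lebesgue. W (x - c) \<bullet> (D x *v v x))"
    using integral_convection[OF v smooth_shift[OF W(1)] ball_supported_shift[OF W(2)], of c] W(3)
    by (simp add: frechet_derivative_shift[OF W(1)] divergence_shift[OF W(1)])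
  then have "\<bar>LINT x|lebesgue. v x \<bullet> frechet_derivative W (at (x - c)) (v x)\<bar> = 2 * \<bar>LINT x|lebesgue. W (x - c) \<bullet> (D x *v v x)\<bar>"
    by (simp add: abs_mult)
  also have "\<dots> \<le> 2 * (b * (norm_L2 D * norm_L2 w))"
    using L2_bounded_product(2)[OF v(2) w2 m ae] mult_left_mono[OF L2_norm_product(2)[OF v(2) w2], of b] b
    by (intro mult_left_mono) auto
  also have "\<dots> \<le> 2 * (b * (norm_L2 D * sqrt (C * norm_L2 D)))"
    using b by (intro mult_left_mono wn norm_L2_nonneg) auto
  also have "\<dots> \<le> 2 * (b * (sqrt C * (1 + (norm_L2 D)\<^sup>2)))"
    using b by (intro mult_left_mono sqrt_mult_sqrt_le norm_L2_nonneg C) auto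
  finally show ?thesis by (simp add: C_def mult_ac)
qed

subsection \<open>Velocity of the body of a weak solution\<close>

text \<open>An interval of length 1 is not a null set. This provides a time beyond T at which the
  energy inequality actually holds.\<close>

lemma AE_lebesgue_ex_in_interval:
  assumes "AE t in lebesgue. P t" shows "\<exists>t\<in>{T..T + 1::real}. P t"
proof (rule ccontr)
  assume no: "\<not> ?thesis"
  obtain N where N: "N \<in> null_sets lebesgue" "{t. \<not> P t} \<subseteq> N"
    using assms by (auto simp: eventually_ae_filter)
  have "{T..T+1} \<subseteq> N" using no N(2) by auto
  then have "emeasure lebesgue {T..T+1} \<le> emeasure lebesgue N" using N(1) by (intro emeasure_mono) auto
  then show False using N(1) by (auto simp: null_sets_def)
qed

lemma AE_lebesgue_on_atLeast_iff: "(AE t in lebesgue_on {0..}. P t) \<longleftrightarrow> (AE t in lebesgue. t \<ge> 0 \<longrightarrow> P (t::real))"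
  by (subst AE_restrict_space_iff) auto

lemma L1_loc_UNIV_measurable:
  assumes "L1_loc UNIV f" shows "f \<in> borel_measurable lebesgue"
proof (rule borel_measurable_LIMSEQ_metric)
  show "(\<lambda>x. indicator (cball 0 (real n)) x *\<^sub>R f x) \<in> borel_measurable lebesgue" for n
    using assms by (intro borel_measurable_integrable) (auto simp: L1_loc_def set_integrable_def)
  fix x
  show "(\<lambda>n. indicator (cball 0 (real n)) x *\<^sub>R f x) \<longlonglongrightarrow> f x"
  proof (rule tendsto_eventually, rule eventually_sequentiallyI)
    fix n assume "nat \<lceil>norm x\<rceil> \<le> n"
    then have "norm x \<le> real n" by linarith
    then show "indicator (cball 0 (real n)) x *\<^sub>R f x = f x" by simp
  qed
qed

lemma L2_of_AE_eq:
  assumes "L2 UNIV f" "AE x in lebesgue. f x = g x" shows "L2 UNIV g"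
proof -
  have g: "g \<in> borel_measurable lebesgue"
    using borel_measurable_AE[OF _ assms(2)] assms(1) by (simp add: L2_UNIV_iff)
  have "integrable lebesgue (\<lambda>x. (norm (g x))\<^sup>2)"
    by (rule integrable_cong_AE_imp[of _ "\<lambda>x. (norm (f x))\<^sup>2"])
       (use assms g in \<open>auto simp: L2_UNIV_iff elim!: eventually_mono\<close>)
  then show ?thesis using g by (simp add: L2_UNIV_iff)
qed

lemma ennreal_add_leD:
  fixes a b c :: ennreal assumes "a + b \<le> c" shows "a \<le> c" "b \<le> c"
proof -
  have "a \<le> a + b" "b \<le> a + b" by (simp_all add: add_increasing add_increasing2)
  then show "a \<le> c" "b \<le> c" using assms by (blast intro: order_trans)+
qed

lemma integral_le_of_nn_integral_le:
  fixes f :: "'a \<Rightarrow> real"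
  assumes "integrable M f" "\<And>x. 0 \<le> f x" "(\<integral>\<^sup>+x. ennreal (f x) \<partial>M) \<le> ennreal C" "0 \<le> C"
  shows "(LINT x|M. f x) \<le> C"
  using assms nn_integral_eq_integral[OF assms(1)] by simp

text \<open>One solution with the witnesses of \<open>hopf_leray\<close> fixed. Both dimensions are
  treated at once, \<open>ang\<close> being known only as linear for each angular velocity.
  \<open>M\<close> bounds the initial energy and \<open>\<epsilon>\<close> the size of the body, so
  that later constants can be uniform along a sequence.\<close>

locale rigid_body_solution =
  fixes ang :: "'w::euclidean_space \<Rightarrow> real^'n::{finite,wellorder} \<Rightarrow> real^'n::_"
    and \<nu> \<epsilon> M :: real and S :: "(real^'n::_) set" and \<rho>in :: "real^'n::_ \<Rightarrow> real"
    and uin :: "real^'n::_ \<Rightarrow> real^'n::_" and lin :: "real^'n::_" and \<omega>in :: 'w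
    and u :: "real \<Rightarrow> real^'n::_ \<Rightarrow> real^'n::_" and l :: "real \<Rightarrow> real^'n::_" and \<omega> :: "real \<Rightarrow> 'w"
    and h :: "real \<Rightarrow> real^'n::_" and Q :: "real \<Rightarrow> real^'n::_^'n::_" and B :: "real \<Rightarrow> (real^'n::_) set"
    and \<rho> :: "real \<Rightarrow> real^'n::_ \<Rightarrow> real" and U :: "real \<Rightarrow> real^'n::_ \<Rightarrow> real^'n::_"
    and \<rho>0 :: "real^'n::_ \<Rightarrow> real" and U0 :: "real^'n::_ \<Rightarrow> real^'n::_" and Du :: "real \<Rightarrow> real^'n::_ \<Rightarrow> real^'n::_^'n::_"
    and v :: "real \<Rightarrow> real^'n::_ \<Rightarrow> real^'n::_"
  assumes pos: "\<nu> > 0" "\<epsilon> > 0" "M \<ge> 0" and ang: "\<And>w. linear (ang w)"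
    and body: "rigid_body S \<rho>in" and small: "S \<subseteq> ball 0 \<epsilon>" and mass_pos: "mass S \<rho>in > 0"
    and init: "L2 UNIV U0" and energy0: "(\<integral>\<^sup>+x. ennreal (\<rho>0 x * (norm (U0 x))\<^sup>2) \<partial>lebesgue) \<le> ennreal M"
    and motion: "rigid_motion ang l \<omega> h Q"
    and B_eq: "B = (\<lambda>t. body_position S (h t) (Q t))"
    and \<rho>_eq: "\<rho> = (\<lambda>t. global_density (B t) (body_density \<rho>in (h t) (Q t)))"
    and U_eq: "U = (\<lambda>t. global_velocity (B t) (body_velocity ang (l t) (\<omega> t) (h t)) (u t))"
    and \<rho>0_eq: "\<rho>0 = global_density S \<rho>in" and U0_eq: "U0 = initial_velocity ang S uin lin \<omega>in"
    and l_Linf: "Linf_time l"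
    and u_meas: "set_borel_measurable lebesgue {(t, x). t \<ge> 0 \<and> x \<in> - B t} (\<lambda>(t, x). u t x)"
    and v_cont: "weakly_continuous_L2 v" and v_eq: "AE t in lebesgue_on {0..}. AE x in lebesgue. v t x = U t x"
    and Du_meas: "set_borel_measurable lebesgue ({0..} \<times> UNIV) (\<lambda>(t, x). Du t x)"
    and Du_weak: "AE t in lebesgue_on {0..}. weak_sym_grad UNIV (U t) (Du t)"
    and div_free: "AE t in lebesgue_on {0..}. weakly_div_free UNIV (U t)"
    and Du_body: "AE t in lebesgue_on {0..}. AE x in lebesgue. x \<in> B t \<longrightarrow> Du t x = 0"
    and weak_form: "\<And>\<phi>. fluid_body_test_function B \<phi> \<Longrightarrow>
          - (LINT t:{0..}|lebesgue. LINT x|lebesgue.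
               \<rho> t x * (U t x \<bullet> (vector_derivative (\<lambda>s. \<phi> (s, x)) (at t)
                                    + jacobian (\<lambda>y. \<phi> (t, y)) (at x) *v U t x))
               - 2 * \<nu> * (Du t x \<bullet> sym_grad (\<lambda>y. \<phi> (t, y)) x))
          = (LINT x|lebesgue. \<rho>0 x * (U0 x \<bullet> \<phi> (0, x)))"
    and energy: "AE t in lebesgue_on {0..}.
          (\<integral>\<^sup>+x. ennreal (\<rho> t x * (norm (U t x))\<^sup>2) \<partial>lebesgue)
          + ennreal (4 * \<nu>) * (\<integral>\<^sup>+s\<in>{0..t}. (\<integral>\<^sup>+x. ennreal ((norm (Du s x))\<^sup>2) \<partial>lebesgue) \<partial>lebesgue)
          \<le> (\<integral>\<^sup>+x. ennreal (\<rho>0 x * (norm (U0 x))\<^sup>2) \<partial>lebesgue)"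
begin

abbreviation "m \<equiv> mass S \<rho>in"

text \<open>The energy inequality forces m |l|^2 \<le> M, so this is a bound for the speed of the
  centre of mass.\<close>

definition "K = sqrt (M / m)"

lemma K_nonneg: "K \<ge> 0" using pos mass_pos by (simp add: K_def)

lemma orthogonal_Q: "t \<ge> 0 \<Longrightarrow> orthogonal_matrix (Q t)"
  using motion by (simp add: rigid_motion_def rotation_matrix_def)

lemma closed_B: "closed (B t)"
proof -
  have "closed S" using body by (simp add: rigid_body_def)
  moreover have "B t = (\<lambda>x. transpose (Q t) *v (x - h t)) -` S" by (auto simp: B_eq body_position_def)
  moreover have "continuous_on UNIV (\<lambda>x. transpose (Q t) *v (x - h t))"
    by (simp only: matrix_vector_mult_diff_distrib) (intro continuous_intros)
  ultimately show ?thesis using closed_vimage by metis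
qed

lemma B_lebesgue [measurable]: "B t \<in> sets lebesgue" "- B t \<in> sets lebesgue"
proof -
  show "B t \<in> sets lebesgue" using closed_B by (intro sets_completionI_sets) auto
  then show "- B t \<in> sets lebesgue" by (simp add: Compl_in_sets_lebesgue)
qed

lemma body_near: assumes "t \<ge> 0" "x \<in> B t" shows "norm (x - h t) < \<epsilon>"
proof -
  have "orthogonal_transformation ((*v) (transpose (Q t)))"
    using orthogonal_Q[OF assms(1)] by (simp add: orthogonal_transformation_matrix orthogonal_matrix_transpose)
  then have "norm (transpose (Q t) *v (x - h t)) = norm (x - h t)" by (rule orthogonal_transformation_norm)
  moreover have "transpose (Q t) *v (x - h t) \<in> S" using assms(2) by (simp add: B_eq body_position_def)
  ultimately show ?thesis using small by (auto simp: subset_iff)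
qed

text \<open>Extended by 0 to the body and to negative times, so that joint measurability in time and
  space is precisely the assumption on \<open>u\<close>. The velocity inside the body enters through
  its explicit moments instead.\<close>

definition fluid_velocity :: "real \<times> (real^'n::_) \<Rightarrow> real^'n::_" where
  "fluid_velocity = (\<lambda>z. indicator {(t, x). t \<ge> 0 \<and> x \<in> - B t} z *\<^sub>R (case z of (t, x) \<Rightarrow> u t x))"

definition strain :: "real \<times> (real^'n::_) \<Rightarrow> real^'n::_^'n::_" where
  "strain = (\<lambda>z. indicator ({0..} \<times> UNIV) z *\<^sub>R (case z of (t, x) \<Rightarrow> Du t x))"

lemma fluid_velocity_measurable [measurable]: "fluid_velocity \<in> borel_measurable lebesgue"
  using u_meas by (simp add: fluid_velocity_def set_borel_measurable_def)

lemma strain_measurable [measurable]: "strain \<in> borel_measurable lebesgue"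
  using Du_meas by (simp add: strain_def set_borel_measurable_def)

lemma fluid_velocity_eq: "t \<ge> 0 \<Longrightarrow> fluid_velocity (t, x) = indicator (- B t) x *\<^sub>R U t x"
  by (simp add: fluid_velocity_def U_eq global_velocity_def indicator_def)

lemma strain_eq: "t \<ge> 0 \<Longrightarrow> strain (t, x) = Du t x"
  by (simp add: strain_def)

text \<open>Fixing a time at which all properties valid almost everywhere are available reduces the
  analysis to functions of space alone.\<close>

definition good :: "real \<Rightarrow> bool" where
  "good t \<longleftrightarrow> t \<ge> 0 \<and> L2 UNIV (U t) \<and> L2 UNIV (Du t) \<and> weak_sym_grad UNIV (U t) (Du t) \<and> weakly_div_free UNIV (U t) \<and>
     (AE x in lebesgue. x \<notin> - B t \<longrightarrow> Du t x = 0) \<and>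
     (\<integral>\<^sup>+x. ennreal (\<rho> t x * (norm (U t x))\<^sup>2) \<partial>lebesgue) \<le> ennreal M"

text \<open>The integral over space is only known to agree with a Borel function of t at almost
  every t; one such function is chosen, so that it can be integrated over time.\<close>

definition dissipation :: "real \<Rightarrow> ennreal" where
  "dissipation = (SOME d. d \<in> borel_measurable lborel \<and>
     (AE t in lebesgue. (\<integral>\<^sup>+x. ennreal ((norm (strain (t, x)))\<^sup>2) \<partial>lebesgue) = d t))"

lemma dissipation: "dissipation \<in> borel_measurable lborel"
    "AE t in lebesgue. (\<integral>\<^sup>+x. ennreal ((norm (strain (t, x)))\<^sup>2) \<partial>lebesgue) = dissipation t"
proof -
  have "(\<lambda>z. (norm (strain z))\<^sup>2) \<in> borel_measurable lebesgue" by measurable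
  from time_nn_integral_representative[OF this]
  have "\<exists>d. d \<in> borel_measurable lborel \<and> (AE t in lebesgue. (\<integral>\<^sup>+x. ennreal ((norm (strain (t, x)))\<^sup>2) \<partial>lebesgue) = d t)" by blast
  from someI_ex[OF this] show "dissipation \<in> borel_measurable lborel"
    "AE t in lebesgue. (\<integral>\<^sup>+x. ennreal ((norm (strain (t, x)))\<^sup>2) \<partial>lebesgue) = dissipation t"
    by (auto simp: dissipation_def)
qed

lemma dissipation_bound: "(\<integral>\<^sup>+t\<in>{0..T}. dissipation t \<partial>lebesgue) \<le> ennreal (M / (4 * \<nu>))"
proof -
  \<comment> \<open>The energy inequality may fail at T itself; a time shortly after T controls the
    larger interval.\<close>
  obtain t0 where t0: "t0 \<in> {max T 0..max T 0 + 1}" and "t0 \<ge> 0 \<longrightarrow>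
      (\<integral>\<^sup>+x. ennreal (\<rho> t0 x * (norm (U t0 x))\<^sup>2) \<partial>lebesgue)
      + ennreal (4 * \<nu>) * (\<integral>\<^sup>+s\<in>{0..t0}. (\<integral>\<^sup>+x. ennreal ((norm (Du s x))\<^sup>2) \<partial>lebesgue) \<partial>lebesgue)
      \<le> (\<integral>\<^sup>+x. ennreal (\<rho>0 x * (norm (U0 x))\<^sup>2) \<partial>lebesgue)"
    using AE_lebesgue_ex_in_interval[OF energy[unfolded AE_lebesgue_on_atLeast_iff], of "max T 0"] by blast
  then have e: "ennreal (4 * \<nu>) * (\<integral>\<^sup>+s\<in>{0..t0}. (\<integral>\<^sup>+x. ennreal ((norm (Du s x))\<^sup>2) \<partial>lebesgue) \<partial>lebesgue) \<le> ennreal M"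
    using t0 energy0 by (auto intro: order_trans dest: ennreal_add_leD(2))
  define I where "I = (\<integral>\<^sup>+s\<in>{0..t0}. (\<integral>\<^sup>+x. ennreal ((norm (Du s x))\<^sup>2) \<partial>lebesgue) \<partial>lebesgue)"
  have "I \<le> ennreal (M / (4 * \<nu>))"
  proof (cases I)
    case (real r)
    then have "ennreal (4 * \<nu> * r) \<le> ennreal M" using e pos by (simp add: I_def ennreal_mult)
    then have "4 * \<nu> * r \<le> M" using pos by (simp add: ennreal_le_iff)
    then show ?thesis using real pos by (auto intro!: ennreal_leI simp: field_simps)
  next
    case top
    then show ?thesis using e pos by (simp add: I_def[symmetric] ennreal_mult_top top_unique)
  qed
  moreover have "(\<integral>\<^sup>+t\<in>{0..T}. dissipation t \<partial>lebesgue) \<le> I"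
    unfolding I_def
  proof (rule nn_integral_mono_AE)
    show "AE t in lebesgue. dissipation t * indicator {0..T} t \<le> (\<integral>\<^sup>+x. ennreal ((norm (Du t x))\<^sup>2) \<partial>lebesgue) * indicator {0..t0} t"
      using dissipation(2)
    proof eventually_elim
      case (elim t)
      then show ?case using t0 by (auto simp: indicator_def strain_eq)
    qed
  qed
  ultimately show ?thesis by (rule order_trans[rotated])
qed

text \<open>The bound on every interval [0, n] makes the dissipation finite at almost every time,
  which puts \<open>Du t\<close> in L2. That \<open>U t\<close> is in L2 comes from the weakly
  continuous representative \<open>v\<close>.\<close>

lemma AE_good: "AE t in lebesgue. t \<ge> 0 \<longrightarrow> good t \<and> dissipation t = ennreal ((norm_L2 (Du t))\<^sup>2)"
proof -
  have fin: "AE t in lebesgue. \<forall>n. t \<in> {0..real n} \<longrightarrow> dissipation t \<noteq> \<infinity>"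
  proof (subst AE_all_countable, rule allI)
    fix n
    have dm: "(\<lambda>t. dissipation t * indicator {0..real n} t) \<in> borel_measurable lebesgue"
      by (intro measurable_completion borel_measurable_times_ennreal dissipation(1) borel_measurable_indicator) simp
    have "(\<integral>\<^sup>+t. dissipation t * indicator {0..real n} t \<partial>lebesgue) \<noteq> \<infinity>"
      using dissipation_bound[of "real n"] by (auto simp: top_unique)
    from nn_integral_PInf_AE[OF dm this]
    show "AE t in lebesgue. t \<in> {0..real n} \<longrightarrow> dissipation t \<noteq> \<infinity>" by eventually_elim auto
  qed
  show ?thesis
    using fin dissipation(2) v_eq[unfolded AE_lebesgue_on_atLeast_iff] Du_weak[unfolded AE_lebesgue_on_atLeast_iff]
      div_free[unfolded AE_lebesgue_on_atLeast_iff] Du_body[unfolded AE_lebesgue_on_atLeast_iff] energy[unfolded AE_lebesgue_on_atLeast_iff]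
  proof eventually_elim
    case (elim t)
    show ?case
    proof
      assume t: "t \<ge> 0"
      have "L2 UNIV (v t)" using v_cont t by (simp add: weakly_continuous_L2_def)
      then have 1: "L2 UNIV (U t)" by (rule L2_of_AE_eq) (use elim t in blast)
      have Dm: "Du t \<in> borel_measurable lebesgue" using elim t by (intro L1_loc_UNIV_measurable) (simp add: weak_sym_grad_def)
      have d: "(\<integral>\<^sup>+x. ennreal ((norm (Du t x))\<^sup>2) \<partial>lebesgue) = dissipation t" using elim(2) t by (simp add: strain_eq)
      have "dissipation t \<noteq> \<infinity>" using elim(1) t by (metis atLeastAtMost_iff real_arch_simple)
      then have Di: "integrable lebesgue (\<lambda>x. (norm (Du t x))\<^sup>2)"
        using Dm d by (intro integrableI_nonneg) (auto simp: less_top)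
      then have 2: "L2 UNIV (Du t)" using Dm by (simp add: L2_UNIV_iff)
      have 3: "dissipation t = ennreal ((norm_L2 (Du t))\<^sup>2)"
        unfolding d[symmetric] power2_norm_L2 by (rule nn_integral_eq_integral[OF Di]) simp
      have "(\<integral>\<^sup>+x. ennreal (\<rho> t x * (norm (U t x))\<^sup>2) \<partial>lebesgue) \<le> ennreal M"
        using elim(7) t energy0 by (auto intro: order_trans dest: ennreal_add_leD(1))
      then show "good t \<and> dissipation t = ennreal ((norm_L2 (Du t))\<^sup>2)"
        using 1 2 3 elim t by (simp add: good_def)
    qed
  qed
qed

lemma goodD:
  assumes "good t"
  shows "t \<ge> 0" "L2 UNIV (U t)" "L2 UNIV (Du t)" "weak_sym_grad UNIV (U t) (Du t)" "weakly_div_free UNIV (U t)"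
    "AE x in lebesgue. x \<notin> - B t \<longrightarrow> Du t x = 0"
    "(\<integral>\<^sup>+x. ennreal (\<rho> t x * (norm (U t x))\<^sup>2) \<partial>lebesgue) \<le> ennreal M"
  using assms by (auto simp: good_def)

lemma L2_indicator:
  assumes "L2 UNIV f" "A \<in> sets lebesgue"
  shows "L2 UNIV (\<lambda>x. indicator A x *\<^sub>R f x)"
proof -
  have [measurable]: "f \<in> borel_measurable lebesgue" "A \<in> sets lebesgue" and i: "integrable lebesgue (\<lambda>x. (norm (f x))\<^sup>2)"
    using assms by (auto simp: L2_UNIV_iff)
  have "integrable lebesgue (\<lambda>x. (norm (indicator A x *\<^sub>R f x))\<^sup>2)"
  proof (rule Bochner_Integration.integrable_bound[OF i])
    show "(\<lambda>x. (norm (indicator A x *\<^sub>R f x))\<^sup>2) \<in> borel_measurable lebesgue" by measurable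
  qed (simp add: indicator_def)
  moreover have "(\<lambda>x. indicator A x *\<^sub>R f x) \<in> borel_measurable lebesgue" by measurable
  ultimately show ?thesis by (simp add: L2_UNIV_iff)
qed

text \<open>The density is 1 in the fluid, so there the energy bounds the unweighted norm of the
  velocity.\<close>

lemma fluid_energy:
  assumes "good t"
  shows "L2 UNIV (\<lambda>x. fluid_velocity (t, x))" "norm_L2 (\<lambda>x. fluid_velocity (t, x)) \<le> sqrt M"
    "(LINT x|lebesgue. indicator (- B t) x * (norm (U t x))\<^sup>2) \<le> M"
proof -
  note g = goodD[OF assms]
  show 2: "L2 UNIV (\<lambda>x. fluid_velocity (t, x))"
    unfolding fluid_velocity_eq[OF g(1)] by (rule L2_indicator[OF g(2) B_lebesgue(2)])
  have eq: "(norm (fluid_velocity (t, x)))\<^sup>2 = indicator (- B t) x * (norm (U t x))\<^sup>2" for x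
    by (simp add: fluid_velocity_eq[OF g(1)] indicator_def)
  have "(LINT x|lebesgue. (norm (fluid_velocity (t, x)))\<^sup>2) \<le> M"
  proof (rule integral_le_of_nn_integral_le)
    show "(\<integral>\<^sup>+x. ennreal ((norm (fluid_velocity (t, x)))\<^sup>2) \<partial>lebesgue) \<le> ennreal M"
      by (rule order_trans[OF nn_integral_mono g(7)]) (auto simp: eq \<rho>_eq global_density_def indicator_def)
  qed (use 2 pos in \<open>auto simp: L2_UNIV_iff\<close>)
  then show "norm_L2 (\<lambda>x. fluid_velocity (t, x)) \<le> sqrt M"
    "(LINT x|lebesgue. indicator (- B t) x * (norm (U t x))\<^sup>2) \<le> M"
    by (simp_all add: norm_L2_def eq)
qed

lemma velocity_bound: assumes "good t" shows "norm (l t) \<le> K"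
proof -
  note g = goodD[OF assms]
  have "ennreal (m * (norm (l t))\<^sup>2) \<le> ennreal M"
  proof (rule order_trans[OF body_energy[OF orthogonal_Q[OF g(1)] body ang, of "l t" "h t" "\<omega> t"]])
    show "(\<integral>\<^sup>+x. ennreal (indicator (body_position S (h t) (Q t)) x * (body_density \<rho>in (h t) (Q t) x * (norm (l t + ang (\<omega> t) (x - h t)))\<^sup>2)) \<partial>lebesgue) \<le> ennreal M"
      by (rule order_trans[OF nn_integral_mono g(7)])
        (auto simp: \<rho>_eq U_eq B_eq global_density_def global_velocity_def body_velocity_def indicator_def)
  qed
  then have "m * (norm (l t))\<^sup>2 \<le> M" using pos by (simp add: ennreal_le_iff)
  then have "(norm (l t))\<^sup>2 \<le> M / m" using mass_pos by (simp add: pos_le_divide_eq mult.commute)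
  then show ?thesis unfolding K_def by (rule real_le_rsqrt)
qed

lemma l_measurable: "l \<in> borel_measurable (lebesgue_on {0..})"
  using l_Linf by (simp add: Linf_time_def)

lemma AE_velocity_bound: "AE t in lebesgue_on {0..}. norm (l t) \<le> K"
  unfolding AE_lebesgue_on_atLeast_iff using AE_good by eventually_elim (auto intro: velocity_bound)

lemma h_derivative: "AE t in lebesgue_on {0..}. (h has_vector_derivative l t) (at t)" and h_0: "h 0 = 0"
  using motion by (auto simp: rigid_motion_def)

lemma h_lipschitz: "K-lipschitz_on {0..} h"
proof -
  obtain L where "L-lipschitz_on {0..} h" using motion by (auto simp: rigid_motion_def)
  then show ?thesis by (rule lipschitz_of_AE_derivative_bound[OF _ l_measurable h_derivative AE_velocity_bound K_nonneg])
qed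

end

section \<open>The weak formulation tested with a moving field\<close>

lemma frechet_derivative_scaleR_shift:
  assumes "smooth_on UNIV W"
  shows "frechet_derivative (\<lambda>x. c *\<^sub>R W (x - p)) (at x) = (\<lambda>k. c *\<^sub>R frechet_derivative W (at (x - p)) k)"
proof -
  have "((\<lambda>x. W (x - p)) has_derivative frechet_derivative W (at (x - p))) (at x)"
    using smooth_on_has_derivative[OF smooth_shift[OF assms, of p] UNIV_I, of x] by (simp add: frechet_derivative_shift[OF assms])
  then have "((\<lambda>x. c *\<^sub>R W (x - p)) has_derivative (\<lambda>k. c *\<^sub>R frechet_derivative W (at (x - p)) k)) (at x)"
    by (rule has_derivative_scaleR_right)
  then show ?thesis by (rule frechet_derivative_at[symmetric])
qed

lemma inner_frechet_derivative:
  fixes W :: "real^'n \<Rightarrow> real^'n"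
  assumes "smooth_on UNIV W"
  shows "a \<bullet> frechet_derivative W (at y) b = (\<Sum>i\<in>UNIV. \<Sum>j\<in>UNIV. a $ i * (b $ j * pd j (\<lambda>x. W x $ i) y))"
  by (simp add: inner_vec_def frechet_derivative_vec_nth[OF assms] sum_distrib_left)

text \<open>The radius 2\<epsilon> leaves room for two errors of size \<epsilon>: the body lies
  within \<epsilon> of \<open>h t\<close>, and so does \<open>g t\<close>. The parameters
  \<open>a\<close> and \<open>\<tau>\<close> fix the time window in which the field is switched
  off.\<close>

locale tested_solution =
  rigid_body_solution ang \<nu> \<epsilon> M S \<rho>in uin lin \<omega>in u l \<omega> h Q B \<rho> U \<rho>0 U0 Du v
  for ang :: "'w::euclidean_space \<Rightarrow> real^'n::{finite,wellorder} \<Rightarrow> real^'n::_"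
    and \<nu> \<epsilon> M S \<rho>in uin lin \<omega>in u l \<omega> h Q B \<rho> U \<rho>0 U0 Du v +
  fixes g :: "real \<Rightarrow> real^'n::_" and W :: "real^'n::_ \<Rightarrow> real^'n::_" and e :: "real^'n::_" and R b a \<tau> T :: real
  assumes g: "smooth_on UNIV g" "\<And>t. t \<ge> 0 \<Longrightarrow> norm (g t - h t) \<le> \<epsilon>" "\<And>t. norm (frechet_derivative g (at t) 1) \<le> K"
    and W: "smooth_on UNIV W" "ball_supported R W" "\<And>x. divergence W x = 0" "\<And>x. norm (W x) \<le> b" "\<And>x. norm x < 2 * \<epsilon> \<Longrightarrow> W x = e"
    and R: "R > 0" and a: "a > 0" and \<tau>: "\<tau> > 0" and T: "a + \<tau> \<le> T"
begin

text \<open>The first factor ensures compact support in time: it is 1 for t \<ge> -1 and 0 for t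
  \<le> -2, hence invisible at nonnegative times. The second factor descends from 1 to 0 on
  [a, a + \<tau>], and \<open>\<sigma>'\<close> is its derivative alone.\<close>

definition "\<sigma> t = smooth_step (t + 2) * (1 - smooth_step ((t - a) / \<tau>))"
definition "\<sigma>' t = - (smooth_step' ((t - a) / \<tau>) / \<tau>)"
definition "\<phi> z = \<sigma> (fst z) *\<^sub>R W (snd z - g (fst z))"
definition "g' t = frechet_derivative g (at t) 1"

lemma \<sigma>_smooth: "smooth_on UNIV \<sigma>"
proof -
  have 1: "smooth_on UNIV (\<lambda>t. smooth_step (t + 2))"
    by (intro smooth_on_compose_UNIV[OF _ smooth_step_smooth] smooth_on_add smooth_on_id smooth_on_const open_UNIV)
  have "smooth_on UNIV (\<lambda>t. smooth_step (inverse \<tau> * (t - a)))"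
    by (intro smooth_on_compose_UNIV[OF _ smooth_step_smooth] smooth_on_mult smooth_on_diff smooth_on_id smooth_on_const open_UNIV)
  then have 2: "smooth_on UNIV (\<lambda>t. smooth_step ((t - a) / \<tau>))" by (simp add: divide_inverse mult.commute)
  show ?thesis unfolding \<sigma>_def[abs_def]
    by (intro smooth_on_mult smooth_on_diff smooth_on_const 1 2 open_UNIV)
qed

lemma \<sigma>_range: "0 \<le> \<sigma> t" "\<sigma> t \<le> 1"
  using smooth_step_range[of "t + 2"] smooth_step_range[of "(t - a) / \<tau>"] unfolding \<sigma>_def by (auto intro: mult_le_one)

lemma \<sigma>_late: "t \<ge> T \<Longrightarrow> \<sigma> t = 0"
proof -
  assume "t \<ge> T"
  then have "1 \<le> (t - a) / \<tau>" using T \<tau> by (simp add: pos_le_divide_eq)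
  then show ?thesis by (simp add: \<sigma>_def smooth_step_1)
qed

lemma \<sigma>_early: "t \<le> - 2 \<Longrightarrow> \<sigma> t = 0"
  by (simp add: \<sigma>_def smooth_step_0)

lemma \<sigma>_0: "\<sigma> 0 = 1"
  using a \<tau> by (simp add: \<sigma>_def smooth_step_1 smooth_step_0 divide_nonpos_pos)

lemma \<sigma>_derivative: assumes "t \<ge> 0" shows "(\<sigma> has_field_derivative \<sigma>' t) (at t)"
proof -
  have inner: "((\<lambda>t. (t - a) / \<tau>) has_field_derivative 1 / \<tau>) (at t)"
    using \<tau> by (auto intro!: derivative_eq_intros)
  have "((\<lambda>t. 1 - smooth_step ((t - a) / \<tau>)) has_field_derivative (0 - smooth_step' ((t - a) / \<tau>) * (1 / \<tau>))) (at t)"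
    by (intro DERIV_diff DERIV_const DERIV_chain2[OF smooth_step_DERIV inner])
  then have "((\<lambda>t. 1 - smooth_step ((t - a) / \<tau>)) has_field_derivative \<sigma>' t) (at t)" by (simp add: \<sigma>'_def)
  then show ?thesis
    by (rule has_field_derivative_transform_within_open[where S = "{-1<..}"]) (use assms in \<open>auto simp: \<sigma>_def smooth_step_1\<close>)
qed

lemma \<sigma>'_outside: "t \<notin> {a..a + \<tau>} \<Longrightarrow> \<sigma>' t = 0"
proof -
  assume "t \<notin> {a..a + \<tau>}"
  then have "(t - a) / \<tau> < 0 \<or> 1 < (t - a) / \<tau>" using \<tau> by (auto simp: divide_less_0_iff less_divide_eq)
  then show ?thesis using smooth_step'_0 by (simp add: \<sigma>'_def)
qed

lemma \<phi>_smooth: "smooth_on UNIV \<phi>"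
proof -
  have f: "smooth_on UNIV (fst :: real \<times> (real^'n::_) \<Rightarrow> real)" and s: "smooth_on UNIV (snd :: real \<times> (real^'n::_) \<Rightarrow> real^'n::_)"
    by (intro smooth_on_bounded_linear bounded_linear_fst bounded_linear_snd open_UNIV)+
  have d: "smooth_on UNIV (\<lambda>z::real \<times> (real^'n::_). snd z - g (fst z))"
    by (intro smooth_on_diff s smooth_on_compose_UNIV[OF f g(1)] open_UNIV)
  show ?thesis unfolding \<phi>_def[abs_def]
    by (intro smooth_on_scaleR smooth_on_compose_UNIV[OF f \<sigma>_smooth] smooth_on_compose_UNIV[OF d W(1)] open_UNIV)
qed

lemma \<phi>_compact: "compact (closure {z. \<phi> z \<noteq> 0})"
proof -
  have "compact (g ` {-2..T})"
    by (intro compact_continuous_image continuous_on_subset[OF smooth_on_continuous_on[OF g(1)]]) auto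
  then obtain G where "\<forall>y\<in>g ` {-2..T}. norm y \<le> G"
    using compact_imp_bounded bounded_iff by metis
  then have G: "\<And>t. t \<in> {-2..T} \<Longrightarrow> norm (g t) \<le> G" by blast
  have sub: "{z. \<phi> z \<noteq> 0} \<subseteq> {-2..T} \<times> cball 0 (R + G)"
  proof safe
    fix t x assume nz: "\<phi> (t, x) \<noteq> 0"
    then have "\<sigma> t \<noteq> 0" and Wn: "W (x - g t) \<noteq> 0" by (auto simp: \<phi>_def)
    then have "\<not> t \<ge> T" "\<not> t \<le> - 2" using \<sigma>_late \<sigma>_early by blast+
    then show t: "t \<in> {-2..T}" by simp
    have "norm (x - g t) \<le> R" using Wn W(2) by (auto simp: ball_supported_def not_less[symmetric])
    then show "x \<in> cball 0 (R + G)" using G[OF t] norm_triangle_sub[of x "g t"] by simp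
  qed
  have c: "compact ({-2..T} \<times> cball (0::real^'n::_) (R + G))" by (intro compact_Times) auto
  then have "closure {z. \<phi> z \<noteq> 0} \<subseteq> {-2..T} \<times> cball 0 (R + G)"
    by (intro closure_minimal[OF sub] compact_imp_closed)
  then show ?thesis using compact_Int_closed[OF c closed_closure[of "{z. \<phi> z \<noteq> 0}"]] by (simp add: Int_absorb1)
qed

lemma near_body: assumes "t \<ge> 0" "x \<in> B t" shows "norm (x - g t) < 2 * \<epsilon>"
proof -
  have "norm (x - g t) \<le> norm (x - h t) + norm (g t - h t)"
    using norm_triangle_ineq4[of "x - h t" "g t - h t"] by simp
  then show ?thesis using body_near[OF assms] g(2)[OF assms(1)] by linarith
qed

lemma W_near:
  assumes "norm y < 2 * \<epsilon>"
  shows "W y = e" "frechet_derivative W (at y) k = 0" "sym_grad W y = 0"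
proof -
  have o: "open {y::real^'n::_. norm y < 2 * \<epsilon>}" by (intro open_Collect_less continuous_intros)
  show "W y = e" by (rule W(5)[OF assms])
  show "frechet_derivative W (at y) k = 0" "sym_grad W y = 0"
    using sym_grad_eq_0[OF o, of y W e] assms W(5) by auto
qed

lemma \<phi>_divergence: "divergence (\<lambda>y. \<phi> (t, y)) x = 0"
proof -
  have "divergence (\<lambda>y. \<phi> (t, y)) x = \<sigma> t * divergence W (x - g t)"
    by (simp add: \<phi>_def divergence_def trace_def jacobian_def frechet_derivative_scaleR_shift[OF W(1)] matrix_def sum_distrib_left)
  then show ?thesis by (simp add: W(3))
qed

lemma \<phi>_sym_grad: "sym_grad (\<lambda>y. \<phi> (t, y)) x = \<sigma> t *\<^sub>R sym_grad W (x - g t)"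
  by (simp add: \<phi>_def sym_grad_def jacobian_def frechet_derivative_scaleR_shift[OF W(1)] matrix_def transpose_def vec_eq_iff distrib_left)

lemma \<phi>_jacobian: "jacobian (\<lambda>y. \<phi> (t, y)) (at x) *v w = \<sigma> t *\<^sub>R frechet_derivative W (at (x - g t)) w"
proof -
  have "(\<lambda>y. \<phi> (t, y)) = (\<lambda>y. \<sigma> t *\<^sub>R W (y - g t))" by (simp add: \<phi>_def)
  moreover have "(\<lambda>y. \<sigma> t *\<^sub>R W (y - g t)) differentiable (at x)"
    using smooth_on_has_derivative[OF smooth_on_scaleR[OF open_UNIV smooth_on_const smooth_shift[OF W(1)]] UNIV_I] differentiableI by blast
  ultimately have "((\<lambda>y. \<phi> (t, y)) has_derivative (\<lambda>w. jacobian (\<lambda>y. \<phi> (t, y)) (at x) *v w)) (at x)"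
    using jacobian_works by metis
  from frechet_derivative_at[OF this] show ?thesis
    by (simp add: \<phi>_def frechet_derivative_scaleR_shift[OF W(1)] fun_eq_iff)
qed

lemma \<phi>_time_derivative:
  assumes "t \<ge> 0"
  shows "vector_derivative (\<lambda>s. \<phi> (s, x)) (at t) = \<sigma>' t *\<^sub>R W (x - g t) - \<sigma> t *\<^sub>R frechet_derivative W (at (x - g t)) (g' t)"
proof -
  have lg: "linear (frechet_derivative g (at t))" and lW: "linear (frechet_derivative W (at y))" for y
    using smooth_on_has_derivative[OF g(1) UNIV_I] smooth_on_has_derivative[OF W(1) UNIV_I] has_derivative_linear by blast+
  have gd: "((\<lambda>s. x - g s) has_derivative (\<lambda>k. - frechet_derivative g (at t) k)) (at t)"
    using has_derivative_diff[OF has_derivative_const smooth_on_has_derivative[OF g(1) UNIV_I], of x] by simp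
  have "((\<lambda>s. W (x - g s)) has_derivative (\<lambda>k. frechet_derivative W (at (x - g t)) (- frechet_derivative g (at t) k))) (at t)"
    by (rule has_derivative_compose[OF gd smooth_on_has_derivative[OF W(1) UNIV_I]])
  moreover have "frechet_derivative W (at (x - g t)) (- frechet_derivative g (at t) k) = k *\<^sub>R (- frechet_derivative W (at (x - g t)) (g' t))" for k
    using linear_cmul[OF lg, of k 1] by (simp add: g'_def linear_neg[OF lW] linear_cmul[OF lW])
  ultimately have "((\<lambda>s. W (x - g s)) has_vector_derivative (- frechet_derivative W (at (x - g t)) (g' t))) (at t)"
    by (simp add: has_vector_derivative_def)
  from has_vector_derivative_scaleR[OF \<sigma>_derivative[OF assms] this]
  show ?thesis by (simp add: \<phi>_def vector_derivative_at)
qed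

lemma \<phi>_test: "fluid_body_test_function B \<phi>"
  unfolding fluid_body_test_function_def
  using \<phi>_smooth \<phi>_compact \<phi>_divergence \<phi>_sym_grad W_near(3)[OF near_body] by simp

text \<open>The integrand of the weak formulation without the momentum of the body. Passing to
  \<open>fluid_velocity\<close> makes it jointly measurable and does not change the terms with
  derivatives of \<open>W\<close>, which vanish on the body; the body's share of the term with
  \<open>\<sigma>'\<close> is accounted for separately.\<close>

definition H :: "real \<times> (real^'n::_) \<Rightarrow> real" where
  "H z = \<sigma>' (fst z) * (fluid_velocity z \<bullet> W (snd z - g (fst z)))
     + \<sigma> (fst z) * (fluid_velocity z \<bullet> frechet_derivative W (at (snd z - g (fst z))) (fluid_velocity z)
         - fluid_velocity z \<bullet> frechet_derivative W (at (snd z - g (fst z))) (g' (fst z))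
         - 2 * \<nu> * (strain z \<bullet> sym_grad W (snd z - g (fst z))))"

lemma H_measurable: "H \<in> borel_measurable lebesgue"
proof -
  have cont: "(\<lambda>z. f (snd z - g (fst z))) \<in> borel_measurable lebesgue" if "continuous_on UNIV f" for f :: "real^'n::_ \<Rightarrow> 'z::euclidean_space"
  proof (rule measurable_completion)
    have "continuous_on UNIV (\<lambda>z::real \<times> (real^'n::_). f (snd z - g (fst z)))"
      by (intro continuous_on_compose2[OF that] continuous_on_diff continuous_on_snd continuous_on_fst continuous_on_id
           continuous_on_compose2[OF smooth_on_continuous_on[OF g(1)]]) auto
    then show "(\<lambda>z. f (snd z - g (fst z))) \<in> borel_measurable lborel" by (simp add: borel_measurable_continuous_onI)
  qed
  have time: "(\<lambda>z::real \<times> (real^'n::_). f (fst z)) \<in> borel_measurable lebesgue" if "continuous_on UNIV f" for f :: "real \<Rightarrow> 'z::euclidean_space"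
  proof (rule measurable_completion)
    have "continuous_on UNIV (\<lambda>z::real \<times> (real^'n::_). f (fst z))"
      by (intro continuous_on_compose2[OF that] continuous_on_fst continuous_on_id) auto
    then show "(\<lambda>z::real \<times> (real^'n::_). f (fst z)) \<in> borel_measurable lborel" by (simp add: borel_measurable_continuous_onI)
  qed
  have "continuous_on UNIV \<sigma>'"
    unfolding \<sigma>'_def[abs_def] using \<tau>
    by (intro continuous_intros continuous_on_compose2[OF smooth_on_continuous_on[OF smooth_step'_smooth]]) auto
  note [measurable] = time[OF this] time[OF smooth_on_continuous_on[OF \<sigma>_smooth]]
    time[OF smooth_on_continuous_on[OF smooth_on_frechet_derivative[OF g(1), of 1]], folded g'_def]
    cont[OF smooth_on_continuous_on[OF W(1)]] cont[OF sym_grad_continuous[OF W(1)]]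
    cont[OF smooth_on_continuous_on[OF pd_smooth[OF smooth_on_vec_nth[OF W(1)]]]]
  show ?thesis unfolding H_def[abs_def] inner_frechet_derivative[OF W(1)] by measurable
qed

definition "P t = (LINT x|lebesgue. H (t, x))"

lemma P_measurable: "P \<in> borel_measurable lebesgue"
  unfolding P_def[abs_def] by (rule borel_measurable_time_integral[OF H_measurable])

definition "w2 = norm_L2 W"
definition "s2 = norm_L2 (sym_grad W)"

lemma sym_grad_W_supported: "ball_supported R (sym_grad W)"
proof -
  have o: "open {y::real^'n::_. R < norm y}" by (intro open_Collect_less continuous_intros)
  show ?thesis unfolding ball_supported_def
  proof safe
    fix z :: "real^'n::_" assume "R < norm z"
    then show "sym_grad W z = 0" using W(2) by (intro sym_grad_eq_0(1)[OF o, of z W 0]) (auto simp: ball_supported_def)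
  qed
qed

lemma shifted_norms:
  "L2 UNIV (\<lambda>x. W (x - c))" "norm_L2 (\<lambda>x. W (x - c)) = w2"
  "L2 UNIV (\<lambda>x. sym_grad W (x - c))" "norm_L2 (\<lambda>x. sym_grad W (x - c)) = s2"
proof -
  note Ws = L2_shift[OF smooth_on_continuous_on[OF W(1)] W(2)] and Gs = L2_shift[OF sym_grad_continuous[OF W(1)] sym_grad_W_supported]
  show "L2 UNIV (\<lambda>x. W (x - c))" "L2 UNIV (\<lambda>x. sym_grad W (x - c))" by (rule Ws(1) Gs(1))+
  show "norm_L2 (\<lambda>x. W (x - c)) = w2" "norm_L2 (\<lambda>x. sym_grad W (x - c)) = s2"
    using Ws(2)[of c] Ws(2)[of 0] Gs(2)[of c] Gs(2)[of 0] by (simp_all add: norm_L2_def w2_def s2_def)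
qed

text \<open>The coefficients of 1 + |Du|^2 in the bounds for transport, convection and viscosity, in
  this order.\<close>

definition "\<Theta> = 2 * K * w2 + 2 * b * sqrt (2 * pi * real CARD('n) * R * sqrt M) + 2 * \<nu> * s2"

lemma b_nonneg: "b \<ge> 0" using W(4)[of 0] norm_ge_zero order_trans by blast

lemma \<Theta>_nonneg: "\<Theta> \<ge> 0"
  unfolding \<Theta>_def using K_nonneg b_nonneg pos R by (auto simp: w2_def s2_def intro!: add_nonneg_nonneg mult_nonneg_nonneg norm_L2_nonneg)

lemma good_slice:
  assumes "good t"
  shows "integrable lebesgue (\<lambda>x. H (t, x))"
    and "\<bar>P t\<bar> \<le> \<bar>\<sigma>' t\<bar> * (sqrt M * w2) + \<sigma> t * (\<Theta> * (1 + (norm_L2 (Du t))\<^sup>2))"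
proof -
  note gd = goodD[OF assms]
  define Uf where "Uf x = fluid_velocity (t, x)" for x
  define DW where "DW x = frechet_derivative W (at (x - g t))" for x
  have Uf2: "L2 UNIV Uf" and UfM: "norm_L2 Uf \<le> sqrt M" using fluid_energy[OF assms] by (auto simp: Uf_def[abs_def])
  \<comment> \<open>Derivatives of the shifted field vanish on the body, so the fluid velocity may
    be exchanged for \<open>U t\<close>, which is divergence free on the whole space as the integral
    identities require.\<close>
  have rep: "Uf x \<bullet> DW x k = U t x \<bullet> DW x k" "Uf x \<bullet> DW x (Uf x) = U t x \<bullet> DW x (U t x)" for x k
  proof -
    show "Uf x \<bullet> DW x k = U t x \<bullet> DW x k" "Uf x \<bullet> DW x (Uf x) = U t x \<bullet> DW x (U t x)"
      using W_near(2)[OF near_body[OF gd(1)]] by (cases "x \<in> B t"; simp add: Uf_def DW_def fluid_velocity_eq[OF gd(1)])+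
  qed
  have i1: "integrable lebesgue (\<lambda>x. Uf x \<bullet> W (x - g t))" and b1: "\<bar>LINT x|lebesgue. Uf x \<bullet> W (x - g t)\<bar> \<le> sqrt M * w2"
    using L2_inner_bound[OF Uf2 shifted_norms(1)] UfM mult_right_mono[OF UfM norm_L2_nonneg[of W]]
    by (auto simp: shifted_norms(2) w2_def intro: order_trans)
  \<comment> \<open>A crude bound on the derivative of \<open>W\<close>; it serves integrability and
    does not enter the estimate of \<open>P t\<close>.\<close>
  have "\<exists>C. \<forall>x p q. \<bar>p \<bullet> DW x q\<bar> \<le> C * (norm p * norm q) \<and> (DW x q \<noteq> 0 \<longrightarrow> x \<in> cball (g t) R)"
  proof -
    have "\<exists>C. \<forall>x. \<bar>pd j (\<lambda>x. W x $ i) x\<bar> \<le> C" for i j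
    proof -
      have "ball_supported R (\<lambda>x. W x $ i)" using W(2) by (simp add: ball_supported_def)
      then show ?thesis
        using bounded_measurable_ball_supported[OF pd_smooth[OF smooth_on_vec_nth[OF W(1), of i]] pd_ball_supported] by metis
    qed
    then have "\<forall>i j. \<exists>C. \<forall>x. \<bar>pd j (\<lambda>x. W x $ i) x\<bar> \<le> C" by blast
    then obtain C where C: "\<And>i j x. \<bar>pd j (\<lambda>x. W x $ i) x\<bar> \<le> C i j" by metis
    show ?thesis
    proof (intro exI[of _ "\<Sum>i\<in>UNIV. \<Sum>j\<in>UNIV. C i j"] allI conjI impI)
      fix x p q
      have "\<bar>p \<bullet> DW x q\<bar> \<le> (\<Sum>i\<in>UNIV. \<Sum>j\<in>UNIV. \<bar>p $ i * (q $ j * pd j (\<lambda>x. W x $ i) (x - g t))\<bar>)"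
        unfolding DW_def inner_frechet_derivative[OF W(1)] by (intro order_trans[OF sum_abs] sum_mono order_refl)
      also have "\<dots> \<le> (\<Sum>i\<in>UNIV. \<Sum>j\<in>UNIV. C i j * (norm p * norm q))"
      proof (intro sum_mono)
        fix i j
        have "\<bar>p $ i\<bar> * (\<bar>q $ j\<bar> * \<bar>pd j (\<lambda>x. W x $ i) (x - g t)\<bar>) \<le> norm p * (norm q * C i j)"
          by (intro mult_mono C component_le_norm_cart) auto
        then show "\<bar>p $ i * (q $ j * pd j (\<lambda>x. W x $ i) (x - g t))\<bar> \<le> C i j * (norm p * norm q)" by (simp add: abs_mult mult_ac)
      qed
      finally show "\<bar>p \<bullet> DW x q\<bar> \<le> (\<Sum>i\<in>UNIV. \<Sum>j\<in>UNIV. C i j) * (norm p * norm q)" by (simp add: sum_distrib_right)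
      assume nz: "DW x q \<noteq> 0"
      have o: "open {y::real^'n::_. R < norm y}" by (intro open_Collect_less continuous_intros)
      have "\<not> R < norm (x - g t)"
      proof
        assume "R < norm (x - g t)"
        then have "DW x q = 0" unfolding DW_def using W(2) by (intro sym_grad_eq_0(2)[OF o, of "x - g t" W 0]) (auto simp: ball_supported_def)
        then show False using nz by simp
      qed
      then show "x \<in> cball (g t) R" by (simp add: dist_norm norm_minus_commute)
    qed
  qed
  then obtain C where C: "\<And>x p q. \<bar>p \<bullet> DW x q\<bar> \<le> C * (norm p * norm q)" and DWs: "\<And>x q. DW x q \<noteq> 0 \<Longrightarrow> x \<in> cball (g t) R" by blast
  have pdc: "(\<lambda>x. pd j (\<lambda>x. W x $ i) (x - g t)) \<in> borel_measurable lebesgue" for i j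
  proof (rule measurable_completion)
    have "continuous_on UNIV (\<lambda>x. pd j (\<lambda>x. W x $ i) (x - g t))"
      by (intro continuous_on_compose2[OF smooth_on_continuous_on[OF pd_smooth[OF smooth_on_vec_nth[OF W(1)]]]] continuous_intros) auto
    then show "(\<lambda>x. pd j (\<lambda>x. W x $ i) (x - g t)) \<in> borel_measurable lborel" by (simp add: borel_measurable_continuous_onI)
  qed
  have [measurable]: "U t \<in> borel_measurable lebesgue" using gd(2) by (simp add: L2_UNIV_iff)
  have DWm: "(\<lambda>x. U t x \<bullet> DW x (q x)) \<in> borel_measurable lebesgue" if [measurable]: "q \<in> borel_measurable lebesgue" for q
    unfolding DW_def inner_frechet_derivative[OF W(1)] using pdc by measurable
  have i2: "integrable lebesgue (\<lambda>x. U t x \<bullet> DW x (U t x))"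
    by (rule L2_bounded_product(1)[OF gd(2) gd(2) DWm]) (use C in auto)
  \<comment> \<open>A nonzero constant vector is not square integrable on the whole space; it is
    restricted to the ball outside which the derivative of the shifted field vanishes.\<close>
  have ci: "L2 UNIV (\<lambda>x. indicator (cball (g t) R) x *\<^sub>R g' t)"
  proof -
    have [measurable]: "cball (g t) R \<in> sets lebesgue" by (intro sets_completionI_sets) simp
    have "integrable lebesgue (\<lambda>x. indicator (cball (g t) R) x * (norm (g' t))\<^sup>2)"
      using emeasure_compact_finite[of "cball (g t) R"] by (intro integrable_mult_left integrable_real_indicator) auto
    moreover have "(norm (indicator (cball (g t) R) x *\<^sub>R g' t))\<^sup>2 = indicator (cball (g t) R) x * (norm (g' t))\<^sup>2" for x
      by (simp add: indicator_def)
    moreover have "(\<lambda>x. indicator (cball (g t) R) x *\<^sub>R g' t) \<in> borel_measurable lebesgue" by measurable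
    ultimately show ?thesis by (simp only: L2_UNIV_iff)
  qed
  have i3: "integrable lebesgue (\<lambda>x. U t x \<bullet> DW x (g' t))"
  proof (rule L2_bounded_product(1)[OF gd(2) ci DWm[of "\<lambda>_. g' t"]])
    show "AE x in lebesgue. \<bar>U t x \<bullet> DW x (g' t)\<bar> \<le> C * (norm (U t x) * norm (indicator (cball (g t) R) x *\<^sub>R g' t))"
    proof (rule AE_I2)
      fix x
      show "\<bar>U t x \<bullet> DW x (g' t)\<bar> \<le> C * (norm (U t x) * norm (indicator (cball (g t) R) x *\<^sub>R g' t))"
      proof (cases "x \<in> cball (g t) R")
        case True then show ?thesis using C[where p = "U t x" and x = x and q = "g' t"] by simp
      next
        case False
        then have "DW x (g' t) = 0" using DWs by blast
        then show ?thesis using False by simp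
      qed
    qed
  qed simp
  have i4: "integrable lebesgue (\<lambda>x. Du t x \<bullet> sym_grad W (x - g t))" and b4: "\<bar>LINT x|lebesgue. Du t x \<bullet> sym_grad W (x - g t)\<bar> \<le> norm_L2 (Du t) * s2"
    using L2_inner_bound[OF gd(3) shifted_norms(3)[of "g t"]] by (auto simp: shifted_norms(4))
  have b2: "\<bar>LINT x|lebesgue. U t x \<bullet> DW x (U t x)\<bar> \<le> 2 * b * sqrt (2 * pi * real CARD('n) * R * sqrt M) * (1 + (norm_L2 (Du t))\<^sup>2)"
    unfolding DW_def by (rule convection_bound[OF gd(2-5) R B_lebesgue(2) gd(6) fluid_energy(3)[OF assms] pos(3) W(1-4)])
  have b3: "\<bar>LINT x|lebesgue. U t x \<bullet> DW x (g' t)\<bar> \<le> 2 * norm (g' t) * norm_L2 (Du t) * w2"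
    unfolding DW_def using transport_bound[OF gd(2-4) W(1-3), of "g t" "g' t"] by (simp add: shifted_norms(2))
  have Heq: "H (t, x) = \<sigma>' t * (Uf x \<bullet> W (x - g t)) + \<sigma> t * (U t x \<bullet> DW x (U t x) - U t x \<bullet> DW x (g' t) - 2 * \<nu> * (Du t x \<bullet> sym_grad W (x - g t)))" for x
    unfolding H_def fst_conv snd_conv Uf_def[symmetric] DW_def[symmetric] strain_eq[OF gd(1)] rep(2) rep(1)[of x "g' t"] ..
  show "integrable lebesgue (\<lambda>x. H (t, x))"
    unfolding Heq by (intro Bochner_Integration.integrable_add integrable_mult_right Bochner_Integration.integrable_diff i1 i2 i3 i4)
  define x1 where "x1 = (LINT x|lebesgue. Uf x \<bullet> W (x - g t))"
  define x2 where "x2 = (LINT x|lebesgue. U t x \<bullet> DW x (U t x))"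
  define x3 where "x3 = (LINT x|lebesgue. U t x \<bullet> DW x (g' t))"
  define x4 where "x4 = (LINT x|lebesgue. Du t x \<bullet> sym_grad W (x - g t))"
  have "P t = \<sigma>' t * x1 + \<sigma> t * (x2 - x3 - 2 * \<nu> * x4)"
    unfolding P_def Heq x1_def x2_def x3_def x4_def using i1 i2 i3 i4 by simp
  then have "\<bar>P t\<bar> \<le> \<bar>\<sigma>' t\<bar> * \<bar>x1\<bar> + \<sigma> t * \<bar>x2 - x3 - 2 * \<nu> * x4\<bar>"
    using abs_triangle_ineq[of "\<sigma>' t * x1" "\<sigma> t * (x2 - x3 - 2 * \<nu> * x4)"] \<sigma>_range(1)[of t] by (simp add: abs_mult)
  also have "\<dots> \<le> \<bar>\<sigma>' t\<bar> * (sqrt M * w2) + \<sigma> t * (\<Theta> * (1 + (norm_L2 (Du t))\<^sup>2))"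
  proof (intro add_mono mult_left_mono \<sigma>_range)
    show "\<bar>x1\<bar> \<le> sqrt M * w2" using b1 by (simp add: x1_def)
    \<comment> \<open>\<open>D\<close> dominates both 1 and the norm of \<open>Du t\<close>, so the
      three terms become multiples of one quantity whose time integral the energy controls.\<close>
    define D where "D = 1 + (norm_L2 (Du t))\<^sup>2"
    have nD: "norm_L2 (Du t) \<le> D"
      using zero_le_power2[of "norm_L2 (Du t) - 1"] norm_L2_nonneg[of "Du t"] by (simp add: D_def power2_diff)
    have g'K: "norm (g' t) \<le> K" using g(3) by (simp add: g'_def)
    have "\<bar>x3\<bar> \<le> 2 * norm (g' t) * norm_L2 (Du t) * w2" using b3 by (simp add: x3_def)
    also have "\<dots> \<le> 2 * K * D * w2"
      using g'K nD K_nonneg by (intro mult_right_mono mult_mono) (auto simp: w2_def norm_L2_nonneg)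
    finally have "\<bar>x3\<bar> \<le> 2 * K * w2 * D" by (simp add: mult_ac)
    moreover have "\<bar>x2\<bar> \<le> 2 * b * sqrt (2 * pi * real CARD('n) * R * sqrt M) * D" using b2 by (simp add: x2_def D_def)
    moreover have "\<bar>2 * \<nu> * x4\<bar> \<le> 2 * \<nu> * s2 * D"
    proof -
      have "\<bar>x4\<bar> \<le> norm_L2 (Du t) * s2" using b4 by (simp add: x4_def)
      also have "\<dots> \<le> D * s2" using nD by (intro mult_right_mono) (auto simp: s2_def norm_L2_nonneg)
      finally have "2 * \<nu> * \<bar>x4\<bar> \<le> 2 * \<nu> * (D * s2)" using pos by (intro mult_left_mono) auto
      then show ?thesis using pos by (simp add: abs_mult mult_ac)
    qed
    moreover have "\<bar>x2 - x3 - 2 * \<nu> * x4\<bar> \<le> \<bar>x2\<bar> + \<bar>x3\<bar> + \<bar>2 * \<nu> * x4\<bar>" by linarith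
    ultimately have "\<bar>x2 - x3 - 2 * \<nu> * x4\<bar> \<le> 2 * b * sqrt (2 * pi * real CARD('n) * R * sqrt M) * D + 2 * K * w2 * D + 2 * \<nu> * s2 * D" by linarith
    also have "\<dots> = \<Theta> * D" by (simp add: \<Theta>_def algebra_simps)
    finally show "\<bar>x2 - x3 - 2 * \<nu> * x4\<bar> \<le> \<Theta> * (1 + (norm_L2 (Du t))\<^sup>2)" by (simp add: D_def)
  qed auto
  finally show "\<bar>P t\<bar> \<le> \<bar>\<sigma>' t\<bar> * (sqrt M * w2) + \<sigma> t * (\<Theta> * (1 + (norm_L2 (Du t))\<^sup>2))" .
qed

text \<open>On the body the test function has the constant value
  \<open>\<sigma> t *\<^sub>R e\<close> in space, and in a whole neighbourhood of each of its
  points, so only the term with \<open>\<sigma>'\<close> survives there;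
  \<open>body_momentum\<close> evaluates it exactly. In the fluid the density is 1 and the integrand
  is that of \<open>P\<close>.\<close>

lemma inner_identity:
  assumes "good t"
  shows "(LINT x|lebesgue. \<rho> t x * (U t x \<bullet> (vector_derivative (\<lambda>s. \<phi> (s, x)) (at t) + jacobian (\<lambda>y. \<phi> (t, y)) (at x) *v U t x))
               - 2 * \<nu> * (Du t x \<bullet> sym_grad (\<lambda>y. \<phi> (t, y)) x))
    = \<sigma>' t * (m * (l t \<bullet> e)) + P t"
proof -
  note gd = goodD[OF assms]
  note bm = body_momentum[OF orthogonal_Q[OF gd(1)] body ang[of "\<omega> t"], where l = "l t" and h = "h t" and e = e]
  let ?I = "\<lambda>x. indicator (body_position S (h t) (Q t)) x * (body_density \<rho>in (h t) (Q t) x * ((l t + ang (\<omega> t) (x - h t)) \<bullet> e))"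
  have eq: "\<rho> t x * (U t x \<bullet> (vector_derivative (\<lambda>s. \<phi> (s, x)) (at t) + jacobian (\<lambda>y. \<phi> (t, y)) (at x) *v U t x))
               - 2 * \<nu> * (Du t x \<bullet> sym_grad (\<lambda>y. \<phi> (t, y)) x) = \<sigma>' t * ?I x + H (t, x)" for x
  proof (cases "x \<in> B t")
    case True
    note near = W_near[OF near_body[OF gd(1) True]]
    show ?thesis using True
      by (simp add: \<phi>_time_derivative[OF gd(1)] \<phi>_jacobian \<phi>_sym_grad near H_def fluid_velocity_eq[OF gd(1)])
         (simp add: \<rho>_eq U_eq B_eq global_density_def global_velocity_def body_velocity_def)
  next
    case False
    have "x \<notin> body_position S (h t) (Q t)" using False by (simp add: B_eq)
    then have "?I x = 0" by simp
    moreover have "\<rho> t x = 1" using False by (simp add: \<rho>_eq global_density_def)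
    moreover have "fluid_velocity (t, x) = U t x" using False by (simp add: fluid_velocity_eq[OF gd(1)])
    ultimately show ?thesis
      by (simp add: \<phi>_time_derivative[OF gd(1)] \<phi>_jacobian \<phi>_sym_grad H_def strain_eq[OF gd(1)] inner_add_right inner_diff_right algebra_simps)
  qed
  show ?thesis unfolding eq P_def
    using bm good_slice(1)[OF assms] by simp
qed

text \<open>\<open>body_momentum\<close> with h = 0 and the identity rotation evaluates the part on
  the body. The fluid part is the product of a velocity of norm at most sqrt M with the field,
  estimated by Cauchy-Schwarz.\<close>

lemma initial_identity:
  "\<bar>(LINT x|lebesgue. \<rho>0 x * (U0 x \<bullet> \<phi> (0, x))) - m * (lin \<bullet> e)\<bar> \<le> sqrt M * w2"
proof -
  have oI: "orthogonal_matrix (mat 1 :: real^'n::_^'n::_)" by (simp add: orthogonal_matrix_def transpose_mat)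
  have pS: "body_position S 0 (mat 1) = S" by (simp add: body_position_def transpose_mat del: transpose_matrix_vector)
  have dS: "body_density \<rho>in 0 (mat 1) = \<rho>in" by (simp add: body_density_def fun_eq_iff transpose_mat del: transpose_matrix_vector)
  note bm = body_momentum[OF oI body ang[of \<omega>in], where l = lin and h = 0 and e = e, unfolded pS dS]
  have SS [measurable]: "S \<in> sets lebesgue" "- S \<in> sets lebesgue"
  proof -
    have "closed S" using body by (simp add: rigid_body_def)
    then show "S \<in> sets lebesgue" by (intro sets_completionI_sets) auto
    then show "- S \<in> sets lebesgue" by (simp add: Compl_in_sets_lebesgue)
  qed
  define f where "f x = indicator (- S) x *\<^sub>R U0 x" for x
  have f2: "L2 UNIV f" unfolding f_def by (rule L2_indicator[OF init SS(2)])
  have feq: "(norm (f x))\<^sup>2 = indicator (- S) x * (norm (U0 x))\<^sup>2" for x by (simp add: f_def indicator_def)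
  have "(LINT x|lebesgue. (norm (f x))\<^sup>2) \<le> M"
  proof (rule integral_le_of_nn_integral_le)
    show "(\<integral>\<^sup>+x. ennreal ((norm (f x))\<^sup>2) \<partial>lebesgue) \<le> ennreal M"
      by (rule order_trans[OF nn_integral_mono energy0]) (auto simp: feq \<rho>0_eq global_density_def indicator_def)
  qed (use f2 pos in \<open>auto simp: L2_UNIV_iff\<close>)
  then have fM: "norm_L2 f \<le> sqrt M" by (simp add: norm_L2_def)
  have i1: "integrable lebesgue (\<lambda>x. f x \<bullet> W (x - g 0))" and b1: "\<bar>LINT x|lebesgue. f x \<bullet> W (x - g 0)\<bar> \<le> sqrt M * w2"
    using L2_inner_bound[OF f2 shifted_norms(1)] mult_right_mono[OF fM norm_L2_nonneg[of W]]
    by (auto simp: shifted_norms(2) w2_def intro: order_trans)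
  have eq: "\<rho>0 x * (U0 x \<bullet> \<phi> (0, x)) = indicator S x * (\<rho>in x * ((lin + ang \<omega>in (x - 0)) \<bullet> e)) + f x \<bullet> W (x - g 0)" for x
  proof (cases "x \<in> S")
    case True
    have "norm (g 0) \<le> \<epsilon>" using g(2)[of 0] by (simp add: h_0)
    moreover have "norm x < \<epsilon>" using True small by auto
    ultimately have "norm (x - g 0) < 2 * \<epsilon>" using norm_triangle_ineq4[of x "g 0"] by linarith
    then have "W (x - g 0) = e" by (rule W_near(1))
    then show ?thesis using True
      by (simp add: \<phi>_def \<sigma>_0 f_def \<rho>0_eq U0_eq global_density_def initial_velocity_def global_velocity_def body_velocity_def)
  next
    case False
    then show ?thesis by (simp add: \<phi>_def \<sigma>_0 f_def \<rho>0_eq global_density_def)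
  qed
  have "(LINT x|lebesgue. \<rho>0 x * (U0 x \<bullet> \<phi> (0, x))) = m * (lin \<bullet> e) + (LINT x|lebesgue. f x \<bullet> W (x - g 0))"
    unfolding eq using bm i1 by simp
  then show ?thesis using b1 by simp
qed

text \<open>Switching off costs at most (C/\<tau>) sqrt M w2 over a window of length \<tau>, so
  \<tau> disappears from the bound; the initial fluid momentum turns C into C + 1. The other terms
  integrate 1 + |Du|^2 over [0, T], where the dissipation amounts to at most M / (4\<nu>).\<close>

lemma momentum_estimate:
  assumes C: "C \<ge> 0" "\<And>y. \<bar>smooth_step' y\<bar> \<le> C"
  shows "m * \<bar>integral\<^sup>L (lebesgue_on {a..a + \<tau>}) (\<lambda>t. smooth_step' ((t - a) / \<tau>) / \<tau> * (l t \<bullet> e)) - lin \<bullet> e\<bar>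
    \<le> (C + 1) * sqrt M * w2 + \<Theta> * (T + M / (4 * \<nu>))"
proof -
  define I where "I = integral\<^sup>L (lebesgue_on {a..a + \<tau>}) (\<lambda>t. smooth_step' ((t - a) / \<tau>) / \<tau> * (l t \<bullet> e))"
  have sub: "{a..a + \<tau>} \<subseteq> {0..}" using a by auto
  have T0: "T \<ge> 0" using a \<tau> T by linarith
  have w20: "w2 \<ge> 0" by (simp add: w2_def norm_L2_nonneg)
  have \<sigma>'C: "\<bar>\<sigma>' t\<bar> \<le> C / \<tau> * indicator {a..a + \<tau>} t" for t
    using \<sigma>'_outside[of t] C(2)[of "(t - a) / \<tau>"] \<tau> by (auto simp: indicator_def \<sigma>'_def divide_right_mono)
  \<comment> \<open>\<open>q\<close> is the contribution of the body to the time integrand and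
    \<open>p\<close>, below, that of the fluid; both are extended by 0 to negative times.\<close>
  define q where "q t = indicator {0..} t * (\<sigma>' t * (m * (l t \<bullet> e)))" for t
  have lm: "(\<lambda>t. indicator {a..a + \<tau>} t *\<^sub>R (l t \<bullet> e)) \<in> borel_measurable lebesgue"
  proof -
    have "(\<lambda>t. l t \<bullet> e) \<in> borel_measurable (lebesgue_on {a..a + \<tau>})"
      using measurable_restrict_mono[OF l_measurable sub] by measurable
    then show ?thesis by (simp add: borel_measurable_restrict_space_iff)
  qed
  have \<sigma>'m: "\<sigma>' \<in> borel_measurable lebesgue"
  proof (rule measurable_completion)
    have "continuous_on UNIV \<sigma>'"
      unfolding \<sigma>'_def[abs_def] using \<tau>
      by (intro continuous_intros continuous_on_compose2[OF smooth_on_continuous_on[OF smooth_step'_smooth]]) auto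
    then show "\<sigma>' \<in> borel_measurable lborel" by (simp add: borel_measurable_continuous_onI)
  qed
  have q_eq: "q t = m * (\<sigma>' t * (indicator {a..a + \<tau>} t *\<^sub>R (l t \<bullet> e)))" for t
    using \<sigma>'_outside[of t] sub by (auto simp: q_def indicator_def)
  have qi: "integrable lebesgue q"
  proof (rule Bochner_Integration.integrable_bound)
    show "integrable lebesgue (\<lambda>t. indicator {a..a + \<tau>} t * (m * (C / \<tau>) * (K * norm e)))"
      using emeasure_compact_finite[of "{a..a + \<tau>}"] by (intro integrable_mult_left integrable_real_indicator) auto
    show "q \<in> borel_measurable lebesgue" unfolding q_eq[abs_def] using \<sigma>'m lm by measurable
    show "AE t in lebesgue. norm (q t) \<le> norm (indicator {a..a + \<tau>} t * (m * (C / \<tau>) * (K * norm e)))"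
      using AE_velocity_bound[unfolded AE_lebesgue_on_atLeast_iff]
    proof eventually_elim
      case (elim t)
      show ?case
      proof (cases "t \<in> {a..a + \<tau>}")
        case True
        then have "norm (l t) \<le> K" using elim a by auto
        then have "\<bar>l t \<bullet> e\<bar> \<le> K * norm e" using Cauchy_Schwarz_ineq2[of "l t" e] mult_right_mono[of "norm (l t)" K "norm e"] by simp
        moreover have "\<bar>\<sigma>' t\<bar> \<le> C / \<tau>" using \<sigma>'C[of t] True by simp
        ultimately have "\<bar>\<sigma>' t\<bar> * \<bar>l t \<bullet> e\<bar> \<le> C / \<tau> * (K * norm e)" using C \<tau> by (intro mult_mono) auto
        then have "m * (\<bar>\<sigma>' t\<bar> * \<bar>l t \<bullet> e\<bar>) \<le> m * (C / \<tau> * (K * norm e))" using mass_pos by (intro mult_left_mono) auto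
        then show ?thesis using True mass_pos C \<tau> K_nonneg by (simp add: q_eq abs_mult mult_ac)
      next
        case False then show ?thesis by (simp add: q_eq)
      qed
    qed
  qed
  have q_int: "(LINT t|lebesgue. q t) = - (m * I)"
  proof -
    have "I = (LINT t|lebesgue. indicator {a..a + \<tau>} t *\<^sub>R (smooth_step' ((t - a) / \<tau>) / \<tau> * (l t \<bullet> e)))"
      unfolding I_def by (rule integral_restrict_space) auto
    moreover have "q t = - m * (indicator {a..a + \<tau>} t *\<^sub>R (smooth_step' ((t - a) / \<tau>) / \<tau> * (l t \<bullet> e)))" for t
      by (simp add: q_eq \<sigma>'_def indicator_def)
    ultimately show ?thesis by simp
  qed
  define p where "p t = indicator {0..} t * P t" for t
  define bnd where "bnd t = ennreal (sqrt M * w2 * (C / \<tau>)) * indicator {a..a + \<tau>} t + ennreal \<Theta> * (indicator {0..T} t + dissipation t * indicator {0..T} t)" for t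
  have pm: "p \<in> borel_measurable lebesgue" unfolding p_def[abs_def] by (intro borel_measurable_times borel_measurable_indicator P_measurable) auto
  have pb: "AE t in lebesgue. ennreal (norm (p t)) \<le> bnd t"
    using AE_good
  proof eventually_elim
    case (elim t)
    show ?case
    proof (cases "t \<ge> 0")
      case True
      then have g: "good t" and d: "dissipation t = ennreal ((norm_L2 (Du t))\<^sup>2)" using elim by auto
      have s: "\<sigma> t \<le> indicator {0..T} t" using True \<sigma>_range(2)[of t] \<sigma>_late[of t] by (auto simp: indicator_def)
      have "\<bar>P t\<bar> \<le> \<bar>\<sigma>' t\<bar> * (sqrt M * w2) + \<sigma> t * (\<Theta> * (1 + (norm_L2 (Du t))\<^sup>2))" by (rule good_slice(2)[OF g])
      also have "\<dots> \<le> (C / \<tau> * indicator {a..a + \<tau>} t) * (sqrt M * w2) + indicator {0..T} t * (\<Theta> * (1 + (norm_L2 (Du t))\<^sup>2))"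
        using \<sigma>'C s w20 pos \<Theta>_nonneg by (intro add_mono mult_right_mono) auto
      finally have "ennreal (norm (p t)) \<le> ennreal ((C / \<tau> * indicator {a..a + \<tau>} t) * (sqrt M * w2) + indicator {0..T} t * (\<Theta> * (1 + (norm_L2 (Du t))\<^sup>2)))"
        using True by (intro ennreal_leI) (simp add: p_def)
      also have "\<dots> = bnd t"
        using C \<tau> w20 pos \<Theta>_nonneg unfolding bnd_def d
        by (auto simp: indicator_def ennreal_plus[symmetric] ennreal_mult[symmetric] ennreal_1[symmetric] mult_ac distrib_left simp del: ennreal_plus ennreal_1)
      finally show ?thesis .
    qed (simp add: p_def)
  qed
  have bnd_int: "(\<integral>\<^sup>+t. bnd t \<partial>lebesgue) \<le> ennreal (C * sqrt M * w2 + \<Theta> * (T + M / (4 * \<nu>)))"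
  proof -
    have dm: "dissipation \<in> borel_measurable lebesgue" using dissipation(1) by (rule measurable_completion)
    have m1: "(indicator A :: real \<Rightarrow> ennreal) \<in> borel_measurable lebesgue" if "A \<in> sets borel" for A
      using that by (intro measurable_completion) simp
    have m2: "(\<lambda>t. dissipation t * indicator {0..T} t) \<in> borel_measurable lebesgue"
      by (intro borel_measurable_times_ennreal dm m1) simp
    have m3: "(\<lambda>t. ennreal (sqrt M * w2 * (C / \<tau>)) * indicator {a..a + \<tau>} t) \<in> borel_measurable lebesgue"
      by (intro borel_measurable_times_ennreal borel_measurable_const m1) simp
    have m4: "(\<lambda>t. indicator {0..T} t + dissipation t * indicator {0..T} t) \<in> borel_measurable lebesgue"
      by (intro borel_measurable_add m1 m2) simp
    have m5: "(\<lambda>t. ennreal \<Theta> * (indicator {0..T} t + dissipation t * indicator {0..T} t)) \<in> borel_measurable lebesgue"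
      by (intro borel_measurable_times_ennreal borel_measurable_const m4)
    have "(\<integral>\<^sup>+t. bnd t \<partial>lebesgue) = ennreal (sqrt M * w2 * (C / \<tau>)) * emeasure lebesgue {a..a + \<tau>}
       + ennreal \<Theta> * (emeasure lebesgue {0..T} + (\<integral>\<^sup>+t. dissipation t * indicator {0..T} t \<partial>lebesgue))"
      unfolding bnd_def nn_integral_add[OF m3 m5] nn_integral_cmult[OF m4] nn_integral_add[OF m1[of "{0..T}"] m2, simplified]
      by (subst nn_integral_cmult_indicator) auto
    also have "\<dots> \<le> ennreal (sqrt M * w2 * (C / \<tau>)) * ennreal \<tau> + ennreal \<Theta> * (ennreal T + ennreal (M / (4 * \<nu>)))"
      using dissipation_bound[of T] \<tau> T0 by (intro add_mono mult_left_mono) auto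
    also have "\<dots> = ennreal (sqrt M * w2 * (C / \<tau>) * \<tau> + \<Theta> * (T + M / (4 * \<nu>)))"
      using C \<tau> w20 pos \<Theta>_nonneg T0 by (simp add: ennreal_plus[symmetric] ennreal_mult[symmetric] del: ennreal_plus)
    also have "sqrt M * w2 * (C / \<tau>) * \<tau> = C * sqrt M * w2" using \<tau> by simp
    finally show ?thesis .
  qed
  have pi: "integrable lebesgue p"
    using pm le_less_trans[OF order_trans[OF nn_integral_mono_AE[OF pb] bnd_int], of \<infinity>] by (intro integrableI_bounded) auto
  have p_int: "\<bar>LINT t|lebesgue. p t\<bar> \<le> C * sqrt M * w2 + \<Theta> * (T + M / (4 * \<nu>))"
  proof -
    have "ennreal \<bar>LINT t|lebesgue. p t\<bar> \<le> (\<integral>\<^sup>+t. ennreal (norm (p t)) \<partial>lebesgue)"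
      using integral_norm_bound_ennreal[OF pi] by simp
    also have "\<dots> \<le> ennreal (C * sqrt M * w2 + \<Theta> * (T + M / (4 * \<nu>)))" by (rule order_trans[OF nn_integral_mono_AE[OF pb] bnd_int])
    finally show ?thesis using C w20 pos \<Theta>_nonneg T0 by (subst (asm) ennreal_le_iff) (auto intro!: add_nonneg_nonneg mult_nonneg_nonneg)
  qed
  have "(LINT t:{0..}|lebesgue. LINT x|lebesgue.
               \<rho> t x * (U t x \<bullet> (vector_derivative (\<lambda>s. \<phi> (s, x)) (at t) + jacobian (\<lambda>y. \<phi> (t, y)) (at x) *v U t x))
               - 2 * \<nu> * (Du t x \<bullet> sym_grad (\<lambda>y. \<phi> (t, y)) x)) = (LINT t|lebesgue. q t + p t)"
    unfolding set_lebesgue_integral_def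
  proof -
    \<comment> \<open>The integral over space is identified with q + p only at good times; since the
      measure is complete, it inherits measurability from q + p.\<close>
    have ae: "AE t in lebesgue. q t + p t = indicator {0..} t *\<^sub>R (LINT x|lebesgue.
               \<rho> t x * (U t x \<bullet> (vector_derivative (\<lambda>s. \<phi> (s, x)) (at t) + jacobian (\<lambda>y. \<phi> (t, y)) (at x) *v U t x))
               - 2 * \<nu> * (Du t x \<bullet> sym_grad (\<lambda>y. \<phi> (t, y)) x))"
      using AE_good
    proof eventually_elim
      case (elim t)
      then show ?case by (cases "t \<ge> 0") (auto simp: inner_identity q_def p_def)
    qed
    have qpm: "(\<lambda>t. q t + p t) \<in> borel_measurable lebesgue" using qi pm by measurable
    show "(LINT t|lebesgue. indicator {0..} t *\<^sub>R (LINT x|lebesgue.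
               \<rho> t x * (U t x \<bullet> (vector_derivative (\<lambda>s. \<phi> (s, x)) (at t) + jacobian (\<lambda>y. \<phi> (t, y)) (at x) *v U t x))
               - 2 * \<nu> * (Du t x \<bullet> sym_grad (\<lambda>y. \<phi> (t, y)) x))) = (LINT t|lebesgue. q t + p t)"
      by (rule integral_cong_AE[OF qpm borel_measurable_AE[OF qpm ae] ae, symmetric])
  qed
  also have "\<dots> = - (m * I) + (LINT t|lebesgue. p t)" using qi pi q_int by simp
  finally have "m * I - (LINT t|lebesgue. p t) = (LINT x|lebesgue. \<rho>0 x * (U0 x \<bullet> \<phi> (0, x)))"
    using weak_form[OF \<phi>_test] by simp
  then have "\<bar>m * I - m * (lin \<bullet> e)\<bar> \<le> \<bar>LINT t|lebesgue. p t\<bar> + sqrt M * w2" using initial_identity by linarith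
  also have "\<dots> \<le> (C + 1) * sqrt M * w2 + \<Theta> * (T + M / (4 * \<nu>))" using p_int by (simp add: algebra_simps)
  also have "\<bar>m * I - m * (lin \<bullet> e)\<bar> = m * \<bar>I - lin \<bullet> e\<bar>" using mass_pos by (simp add: right_diff_distrib[symmetric] abs_mult)
  finally show ?thesis by (simp add: I_def)
qed

end

text \<open>The bound of \<open>momentum_estimate\<close> depends neither on the window length
  \<tau> nor on the smooth curve. At each time where \<open>h\<close> is differentiable with
  derivative \<open>l\<close>, the window may therefore shrink, and the averaged velocity becomes
  its value.\<close>

theorem (in rigid_body_solution) velocity_estimate:
  assumes W: "smooth_on UNIV W" "ball_supported R W" "\<And>x. divergence W x = 0" "\<And>x. norm (W x) \<le> b" "\<And>x. norm x < 2 * \<epsilon> \<Longrightarrow> W x = e"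
    and R: "R > 0" and C: "C \<ge> 0" "\<And>y. \<bar>smooth_step' y\<bar> \<le> C"
  shows "AE t in lebesgue. 0 < t \<and> t < T \<longrightarrow> m * \<bar>(l t - lin) \<bullet> e\<bar> \<le> (C + 1) * sqrt M * norm_L2 W +
     (2 * K * norm_L2 W + 2 * b * sqrt (2 * pi * real CARD('n) * R * sqrt M) + 2 * \<nu> * norm_L2 (sym_grad W)) * (T + M / (4 * \<nu>))"
  using h_derivative[unfolded AE_lebesgue_on_atLeast_iff]
proof eventually_elim
  case (elim a)
  show ?case
  proof safe
    assume a: "0 < a" "a < T"
    then have da: "(h has_vector_derivative l a) (at a)" using elim by simp
    obtain g where g: "smooth_on UNIV g" "\<And>t. t \<ge> 0 \<Longrightarrow> norm (g t - h t) \<le> \<epsilon>" "\<And>t. norm (frechet_derivative g (at t) 1) \<le> K"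
      using smooth_approximation_of_lipschitz[OF h_lipschitz pos(2)] by blast
    let ?R = "(C + 1) * sqrt M * norm_L2 W +
     (2 * K * norm_L2 W + 2 * b * sqrt (2 * pi * real CARD('n) * R * sqrt M) + 2 * \<nu> * norm_L2 (sym_grad W)) * (T + M / (4 * \<nu>))"
    have inner_d: "(f has_vector_derivative d) (at t) \<Longrightarrow> ((\<lambda>t. f t \<bullet> e) has_vector_derivative (d \<bullet> e)) (at t)" for f :: "real \<Rightarrow> real^'n::_" and d t
      by (rule bounded_linear.has_vector_derivative[OF bounded_linear_inner_left])
    have L: "(K * norm e)-lipschitz_on {0..} (\<lambda>t. h t \<bullet> e)"
    proof (rule lipschitz_onI)
      fix s t :: real assume "s \<in> {0..}" "t \<in> {0..}"
      then have "norm (h s - h t) * norm e \<le> (K * dist s t) * norm e"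
        using lipschitz_onD[OF h_lipschitz] by (intro mult_right_mono) (auto simp: dist_norm)
      moreover have "\<bar>(h s - h t) \<bullet> e\<bar> \<le> norm (h s - h t) * norm e" by (rule Cauchy_Schwarz_ineq2)
      ultimately show "dist (h s \<bullet> e) (h t \<bullet> e) \<le> K * norm e * dist s t"
        by (simp add: dist_real_def inner_diff_left mult_ac)
    qed (use K_nonneg in simp)
    have lm: "(\<lambda>t. l t \<bullet> e) \<in> borel_measurable (lebesgue_on {0..})" using l_measurable by measurable
    have ld: "AE t in lebesgue_on {0..}. ((\<lambda>t. h t \<bullet> e) has_vector_derivative (l t \<bullet> e)) (at t)"
      using h_derivative by eventually_elim (rule inner_d)
    have key: "m * \<bar>(l a - lin) \<bullet> e\<bar> \<le> ?R + m * \<eta>" if "\<eta> > 0" for \<eta>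
    proof -
      obtain \<Lambda> where \<Lambda>: "\<Lambda> > 0" "\<And>\<tau>. 0 < \<tau> \<Longrightarrow> \<tau> < \<Lambda> \<Longrightarrow>
         \<bar>integral\<^sup>L (lebesgue_on {a..a + \<tau>}) (\<lambda>t. smooth_step' ((t - a) / \<tau>) / \<tau> * (l t \<bullet> e)) - l a \<bullet> e\<bar> \<le> \<eta>"
        using smooth_step'_kernel_limit[OF a(1) L lm ld inner_d[OF da] \<open>\<eta> > 0\<close>] by blast
      \<comment> \<open>Half of \<Lambda> stays strictly below \<Lambda>, and T - a keeps the window
        inside [0, T].\<close>
      define \<tau> where "\<tau> = min (\<Lambda> / 2) (T - a)"
      have \<tau>s: "0 < \<tau>" "\<tau> < \<Lambda>" "a + \<tau> \<le> T" using \<Lambda>(1) a by (auto simp: \<tau>_def)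
      interpret tested_solution ang \<nu> \<epsilon> M S \<rho>in uin lin \<omega>in u l \<omega> h Q B \<rho> U \<rho>0 U0 Du v g W e R b a \<tau> T
        by unfold_locales (use g W R a \<tau>s in auto)
      define I where "I = integral\<^sup>L (lebesgue_on {a..a + \<tau>}) (\<lambda>t. smooth_step' ((t - a) / \<tau>) / \<tau> * (l t \<bullet> e))"
      have 1: "m * \<bar>I - lin \<bullet> e\<bar> \<le> ?R"
        using momentum_estimate[OF C] by (simp add: I_def w2_def s2_def \<Theta>_def)
      have "\<bar>I - l a \<bullet> e\<bar> \<le> \<eta>" using \<Lambda>(2)[OF \<tau>s(1,2)] by (simp add: I_def)
      then have "m * \<bar>I - l a \<bullet> e\<bar> \<le> m * \<eta>" using mass_pos by (intro mult_left_mono) auto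
      moreover have "m * \<bar>(l a - lin) \<bullet> e\<bar> \<le> m * (\<bar>I - lin \<bullet> e\<bar> + \<bar>I - l a \<bullet> e\<bar>)"
        using mass_pos by (intro mult_left_mono) (auto simp: inner_diff_left)
      ultimately show ?thesis using 1 by (simp add: distrib_left)
    qed
    show "m * \<bar>(l a - lin) \<bullet> e\<bar> \<le> ?R"
    proof (rule field_le_epsilon)
      fix \<delta> :: real assume "\<delta> > 0"
      then show "m * \<bar>(l a - lin) \<bullet> e\<bar> \<le> ?R + \<delta>"
        using key[of "\<delta> / m"] mass_pos by simp
    qed
  qed
qed

subsection \<open>The limit of small bodies\<close>

text \<open>Koenig's decomposition: the mixed term vanishes because the centre of mass is the
  origin. It follows from \<open>body_momentum\<close> through |l + Lx|^2 = 2 (l + Lx) . l - |l|^2 +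
  |Lx|^2. Boundedness of the body makes the rotational part finite.\<close>

lemma body_kinetic_energy:
  fixes S :: "(real^'n::{finite,wellorder}) set" and L :: "real^'n::_ \<Rightarrow> real^'n::_"
  assumes S: "rigid_body S \<rho>" "S \<subseteq> ball 0 \<epsilon>" and L: "linear L"
  shows "integrable lebesgue (\<lambda>x. indicator S x * (\<rho> x * (norm (l + L x))\<^sup>2))"
    and "(LINT x|lebesgue. indicator S x * (\<rho> x * (norm (l + L x))\<^sup>2))
      = mass S \<rho> * (norm l)\<^sup>2 + (LINT x|lebesgue. indicator S x * (\<rho> x * (norm (L x))\<^sup>2))"
proof -
  have oI: "orthogonal_matrix (mat 1 :: real^'n::_^'n::_)" by (simp add: orthogonal_matrix_def transpose_mat)
  have pS: "body_position S 0 (mat 1) = S" by (simp add: body_position_def transpose_mat del: transpose_matrix_vector)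
  have dS: "body_density \<rho> 0 (mat 1) = \<rho>" by (simp add: body_density_def fun_eq_iff transpose_mat del: transpose_matrix_vector)
  note bm = body_momentum[OF oI S(1) L, where h = 0 and e = l, unfolded pS dS diff_zero]
  have i0: "integrable lebesgue (\<lambda>x. indicator S x * \<rho> x)" and m0: "(LINT x|lebesgue. indicator S x * \<rho> x) = mass S \<rho>"
    using S by (auto simp: rigid_body_def set_integrable_def mass_def set_lebesgue_integral_def)
  obtain c where c: "c > 0" "\<And>x. norm (L x) \<le> c * norm x"
    using linear_bounded_pos[OF L] by (metis mult.commute)
  have iL: "integrable lebesgue (\<lambda>x. indicator S x * (\<rho> x * (norm (L x))\<^sup>2))"
  proof (rule Bochner_Integration.integrable_bound)
    show "integrable lebesgue (\<lambda>x. (c * \<epsilon>)\<^sup>2 * (indicator S x * \<rho> x))" by (intro integrable_mult_right i0)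
    have "(\<lambda>x. (norm (L x))\<^sup>2) \<in> borel_measurable lebesgue"
    proof (rule measurable_completion)
      have "continuous_on UNIV L" using L by (intro linear_continuous_on) (simp add: linear_conv_bounded_linear)
      then show "(\<lambda>x. (norm (L x))\<^sup>2) \<in> borel_measurable lborel"
        by (simp add: borel_measurable_continuous_onI continuous_intros)
    qed
    then have "(\<lambda>x. (indicator S x * \<rho> x) * (norm (L x))\<^sup>2) \<in> borel_measurable lebesgue"
      by (rule borel_measurable_times[OF borel_measurable_integrable[OF i0]])
    then show "(\<lambda>x. indicator S x * (\<rho> x * (norm (L x))\<^sup>2)) \<in> borel_measurable lebesgue" by (simp add: mult.assoc)
    show "AE x in lebesgue. norm (indicator S x * (\<rho> x * (norm (L x))\<^sup>2)) \<le> norm ((c * \<epsilon>)\<^sup>2 * (indicator S x * \<rho> x))"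
    proof (rule AE_I2)
      fix x
      show "norm (indicator S x * (\<rho> x * (norm (L x))\<^sup>2)) \<le> norm ((c * \<epsilon>)\<^sup>2 * (indicator S x * \<rho> x))"
      proof (cases "x \<in> S")
        case True
        then have "norm x \<le> \<epsilon>" using S(2) by (auto simp: subset_iff intro: less_imp_le)
        then have "norm (L x) \<le> c * \<epsilon>" using c by (meson mult_left_mono less_imp_le order_trans)
        then have "(norm (L x))\<^sup>2 \<le> (c * \<epsilon>)\<^sup>2" by (rule power_mono) simp
        then have "\<bar>\<rho> x\<bar> * (norm (L x))\<^sup>2 \<le> \<bar>\<rho> x\<bar> * (c * \<epsilon>)\<^sup>2" by (rule mult_left_mono) simp
        then show ?thesis using True by (simp add: abs_mult mult.commute)
      qed simp
    qed
  qed
  have eq: "indicator S x * (\<rho> x * (norm (l + L x))\<^sup>2) = 2 * (indicator S x * (\<rho> x * ((l + L x) \<bullet> l))) - (norm l)\<^sup>2 * (indicator S x * \<rho> x)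
      + indicator S x * (\<rho> x * (norm (L x))\<^sup>2)" for x
  proof -
    have "(norm (l + L x))\<^sup>2 = 2 * ((l + L x) \<bullet> l) - (norm l)\<^sup>2 + (norm (L x))\<^sup>2"
      by (simp add: power2_norm_eq_inner inner_add_left inner_add_right inner_commute)
    then show ?thesis by (simp only:) (simp add: algebra_simps)
  qed
  have i1: "integrable lebesgue (\<lambda>x. indicator S x * (\<rho> x * ((l + L x) \<bullet> l)))" by (rule bm(1))
  show "integrable lebesgue (\<lambda>x. indicator S x * (\<rho> x * (norm (l + L x))\<^sup>2))"
    unfolding eq by (intro Bochner_Integration.integrable_add Bochner_Integration.integrable_diff integrable_mult_right i0 i1 iL)
  show "(LINT x|lebesgue. indicator S x * (\<rho> x * (norm (l + L x))\<^sup>2))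
      = mass S \<rho> * (norm l)\<^sup>2 + (LINT x|lebesgue. indicator S x * (\<rho> x * (norm (L x))\<^sup>2))"
    unfolding eq using i0 i1 iL bm(2)[of l] m0 by (simp add: dot_square_norm)
qed

text \<open>On the body the initial energy is that of a rigid motion, and elsewhere the density is
  1. Adding the norm of the velocity over the whole space counts the body once more, which is
  harmless for an upper bound.\<close>

lemma initial_energy_le:
  fixes S :: "(real^'n::{finite,wellorder}) set" and ang :: "'w \<Rightarrow> real^'n::_ \<Rightarrow> real^'n::_"
  assumes S: "rigid_body S \<rho>" "S \<subseteq> ball 0 \<epsilon>" and ang: "linear (ang \<omega>)" and U0: "L2 UNIV (initial_velocity ang S u l \<omega>)"
  shows "(\<integral>\<^sup>+x. ennreal (global_density S \<rho> x * (norm (initial_velocity ang S u l \<omega> x))\<^sup>2) \<partial>lebesgue)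
    \<le> ennreal (mass S \<rho> * (norm l)\<^sup>2 + (LINT x|lebesgue. indicator S x * (\<rho> x * (norm (ang \<omega> x))\<^sup>2))
        + (LINT x|lebesgue. (norm (initial_velocity ang S u l \<omega> x))\<^sup>2))"
proof -
  let ?U = "initial_velocity ang S u l \<omega>" and ?f = "\<lambda>x. indicator S x * (\<rho> x * (norm (l + ang \<omega> x))\<^sup>2)"
  note ke = body_kinetic_energy[OF S ang, of l]
  have f0: "0 \<le> ?f x" for x using S(1) by (auto simp: rigid_body_def indicator_def intro: less_imp_le)
  have Ui: "integrable lebesgue (\<lambda>x. (norm (?U x))\<^sup>2)" using U0 by (simp add: L2_UNIV_iff)
  have i: "integrable lebesgue (\<lambda>x. ?f x + (norm (?U x))\<^sup>2)" by (intro Bochner_Integration.integrable_add ke(1) Ui)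
  have "(\<integral>\<^sup>+x. ennreal (global_density S \<rho> x * (norm (?U x))\<^sup>2) \<partial>lebesgue) \<le> (\<integral>\<^sup>+x. ennreal (?f x + (norm (?U x))\<^sup>2) \<partial>lebesgue)"
    by (intro nn_integral_mono ennreal_leI)
       (auto simp: global_density_def initial_velocity_def global_velocity_def body_velocity_def indicator_def)
  also have "\<dots> = ennreal (LINT x|lebesgue. ?f x + (norm (?U x))\<^sup>2)"
    using f0 by (intro nn_integral_eq_integral i AE_I2 add_nonneg_nonneg) auto
  also have "(LINT x|lebesgue. ?f x + (norm (?U x))\<^sup>2) = (LINT x|lebesgue. ?f x) + (LINT x|lebesgue. (norm (?U x))\<^sup>2)"
    by (rule Bochner_Integration.integral_add[OF ke(1) Ui])
  finally show ?thesis unfolding ke(2) by (simp add: add.assoc)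
qed

lemma L2_approximation_bounded:
  fixes f :: "nat \<Rightarrow> real^'n \<Rightarrow> real^'n"
  assumes f: "\<And>k. L2 UNIV (f k)" and g: "L2 UNIV g" and lim: "(\<lambda>k. LINT x|lebesgue. (norm (f k x - g x))\<^sup>2) \<longlonglongrightarrow> 0"
  obtains A where "\<And>k. (LINT x|lebesgue. (norm (f k x))\<^sup>2) \<le> A"
proof -
  obtain D where D: "\<And>k. \<bar>LINT x|lebesgue. (norm (f k x - g x))\<^sup>2\<bar> \<le> D"
    using convergent_imp_Bseq[OF convergentI[OF lim]] unfolding Bseq_def by auto
  have sq: "(norm (a + b))\<^sup>2 \<le> 2 * (norm a)\<^sup>2 + 2 * (norm b)\<^sup>2" for a b :: "real^'n"
    using power_mono[OF norm_triangle_ineq norm_ge_zero, of a b 2] sum_two_squares_le[of "norm a" "norm b"] by linarith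
  show ?thesis
  proof (rule that)
    fix k
    have [measurable]: "f k \<in> borel_measurable lebesgue" "g \<in> borel_measurable lebesgue"
      and fi: "integrable lebesgue (\<lambda>x. (norm (f k x))\<^sup>2)" and gi: "integrable lebesgue (\<lambda>x. (norm (g x))\<^sup>2)"
      using f[of k] g by (auto simp: L2_UNIV_iff)
    have di: "integrable lebesgue (\<lambda>x. (norm (f k x - g x))\<^sup>2)"
    proof (rule Bochner_Integration.integrable_bound)
      show "integrable lebesgue (\<lambda>x. 2 * (norm (f k x))\<^sup>2 + 2 * (norm (g x))\<^sup>2)" using fi gi by simp
      show "AE x in lebesgue. norm ((norm (f k x - g x))\<^sup>2) \<le> norm (2 * (norm (f k x))\<^sup>2 + 2 * (norm (g x))\<^sup>2)"
      proof (rule AE_I2)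
        show "norm ((norm (f k x - g x))\<^sup>2) \<le> norm (2 * (norm (f k x))\<^sup>2 + 2 * (norm (g x))\<^sup>2)" for x
          using sq[of "f k x" "- g x"] by simp
      qed
    qed measurable
    have "(LINT x|lebesgue. (norm (f k x))\<^sup>2) \<le> (LINT x|lebesgue. 2 * (norm (f k x - g x))\<^sup>2 + 2 * (norm (g x))\<^sup>2)"
    proof (rule integral_mono)
      show "(norm (f k x))\<^sup>2 \<le> 2 * (norm (f k x - g x))\<^sup>2 + 2 * (norm (g x))\<^sup>2" for x
        using sq[of "f k x - g x" "g x"] by simp
    qed (use fi gi di in auto)
    also have "\<dots> = 2 * (LINT x|lebesgue. (norm (f k x - g x))\<^sup>2) + 2 * (LINT x|lebesgue. (norm (g x))\<^sup>2)" using di gi by simp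
    also have "\<dots> \<le> 2 * D + 2 * (LINT x|lebesgue. (norm (g x))\<^sup>2)" using D[of k] by simp
    finally show "(LINT x|lebesgue. (norm (f k x))\<^sup>2) \<le> 2 * D + 2 * (LINT x|lebesgue. (norm (g x))\<^sup>2)" .
  qed
qed

lemma fluid_body_solution_interpretation:
  fixes ang :: "'w::euclidean_space \<Rightarrow> real^'n::{finite,wellorder} \<Rightarrow> real^'n::_"
  assumes sol: "fluid_body_solution ang \<nu> S \<rho>in uin lin \<omega>in u l \<omega>"
    and pos: "\<nu> > 0" "\<epsilon> > 0" "M \<ge> 0" and ang: "\<And>w. linear (ang w)" and small: "S \<subseteq> ball 0 \<epsilon>" and mass_pos: "mass S \<rho>in > 0"
    and energy0: "(\<integral>\<^sup>+x. ennreal (global_density S \<rho>in x * (norm (initial_velocity ang S uin lin \<omega>in x))\<^sup>2) \<partial>lebesgue) \<le> ennreal M"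
  obtains h Q B \<rho> U \<rho>0 U0 Du v where "rigid_body_solution ang \<nu> \<epsilon> M S \<rho>in uin lin \<omega>in u l \<omega> h Q B \<rho> U \<rho>0 U0 Du v"
proof -
  have hl: "hopf_leray ang \<nu> S \<rho>in uin lin \<omega>in u l \<omega>" and rb: "rigid_body S \<rho>in" and L2: "L2 UNIV (initial_velocity ang S uin lin \<omega>in)"
    using sol by (auto simp: fluid_body_solution_def)
  from hl[unfolded hopf_leray_def] show ?thesis
  proof (elim exE conjE)
    fix h Q B \<rho> U \<rho>0 U0 Du v
    assume "rigid_motion ang l \<omega> h Q"
      "B = (\<lambda>t. body_position S (h t) (Q t))"
      "\<rho> = (\<lambda>t. global_density (B t) (body_density \<rho>in (h t) (Q t)))"
      "U = (\<lambda>t. global_velocity (B t) (body_velocity ang (l t) (\<omega> t) (h t)) (u t))"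
      "\<rho>0 = global_density S \<rho>in" "U0 = initial_velocity ang S uin lin \<omega>in"
      "Linf_time l" "Linf_time_L2 (\<lambda>t. - B t) u" "weakly_continuous_L2 v"
      "AE t in lebesgue_on {0..}. AE x in lebesgue. v t x = U t x"
      "set_borel_measurable lebesgue ({0..} \<times> UNIV) (\<lambda>(t, x). Du t x)"
      "AE t in lebesgue_on {0..}. weak_sym_grad UNIV (U t) (Du t)"
      "AE t in lebesgue_on {0..}. weakly_div_free UNIV (U t)"
      "AE t in lebesgue_on {0..}. AE x in lebesgue. x \<in> B t \<longrightarrow> Du t x = 0"
      "\<forall>\<phi>. fluid_body_test_function B \<phi> \<longrightarrow>
          - (LINT t:{0..}|lebesgue. LINT x|lebesgue.
               \<rho> t x * (U t x \<bullet> (vector_derivative (\<lambda>s. \<phi> (s, x)) (at t)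
                                    + jacobian (\<lambda>y. \<phi> (t, y)) (at x) *v U t x))
               - 2 * \<nu> * (Du t x \<bullet> sym_grad (\<lambda>y. \<phi> (t, y)) x))
          = (LINT x|lebesgue. \<rho>0 x * (U0 x \<bullet> \<phi> (0, x)))"
      "AE t in lebesgue_on {0..}.
          (\<integral>\<^sup>+x. ennreal (\<rho> t x * (norm (U t x))\<^sup>2) \<partial>lebesgue)
          + ennreal (4 * \<nu>) * (\<integral>\<^sup>+s\<in>{0..t}. (\<integral>\<^sup>+x. ennreal ((norm (Du s x))\<^sup>2) \<partial>lebesgue) \<partial>lebesgue)
          \<le> (\<integral>\<^sup>+x. ennreal (\<rho>0 x * (norm (U0 x))\<^sup>2) \<partial>lebesgue)"
    note hyps = this
    have "rigid_body_solution ang \<nu> \<epsilon> M S \<rho>in uin lin \<omega>in u l \<omega> h Q B \<rho> U \<rho>0 U0 Du v"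
    proof -
      have init: "L2 UNIV U0" using L2 hyps(6) by simp
      have energy: "(\<integral>\<^sup>+x. ennreal (\<rho>0 x * (norm (U0 x))\<^sup>2) \<partial>lebesgue) \<le> ennreal M" using energy0 hyps(5,6) by simp
      have meas: "set_borel_measurable lebesgue {(t, x). t \<ge> 0 \<and> x \<in> - B t} (\<lambda>(t, x). u t x)"
        using hyps(8) by (simp add: Linf_time_L2_def)
      show ?thesis
        by (rule rigid_body_solution.intro) (fact pos ang rb small mass_pos init energy meas hyps hyps(15)[rule_format])+
    qed
    then show thesis by (rule that)
  qed
qed

lemma AE_imp_le_trans:
  fixes b c :: real
  assumes "AE t in M. P t \<longrightarrow> a t \<le> b" "b \<le> c"
  shows "AE t in M. P t \<longrightarrow> a t \<le> c"
  using assms(1) by (rule eventually_mono) (use assms(2) in linarith)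

text \<open>The field is \<open>log_field\<close> with inner radius 2\<epsilon> and N scales, so R =
  2^N 2\<epsilon>. The constant \<open>c\<close> is chosen before the solution and hence serves a
  whole sequence; the factor 1 / sqrt m comes from the speed bound \<open>K\<close> in the transport
  term.\<close>

lemma velocity_error_bound:
  fixes ang :: "'w::euclidean_space \<Rightarrow> real^'n::{finite,wellorder} \<Rightarrow> real^'n::_" and e :: "real^'n::_"
  assumes n: "CARD('n) \<ge> 2" and ang: "\<And>w. linear (ang w)" and \<nu>: "\<nu> > 0" and M: "M \<ge> 0" and T: "T > 0"
  obtains c where "c \<ge> 0"
    "\<And>\<epsilon> N S \<rho>in uin lin \<omega>in u l \<omega>. fluid_body_solution ang \<nu> S \<rho>in uin lin \<omega>in u l \<omega> \<Longrightarrow> \<epsilon> > 0 \<Longrightarrow> N \<ge> 1 \<Longrightarrow>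
       S \<subseteq> ball 0 \<epsilon> \<Longrightarrow> mass S \<rho>in > 0 \<Longrightarrow>
       (\<integral>\<^sup>+x. ennreal (global_density S \<rho>in x * (norm (initial_velocity ang S uin lin \<omega>in x))\<^sup>2) \<partial>lebesgue) \<le> ennreal M \<Longrightarrow>
       AE t in lebesgue. 0 < t \<and> t < T \<longrightarrow> mass S \<rho>in * \<bar>(l t - lin) \<bullet> e\<bar> \<le>
         c * (sqrt ((2 ^ N * (2 * \<epsilon>)) ^ CARD('n)) * (1 + 1 / sqrt (mass S \<rho>in)) + sqrt (2 ^ N * (2 * \<epsilon>))
            + sqrt ((\<Sum>j<N. (2 ^ j * (2 * \<epsilon>)) ^ (CARD('n) - 2)) / (real N)\<^sup>2))"
proof -
  obtain b where b: "b > 0"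
    "\<And>N r x. N \<ge> 1 \<Longrightarrow> norm (log_field e N r x) \<le> b"
    "\<And>N r. N \<ge> 1 \<Longrightarrow> r > 0 \<Longrightarrow> (LINT x|lborel. (norm (log_field e N r x))\<^sup>2) \<le> b * (2 ^ N * r) ^ CARD('n)"
    "\<And>N r. N \<ge> 1 \<Longrightarrow> r > 0 \<Longrightarrow> (LINT x|lborel. (norm (sym_grad (log_field e N r) x))\<^sup>2) \<le> b / (real N)\<^sup>2 * (\<Sum>j<N. (2 ^ j * r) ^ (CARD('n) - 2))"
    using log_field_bounds[OF n] by blast
  obtain C where C: "C > 0" "\<And>y. \<bar>smooth_step' y\<bar> \<le> C" using smooth_step_derivative_bounds by blast
  define T' where "T' = T + M / (4 * \<nu>)"
  have T': "T' \<ge> 0" using T M \<nu> by (simp add: T'_def)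
  define c1 where "c1 = (C + 1) * sqrt M * sqrt b"
  define c2 where "c2 = 2 * sqrt M * sqrt b * T'"
  define c3 where "c3 = 2 * b * sqrt (2 * pi * real CARD('n) * sqrt M) * T'"
  define c4 where "c4 = 2 * \<nu> * sqrt b * T'"
  have cs: "c1 \<ge> 0" "c2 \<ge> 0" "c3 \<ge> 0" "c4 \<ge> 0" 
    unfolding c1_def c2_def c3_def c4_def using b(1) C M T' \<nu> by (intro mult_nonneg_nonneg; simp)+
  define c where "c = c1 + c2 + c3 + c4"
  have cc: "c1 \<le> c" "c2 \<le> c" "c3 \<le> c" "c4 \<le> c" "c \<ge> 0" using cs by (auto simp: c_def)
  show ?thesis
  proof (rule that[OF cc(5)])
    fix \<epsilon> N S \<rho>in uin lin \<omega>in u l \<omega>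
    assume sol: "fluid_body_solution ang \<nu> S \<rho>in uin lin \<omega>in u l \<omega>" and \<epsilon>: "\<epsilon> > (0::real)" and N: "N \<ge> (1::nat)"
      and S: "S \<subseteq> ball 0 \<epsilon>" "mass S \<rho>in > 0"
      and en: "(\<integral>\<^sup>+x. ennreal (global_density S \<rho>in x * (norm (initial_velocity ang S uin lin \<omega>in x))\<^sup>2) \<partial>lebesgue) \<le> ennreal M"
    obtain h Q B \<rho> U \<rho>0 U0 Du v where "rigid_body_solution ang \<nu> \<epsilon> M S \<rho>in uin lin \<omega>in u l \<omega> h Q B \<rho> U \<rho>0 U0 Du v"
      using fluid_body_solution_interpretation[OF sol \<nu> \<epsilon> M ang S en] by blast
    then interpret rigid_body_solution ang \<nu> \<epsilon> M S \<rho>in uin lin \<omega>in u l \<omega> h Q B \<rho> U \<rho>0 U0 Du v .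
    define R where "R = 2 ^ N * (2 * \<epsilon>)"
    define s where "s = (\<Sum>j<N. (2 ^ j * (2 * \<epsilon>)) ^ (CARD('n) - 2)) / (real N)\<^sup>2"
    define W where "W = log_field e N (2 * \<epsilon>)"
    have R: "R > 0" using \<epsilon> by (simp add: R_def)
    have e2: "2 * \<epsilon> > 0" using \<epsilon> by simp
    have W: "smooth_on UNIV W" "ball_supported R W" "\<And>x. divergence W x = 0" "\<And>x. norm (W x) \<le> b" "\<And>x. norm x < 2 * \<epsilon> \<Longrightarrow> W x = e"
      unfolding W_def R_def using log_field_smooth log_field_ball_supported[OF e2] divergence_log_field[OF n] b(2)[OF N] log_field_near[OF N e2] by auto
    have nW: "norm_L2 W \<le> sqrt b * sqrt (R ^ CARD('n))"
    proof -
      have "(LINT x|lebesgue. (norm (W x))\<^sup>2) = (LINT x|lborel. (norm (W x))\<^sup>2)"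
        using L2_shift(2)[OF smooth_on_continuous_on[OF W(1)] W(2), of 0] by simp
      also have "\<dots> \<le> b * R ^ CARD('n)" unfolding W_def R_def by (rule b(3)[OF N e2])
      finally show ?thesis unfolding norm_L2_def real_sqrt_mult[symmetric] by (rule real_sqrt_le_mono)
    qed
    have nG: "norm_L2 (sym_grad W) \<le> sqrt b * sqrt s"
    proof -
      have "continuous_on UNIV (\<lambda>x. (norm (sym_grad W x))\<^sup>2)" by (intro continuous_intros sym_grad_continuous W)
      then have "(LINT x|lebesgue. (norm (sym_grad W x))\<^sup>2) = (LINT x|lborel. (norm (sym_grad W x))\<^sup>2)"
        by (intro integral_completion) (simp add: borel_measurable_continuous_onI)
      also have "\<dots> \<le> b / (real N)\<^sup>2 * (\<Sum>j<N. (2 ^ j * (2 * \<epsilon>)) ^ (CARD('n) - 2))" unfolding W_def by (rule b(4)[OF N e2])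
      also have "\<dots> = b * s" by (simp add: s_def)
      finally show ?thesis unfolding norm_L2_def real_sqrt_mult[symmetric] by (rule real_sqrt_le_mono)
    qed
    have K: "K = sqrt M * (1 / sqrt (mass S \<rho>in))" by (simp add: K_def real_sqrt_divide)
    define X where "X = sqrt (R ^ CARD('n))"
    have X: "X \<ge> 0" using R by (simp add: X_def)
    have s0: "s \<ge> 0" unfolding s_def using \<epsilon> by (intro divide_nonneg_nonneg sum_nonneg) auto
    have "AE t in lebesgue. 0 < t \<and> t < T \<longrightarrow> mass S \<rho>in * \<bar>(l t - lin) \<bullet> e\<bar> \<le> (C + 1) * sqrt M * norm_L2 W +
     (2 * K * norm_L2 W + 2 * b * sqrt (2 * pi * real CARD('n) * R * sqrt M) + 2 * \<nu> * norm_L2 (sym_grad W)) * T'"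
      unfolding T'_def using velocity_estimate[OF W R _ C(2), of T] C(1) by simp
    moreover have "(C + 1) * sqrt M * norm_L2 W +
     (2 * K * norm_L2 W + 2 * b * sqrt (2 * pi * real CARD('n) * R * sqrt M) + 2 * \<nu> * norm_L2 (sym_grad W)) * T'
     \<le> c * (X * (1 + 1 / sqrt (mass S \<rho>in)) + sqrt R + sqrt s)"
    proof -
      have 1: "(C + 1) * sqrt M * norm_L2 W \<le> c1 * X"
        using mult_left_mono[OF nW, of "(C + 1) * sqrt M"] C M by (simp add: c1_def X_def mult_ac)
      have 2: "2 * K * norm_L2 W * T' \<le> c2 * (X * (1 / sqrt (mass S \<rho>in)))"
      proof -
        have "2 * K * norm_L2 W * T' \<le> 2 * K * (sqrt b * X) * T'"
          using nW K_nonneg T' by (intro mult_right_mono mult_left_mono) (auto simp: X_def)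
        then show ?thesis unfolding K c2_def by (simp add: mult_ac)
      qed
      have 3: "2 * b * sqrt (2 * pi * real CARD('n) * R * sqrt M) * T' = c3 * sqrt R"
        by (simp add: c3_def real_sqrt_mult mult_ac)
      have 4: "2 * \<nu> * norm_L2 (sym_grad W) * T' \<le> c4 * sqrt s"
      proof -
        have "2 * \<nu> * norm_L2 (sym_grad W) * T' \<le> 2 * \<nu> * (sqrt b * sqrt s) * T'"
          using nG \<nu> T' by (intro mult_right_mono mult_left_mono) auto
        then show ?thesis unfolding c4_def by (simp add: mult_ac)
      qed
      have "c1 * X \<le> c * X" "c2 * (X * (1 / sqrt (mass S \<rho>in))) \<le> c * (X * (1 / sqrt (mass S \<rho>in)))" "c3 * sqrt R \<le> c * sqrt R" "c4 * sqrt s \<le> c * sqrt s"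
        using cc X R s0 S(2) by (intro mult_right_mono; simp)+
      then have "c1 * X + c2 * (X * (1 / sqrt (mass S \<rho>in))) + c3 * sqrt R + c4 * sqrt s \<le> c * X + c * (X * (1 / sqrt (mass S \<rho>in))) + c * sqrt R + c * sqrt s"
        by linarith
      moreover have "c * X + c * (X * (1 / sqrt (mass S \<rho>in))) + c * sqrt R + c * sqrt s = c * (X * (1 + 1 / sqrt (mass S \<rho>in)) + sqrt R + sqrt s)"
        by (simp only: distrib_left mult_1_right)
      moreover have "(C + 1) * sqrt M * norm_L2 W +
        (2 * K * norm_L2 W + 2 * b * sqrt (2 * pi * real CARD('n) * R * sqrt M) + 2 * \<nu> * norm_L2 (sym_grad W)) * T'
        = (C + 1) * sqrt M * norm_L2 W + 2 * K * norm_L2 W * T' + 2 * b * sqrt (2 * pi * real CARD('n) * R * sqrt M) * T' + 2 * \<nu> * norm_L2 (sym_grad W) * T'"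
        by (simp only: distrib_right add.assoc)
      ultimately show ?thesis using 1 2 3 4 by linarith
    qed
    ultimately have "AE t in lebesgue. 0 < t \<and> t < T \<longrightarrow> mass S \<rho>in * \<bar>(l t - lin) \<bullet> e\<bar> \<le> c * (X * (1 + 1 / sqrt (mass S \<rho>in)) + sqrt R + sqrt s)"
      by (rule AE_imp_le_trans)
    then show "AE t in lebesgue. 0 < t \<and> t < T \<longrightarrow> mass S \<rho>in * \<bar>(l t - lin) \<bullet> e\<bar> \<le>
         c * (sqrt ((2 ^ N * (2 * \<epsilon>)) ^ CARD('n)) * (1 + 1 / sqrt (mass S \<rho>in)) + sqrt (2 ^ N * (2 * \<epsilon>))
            + sqrt ((\<Sum>j<N. (2 ^ j * (2 * \<epsilon>)) ^ (CARD('n) - 2)) / (real N)\<^sup>2))"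
      unfolding X_def R_def s_def .
  qed
qed

text \<open>Convergence of the initial velocities and kinetic energies bounds all initial energies
  by one \<open>M\<close>, so the constants of \<open>velocity_error_bound\<close> are the same for
  all indices and the errors tend to 0 with \<open>err\<close>. Positivity of the mass is required
  eventually, since in dimension 3 it is read off a limit.\<close>

theorem velocity_limit:
  fixes ang :: "'w::euclidean_space \<Rightarrow> real^'n::{finite,wellorder} \<Rightarrow> real^'n::_"
    and S :: "nat \<Rightarrow> (real^'n::_) set" and N :: "nat \<Rightarrow> nat"
  defines "err \<equiv> \<lambda>k \<epsilon> m. (sqrt ((2 ^ N k * (2 * \<epsilon>)) ^ CARD('n)) * (1 + 1 / sqrt m) + sqrt (2 ^ N k * (2 * \<epsilon>))
            + sqrt ((\<Sum>j<N k. (2 ^ j * (2 * \<epsilon>)) ^ (CARD('n) - 2)) / (real (N k))\<^sup>2)) / m"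
  assumes n: "CARD('n) \<ge> 2" and ang: "\<And>w. linear (ang w)" and \<nu>: "\<nu> > 0"
    and sol: "\<And>k. fluid_body_solution ang \<nu> (S k) (\<rho>in k) (uin k) (lin k) (\<omega>in k) (u k) (l k) (\<omega> k)"
    and \<epsilon>: "\<And>k. \<epsilon> k > 0" and small: "\<And>k. S k \<subseteq> ball 0 (\<epsilon> k)"
    and mass_pos: "\<forall>\<^sub>F k in sequentially. mass (S k) (\<rho>in k) > 0"
    and uin: "L2 UNIV uin_lim" "(\<lambda>k. LINT x|lebesgue. (norm (initial_velocity ang (S k) (uin k) (lin k) (\<omega>in k) x - uin_lim x))\<^sup>2) \<longlonglongrightarrow> 0"
    and kin: "(\<lambda>k. mass (S k) (\<rho>in k) * (norm (lin k))\<^sup>2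
        + (LINT x|lebesgue. indicator (S k) x * (\<rho>in k x * (norm (ang (\<omega>in k) x))\<^sup>2))) \<longlonglongrightarrow> E"
    and N: "\<And>k. N k \<ge> 1" and err: "(\<lambda>k. err k (\<epsilon> k) (mass (S k) (\<rho>in k))) \<longlonglongrightarrow> 0"
    and lin: "lin \<longlonglongrightarrow> lin_lim"
  shows "Linf_loc_tendsto l (\<lambda>t. lin_lim)"
  unfolding Linf_loc_tendsto_def
proof (intro allI impI)
  fix T :: real assume T: "T > 0"
  have L2k: "L2 UNIV (initial_velocity ang (S k) (uin k) (lin k) (\<omega>in k))" and rb: "rigid_body (S k) (\<rho>in k)" for k
    using sol[of k] by (auto simp: fluid_body_solution_def)
  obtain A where A: "\<And>k. (LINT x|lebesgue. (norm (initial_velocity ang (S k) (uin k) (lin k) (\<omega>in k) x))\<^sup>2) \<le> A"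
    using L2_approximation_bounded[OF L2k uin] by blast
  obtain D where D: "\<And>k. norm (mass (S k) (\<rho>in k) * (norm (lin k))\<^sup>2
        + (LINT x|lebesgue. indicator (S k) x * (\<rho>in k x * (norm (ang (\<omega>in k) x))\<^sup>2))) \<le> D"
    using convergent_imp_Bseq[OF convergentI[OF kin]] unfolding Bseq_def by auto
  define M where "M = max 0 (D + A)"
  have M: "M \<ge> 0" by (simp add: M_def)
  have en: "(\<integral>\<^sup>+x. ennreal (global_density (S k) (\<rho>in k) x * (norm (initial_velocity ang (S k) (uin k) (lin k) (\<omega>in k) x))\<^sup>2) \<partial>lebesgue) \<le> ennreal M" for k
  proof (rule order_trans[OF initial_energy_le[where ang = ang, OF rb small ang L2k] ennreal_leI])
    show "mass (S k) (\<rho>in k) * (norm (lin k))\<^sup>2 + (LINT x|lebesgue. indicator (S k) x * (\<rho>in k x * (norm (ang (\<omega>in k) x))\<^sup>2))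
        + (LINT x|lebesgue. (norm (initial_velocity ang (S k) (uin k) (lin k) (\<omega>in k) x))\<^sup>2) \<le> M"
      using A[of k] D[of k] by (simp add: M_def)
  qed
  \<comment> \<open>Testing with the basis vectors bounds the error component by component.\<close>
  have "\<exists>c\<ge>0. \<forall>k. mass (S k) (\<rho>in k) > 0 \<longrightarrow> (AE t in lebesgue. 0 < t \<and> t < T \<longrightarrow> \<bar>(l k t - lin k) $ i\<bar> \<le> c * err k (\<epsilon> k) (mass (S k) (\<rho>in k)))" for i
  proof -
    obtain c where c: "c \<ge> 0" "\<And>\<epsilon> N S \<rho>in uin lin \<omega>in u l \<omega>. fluid_body_solution ang \<nu> S \<rho>in uin lin \<omega>in u l \<omega> \<Longrightarrow> \<epsilon> > 0 \<Longrightarrow> N \<ge> 1 \<Longrightarrow>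
       S \<subseteq> ball 0 \<epsilon> \<Longrightarrow> mass S \<rho>in > 0 \<Longrightarrow>
       (\<integral>\<^sup>+x. ennreal (global_density S \<rho>in x * (norm (initial_velocity ang S uin lin \<omega>in x))\<^sup>2) \<partial>lebesgue) \<le> ennreal M \<Longrightarrow>
       AE t in lebesgue. 0 < t \<and> t < T \<longrightarrow> mass S \<rho>in * \<bar>(l t - lin) \<bullet> axis i 1\<bar> \<le>
         c * (sqrt ((2 ^ N * (2 * \<epsilon>)) ^ CARD('n)) * (1 + 1 / sqrt (mass S \<rho>in)) + sqrt (2 ^ N * (2 * \<epsilon>))
            + sqrt ((\<Sum>j<N. (2 ^ j * (2 * \<epsilon>)) ^ (CARD('n) - 2)) / (real N)\<^sup>2))"
    proof (rule velocity_error_bound[where ang = ang and e = "axis i 1", OF n ang \<nu> M T], goal_cases)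
      case (1 c)
      from 1(2,3) show ?case by (rule 1(1))
    qed
    show ?thesis
    proof (intro exI[of _ c] conjI c(1) allI impI)
      fix k assume m: "mass (S k) (\<rho>in k) > 0"
      show "AE t in lebesgue. 0 < t \<and> t < T \<longrightarrow> \<bar>(l k t - lin k) $ i\<bar> \<le> c * err k (\<epsilon> k) (mass (S k) (\<rho>in k))"
        using c(2)[OF sol[of k] \<epsilon>[of k] N[of k] small[of k] m en[of k]]
      proof eventually_elim
        case (elim t)
        then show ?case using m by (auto simp: err_def inner_axis pos_le_divide_eq mult.commute[of _ "mass (S k) (\<rho>in k)"])
      qed
    qed
  qed
  from choice[OF allI[OF this]] obtain c where c': "\<forall>i. c i \<ge> 0 \<and> (\<forall>k. mass (S k) (\<rho>in k) > 0 \<longrightarrow>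
      (AE t in lebesgue. 0 < t \<and> t < T \<longrightarrow> \<bar>(l k t - lin k) $ i\<bar> \<le> c i * err k (\<epsilon> k) (mass (S k) (\<rho>in k))))" by (rule exE)
  note c = c'[rule_format, THEN conjunct1] c'[rule_format, THEN conjunct2, rule_format]
  define bd where "bd k = (\<Sum>i\<in>UNIV. c i) * err k (\<epsilon> k) (mass (S k) (\<rho>in k)) + norm (lin k - lin_lim)" for k
  have "(\<lambda>k. (\<Sum>i\<in>UNIV. c i) * err k (\<epsilon> k) (mass (S k) (\<rho>in k)) + norm (lin k - lin_lim)) \<longlonglongrightarrow> (\<Sum>i\<in>UNIV. c i) * 0 + norm (lin_lim - lin_lim)"
    by (intro tendsto_intros err lin)
  then have bd: "bd \<longlonglongrightarrow> 0" by (simp add: bd_def[abs_def])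
  have meas: "(\<lambda>t. ereal (norm (l k t - lin_lim))) \<in> borel_measurable (lebesgue_on {0<..<T})" for k
  proof -
    have "Linf_time (l k)" using sol[of k] by (auto simp: fluid_body_solution_def hopf_leray_def)
    then have "l k \<in> borel_measurable (lebesgue_on {0<..<T})"
      unfolding Linf_time_def by (elim conjE measurable_restrict_mono) auto
    then show ?thesis by measurable
  qed
  \<comment> \<open>On a null space the essential supremum would be -\<infinity>; the interval has
    positive length because T > 0.\<close>
  have lower: "0 \<le> esssup (lebesgue_on {0<..<T}) (\<lambda>t. ereal (norm (l k t - lin_lim)))" for k
  proof -
    have "emeasure (lebesgue_on {0<..<T}) (space (lebesgue_on {0<..<T})) \<noteq> 0"
      using T by (simp add: emeasure_restrict_space)
    from esssup_const[OF this, of "0::ereal"]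
    have "0 = esssup (lebesgue_on {0<..<T}) (\<lambda>t. 0::ereal)" by simp
    also have "\<dots> \<le> esssup (lebesgue_on {0<..<T}) (\<lambda>t. ereal (norm (l k t - lin_lim)))"
      by (rule esssup_mono) auto
    finally show ?thesis .
  qed
  have upper: "esssup (lebesgue_on {0<..<T}) (\<lambda>t. ereal (norm (l k t - lin_lim))) \<le> ereal (bd k)" if m: "mass (S k) (\<rho>in k) > 0" for k
  proof (rule esssup_I[OF meas])
    have "AE t in lebesgue. \<forall>i. 0 < t \<and> t < T \<longrightarrow> \<bar>(l k t - lin k) $ i\<bar> \<le> c i * err k (\<epsilon> k) (mass (S k) (\<rho>in k))"
      using c(2)[OF m] by (subst AE_all_countable) auto
    then have "AE t in lebesgue. t \<in> {0<..<T} \<longrightarrow> ereal (norm (l k t - lin_lim)) \<le> ereal (bd k)"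
    proof eventually_elim
      case (elim t)
      show ?case
      proof
        assume "t \<in> {0<..<T}"
        then have "norm (l k t - lin k) \<le> (\<Sum>i\<in>UNIV. c i * err k (\<epsilon> k) (mass (S k) (\<rho>in k)))"
          using elim by (intro order_trans[OF norm_le_l1_cart] sum_mono) auto
        then have "norm (l k t - lin k) \<le> (\<Sum>i\<in>UNIV. c i) * err k (\<epsilon> k) (mass (S k) (\<rho>in k))" by (simp add: sum_distrib_right)
        moreover have "norm (l k t - lin_lim) \<le> norm (l k t - lin k) + norm (lin k - lin_lim)"
          using norm_triangle_ineq[of "l k t - lin k" "lin k - lin_lim"] by simp
        ultimately show "ereal (norm (l k t - lin_lim)) \<le> ereal (bd k)" by (simp add: bd_def)
      qed
    qed
    then show "AE t in lebesgue_on {0<..<T}. ereal (norm (l k t - lin_lim)) \<le> ereal (bd k)"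
      by (subst AE_restrict_space_iff) auto
  qed
  have bd': "(\<lambda>k. ereal (bd k)) \<longlonglongrightarrow> 0" using bd by (simp add: zero_ereal_def)
  show "(\<lambda>k. esssup (lebesgue_on {0<..<T}) (\<lambda>t. ereal (norm (l k t - lin_lim)))) \<longlonglongrightarrow> 0"
    by (rule tendsto_sandwich[OF _ _ tendsto_const bd'])
       (use lower upper mass_pos in \<open>auto elim!: eventually_mono\<close>)
qed

section \<open>Rotational energy and the choice of scales\<close>

lemma rotational_energy2:
  "(LINT x|lebesgue. indicator S x * (\<rho> x * (norm (cross2 \<omega> x))\<^sup>2)) = (inertia2 S \<rho> * \<omega>) \<bullet> \<omega>"
proof -
  have "(norm (cross2 \<omega> x))\<^sup>2 = \<omega>\<^sup>2 * (norm x)\<^sup>2" for x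
    unfolding power2_norm_eq_inner cross2_def by (simp add: inner_vec_def sum_2 power2_eq_square algebra_simps)
  then have "(\<lambda>x. indicator S x * (\<rho> x * (norm (cross2 \<omega> x))\<^sup>2)) = (\<lambda>x. \<omega>\<^sup>2 * (indicator S x * (\<rho> x * (norm x)\<^sup>2)))"
    by (simp add: mult_ac)
  then show ?thesis by (simp add: inertia2_def set_lebesgue_integral_def power2_eq_square)
qed

text \<open>Lagrange's identity |\<omega>|^2 |x|^2 - (\<omega> . x)^2 = |\<omega> \<times> x|^2
  identifies the integrands. For the quadratic form to pass through the matrix valued integral, that
  integral must exist; this follows because the matrix is bounded on the ball containing the
  body.\<close>

lemma rotational_energy3:
  assumes S: "rigid_body S \<rho>" "S \<subseteq> ball 0 \<epsilon>"
  shows "(LINT x|lebesgue. indicator S x * (\<rho> x * (norm (cross3 \<omega> x))\<^sup>2)) = (inertia3 S \<rho> *v \<omega>) \<bullet> \<omega>"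
proof -
  define A :: "real^3 \<Rightarrow> real^3^3" where "A x = (norm x)\<^sup>2 *\<^sub>R mat 1 - (\<chi> i j. x $ i * x $ j)" for x
  have A: "(A x *v \<omega>) \<bullet> \<omega> = (norm (cross3 \<omega> x))\<^sup>2" for x
  proof -
    have "(\<chi> i j. x $ i * x $ j) *v \<omega> = (x \<bullet> \<omega>) *\<^sub>R x"
      by (simp add: vec_eq_iff matrix_vector_mult_def inner_vec_def sum_distrib_left sum_distrib_right mult_ac)
    then have "A x *v \<omega> = (norm x)\<^sup>2 *\<^sub>R \<omega> - (x \<bullet> \<omega>) *\<^sub>R x"
      by (simp add: A_def matrix_vector_mult_diff_rdistrib scaleR_matrix_vector_assoc[symmetric])
    then have "(A x *v \<omega>) \<bullet> \<omega> = (norm \<omega>)\<^sup>2 * (norm x)\<^sup>2 - (\<omega> \<bullet> x)\<^sup>2"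
      by (simp add: inner_diff_left dot_square_norm power2_eq_square inner_commute[of x \<omega>])
    then show ?thesis by (simp only: norm_cross)
  qed
  have i0: "integrable lebesgue (\<lambda>x. indicator S x * \<rho> x)"
    using S by (auto simp: rigid_body_def set_integrable_def)
  have Ac: "continuous_on UNIV A"
    unfolding A_def by (intro continuous_intros continuous_on_vec_lambda)
  obtain c where c: "\<And>x. x \<in> cball 0 \<epsilon> \<Longrightarrow> norm (A x) \<le> c"
    using compact_imp_bounded[OF compact_continuous_image[OF continuous_on_subset[OF Ac] compact_cball]]
    unfolding bounded_iff by blast
  have int: "integrable lebesgue (\<lambda>x. (indicator S x * \<rho> x) *\<^sub>R A x)"
  proof (rule Bochner_Integration.integrable_bound)
    show "integrable lebesgue (\<lambda>x. c * (indicator S x * \<rho> x))" by (intro integrable_mult_right i0)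
    have "A \<in> borel_measurable lebesgue"
      using Ac by (intro measurable_completion) (simp add: borel_measurable_continuous_onI)
    then show "(\<lambda>x. (indicator S x * \<rho> x) *\<^sub>R A x) \<in> borel_measurable lebesgue"
      by (rule borel_measurable_scaleR[OF borel_measurable_integrable[OF i0]])
    show "AE x in lebesgue. norm ((indicator S x * \<rho> x) *\<^sub>R A x) \<le> norm (c * (indicator S x * \<rho> x))"
    proof (rule AE_I2)
      fix x
      show "norm ((indicator S x * \<rho> x) *\<^sub>R A x) \<le> norm (c * (indicator S x * \<rho> x))"
      proof (cases "x \<in> S")
        case True
        then have "norm (A x) \<le> \<bar>c\<bar>" using S(2) c[of x] by (force simp: subset_iff)
        then have "\<bar>\<rho> x\<bar> * norm (A x) \<le> \<bar>\<rho> x\<bar> * \<bar>c\<bar>" by (rule mult_left_mono) simp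
        then show ?thesis using True by (simp add: abs_mult mult.commute)
      qed simp
    qed
  qed
  have bl: "bounded_linear (\<lambda>A::real^3^3. (A *v \<omega>) \<bullet> \<omega>)"
    unfolding linear_conv_bounded_linear[symmetric]
    by (rule linearI) (simp_all add: matrix_vector_mult_add_rdistrib inner_add_left scaleR_matrix_vector_assoc[symmetric])
  have "(LINT x|lebesgue. indicator S x * (\<rho> x * (norm (cross3 \<omega> x))\<^sup>2))
    = (LINT x|lebesgue. (((indicator S x * \<rho> x) *\<^sub>R A x) *v \<omega>) \<bullet> \<omega>)"
    by (simp add: A[symmetric] scaleR_matrix_vector_assoc[symmetric] mult.assoc)
  also have "\<dots> = ((LINT x|lebesgue. (indicator S x * \<rho> x) *\<^sub>R A x) *v \<omega>) \<bullet> \<omega>"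
    by (rule integral_bounded_linear[OF bl int])
  also have "(LINT x|lebesgue. (indicator S x * \<rho> x) *\<^sub>R A x) = inertia3 S \<rho>"
    by (simp add: inertia3_def set_lebesgue_integral_def A_def)
  finally show ?thesis .
qed

text \<open>N grows like |ln \<epsilon>| / 2. With x = - ln \<epsilon> / 2 one has \<epsilon> = exp
  (-2x), and for x \<ge> 0 also 2^N \<le> exp (x + 1), so the outer radius 2^N 2\<epsilon> is at
  most 2 exp (1 - x), while N tends to infinity with x.\<close>

lemma dyadic_scales_exist:
  fixes \<epsilon> :: "nat \<Rightarrow> real"
  assumes \<epsilon>: "\<And>k. \<epsilon> k > 0" "\<epsilon> \<longlonglongrightarrow> 0"
  obtains N :: "nat \<Rightarrow> nat" where "\<And>k. N k \<ge> 1" "filterlim (\<lambda>k. real (N k)) at_top sequentially"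
    "(\<lambda>k. 2 ^ N k * (2 * \<epsilon> k)) \<longlonglongrightarrow> 0"
proof -
  define x where "x k = - ln (\<epsilon> k) / 2" for k
  have "filterlim \<epsilon> (at_right 0) sequentially" 
    using \<epsilon> by (intro tendsto_imp_filterlim_at_right always_eventually) auto
  then have "filterlim (\<lambda>k. ln (\<epsilon> k)) at_bot sequentially" by (rule filterlim_compose[OF ln_at_0])
  then have "filterlim (\<lambda>k. (1/2) * (- ln (\<epsilon> k))) at_top sequentially"
    by (intro filterlim_tendsto_pos_mult_at_top[OF tendsto_const]) (auto simp: filterlim_uminus_at_bot)
  then have x: "filterlim x at_top sequentially" by (simp add: x_def[abs_def])
  \<comment> \<open>Adding 1 keeps N positive at early indices, where x may be negative, and makes x
    \<le> N.\<close>
  define N where "N k = nat \<lfloor>x k\<rfloor> + 1" for k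
  show ?thesis
  proof (rule that)
    show "N k \<ge> 1" for k by (simp add: N_def)
    have "x k \<le> real (N k)" for k unfolding N_def by linarith
    then show "filterlim (\<lambda>k. real (N k)) at_top sequentially" by (intro filterlim_at_top_mono[OF x]) simp
    have "filterlim (\<lambda>k. 1 - x k) at_bot sequentially"
      using filterlim_tendsto_add_at_top[OF tendsto_const x, of "-1"] by (simp add: filterlim_uminus_at_top)
    then have up: "(\<lambda>k. 2 * exp (1 - x k)) \<longlonglongrightarrow> 0"
      using tendsto_mult_right_zero[OF filterlim_compose[OF exp_at_bot]] by blast
    have "\<forall>\<^sub>F k in sequentially. x k \<ge> 0" using x by (simp add: filterlim_at_top)
    then have le: "\<forall>\<^sub>F k in sequentially. 2 ^ N k * (2 * \<epsilon> k) \<le> 2 * exp (1 - x k)"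
    proof eventually_elim
      case (elim k)
      have "(2::real) ^ N k \<le> exp 1 ^ N k" using exp_ge_add_one_self[of 1] by (intro power_mono) auto
      also have "\<dots> = exp (real (N k))" by (simp add: exp_of_nat_mult[symmetric])
      also have "\<dots> \<le> exp (x k + 1)" using elim by (simp add: N_def)
      finally have "2 ^ N k * (2 * \<epsilon> k) \<le> exp (x k + 1) * (2 * \<epsilon> k)"
        using \<epsilon>(1)[of k] by (intro mult_right_mono) auto
      also have "\<dots> = exp (x k + 1) * (2 * exp (- 2 * x k))" using \<epsilon>(1)[of k] by (simp add: x_def)
      also have "\<dots> = 2 * exp (1 - x k)"
        by (simp add: exp_add[symmetric] mult.left_commute)
      finally show ?case .
    qed
    show "(\<lambda>k. 2 ^ N k * (2 * \<epsilon> k)) \<longlonglongrightarrow> 0"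
      by (rule tendsto_sandwich[OF _ le tendsto_const up]) (use \<epsilon>(1) in \<open>simp add: less_imp_le\<close>)
  qed
qed

text \<open>Both cases are instances of \<open>velocity_limit\<close>, which asks for scales that
  make the error divided by the mass tend to 0: slowly growing N in dimension 2, where the mass is
  bounded below, and N = 1 in dimension 3.\<close>

theorem theorem3:
  fixes \<nu> :: real and \<epsilon> :: "nat \<Rightarrow> real"
  assumes "\<nu> > 0" and "\<And>k. \<epsilon> k > 0" and "\<epsilon> \<longlonglongrightarrow> 0"
  shows
    "(\<forall>(S :: nat \<Rightarrow> (real^2) set) (\<rho>in :: nat \<Rightarrow> real^2 \<Rightarrow> real) (uin :: nat \<Rightarrow> real^2 \<Rightarrow> real^2)
       (lin :: nat \<Rightarrow> real^2) (\<omega>in :: nat \<Rightarrow> real)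
       (u :: nat \<Rightarrow> real \<Rightarrow> real^2 \<Rightarrow> real^2) (l :: nat \<Rightarrow> real \<Rightarrow> real^2) (\<omega> :: nat \<Rightarrow> real \<Rightarrow> real)
       (uin_lim :: real^2 \<Rightarrow> real^2) (lin_lim :: real^2) (E :: real) (C :: real).
       (\<forall>k. fluid_body_solution cross2 \<nu> (S k) (\<rho>in k) (uin k) (lin k) (\<omega>in k) (u k) (l k) (\<omega> k)) \<longrightarrow>
       (\<forall>k. S k \<subseteq> ball 0 (\<epsilon> k)) \<longrightarrow>
       filterlim (\<lambda>k. mass (S k) (\<rho>in k) / \<epsilon> k ^ 2) at_top sequentially \<longrightarrow>
       L2 UNIV uin_lim \<longrightarrow>
       (\<lambda>k. LINT x|lebesgue.
          (norm (initial_velocity cross2 (S k) (uin k) (lin k) (\<omega>in k) x - uin_lim x))\<^sup>2) \<longlonglongrightarrow> 0 \<longrightarrow>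
       (\<lambda>k. mass (S k) (\<rho>in k) * (norm (lin k))\<^sup>2
            + (inertia2 (S k) (\<rho>in k) * \<omega>in k) \<bullet> \<omega>in k) \<longlonglongrightarrow> 2 * E \<longrightarrow>
       C > 0 \<longrightarrow> (\<forall>k. mass (S k) (\<rho>in k) \<ge> C) \<longrightarrow>
       lin \<longlonglongrightarrow> lin_lim \<longrightarrow>
       Linf_loc_tendsto l (\<lambda>t. lin_lim))
     \<and>
     (\<forall>(S :: nat \<Rightarrow> (real^3) set) (\<rho>in :: nat \<Rightarrow> real^3 \<Rightarrow> real) (uin :: nat \<Rightarrow> real^3 \<Rightarrow> real^3)
       (lin :: nat \<Rightarrow> real^3) (\<omega>in :: nat \<Rightarrow> real^3)
       (u :: nat \<Rightarrow> real \<Rightarrow> real^3 \<Rightarrow> real^3) (l :: nat \<Rightarrow> real \<Rightarrow> real^3) (\<omega> :: nat \<Rightarrow> real \<Rightarrow> real^3)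
       (uin_lim :: real^3 \<Rightarrow> real^3) (lin_lim :: real^3) (E :: real).
       (\<forall>k. fluid_body_solution cross3 \<nu> (S k) (\<rho>in k) (uin k) (lin k) (\<omega>in k) (u k) (l k) (\<omega> k)) \<longrightarrow>
       (\<forall>k. S k \<subseteq> ball 0 (\<epsilon> k)) \<longrightarrow>
       filterlim (\<lambda>k. mass (S k) (\<rho>in k) / \<epsilon> k ^ 3) at_top sequentially \<longrightarrow>
       L2 UNIV uin_lim \<longrightarrow>
       (\<lambda>k. LINT x|lebesgue.
          (norm (initial_velocity cross3 (S k) (uin k) (lin k) (\<omega>in k) x - uin_lim x))\<^sup>2) \<longlonglongrightarrow> 0 \<longrightarrow>
       (\<lambda>k. mass (S k) (\<rho>in k) * (norm (lin k))\<^sup>2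
            + (inertia3 (S k) (\<rho>in k) *v \<omega>in k) \<bullet> \<omega>in k) \<longlonglongrightarrow> 2 * E \<longrightarrow>
       filterlim (\<lambda>k. mass (S k) (\<rho>in k) / \<epsilon> k powr (1/2)) at_top sequentially \<longrightarrow>
       lin \<longlonglongrightarrow> lin_lim \<longrightarrow>
       Linf_loc_tendsto l (\<lambda>t. lin_lim))"
proof (intro conjI allI impI, goal_cases)
  case (1 S \<rho>in uin lin \<omega>in u l \<omega> uin_lim lin_lim E C)
  obtain N where N: "\<And>k. N k \<ge> 1" "filterlim (\<lambda>k. real (N k)) at_top sequentially" "(\<lambda>k. 2 ^ N k * (2 * \<epsilon> k)) \<longlonglongrightarrow> 0"
    using dyadic_scales_exist[OF assms(2,3)] by blast
  have m: "mass (S k) (\<rho>in k) \<ge> C" for k using 1 by blast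
  have lin: "linear (cross2 w)" for w
    by (rule linearI) (simp_all add: cross2_def vec_eq_iff forall_2 algebra_simps)
  have "(\<lambda>k. sqrt ((2 ^ N k * (2 * \<epsilon> k))\<^sup>2) * (1 + 1 / sqrt C) + sqrt (2 ^ N k * (2 * \<epsilon> k)) + sqrt (inverse (real (N k)))) \<longlonglongrightarrow>
      sqrt (0\<^sup>2) * (1 + 1 / sqrt C) + sqrt 0 + sqrt 0"
    by (intro tendsto_intros N(3) tendsto_inverse_0_at_top N(2))
  then have "(\<lambda>k. (sqrt ((2 ^ N k * (2 * \<epsilon> k))\<^sup>2) * (1 + 1 / sqrt C) + sqrt (2 ^ N k * (2 * \<epsilon> k)) + sqrt (inverse (real (N k)))) / C) \<longlonglongrightarrow>
      (sqrt (0\<^sup>2) * (1 + 1 / sqrt C) + sqrt 0 + sqrt 0) / C"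
    by (intro tendsto_divide tendsto_const) (use 1 in auto)
  then have up: "(\<lambda>k. (sqrt ((2 ^ N k * (2 * \<epsilon> k))\<^sup>2) * (1 + 1 / sqrt C) + sqrt (2 ^ N k * (2 * \<epsilon> k)) + sqrt (inverse (real (N k)))) / C) \<longlonglongrightarrow> 0"
    by simp
  have bound: "0 \<le> (sqrt ((2 ^ N k * (2 * \<epsilon> k)) ^ CARD(2)) * (1 + 1 / sqrt (mass (S k) (\<rho>in k))) + sqrt (2 ^ N k * (2 * \<epsilon> k))
            + sqrt ((\<Sum>j<N k. (2 ^ j * (2 * \<epsilon> k)) ^ (CARD(2) - 2)) / (real (N k))\<^sup>2)) / mass (S k) (\<rho>in k) \<and>
      (sqrt ((2 ^ N k * (2 * \<epsilon> k)) ^ CARD(2)) * (1 + 1 / sqrt (mass (S k) (\<rho>in k))) + sqrt (2 ^ N k * (2 * \<epsilon> k))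
            + sqrt ((\<Sum>j<N k. (2 ^ j * (2 * \<epsilon> k)) ^ (CARD(2) - 2)) / (real (N k))\<^sup>2)) / mass (S k) (\<rho>in k)
     \<le> (sqrt ((2 ^ N k * (2 * \<epsilon> k))\<^sup>2) * (1 + 1 / sqrt C) + sqrt (2 ^ N k * (2 * \<epsilon> k)) + sqrt (inverse (real (N k)))) / C"
    (is "0 \<le> ?a / ?m \<and> ?a / ?m \<le> ?b / C") for k
  proof -
    have C: "C > 0" using 1 by blast
    then have "?m > 0" using m[of k] by linarith
    note C = C this
    \<comment> \<open>In dimension 2 the exponent is 0, every summand is 1, and the gradient term is
      the root of N / N^2.\<close>
    have "(\<Sum>j<N k. (2 ^ j * (2 * \<epsilon> k)) ^ (CARD(2) - 2)) / (real (N k))\<^sup>2 = inverse (real (N k))"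
      using N(1)[of k] by (simp add: power2_eq_square field_simps)
    then have a: "?a = sqrt ((2 ^ N k * (2 * \<epsilon> k))\<^sup>2) * (1 + 1 / sqrt ?m) + sqrt (2 ^ N k * (2 * \<epsilon> k)) + sqrt (inverse (real (N k)))"
      by simp
    have e: "0 \<le> 2 ^ N k * (2 * \<epsilon> k)" using assms(2)[of k] by simp
    have "1 / sqrt ?m \<le> 1 / sqrt C" using C m[of k] by (intro divide_left_mono) auto
    then have "?a \<le> ?b" unfolding a by (intro add_mono mult_left_mono) auto
    moreover have "0 \<le> ?a" unfolding a using C e by (intro add_nonneg_nonneg mult_nonneg_nonneg) auto
    ultimately show ?thesis using C m[of k] by (auto intro!: frac_le divide_nonneg_nonneg)
  qed
  have err: "(\<lambda>k. (sqrt ((2 ^ N k * (2 * \<epsilon> k)) ^ CARD(2)) * (1 + 1 / sqrt (mass (S k) (\<rho>in k))) + sqrt (2 ^ N k * (2 * \<epsilon> k))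
            + sqrt ((\<Sum>j<N k. (2 ^ j * (2 * \<epsilon> k)) ^ (CARD(2) - 2)) / (real (N k))\<^sup>2)) / mass (S k) (\<rho>in k)) \<longlonglongrightarrow> 0"
    using bound by (intro tendsto_sandwich[OF _ _ tendsto_const up] always_eventually allI) blast+
  show ?case
  proof (rule velocity_limit[where ang = cross2 and N = N and \<nu> = \<nu> and S = S and \<rho>in = \<rho>in and uin = uin
      and lin = lin and \<omega>in = \<omega>in and u = u and l = l and \<omega> = \<omega> and \<epsilon> = \<epsilon> and uin_lim = uin_lim and E = "2 * E"])
    show "\<forall>\<^sub>F k in sequentially. mass (S k) (\<rho>in k) > 0"
      using m 1 by (intro always_eventually allI) (meson less_le_trans)
    show "(\<lambda>k. mass (S k) (\<rho>in k) * (norm (lin k))\<^sup>2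
        + (LINT x|lebesgue. indicator (S k) x * (\<rho>in k x * (norm (cross2 (\<omega>in k) x))\<^sup>2))) \<longlonglongrightarrow> 2 * E"
      unfolding rotational_energy2 using 1 by blast
  qed (use 1 assms N err lin in auto)
next
  case (2 S \<rho>in uin lin \<omega>in u l \<omega> uin_lim lin_lim E)
  define m where "m k = mass (S k) (\<rho>in k)" for k
  \<comment> \<open>The inverse of the quotient that tends to infinity by hypothesis; every term of
    the error contains it as a factor.\<close>
  define z where "z k = sqrt (\<epsilon> k) / m k" for k
  have q: "filterlim (\<lambda>k. m k / sqrt (\<epsilon> k)) at_top sequentially"
    using 2 assms(2) by (simp add: m_def powr_half_sqrt less_imp_le)
  have z: "z \<longlonglongrightarrow> 0"
    using tendsto_inverse_0_at_top[OF q] by (simp add: z_def[abs_def])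
  have "\<forall>\<^sub>F k in sequentially. m k / sqrt (\<epsilon> k) > 0" using q by (simp add: filterlim_at_top_dense)
  then have mp: "\<forall>\<^sub>F k in sequentially. m k > 0"
  proof eventually_elim
    case (elim k) then show ?case using assms(2)[of k] by (simp add: zero_less_divide_iff)
  qed
  \<comment> \<open>The error for R = 4\<epsilon> divided by m: sqrt (R^3) = 8 \<epsilon>^(3/2),
    sqrt R = 2 \<epsilon>^(1/2), and the gradient term is sqrt (2\<epsilon>). The factor 1 / sqrt m
    is absorbed by \<epsilon> / sqrt m = sqrt (\<epsilon>^(3/2) z).\<close>
  have "(\<lambda>k. 8 * \<epsilon> k * z k + 8 * z k * sqrt (\<epsilon> k * sqrt (\<epsilon> k) * z k) + 2 * z k + sqrt 2 * z k) \<longlonglongrightarrow>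
      8 * 0 * 0 + 8 * 0 * sqrt (0 * sqrt 0 * 0) + 2 * 0 + sqrt 2 * 0"
    by (intro tendsto_intros z assms(3))
  then have lim: "(\<lambda>k. 8 * \<epsilon> k * z k + 8 * z k * sqrt (\<epsilon> k * sqrt (\<epsilon> k) * z k) + 2 * z k + sqrt 2 * z k) \<longlonglongrightarrow> 0" by simp
  have eq: "\<forall>\<^sub>F k in sequentially. 8 * \<epsilon> k * z k + 8 * z k * sqrt (\<epsilon> k * sqrt (\<epsilon> k) * z k) + 2 * z k + sqrt 2 * z k
     = (sqrt ((2 ^ 1 * (2 * \<epsilon> k)) ^ CARD(3)) * (1 + 1 / sqrt (m k)) + sqrt (2 ^ 1 * (2 * \<epsilon> k))
            + sqrt ((\<Sum>j<1. (2 ^ j * (2 * \<epsilon> k)) ^ (CARD(3) - 2)) / (real 1)\<^sup>2)) / m k"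
    using mp
  proof eventually_elim
    case (elim k)
    define s where "s = sqrt (\<epsilon> k)"
    have s: "s > 0" "\<epsilon> k = s\<^sup>2" using assms(2)[of k] by (auto simp: s_def)
    have 1: "sqrt ((2 ^ 1 * (2 * \<epsilon> k)) ^ CARD(3)) = 8 * s ^ 3"
    proof (rule real_sqrt_unique)
      show "(8 * s ^ 3)\<^sup>2 = (2 ^ 1 * (2 * \<epsilon> k)) ^ CARD(3)" by (simp add: s(2) power_mult_distrib flip: power_mult)
    qed (use s in simp)
    have 2: "sqrt (\<epsilon> k * sqrt (\<epsilon> k) * z k) = s\<^sup>2 / sqrt (m k)"
    proof (rule real_sqrt_unique)
      show "(s\<^sup>2 / sqrt (m k))\<^sup>2 = \<epsilon> k * sqrt (\<epsilon> k) * z k"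
        unfolding z_def s_def[symmetric] using s elim by (simp add: power_divide power2_eq_square)
    qed (use elim in simp)
    have 3: "sqrt (2 ^ 1 * (2 * \<epsilon> k)) = 2 * s" using s(1) by (simp add: s(2) real_sqrt_mult)
    have 4: "sqrt ((\<Sum>j<1. (2 ^ j * (2 * \<epsilon> k)) ^ (CARD(3) - 2)) / (real 1)\<^sup>2) = sqrt 2 * s"
      by (simp add: real_sqrt_mult s_def)
    show ?case unfolding 1 2 3 4 unfolding z_def s_def[symmetric] unfolding s(2)
      using elim by (simp add: field_simps power2_eq_square power3_eq_cube)
  qed
  have err: "(\<lambda>k. (sqrt ((2 ^ 1 * (2 * \<epsilon> k)) ^ CARD(3)) * (1 + 1 / sqrt (m k)) + sqrt (2 ^ 1 * (2 * \<epsilon> k))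
            + sqrt ((\<Sum>j<1. (2 ^ j * (2 * \<epsilon> k)) ^ (CARD(3) - 2)) / (real 1)\<^sup>2)) / m k) \<longlonglongrightarrow> 0"
    by (rule Lim_transform_eventually[OF lim eq])
  show ?case
  proof (rule velocity_limit[where ang = cross3 and N = "\<lambda>_. 1" and \<nu> = \<nu> and S = S and \<rho>in = \<rho>in and uin = uin
      and lin = lin and \<omega>in = \<omega>in and u = u and l = l and \<omega> = \<omega> and \<epsilon> = \<epsilon> and uin_lim = uin_lim and E = "2 * E"])
    show "\<forall>\<^sub>F k in sequentially. mass (S k) (\<rho>in k) > 0" using mp by (simp add: m_def)
    show "(\<lambda>k. mass (S k) (\<rho>in k) * (norm (lin k))\<^sup>2
        + (LINT x|lebesgue. indicator (S k) x * (\<rho>in k x * (norm (cross3 (\<omega>in k) x))\<^sup>2))) \<longlonglongrightarrow> 2 * E"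
    proof -
      have "rigid_body (S k) (\<rho>in k)" "S k \<subseteq> ball 0 (\<epsilon> k)" for k using 2 by (auto simp: fluid_body_solution_def)
      note rotational_energy3[OF this]
      then show ?thesis using 2 by simp
    qed
    show "linear (cross3 w)" for w using bilinear_cross by (simp add: bilinear_def)
    show "(\<lambda>k. (sqrt ((2 ^ 1 * (2 * \<epsilon> k)) ^ CARD(3)) * (1 + 1 / sqrt (mass (S k) (\<rho>in k))) + sqrt (2 ^ 1 * (2 * \<epsilon> k))
            + sqrt ((\<Sum>j<1. (2 ^ j * (2 * \<epsilon> k)) ^ (CARD(3) - 2)) / (real 1)\<^sup>2)) / mass (S k) (\<rho>in k)) \<longlonglongrightarrow> 0"
      using err by (simp only: m_def)
  qed (use 2 assms in auto)
qed

end
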